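(* Let $\mathfrak g=\mathfrak l\oplus\mathfrak m$ be a reductive decomposition of a Lie algebra, $\mathcal G=(\mathfrak g,[\,,\,],\varpi,\varphi)$ a Lie quasi-bialgebra canonically compatible with it, with canonical double $\mathfrak d$, and $l=l^{\mathrm{can}}:U\to\mathcal A(\mathfrak g^*,\mathfrak g)$ the canonical dynamical $\ell$-matrix. Let $\mathfrak g^\star_0=\mathfrak l\oplus\mathfrak l^\perp$, a Lie subalgebra of $\mathfrak d$. Then the bundle map $$T:U\times\mathfrak l^*\times\mathfrak g^\star_0\longrightarrow N(U)=U\times\mathfrak l\times\mathfrak g^*$$ over $U$ given, for $p\in U$, $\alpha\in\mathfrak l^*$, $z\in\mathfrak l$, $\xi\in\mathfrak l^\perp$, by $$T_p(\alpha,z+\xi)=\Big(\tfrac{\sinh\mathrm{ad}_{sp}-\mathrm{ad}_{sp}}{\mathrm{ad}_{sp}^2}s\alpha-\tfrac{\sinh\mathrm{ad}_{sp}}{\mathrm{ad}_{sp}}z,\ \tfrac{\sinh\mathrm{ad}_{sp}}{\mathrm{ad}_{sp}}s\alpha-\sinh(\mathrm{ad}_{sp})z-\mathrm p_{\mathfrak g^*}\mathrm{Ad}_{e^{sp}}\xi\Big)$$ is an isomorphism of Lie algebroids from the trivial Lie algebroid $TU\times\mathfrak g^\star_0=U\times\mathfrak l^*\times\mathfrak g_0^\star$ onto the Lie algebroid $N(U)$. (Here $\mathrm{ad}=\mathrm{ad}^{\mathfrak d}$, $\mathrm{Ad}_{e^{X}}=\exp(\mathrm{ad}^{\mathfrak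 d}_X)$.)
   Context: Conventions: vector spaces are finite-dimensional over $\mathbb K=\mathbb R$ or $\mathbb C$; $f^*$ is the transpose of $f$; $\mathcal A(\mathfrak g^*,\mathfrak g)$ is the set of linear $t:\mathfrak g^*\to\mathfrak g$ with $t^*=-t$; $\mathrm{ad}^*_x$ is the transpose of $\mathrm{ad}_x$; $A^\perp$ is the annihilator of $A$. Lie quasi-bialgebra: $\mathcal G=(\mathfrak g,[\,,\,],\varpi,\varphi)$ with $\varpi:\mathfrak g\to\mathcal A(\mathfrak g^*,\mathfrak g)$ linear satisfying $\varpi_{[x,y]}=\mathrm{ad}_x\varpi_y+\varpi_y\mathrm{ad}^*_x-\mathrm{ad}_y\varpi_x-\varpi_x\mathrm{ad}^*_y$, $\varphi\in\wedge^3\mathfrak g$, such that $\mathfrak d=\mathfrak g\oplus\mathfrak g^*$ with $[x,y]_{\mathfrak d}=[x,y]$, $[x,\xi]_{\mathfrak d}=\varpi_x\xi-\mathrm{ad}^*_x\xi$, $[\xi,\eta]_{\mathfrak d}=\langle\eta,\varpi_\bullet\xi\rangle+\langle\xi\otimes\eta\otimes1,\varphi\rangle$ is a Lie algebra (the canonical double). $\mathrm p_{\mathfrak g},\mathrm p_{\mathfrak g^*}$ are the projections of $\mathfrak d$ on $\mathfrak g,\mathfrak g^*$, and $i_{\mathfrak g}:\mathfrak g\to\mathfrak d$ the inclusion. Reductive decomposition: $\mathfrak g=\mathfrak l\oplus\mathfrak m$, $\mathfrak l$ a subalgebra, $[\mathfrak l,\mathfrak m]\subset\mathfrak m$; $i:\mathfrak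 l\to\mathfrak g$ the inclusion, $\mathrm p_{\mathfrak l}$ the projection onto $\mathfrak l$ along $\mathfrak m$, $s=\mathrm p_{\mathfrak l}^*:\mathfrak l^*\to\mathfrak g^*$ (image $\mathfrak m^\perp$). $\mathcal G$ is canonically compatible with it if $\varpi_z=0$ for $z\in\mathfrak l$; $\langle\xi,\varpi_x\eta\rangle=0$ for $x\in\mathfrak g$, $\xi,\eta\in\mathfrak m^\perp$; $\varphi\in\mathrm{Alt}(\mathfrak l\otimes\mathfrak l\otimes\mathfrak l\oplus\mathfrak l\otimes\mathfrak m\otimes\mathfrak m\oplus\mathfrak m\otimes\mathfrak m\otimes\mathfrak m)$ and $\varphi$ vanishes on $(\mathfrak l^\perp)^3$. Canonical $\ell$-matrix: with $\mathfrak l\oplus\mathfrak l^*$ the double of the Lie quasi-bialgebra $(\mathfrak l,[\,,\,]_{\mathfrak l},0,\mathrm p_{\mathfrak l}^{\otimes3}\varphi)$, let $U=\{p\in\mathfrak l^*:\mathrm{Sp}(\mathrm{ad}^{\mathfrak l\oplus\mathfrak l^*}_p)\cap\mathrm i\pi(\mathbb Z\setminus\{0\})=\emptyset,\ \mathrm p_{\mathfrak g}\mathrm{Ad}_{e^{-sp}}i_{\mathfrak g}\text{ invertible}\}$ and, for $p\in U$, $\alpha\in\mathfrak l^*$, $\xi\in\mathfrak l^\perp$, $l^{\mathrm{can}}_p(s\alpha+\xi)=F(\mathrm{ad}^{\mathfrak l\oplus\mathfrak l^*}_p)\alpha-(\mathrm p_{\mathfrak g}\mathrm{Ad}_{e^{-sp}}i_{\mathfrak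 g})^{-1}\mathrm p_{\mathfrak g}\mathrm{Ad}_{e^{-sp}}\xi$ with $F(z)=\coth z-1/z$. Quotients such as $\frac{\sinh\mathrm{ad}_{sp}}{\mathrm{ad}_{sp}}$ denote the corresponding entire power series in $\mathrm{ad}_{sp}$. Trivial Lie algebroid $TU\times\mathfrak k$ ($\mathfrak k$ a Lie algebra): anchor the projection on $TU$, bracket $[(X,x),(X',x')]=([X,X'],X\cdot x'-X'\cdot x+[x,x']_{\mathfrak k})$. Lie algebroid $N(U)=U\times\mathfrak l\times\mathfrak g^*$ over $U$ (the Lie algebroid dual associated with $l$): anchor $a_p(z,\xi)=i^*\xi-\mathrm{ad}^*_zp$, and bracket on sections $$[(z,\xi),(z',\xi')]_p=\big(d_pz'(a_p(z_p,\xi_p))-d_pz(a_p(z'_p,\xi'_p))-[z_p,z'_p]+\langle\xi_p,d_pl(\cdot)\xi'_p\rangle,\ d_p\xi'(a_p(z_p,\xi_p))-d_p\xi(a_p(z'_p,\xi'_p))+\mathrm{ad}^*_{z_p}\xi'_p-\mathrm{ad}^*_{z'_p}\xi_p+\langle\xi_p,\varpi_\bullet\xi'_p\rangle+\mathrm{ad}^*_{l_p\xi_p}\xi'_p-\mathrm{ad}^*_{l_p\xi'_p}\xi_p\big),$$ where $\langle\xi_p,d_pl(\cdot)\xi'_p\rangle\in(\mathfrak l^* )^*=\mathfrak l$. *)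

theory Defs
  imports "HOL-Analysis.Analysis"
begin

section \<open>Linear algebra over the real or complex numbers\<close>

text \<open>
  The ground field is \<open>\<real>\<close> or \<open>\<complex>\<close>: the range of \<open>to_cplx\<close> is a subfield of \<open>\<complex>\<close> containing \<open>\<real>\<close>.
\<close>

class real_or_complex = real_normed_field +
  fixes to_cplx :: "'a \<Rightarrow> complex"
  assumes to_cplx_add: "to_cplx (x + y) = to_cplx x + to_cplx y"
    and to_cplx_mult: "to_cplx (x * y) = to_cplx x * to_cplx y"
    and to_cplx_scaleR_one: "to_cplx (r *\<^sub>R 1) = complex_of_real r"
    and norm_to_cplx: "norm (to_cplx x) = norm x"

instantiation real :: real_or_complex
begin
definition to_cplx_real :: "real \<Rightarrow> complex" where "to_cplx_real = complex_of_real"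
instance
  by standard (simp_all only: to_cplx_real_def of_real_add of_real_mult norm_of_real
      real_scaleR_def mult_1_right real_norm_def)
end

instantiation complex :: real_or_complex
begin
definition to_cplx_complex :: "complex \<Rightarrow> complex" where "to_cplx_complex = (\<lambda>z. z)"
instance by standard (simp_all only: to_cplx_complex_def of_real_def)
end

text \<open>
  A finite-dimensional space over the ground field carries a unique Hausdorff vector space topology,
  so the norm of the type \<open>'v\<close> is an auxiliary choice.
\<close>

definition fd_vector_space ::
    "('k::real_or_complex \<Rightarrow> 'v::real_normed_vector \<Rightarrow> 'v) \<Rightarrow> bool" where
  "fd_vector_space sc \<longleftrightarrow> vector_space sc \<and> (\<forall>r x. sc (of_real r) x = r *\<^sub>R x) \<and>
     (\<exists>B. finite B \<and> module.span sc B = UNIV)"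

definition klinear_on ::
    "('k \<Rightarrow> 'v \<Rightarrow> 'v::ab_group_add) \<Rightarrow> ('k \<Rightarrow> 'w \<Rightarrow> 'w::ab_group_add) \<Rightarrow> 'v set \<Rightarrow> ('v \<Rightarrow> 'w) \<Rightarrow> bool" where
  "klinear_on s1 s2 V f \<longleftrightarrow>
     (\<forall>x\<in>V. \<forall>y\<in>V. f (x + y) = f x + f y) \<and> (\<forall>c. \<forall>x\<in>V. f (s1 c x) = s2 c (f x))"

definition prod_scale ::
    "('k \<Rightarrow> 'v \<Rightarrow> 'v) \<Rightarrow> ('k \<Rightarrow> 'w \<Rightarrow> 'w) \<Rightarrow> 'k \<Rightarrow> 'v \<times> 'w \<Rightarrow> 'v \<times> 'w" where
  "prod_scale s1 s2 c v = (s1 c (fst v), s2 c (snd v))"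

text \<open>
  Complex spectrum of an endomorphism \<open>A\<close> of the space \<open>V\<close>: its eigenvalues if the ground field is
  \<open>\<complex>\<close>, and the eigenvalues of the complexification if it is \<open>\<real>\<close>, where
  \<open>A (v + \<i> w) = (a + \<i> b) (v + \<i> w)\<close> has been split into real and imaginary parts.
\<close>

definition cspectrum ::
    "('k::real_or_complex \<Rightarrow> 'v::real_normed_vector \<Rightarrow> 'v) \<Rightarrow> 'v set \<Rightarrow> ('v \<Rightarrow> 'v) \<Rightarrow> complex set" where
  "cspectrum sc V A =
     (if range (to_cplx :: 'k \<Rightarrow> complex) = UNIV
      then {to_cplx c | c. \<exists>v\<in>V. v \<noteq> 0 \<and> A v = sc c v}
      else {Complex a b | a b. \<exists>v\<in>V. \<exists>w\<in>V. (v, w) \<noteq> (0, 0) \<and>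
              A v = a *\<^sub>R v - b *\<^sub>R w \<and> A w = b *\<^sub>R v + a *\<^sub>R w})"

subsection \<open>Functions of an endomorphism\<close>

definition op_series :: "real fps \<Rightarrow> ('v::real_normed_vector \<Rightarrow> 'v) \<Rightarrow> 'v \<Rightarrow> 'v" where
  "op_series f A v = (\<Sum>n. fps_nth f n *\<^sub>R (A ^^ n) v)"

definition fps_sinh :: "real fps" where
  "fps_sinh = fps_const (1 / 2) * (fps_exp 1 - fps_exp (- 1))"

lemma fps_sinh_nth: "fps_nth fps_sinh n = (if odd n then 1 / fact n else 0)"
  unfolding fps_sinh_def by (cases "odd n") simp_all

lemma fps_sinh_div_X_nth:
  "fps_nth (fps_sinh / fps_X) n = (if even n then 1 / fact (n + 1) else 0)"
  by (simp add: fps_sinh_nth)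

lemma fps_sinh_minus_X_div_X2_nth:
  "fps_nth ((fps_sinh - fps_X) / fps_X ^ 2) n = (if odd n then 1 / fact (n + 2) else 0)"
  by (subst fps_div_fps_X_power_nth) (auto simp: fps_sinh_nth)

text \<open>
  Functional calculus for a function \<open>F\<close> that is meromorphic on \<open>\<complex>\<close> and real on \<open>\<real>\<close>: if \<open>F = g / h\<close>
  with \<open>g\<close>, \<open>h\<close> entire and \<open>h(A)\<close> is invertible, then \<open>F(A) = g(A) h(A)\<inverse>\<close>, whatever the choice of
  such \<open>g\<close>, \<open>h\<close>. By the identity theorem it is enough to compare \<open>F\<close> with \<open>g / h\<close> near \<open>0\<close>.
\<close>

definition mero_calc ::
    "(complex \<Rightarrow> complex) \<Rightarrow> 'v::real_normed_vector set \<Rightarrow> ('v \<Rightarrow> 'v) \<Rightarrow> 'v \<Rightarrow> 'v" where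
  "mero_calc F V A v = (THE w. \<exists>g h :: real fps.
     fps_conv_radius g = \<infinity> \<and> fps_conv_radius h = \<infinity> \<and>
     (\<forall>\<^sub>F z in at 0. eval_fps (Abs_fps (\<lambda>n. complex_of_real (fps_nth g n))) z
                   = F z * eval_fps (Abs_fps (\<lambda>n. complex_of_real (fps_nth h n))) z) \<and>
     bij_betw (op_series h A) V V \<and>
     w = op_series g A (inv_into V (op_series h A) v))"

definition F_can :: "complex \<Rightarrow> complex" where
  "F_can z = cosh z / sinh z - 1 / z"

subsection \<open>Spaces in duality\<close>

text \<open>
  A space \<open>V = car D\<close>, given as a subspace of a type \<open>'v\<close>, and its dual, given as a type \<open>'s\<close> with a
  nondegenerate pairing.
\<close>

record ('k, 'v, 's) dual_pair =
  car :: "'v set"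
  scv :: "'k \<Rightarrow> 'v \<Rightarrow> 'v"
  scs :: "'k \<Rightarrow> 's \<Rightarrow> 's"
  pair :: "'s \<Rightarrow> 'v \<Rightarrow> 'k"

definition is_dual_pair ::
    "('k::real_or_complex, 'v::real_normed_vector, 's::real_normed_vector, 'z) dual_pair_scheme \<Rightarrow> bool" where
  "is_dual_pair D \<longleftrightarrow>
     fd_vector_space (scv D) \<and> fd_vector_space (scs D) \<and> module.subspace (scv D) (car D) \<and>
     (\<forall>\<xi>. klinear_on (scv D) (*) (car D) (pair D \<xi>)) \<and>
     (\<forall>x\<in>car D. klinear_on (scs D) (*) UNIV (\<lambda>\<xi>. pair D \<xi> x)) \<and>
     (\<forall>\<xi>. (\<forall>x\<in>car D. pair D \<xi> x = 0) \<longrightarrow> \<xi> = 0) \<and>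
     (\<forall>x\<in>car D. (\<forall>\<xi>. pair D \<xi> x = 0) \<longrightarrow> x = 0)"

definition covec_of :: "('k, 'v, 's, 'z) dual_pair_scheme \<Rightarrow> ('v \<Rightarrow> 'k) \<Rightarrow> 's" where
  "covec_of D u = (THE \<xi>. \<forall>x\<in>car D. pair D \<xi> x = u x)"

definition vec_of :: "('k, 'v, 's, 'z) dual_pair_scheme \<Rightarrow> ('s \<Rightarrow> 'k) \<Rightarrow> 'v" where
  "vec_of D u = (THE x. x \<in> car D \<and> (\<forall>\<xi>. pair D \<xi> x = u \<xi>))"

text \<open>Here \<open>f\<close> maps the space of \<open>D\<close> to that of \<open>E\<close>, and its transpose goes between the duals.\<close>

definition transp ::
    "('k, 'v, 's, 'y) dual_pair_scheme \<Rightarrow> ('k, 'w, 't, 'z) dual_pair_scheme \<Rightarrow> ('v \<Rightarrow> 'w) \<Rightarrow> 't \<Rightarrow> 's" where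
  "transp D E f \<eta> = covec_of D (\<lambda>x. pair E \<eta> (f x))"

definition annihilator :: "('k::zero, 'v, 's, 'z) dual_pair_scheme \<Rightarrow> 'v set \<Rightarrow> 's set" where
  "annihilator D A = {\<xi>. \<forall>x\<in>A. pair D \<xi> x = 0}"

definition skew_maps ::
    "('k::real_or_complex, 'v::real_normed_vector, 's::real_normed_vector, 'z) dual_pair_scheme \<Rightarrow> ('s \<Rightarrow> 'v) set" where
  "skew_maps D = {t. range t \<subseteq> car D \<and> klinear_on (scs D) (scv D) UNIV t \<and>
     (\<forall>\<xi> \<eta>. pair D \<xi> (t \<eta>) = - pair D \<eta> (t \<xi>))}"

text \<open>
  Elements of \<open>V \<otimes> V \<otimes> V\<close> are written as trilinear forms on the dual of \<open>V\<close>, that is \<open>\<psi>\<close> stands for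
  \<open>\<lambda>\<xi> \<eta> \<zeta>. \<langle>\<xi> \<otimes> \<eta> \<otimes> \<zeta>, \<psi>\<rangle>\<close>; the elements of the third exterior power are the alternating ones.
\<close>

definition alternating3 ::
    "('k::real_or_complex, 'v, 's::real_normed_vector, 'z) dual_pair_scheme \<Rightarrow> ('s \<Rightarrow> 's \<Rightarrow> 's \<Rightarrow> 'k) set" where
  "alternating3 D = {\<phi>.
     (\<forall>\<eta> \<zeta>. klinear_on (scs D) (*) UNIV (\<lambda>\<xi>. \<phi> \<xi> \<eta> \<zeta>)) \<and>
     (\<forall>\<xi> \<zeta>. klinear_on (scs D) (*) UNIV (\<lambda>\<eta>. \<phi> \<xi> \<eta> \<zeta>)) \<and>
     (\<forall>\<xi> \<eta>. klinear_on (scs D) (*) UNIV (\<lambda>\<zeta>. \<phi> \<xi> \<eta> \<zeta>)) \<and>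
     (\<forall>\<xi> \<eta>. \<phi> \<xi> \<xi> \<eta> = 0 \<and> \<phi> \<xi> \<eta> \<eta> = 0 \<and> \<phi> \<xi> \<eta> \<xi> = 0)}"

definition tensor3 ::
    "('k::real_or_complex, 'v, 's, 'z) dual_pair_scheme \<Rightarrow> 'v set \<Rightarrow> 'v set \<Rightarrow> 'v set \<Rightarrow> ('s \<Rightarrow> 's \<Rightarrow> 's \<Rightarrow> 'k) set" where
  "tensor3 D A B C = {\<psi>. \<exists>(n::nat) a b c. (\<forall>i<n. a i \<in> A \<and> b i \<in> B \<and> c i \<in> C) \<and>
     \<psi> = (\<lambda>\<xi> \<eta> \<zeta>. \<Sum>i<n. pair D \<xi> (a i) * pair D \<eta> (b i) * pair D \<zeta> (c i))}"

text \<open>The alternation, up to a nonzero scalar.\<close>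

definition Alt3 :: "('s \<Rightarrow> 's \<Rightarrow> 's \<Rightarrow> 'k::real_or_complex) \<Rightarrow> 's \<Rightarrow> 's \<Rightarrow> 's \<Rightarrow> 'k" where
  "Alt3 \<psi> \<xi> \<eta> \<zeta> = \<psi> \<xi> \<eta> \<zeta> + \<psi> \<eta> \<zeta> \<xi> + \<psi> \<zeta> \<xi> \<eta> - \<psi> \<eta> \<xi> \<zeta> - \<psi> \<xi> \<zeta> \<eta> - \<psi> \<zeta> \<eta> \<xi>"


section \<open>Lie quasi-bialgebras\<close>

definition lie_algebra ::
    "('k::real_or_complex \<Rightarrow> 'v::real_normed_vector \<Rightarrow> 'v) \<Rightarrow> 'v set \<Rightarrow> ('v \<Rightarrow> 'v \<Rightarrow> 'v) \<Rightarrow> bool" where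
  "lie_algebra sc V b \<longleftrightarrow>
     module.subspace sc V \<and>
     (\<forall>x\<in>V. \<forall>y\<in>V. b x y \<in> V) \<and>
     (\<forall>x\<in>V. klinear_on sc sc V (b x)) \<and>
     (\<forall>y\<in>V. klinear_on sc sc V (\<lambda>x. b x y)) \<and>
     (\<forall>x\<in>V. b x x = 0) \<and>
     (\<forall>x\<in>V. \<forall>y\<in>V. \<forall>z\<in>V. b x (b y z) + b y (b z x) + b z (b x y) = 0)"

definition lie_subalgebra ::
    "('k::real_or_complex \<Rightarrow> 'v::real_normed_vector \<Rightarrow> 'v) \<Rightarrow> 'v set \<Rightarrow> ('v \<Rightarrow> 'v \<Rightarrow> 'v) \<Rightarrow> 'v set \<Rightarrow> bool" where
  "lie_subalgebra sc V b W \<longleftrightarrow>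
     lie_algebra sc V b \<and> module.subspace sc W \<and> W \<subseteq> V \<and> (\<forall>x\<in>W. \<forall>y\<in>W. b x y \<in> W)"

record ('k, 'v, 's) qbialg = "('k, 'v, 's) dual_pair" +
  brk :: "'v \<Rightarrow> 'v \<Rightarrow> 'v"
  varpi :: "'v \<Rightarrow> 's \<Rightarrow> 'v"
  phi :: "'s \<Rightarrow> 's \<Rightarrow> 's \<Rightarrow> 'k"

definition ad_star :: "('k, 'v, 's, 'z) qbialg_scheme \<Rightarrow> 'v \<Rightarrow> 's \<Rightarrow> 's" where
  "ad_star G x = transp G G (brk G x)"

definition double_car :: "('k, 'v, 's, 'z) qbialg_scheme \<Rightarrow> ('v \<times> 's) set" where
  "double_car G = car G \<times> UNIV"

definition double_scale :: "('k, 'v, 's, 'z) qbialg_scheme \<Rightarrow> 'k \<Rightarrow> 'v \<times> 's \<Rightarrow> 'v \<times> 's" where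
  "double_scale G = prod_scale (scv G) (scs G)"

fun double_brk ::
    "('k, 'v::ab_group_add, 's::ab_group_add, 'z) qbialg_scheme \<Rightarrow> 'v \<times> 's \<Rightarrow> 'v \<times> 's \<Rightarrow> 'v \<times> 's" where
  "double_brk G (x, \<xi>) (y, \<eta>) =
     (brk G x y + varpi G x \<eta> - varpi G y \<xi> + vec_of G (\<lambda>\<zeta>. phi G \<xi> \<eta> \<zeta>),
      - ad_star G x \<eta> + ad_star G y \<xi> + covec_of G (\<lambda>x. pair G \<eta> (varpi G x \<xi>)))"

definition lie_quasi_bialgebra ::
    "('k::real_or_complex, 'v::real_normed_vector, 's::real_normed_vector, 'z) qbialg_scheme \<Rightarrow> bool" where
  "lie_quasi_bialgebra G \<longleftrightarrow>
     is_dual_pair G \<and>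
     lie_algebra (scv G) (car G) (brk G) \<and>
     (\<forall>x\<in>car G. varpi G x \<in> skew_maps G) \<and>
     (\<forall>\<xi>. klinear_on (scv G) (scv G) (car G) (\<lambda>x. varpi G x \<xi>)) \<and>
     (\<forall>x\<in>car G. \<forall>y\<in>car G. \<forall>\<xi>. varpi G (brk G x y) \<xi> =
        brk G x (varpi G y \<xi>) + varpi G y (ad_star G x \<xi>)
        - brk G y (varpi G x \<xi>) - varpi G x (ad_star G y \<xi>)) \<and>
     phi G \<in> alternating3 G \<and>
     lie_algebra (double_scale G) (double_car G) (double_brk G)"

definition Ad_exp ::
    "('k, 'v::real_normed_vector, 's::real_normed_vector, 'z) qbialg_scheme \<Rightarrow> 'v \<times> 's \<Rightarrow> 'v \<times> 's \<Rightarrow> 'v \<times> 's" where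
  "Ad_exp G X = op_series (fps_exp 1) (double_brk G X)"

definition reductive_decomposition ::
    "('k::real_or_complex, 'v::real_normed_vector, 's, 'z) qbialg_scheme \<Rightarrow> 'v set \<Rightarrow> 'v set \<Rightarrow> bool" where
  "reductive_decomposition G l m \<longleftrightarrow>
     lie_subalgebra (scv G) (car G) (brk G) l \<and>
     module.subspace (scv G) m \<and> m \<subseteq> car G \<and>
     l \<inter> m = {0} \<and> (\<forall>x\<in>car G. \<exists>y\<in>l. \<exists>w\<in>m. x = y + w) \<and>
     (\<forall>z\<in>l. \<forall>w\<in>m. brk G z w \<in> m)"

definition canonically_compatible ::
    "('k::real_or_complex, 'v::real_normed_vector, 's, 'z) qbialg_scheme \<Rightarrow> 'v set \<Rightarrow> 'v set \<Rightarrow> bool" where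
  "canonically_compatible G l m \<longleftrightarrow>
     (\<forall>z\<in>l. \<forall>\<xi>. varpi G z \<xi> = 0) \<and>
     (\<forall>x\<in>car G. \<forall>\<xi>\<in>annihilator G m. \<forall>\<eta>\<in>annihilator G m. pair G \<xi> (varpi G x \<eta>) = 0) \<and>
     (\<exists>\<psi>1\<in>tensor3 G l l l. \<exists>\<psi>2\<in>tensor3 G l m m. \<exists>\<psi>3\<in>tensor3 G m m m.
        phi G = Alt3 (\<lambda>\<xi> \<eta> \<zeta>. \<psi>1 \<xi> \<eta> \<zeta> + \<psi>2 \<xi> \<eta> \<zeta> + \<psi>3 \<xi> \<eta> \<zeta>)) \<and>
     (\<forall>\<xi>\<in>annihilator G l. \<forall>\<eta>\<in>annihilator G l. \<forall>\<zeta>\<in>annihilator G l. phi G \<xi> \<eta> \<zeta> = 0)"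


section \<open>The canonical dynamical \<open>\<ell>\<close>-matrix\<close>

text \<open>
  From here on \<open>G\<close> is a Lie quasi-bialgebra on the whole type \<open>'g\<close> with dual \<open>'gs\<close>, and \<open>L\<close> consists of
  the subalgebra \<open>car L\<close> of \<open>'g\<close> and its dual \<open>'ls\<close>; \<open>m\<close> is the complement of \<open>car L\<close>.
\<close>

definition proj_l :: "('k, 'g::ab_group_add, 'ls, 'y) dual_pair_scheme \<Rightarrow> 'g set \<Rightarrow> 'g \<Rightarrow> 'g" where
  "proj_l L m x = (THE y. y \<in> car L \<and> x - y \<in> m)"

definition s_map ::
    "('k, 'g::ab_group_add, 'gs, 'z) qbialg_scheme \<Rightarrow> ('k, 'g, 'ls, 'y) dual_pair_scheme \<Rightarrow> 'g set \<Rightarrow> 'ls \<Rightarrow> 'gs" where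
  "s_map G L m = transp G L (proj_l L m)"

definition i_star ::
    "('k, 'g, 'gs, 'z) qbialg_scheme \<Rightarrow> ('k, 'g, 'ls, 'y) dual_pair_scheme \<Rightarrow> 'gs \<Rightarrow> 'ls" where
  "i_star G L = transp L G (\<lambda>z. z)"

definition l_qbialg ::
    "('k, 'g::ab_group_add, 'gs, 'z) qbialg_scheme \<Rightarrow> ('k, 'g, 'ls, 'y) dual_pair_scheme \<Rightarrow> 'g set \<Rightarrow>
     ('k, 'g, 'ls) qbialg" where
  "l_qbialg G L m =
     \<lparr>car = car L, scv = scv L, scs = scs L, pair = pair L, brk = brk G, varpi = (\<lambda>z \<alpha>. 0),
      phi = (\<lambda>\<alpha> \<beta> \<gamma>. phi G (s_map G L m \<alpha>) (s_map G L m \<beta>) (s_map G L m \<gamma>))\<rparr>"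

definition Ad_gg ::
    "('k, 'g::real_normed_vector, 'gs::real_normed_vector, 'z) qbialg_scheme \<Rightarrow>
     ('k, 'g, 'ls, 'y) dual_pair_scheme \<Rightarrow> 'g set \<Rightarrow> 'ls \<Rightarrow> 'g \<Rightarrow> 'g" where
  "Ad_gg G L m p x = fst (Ad_exp G (0, - s_map G L m p) (x, 0))"

definition U_can ::
    "('k::real_or_complex, 'g::real_normed_vector, 'gs::real_normed_vector, 'z) qbialg_scheme \<Rightarrow>
     ('k, 'g, 'ls::real_normed_vector, 'y) dual_pair_scheme \<Rightarrow> 'g set \<Rightarrow> 'ls set" where
  "U_can G L m = {p.
     cspectrum (double_scale (l_qbialg G L m)) (double_car (l_qbialg G L m))
               (double_brk (l_qbialg G L m) (0, p))
       \<inter> {\<i> * of_real pi * of_int k | k :: int. k \<noteq> 0} = {} \<and>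
     bij (Ad_gg G L m p)}"

text \<open>
  Every \<open>\<eta>\<close> in the dual of \<open>\<gg>\<close> is uniquely \<open>s \<alpha> + \<xi>\<close> with \<open>\<xi>\<close> vanishing on \<open>\<ll>\<close>, and \<open>\<alpha> = i\<^sup>* \<eta>\<close>. As
  \<open>ad\<^sub>p\<close> exchanges \<open>\<ll>\<close> and its dual, and \<open>F\<close> is odd, the value of \<open>F(ad\<^sub>p)\<close> at \<open>(0, \<alpha>)\<close> lies in \<open>\<ll> \<times> {0}\<close>.
\<close>

definition l_can ::
    "('k, 'g::real_normed_vector, 'gs::real_normed_vector, 'z) qbialg_scheme \<Rightarrow>
     ('k, 'g, 'ls::real_normed_vector, 'y) dual_pair_scheme \<Rightarrow> 'g set \<Rightarrow> 'ls \<Rightarrow> 'gs \<Rightarrow> 'g" where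
  "l_can G L m p \<eta> =
     (let \<alpha> = i_star G L \<eta>; \<xi> = \<eta> - s_map G L m \<alpha> in
        fst (mero_calc F_can (double_car (l_qbialg G L m)) (double_brk (l_qbialg G L m) (0, p)) (0, \<alpha>))
        - inv (Ad_gg G L m p) (fst (Ad_exp G (0, - s_map G L m p) (0, \<xi>))))"


section \<open>Lie algebroids on trivial bundles\<close>

text \<open>
  Smooth means \<open>C\<^sup>\<infinity>\<close> over the ground field, hence holomorphic if that is \<open>\<complex>\<close>; \<open>W\<close> is to be open.
\<close>

abbreviation deriv_at :: "('b::real_normed_vector \<Rightarrow> 'f::real_normed_vector) \<Rightarrow> 'b \<Rightarrow> 'b \<Rightarrow> 'f" where
  "deriv_at f p v \<equiv> frechet_derivative f (at p) v"

primrec Ck_on ::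
    "nat \<Rightarrow> ('k \<Rightarrow> 'b::real_normed_vector \<Rightarrow> 'b) \<Rightarrow> ('k \<Rightarrow> 'f::real_normed_vector \<Rightarrow> 'f) \<Rightarrow>
     'b set \<Rightarrow> ('b \<Rightarrow> 'f) \<Rightarrow> bool" where
  "Ck_on 0 sb sf W f \<longleftrightarrow> continuous_on W f"
| "Ck_on (Suc n) sb sf W f \<longleftrightarrow>
     (\<forall>p\<in>W. f differentiable (at p) \<and> klinear_on sb sf UNIV (deriv_at f p)) \<and>
     (\<forall>v. Ck_on n sb sf W (\<lambda>p. deriv_at f p v))"

definition smooth_on ::
    "('k \<Rightarrow> 'b::real_normed_vector \<Rightarrow> 'b) \<Rightarrow> ('k \<Rightarrow> 'f::real_normed_vector \<Rightarrow> 'f) \<Rightarrow>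
     'b set \<Rightarrow> ('b \<Rightarrow> 'f) \<Rightarrow> bool" where
  "smooth_on sb sf W f \<longleftrightarrow> (\<forall>n. Ck_on n sb sf W f)"

text \<open>
  The bundle is \<open>base \<times> fib\<close> with \<open>base\<close> open in the vector space \<open>'b\<close> and \<open>fib\<close> a subspace of \<open>'f\<close>.
  Sections over an open set \<open>W\<close> are functions on \<open>'b\<close>, of which only the values on \<open>W\<close> matter.
\<close>

record ('k, 'b, 'f) algebroid =
  base :: "'b set"
  bsc :: "'k \<Rightarrow> 'b \<Rightarrow> 'b"
  fib :: "'f set"
  fsc :: "'k \<Rightarrow> 'f \<Rightarrow> 'f"
  anchor :: "'b \<Rightarrow> 'f \<Rightarrow> 'b"
  sbrk :: "('b \<Rightarrow> 'f) \<Rightarrow> ('b \<Rightarrow> 'f) \<Rightarrow> 'b \<Rightarrow> 'f"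

definition sections ::
    "('k, 'b::real_normed_vector, 'f::real_normed_vector, 'z) algebroid_scheme \<Rightarrow> 'b set \<Rightarrow> ('b \<Rightarrow> 'f) set" where
  "sections A W = {\<sigma>. smooth_on (bsc A) (fsc A) W \<sigma> \<and> \<sigma> ` W \<subseteq> fib A}"

definition vbracket ::
    "('b::real_normed_vector \<Rightarrow> 'b) \<Rightarrow> ('b \<Rightarrow> 'b) \<Rightarrow> 'b \<Rightarrow> 'b" where
  "vbracket X Y p = deriv_at Y p (X p) - deriv_at X p (Y p)"

definition lie_algebroid ::
    "('k::real_or_complex, 'b::real_normed_vector, 'f::real_normed_vector, 'z) algebroid_scheme \<Rightarrow> bool" where
  "lie_algebroid A \<longleftrightarrow>
     open (base A) \<and> module.subspace (fsc A) (fib A) \<and>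
     (\<forall>p\<in>base A. klinear_on (fsc A) (bsc A) (fib A) (anchor A p)) \<and>
     (\<forall>W. open W \<and> W \<subseteq> base A \<longrightarrow>
        (\<forall>\<sigma>\<in>sections A W. smooth_on (bsc A) (bsc A) W (\<lambda>p. anchor A p (\<sigma> p))) \<and>
        (\<forall>\<sigma>\<in>sections A W. \<forall>\<tau>\<in>sections A W.
           sbrk A \<sigma> \<tau> \<in> sections A W \<and>
           (\<forall>p\<in>W. sbrk A \<sigma> \<tau> p = - sbrk A \<tau> \<sigma> p) \<and>
           (\<forall>\<tau>'. (\<forall>p\<in>W. \<tau>' p = \<tau> p) \<longrightarrow> (\<forall>p\<in>W. sbrk A \<sigma> \<tau>' p = sbrk A \<sigma> \<tau> p)) \<and>
           (\<forall>\<rho>\<in>sections A W. \<forall>p\<in>W.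
              sbrk A \<sigma> (\<lambda>q. \<tau> q + \<rho> q) p = sbrk A \<sigma> \<tau> p + sbrk A \<sigma> \<rho> p \<and>
              sbrk A \<sigma> (sbrk A \<tau> \<rho>) p + sbrk A \<tau> (sbrk A \<rho> \<sigma>) p + sbrk A \<rho> (sbrk A \<sigma> \<tau>) p = 0) \<and>
           (\<forall>f. smooth_on (bsc A) (*) W f \<longrightarrow>
              (\<forall>p\<in>W. sbrk A \<sigma> (\<lambda>q. fsc A (f q) (\<tau> q)) p =
                 fsc A (f p) (sbrk A \<sigma> \<tau> p) + fsc A (deriv_at f p (anchor A p (\<sigma> p))) (\<tau> p))) \<and>
           (\<forall>p\<in>W. anchor A p (sbrk A \<sigma> \<tau> p) =
              vbracket (\<lambda>q. anchor A q (\<sigma> q)) (\<lambda>q. anchor A q (\<tau> q)) p)))"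

text \<open>
  Isomorphisms over the identity of the base. A fibrewise linear map of trivial bundles is smooth
  precisely if it sends smooth sections to smooth sections.
\<close>

definition lie_algebroid_iso ::
    "('k::real_or_complex, 'b::real_normed_vector, 'e::real_normed_vector, 'y) algebroid_scheme \<Rightarrow>
     ('k, 'b, 'f::real_normed_vector, 'z) algebroid_scheme \<Rightarrow> ('b \<Rightarrow> 'e \<Rightarrow> 'f) \<Rightarrow> bool" where
  "lie_algebroid_iso A B T \<longleftrightarrow>
     lie_algebroid A \<and> lie_algebroid B \<and> base A = base B \<and> bsc A = bsc B \<and>
     (\<forall>p\<in>base A. klinear_on (fsc A) (fsc B) (fib A) (T p) \<and> bij_betw (T p) (fib A) (fib B)) \<and>
     (\<forall>p\<in>base A. \<forall>v\<in>fib A. anchor B p (T p v) = anchor A p v) \<and>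
     (\<forall>W. open W \<and> W \<subseteq> base A \<longrightarrow>
        (\<forall>\<sigma>\<in>sections A W. (\<lambda>p. T p (\<sigma> p)) \<in> sections B W) \<and>
        (\<forall>\<tau>\<in>sections B W. (\<lambda>p. inv_into (fib A) (T p) (\<tau> p)) \<in> sections A W) \<and>
        (\<forall>\<sigma>\<in>sections A W. \<forall>\<sigma>'\<in>sections A W. \<forall>p\<in>W.
           T p (sbrk A \<sigma> \<sigma>' p) = sbrk B (\<lambda>q. T q (\<sigma> q)) (\<lambda>q. T q (\<sigma>' q)) p))"

definition trivial_algebroid ::
    "'b::real_normed_vector set \<Rightarrow> ('k \<Rightarrow> 'b \<Rightarrow> 'b) \<Rightarrow> ('k \<Rightarrow> 'v::real_normed_vector \<Rightarrow> 'v) \<Rightarrow> 'v set \<Rightarrow>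
     ('v \<Rightarrow> 'v \<Rightarrow> 'v) \<Rightarrow> ('k, 'b, 'b \<times> 'v) algebroid" where
  "trivial_algebroid U sb sk K b =
     \<lparr>base = U, bsc = sb, fib = UNIV \<times> K, fsc = prod_scale sb sk,
      anchor = (\<lambda>p v. fst v),
      sbrk = (\<lambda>\<sigma> \<sigma>' p.
        let X = (\<lambda>q. fst (\<sigma> q)); x = (\<lambda>q. snd (\<sigma> q));
            X' = (\<lambda>q. fst (\<sigma>' q)); x' = (\<lambda>q. snd (\<sigma>' q))
        in (vbracket X X' p, deriv_at x' p (X p) - deriv_at x p (X' p) + b (x p) (x' p)))\<rparr>"


section \<open>The dual algebroid and the trivialisation\<close>

definition N_anchor ::
    "('k, 'g, 'gs, 'z) qbialg_scheme \<Rightarrow> ('k, 'g::ab_group_add, 'ls::ab_group_add, 'y) dual_pair_scheme \<Rightarrow>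
     'g set \<Rightarrow> 'ls \<Rightarrow> 'g \<times> 'gs \<Rightarrow> 'ls" where
  "N_anchor G L m p v = i_star G L (snd v) - ad_star (l_qbialg G L m) (fst v) p"

definition N_algebroid ::
    "('k::real_or_complex, 'g::real_normed_vector, 'gs::real_normed_vector, 'z) qbialg_scheme \<Rightarrow>
     ('k, 'g, 'ls::real_normed_vector, 'y) dual_pair_scheme \<Rightarrow> 'g set \<Rightarrow> 'ls set \<Rightarrow> ('ls \<Rightarrow> 'gs \<Rightarrow> 'g) \<Rightarrow>
     ('k, 'ls, 'g \<times> 'gs) algebroid" where
  "N_algebroid G L m U l =
     \<lparr>base = U, bsc = scs L, fib = car L \<times> UNIV, fsc = prod_scale (scv G) (scs G),
      anchor = N_anchor G L m,
      sbrk = (\<lambda>\<sigma> \<sigma>' p.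
        let z = (\<lambda>q. fst (\<sigma> q)); \<xi> = (\<lambda>q. snd (\<sigma> q));
            z' = (\<lambda>q. fst (\<sigma>' q)); \<xi>' = (\<lambda>q. snd (\<sigma>' q));
            a = N_anchor G L m p (\<sigma> p); a' = N_anchor G L m p (\<sigma>' p)
        in (deriv_at z' p a - deriv_at z p a' - brk G (z p) (z' p)
              + vec_of L (\<lambda>\<beta>. pair G (\<xi> p) (deriv_at (\<lambda>q. l q (\<xi>' p)) p \<beta>)),
            deriv_at \<xi>' p a - deriv_at \<xi> p a'
              + ad_star G (z p) (\<xi>' p) - ad_star G (z' p) (\<xi> p)
              + covec_of G (\<lambda>x. pair G (\<xi> p) (varpi G x (\<xi>' p)))
              + ad_star G (l p (\<xi> p)) (\<xi>' p) - ad_star G (l p (\<xi>' p)) (\<xi> p)))\<rparr>"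

definition g0_star ::
    "('k::zero, 'g, 'gs, 'z) qbialg_scheme \<Rightarrow> ('k, 'g, 'ls, 'y) dual_pair_scheme \<Rightarrow> ('g \<times> 'gs) set" where
  "g0_star G L = car L \<times> annihilator G (car L)"

text \<open>
  The two components of \<open>T\<close> are computed in the double; for \<open>z\<close> in \<open>\<ll>\<close> the terms other than the last
  one lie in \<open>\<ll>\<close> and in the dual of \<open>\<gg>\<close> respectively, so that \<open>fst\<close> and \<open>snd\<close> only strip a zero.
\<close>

definition T_map ::
    "('k, 'g::real_normed_vector, 'gs::real_normed_vector, 'z) qbialg_scheme \<Rightarrow>
     ('k, 'g, 'ls, 'y) dual_pair_scheme \<Rightarrow> 'g set \<Rightarrow> 'ls \<Rightarrow> 'ls \<times> ('g \<times> 'gs) \<Rightarrow> 'g \<times> 'gs" where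
  "T_map G L m p = (\<lambda>(\<alpha>, (z, \<xi>)).
     let s = s_map G L m; A = double_brk G (0, s p) in
       (fst (op_series ((fps_sinh - fps_X) / fps_X ^ 2) A (0, s \<alpha>) - op_series (fps_sinh / fps_X) A (z, 0)),
        snd (op_series (fps_sinh / fps_X) A (0, s \<alpha>) - op_series fps_sinh A (z, 0)
             - Ad_exp G (0, s p) (0, \<xi>))))"

end

theory Submission
  imports Defs "HOL-Computational_Algebra.Fundamental_Theorem_Algebra"
begin

text \<open>
  Write \<open>A = ad sp\<close> and \<open>y = z + \<xi>\<close>, let \<open>(w, \<eta>)\<close> be the value of \<open>T\<^sub>p\<close> at \<open>(\<alpha>, y)\<close>, and put
  \<open>X = e\<^sup>A y - ((e\<^sup>A - 1) / A) s\<alpha>\<close>. The explicit form of \<open>l\<close> amounts to \<open>(l \<eta>, \<eta>) = - X - w\<close>, hence the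
  bracket of \<open>N(U)\<close> is determined by the pairs \<open>(\<alpha>, X)\<close>. As \<open>(e\<^sup>A - 1) / A\<close> is a flat connection form
  and \<open>e\<^sup>A\<close> acts by automorphisms of the double, \<open>X\<close> is a gauge transform of \<open>y\<close>; this is the component of the
  bracket identity in the dual of \<open>\<gg>\<close>. The component in \<open>\<ll>\<close> is paired with \<open>\<beta>\<close>; the skew-symmetry of \<open>l\<close>
  turns the term with the derivative of \<open>l\<close> into a pairing of \<open>X + w\<close> with the derivative of \<open>X + w\<close>, and the
  identity splits according to the degree in \<open>\<alpha>\<close>. In degree two it says that the two-form
  \<open>(a, ((sinh A - A) / A\<^sup>2) c)\<close> is a primitive of the pull-back of the invariant three-form.

  The spectral condition in the definition of \<open>U\<close> means that \<open>sinh A / A\<close> is injective on the sum of \<open>\<ll>\<close>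
  and \<open>s \<ll>\<^sup>*\<close>, which makes \<open>T\<^sub>p\<close> bijective and \<open>U\<close> open. The axioms of a Lie algebroid hold for \<open>N(U)\<close>
  because they hold for the trivial algebroid and \<open>T\<close> matches the brackets.
\<close>

section \<open>Finite-dimensional spaces\<close>

text \<open>The formula for \<open>l\<close> contains an inverse operator and a meromorphic
  function, and it is never differentiated itself. Differentiating its relation to \<open>T\<close>
  produces the derivative of the inverse of \<open>T\<close>, but only inside a point of the graph
  of \<open>l\<close>; the graph is isotropic for the invariant form, so pairing with another of its
  points removes that term. What is left involves everywhere convergent series in \<open>A\<close>.
  As \<open>A\<close> does not commute with its variation, the main identities are not compared
  coefficientwise: a scale t is put into the series, and both sides solve the same differential
  equation in t. Parity does most of the cancelling. The double is the sum of the subalgebra, the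
  image of its dual and a third summand; odd series exchange the first two, even ones keep them, and
  each of the two is isotropic and orthogonal to the third. The spaces are known to be
  finite-dimensional only through a finite spanning set and carry arbitrary norms, so boundedness of
  linear maps and uniform estimates for families of them come from coordinates.\<close>

definition finite_dim :: "'a::real_vector itself \<Rightarrow> bool" where
  "finite_dim _ \<longleftrightarrow> (\<exists>B::'a set. finite B \<and> span B = UNIV)"

text \<open>The bound dominates each coordinate by the norm, so a Cauchy sequence in the span has
  Cauchy coordinates; the span is complete and therefore closed.\<close>

lemma closed_span_if_coeff_bound:
  fixes B :: "'a::real_normed_vector set"
  assumes "finite B" and C: "\<And>c. (\<Sum>b\<in>B. \<bar>c b\<bar>) \<le> C * norm (\<Sum>b\<in>B. c b *\<^sub>R b)"
  shows "closed (span B)"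
proof -
  have "complete (span B)"
    unfolding complete_def
  proof (intro allI impI, elim conjE)
    fix f :: "nat \<Rightarrow> 'a"
    assume f: "\<forall>n. f n \<in> span B" and cau: "Cauchy f"
    have "\<forall>n. \<exists>u. f n = (\<Sum>b\<in>B. u b *\<^sub>R b)"
      using f span_finite[OF \<open>finite B\<close>] by auto
    then obtain u where u: "\<And>n. f n = (\<Sum>b\<in>B. u n b *\<^sub>R b)" by metis
    have cu: "Cauchy (\<lambda>n. u n b)" if "b \<in> B" for b
    proof (rule metric_CauchyI)
      fix e :: real assume e: "e > 0"
      \<comment> \<open>\<open>C\<close> is not known to be positive, so the tolerance is divided by
        \<open>D\<close> instead.\<close>
      define D where "D = max C 1"
      have D: "D > 0" "C \<le> D" by (auto simp: D_def)
      from cau e D obtain N where N: "\<And>m n. m \<ge> N \<Longrightarrow> n \<ge> N \<Longrightarrow> dist (f m) (f n) < e / D"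
        by (meson Cauchy_def divide_pos_pos)
      have "dist (u m b) (u n b) < e" if "m \<ge> N" "n \<ge> N" for m n
      proof -
        have "dist (u m b) (u n b) \<le> (\<Sum>b\<in>B. \<bar>u m b - u n b\<bar>)"
          using member_le_sum[of b B "\<lambda>b. \<bar>u m b - u n b\<bar>"] \<open>b \<in> B\<close> \<open>finite B\<close>
          by (simp add: dist_real_def)
        also have "\<dots> \<le> C * norm (\<Sum>b\<in>B. (u m b - u n b) *\<^sub>R b)" by (rule C)
        also have "(\<Sum>b\<in>B. (u m b - u n b) *\<^sub>R b) = f m - f n"
          by (simp add: u scaleR_diff_left sum_subtractf)
        also have "C * norm (f m - f n) \<le> D * dist (f m) (f n)"
          using D by (simp add: dist_norm mult_right_mono)
        also have "\<dots> < e" using N[OF that] D by (simp add: field_simps)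
        finally show ?thesis .
      qed
      then show "\<exists>M. \<forall>m\<ge>M. \<forall>n\<ge>M. dist (u m b) (u n b) < e" by blast
    qed
    have "\<forall>b\<in>B. \<exists>l. (\<lambda>n. u n b) \<longlonglongrightarrow> l"
      using cu real_Cauchy_convergent convergent_def by blast
    then obtain l where l: "\<And>b. b \<in> B \<Longrightarrow> (\<lambda>n. u n b) \<longlonglongrightarrow> l b" by metis
    have "(\<lambda>n. \<Sum>b\<in>B. u n b *\<^sub>R b) \<longlonglongrightarrow> (\<Sum>b\<in>B. l b *\<^sub>R b)"
      by (intro tendsto_intros l)
    then show "\<exists>l\<in>span B. f \<longlonglongrightarrow> l"
      unfolding u[symmetric] by (intro bexI[of _ "\<Sum>b\<in>B. l b *\<^sub>R b"] span_sum span_scale span_base)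
  qed
  then show ?thesis by (rule complete_imp_closed)
qed

text \<open>Induction on the basis: the span of the smaller set is closed by the previous lemma, so
  the new vector \<open>a\<close> keeps a distance \<open>d\<close> from it. That distance controls
  the coordinate at \<open>a\<close>, and the induction hypothesis the remaining ones.\<close>

lemma coeff_bound:
  fixes B :: "'a::real_normed_vector set"
  assumes "finite B" "independent B"
  shows "\<exists>C. \<forall>c. (\<Sum>b\<in>B. \<bar>c b\<bar>) \<le> C * norm (\<Sum>b\<in>B. c b *\<^sub>R b)"
  using assms
proof (induction B rule: finite_induct)
  case (insert a B)
  then have "independent B" "a \<notin> span B" by (auto simp: independent_insert)
  with insert obtain C0 where C0: "\<And>c. (\<Sum>b\<in>B. \<bar>c b\<bar>) \<le> C0 * norm (\<Sum>b\<in>B. c b *\<^sub>R b)" by blast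
  have "closed (span B)" by (rule closed_span_if_coeff_bound[OF \<open>finite B\<close> C0])
  then have "open (- span B)" by auto
  then obtain d where d: "d > 0" "ball a d \<subseteq> - span B"
    using \<open>a \<notin> span B\<close> openE by blast
  have dd: "d \<le> norm (a - y)" if "y \<in> span B" for y
    using d that by (force simp: dist_norm)
  define C where "C = max C0 0"
  have C: "(\<Sum>b\<in>B. \<bar>c b\<bar>) \<le> C * norm (\<Sum>b\<in>B. c b *\<^sub>R b)" and Cnn: "C \<ge> 0" for c
    by (rule order_trans[OF C0], rule mult_right_mono) (auto simp: C_def)
  have "(\<Sum>b\<in>insert a B. \<bar>c b\<bar>) \<le> (1 / d + C * (1 + norm a / d)) * norm (\<Sum>b\<in>insert a B. c b *\<^sub>R b)" for c
  proof -
    define y where "y = (\<Sum>b\<in>B. c b *\<^sub>R b)"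
    define x where "x = c a *\<^sub>R a + y"
    have ys: "y \<in> span B" unfolding y_def by (intro span_sum span_scale span_base)
    have ca: "\<bar>c a\<bar> \<le> norm x / d"
    proof (cases "c a = 0")
      case False
      have "d \<le> norm (a - (- (1 / c a)) *\<^sub>R y)" by (intro dd span_scale ys)
      also have "a - (- (1 / c a)) *\<^sub>R y = (1 / c a) *\<^sub>R x"
        using False by (simp add: x_def scaleR_add_right)
      finally have "d \<le> norm x / \<bar>c a\<bar>" by (simp add: divide_inverse mult.commute)
      then show ?thesis using False d by (simp add: field_simps)
    qed (use d in auto)
    have "norm y \<le> norm x + \<bar>c a\<bar> * norm a"
      using norm_triangle_ineq4[of x "c a *\<^sub>R a"] by (simp add: x_def)
    also have "\<dots> \<le> norm x + norm x / d * norm a"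
      using mult_right_mono[OF ca, of "norm a"] by simp
    also have "\<dots> = (1 + norm a / d) * norm x" by (simp add: algebra_simps)
    finally have "C * norm y \<le> C * ((1 + norm a / d) * norm x)" using Cnn by (rule mult_left_mono)
    with ca C[of c] have "\<bar>c a\<bar> + (\<Sum>b\<in>B. \<bar>c b\<bar>) \<le> norm x / d + C * ((1 + norm a / d) * norm x)"
      by (simp add: y_def)
    then show ?thesis using insert by (simp add: x_def y_def algebra_simps)
  qed
  then show ?case by blast
qed simp

lemma finite_dim_basis:
  assumes "finite_dim TYPE('a::real_vector)"
  obtains B :: "'a::real_vector set" where "finite B" "independent B" "span B = UNIV"
proof -
  from assms obtain B0 :: "'a set" where B0: "finite B0" "span B0 = UNIV"
    by (auto simp: finite_dim_def)
  obtain B where B: "B \<subseteq> B0" "independent B" "B0 \<subseteq> span B"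
    using maximal_independent_subset[of B0] by blast
  have "span B = UNIV"
    using span_minimal[OF B(3) subspace_span] B0(2) by auto
  with B B0(1) show ?thesis by (intro that[of B]) (auto intro: finite_subset)
qed

lemma linear_expand:
  fixes f :: "'a::real_vector \<Rightarrow> 'b::real_vector"
  assumes "linear f" "finite B" "independent B" "span B = UNIV"
  shows "f x = (\<Sum>b\<in>B. representation B x b *\<^sub>R f b)"
proof -
  have "x = (\<Sum>b\<in>B. representation B x b *\<^sub>R b)"
    using real_vector.sum_representation_eq[OF assms(3), of x B] assms by simp
  then have "f x = f (\<Sum>b\<in>B. representation B x b *\<^sub>R b)" by simp
  also have "\<dots> = (\<Sum>b\<in>B. representation B x b *\<^sub>R f b)"
    by (simp add: linear_sum[OF assms(1)] linear_scale[OF assms(1)])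
  finally show ?thesis .
qed

lemma finite_dim_linear_bounded:
  fixes f :: "'a::real_normed_vector \<Rightarrow> 'b::real_normed_vector"
  assumes "finite_dim TYPE('a)" "linear f"
  shows "bounded_linear f"
proof -
  obtain B :: "'a set" where B: "finite B" "independent B" "span B = UNIV"
    using finite_dim_basis[OF assms(1)] .
  obtain C where C: "\<And>c. (\<Sum>b\<in>B. \<bar>c b\<bar>) \<le> C * norm (\<Sum>b\<in>B. c b *\<^sub>R b)"
    using coeff_bound[OF B(1,2)] by blast
  define M where "M = (\<Sum>b\<in>B. norm (f b))"
  have "norm (f x) \<le> norm x * (M * C)" for x
  proof -
    let ?c = "representation B x"
    have x: "x = (\<Sum>b\<in>B. ?c b *\<^sub>R b)"
      using linear_expand[OF linear_id B, of x] by simp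
    have "norm (f x) \<le> (\<Sum>b\<in>B. norm (?c b *\<^sub>R f b))"
      by (subst linear_expand[OF assms(2) B]) (rule norm_sum)
    also have "\<dots> \<le> (\<Sum>b\<in>B. \<bar>?c b\<bar> * M)"
      unfolding M_def using B
      by (intro sum_mono) (auto intro!: mult_left_mono member_le_sum)
    also have "\<dots> = (\<Sum>b\<in>B. \<bar>?c b\<bar>) * M" by (simp add: sum_distrib_right)
    also have "\<dots> \<le> (C * norm x) * M"
      using C[of ?c] x by (intro mult_right_mono) (auto simp: M_def intro: sum_nonneg)
    finally show ?thesis by (simp add: mult_ac)
  qed
  then show ?thesis
    using assms(2) by (intro bounded_linear_intro[of f "M * C"]) (auto simp: linear_add linear_scale)
qed

lemma finite_dim_closed_subspace:
  fixes V :: "'a::real_normed_vector set"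
  assumes "finite_dim TYPE('a)" "subspace V"
  shows "closed V"
proof -
  obtain B0 :: "'a set" where B0: "finite B0" "independent B0" "span B0 = UNIV"
    using finite_dim_basis[OF assms(1)] .
  obtain B where B: "B \<subseteq> V" "independent B" "V \<subseteq> span B"
    using maximal_independent_subset[of V] by blast
  have "finite B"
    using independent_span_bound[OF B0(1) B(2)] B0 by auto
  moreover have "span B = V"
    using B assms(2) by (metis span_minimal subset_antisym)
  ultimately show ?thesis
    using closed_span_if_coeff_bound coeff_bound[OF _ B(2)] by metis
qed

lemma finite_dim_bilinear_bounded:
  fixes h :: "'a::real_normed_vector \<Rightarrow> 'b::real_normed_vector \<Rightarrow> 'c::real_normed_vector"
  assumes "finite_dim TYPE('a)" "finite_dim TYPE('b)"
    and l1: "\<And>y. linear (\<lambda>x. h x y)" and l2: "\<And>x. linear (h x)"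
  shows "bounded_bilinear h"
proof -
  obtain B :: "'a set" where B: "finite B" "independent B" "span B = UNIV"
    using finite_dim_basis[OF assms(1)] .
  have "\<forall>b. \<exists>K\<ge>0. \<forall>y. norm (h b y) \<le> norm y * K"
    using bounded_linear.nonneg_bounded[OF finite_dim_linear_bounded[OF assms(2) l2]] by blast
  then obtain K where K: "\<And>b. K b \<ge> 0" "\<And>b y. norm (h b y) \<le> norm y * K b" by metis
  obtain C where C: "\<And>c. (\<Sum>b\<in>B. \<bar>c b\<bar>) \<le> C * norm (\<Sum>b\<in>B. c b *\<^sub>R b)"
    using coeff_bound[OF B(1,2)] by blast
  define M where "M = (\<Sum>b\<in>B. K b)"
  have M: "M \<ge> 0" "\<And>b. b \<in> B \<Longrightarrow> K b \<le> M"
    unfolding M_def using K B by (auto intro: sum_nonneg member_le_sum)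
  have "norm (h x y) \<le> norm x * norm y * (C * M)" for x y
  proof -
    let ?c = "representation B x"
    have x: "x = (\<Sum>b\<in>B. ?c b *\<^sub>R b)"
      using linear_expand[OF linear_id B, of x] by simp
    have "norm (h x y) \<le> (\<Sum>b\<in>B. norm (?c b *\<^sub>R h b y))"
      by (subst linear_expand[OF l1 B]) (rule norm_sum)
    also have "\<dots> \<le> (\<Sum>b\<in>B. \<bar>?c b\<bar> * (norm y * M))"
    proof (rule sum_mono)
      fix b assume "b \<in> B"
      have "norm (h b y) \<le> norm y * M"
        using K(2)[of b y] M(2)[OF \<open>b \<in> B\<close>] by (meson mult_left_mono norm_ge_zero order_trans)
      then show "norm (?c b *\<^sub>R h b y) \<le> \<bar>?c b\<bar> * (norm y * M)" by (simp add: mult_left_mono)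
    qed
    also have "\<dots> = (\<Sum>b\<in>B. \<bar>?c b\<bar>) * (norm y * M)" by (simp add: sum_distrib_right)
    also have "\<dots> \<le> (C * norm x) * (norm y * M)"
      using C[of ?c] x M by (intro mult_right_mono) auto
    finally show ?thesis by (simp add: mult_ac)
  qed
  then show ?thesis
    using l1 l2
    by (intro bounded_bilinear.intro exI[of _ "C * M"]) 
      (auto simp: linear_add linear_scale linear_add[OF l1] linear_scale[OF l1])
qed

text \<open>The product rule for a family of linear maps applied to a moving vector. In coordinates
  the value is a finite sum of scalar functions times curves \<open>T q b\<close>, so
  differentiability of \<open>T\<close> at each fixed vector is enough.\<close>

lemma has_derivative_family_apply:
  fixes T :: "'b::real_normed_vector \<Rightarrow> 'e::real_normed_vector \<Rightarrow> 'f::real_normed_vector"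
  assumes fd: "finite_dim TYPE('e)"
    and lin: "\<And>p. linear (T p)"
    and T: "\<And>u. ((\<lambda>p. T p u) has_derivative D u) (at p)"
    and x: "(x has_derivative x') (at p)"
  shows "((\<lambda>q. T q (x q)) has_derivative (\<lambda>h. D (x p) h + T p (x' h))) (at p)"
proof -
  obtain B :: "'e set" where B: "finite B" "independent B" "span B = UNIV"
    using finite_dim_basis[OF fd] .
  let ?r = "\<lambda>b x. representation B x b"
  have lr: "linear (?r b)" for b
    by (rule linearI) (use B in \<open>simp_all add: real_vector.representation_add real_vector.representation_scale\<close>)
  have bl: "bounded_linear (?r b)" for b
    by (rule finite_dim_linear_bounded[OF fd lr])
  have "((\<lambda>q. \<Sum>b\<in>B. ?r b (x q) *\<^sub>R T q b) has_derivative
      (\<lambda>h. \<Sum>b\<in>B. ?r b (x p) *\<^sub>R D b h + ?r b (x' h) *\<^sub>R T p b)) (at p)"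
    by (intro has_derivative_sum has_derivative_scaleR T bounded_linear.has_derivative[OF bl] x)
  moreover have "(\<lambda>q. \<Sum>b\<in>B. ?r b (x q) *\<^sub>R T q b) = (\<lambda>q. T q (x q))"
    by (intro ext) (rule linear_expand[OF lin B, symmetric])
  \<comment> \<open>Linearity of \<open>D u\<close> in \<open>u\<close> comes from the uniqueness of
    derivatives.\<close>
  moreover have "(\<Sum>b\<in>B. ?r b (x p) *\<^sub>R D b h) = D (x p) h" for h
  proof -
    have "((\<lambda>q. \<Sum>b\<in>B. ?r b (x p) *\<^sub>R T q b) has_derivative
      (\<lambda>h. \<Sum>b\<in>B. ?r b (x p) *\<^sub>R D b h)) (at p)"
      by (intro has_derivative_sum has_derivative_scaleR_right T)
    moreover have "(\<lambda>q. \<Sum>b\<in>B. ?r b (x p) *\<^sub>R T q b) = (\<lambda>q. T q (x p))"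
      by (intro ext) (rule linear_expand[OF lin B, symmetric])
    ultimately show ?thesis using T[of "x p"] has_derivative_unique by metis
  qed
  moreover have "(\<Sum>b\<in>B. ?r b (x' h) *\<^sub>R T p b) = T p (x' h)" for h
    by (rule linear_expand[OF lin B, symmetric])
  ultimately show ?thesis by (simp add: sum.distrib)
qed

text \<open>A vector annihilated by no \<open>c\<^sub>k S\<^sup>k + \<dots> + c\<^sub>n S\<^sup>n\<close> would have infinitely many independent iterates.\<close>

lemma finite_dim_powers_dependent:
  fixes S :: "'a::real_vector \<Rightarrow> 'a"
  assumes "finite_dim TYPE('a)"
  shows "\<exists>p::real poly. p \<noteq> 0 \<and> (\<Sum>i\<le>degree p. coeff p i *\<^sub>R (S ^^ i) x) = 0"
proof -
  obtain B :: "'a set" where B: "finite B" "independent B" "span B = UNIV"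
    using finite_dim_basis[OF assms] .
  define n where "n = Suc (card B)"
  let ?f = "\<lambda>i. (S ^^ i) x"
  have "\<exists>c::nat \<Rightarrow> real. (\<exists>i<n. c i \<noteq> 0) \<and> (\<Sum>i<n. c i *\<^sub>R ?f i) = 0"
  proof (cases "inj_on ?f {..<n}")
    \<comment> \<open>Equal iterates give a relation at once, whereas dependence of a set would not
      see the repetition.\<close>
    case False
    then obtain i j where ij: "i < n" "j < n" "i \<noteq> j" "?f i = ?f j" by (auto simp: inj_on_def)
    have "(\<Sum>k<n. (if k = i then 1 else if k = j then -1 else 0::real) *\<^sub>R ?f k) =
        (\<Sum>k<n. if k = i then ?f i else 0) - (\<Sum>k<n. if k = j then ?f j else 0)"
      unfolding sum_subtractf[symmetric] using ij by (intro sum.cong) auto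
    then show ?thesis using ij
      by (intro exI[of _ "\<lambda>k. if k = i then 1 else if k = j then -1 else 0"]) auto
  next
    case True
    then have "card (?f ` {..<n}) = n" by (simp add: card_image)
    then have "dependent (?f ` {..<n})"
      using independent_span_bound[OF B(1), of "?f ` {..<n}"] B by (auto simp: n_def)
    then obtain u where u: "\<exists>v\<in>?f ` {..<n}. u v \<noteq> 0" "(\<Sum>v\<in>?f ` {..<n}. u v *\<^sub>R v) = 0"
      by (auto simp: dependent_finite)
    then have "(\<Sum>i<n. u (?f i) *\<^sub>R ?f i) = 0"
      by (simp add: sum.reindex[OF True])
    then show ?thesis using u(1) by (intro exI[of _ "\<lambda>i. u (?f i)"]) auto
  qed
  then obtain c where c: "\<exists>i<n. c i \<noteq> (0::real)" "(\<Sum>i<n. c i *\<^sub>R ?f i) = 0" by blast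
  define p where "p = Poly (map c [0..<n])"
  have cp: "coeff p i = (if i < n then c i else 0)" for i
    by (simp add: p_def coeff_Poly_eq nth_default_def)
  have "p \<noteq> 0" using c(1) cp by (metis coeff_0)
  moreover have dn: "degree p < n"
    using \<open>p \<noteq> 0\<close> cp by (metis leading_coeff_0_iff)
  have "(\<Sum>i\<le>degree p. coeff p i *\<^sub>R ?f i) = (\<Sum>i<n. c i *\<^sub>R ?f i)"
    by (rule sum.mono_neutral_cong_left) (use dn cp in \<open>auto simp: not_le coeff_eq_0\<close>, metis coeff_eq_0 cp)
  ultimately show ?thesis using c(2) by metis
qed

section \<open>Spaces over the ground field\<close>

lemma to_cplx_scaleR: "to_cplx (r *\<^sub>R x) = complex_of_real r * to_cplx x"
  by (metis mult_scaleR_left mult_1 to_cplx_mult to_cplx_scaleR_one)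

lemma to_cplx_of_real: "to_cplx (of_real r :: 'a::real_or_complex) = complex_of_real r"
  unfolding of_real_def[where 'a='a] by (rule to_cplx_scaleR_one)

lemma to_cplx_minus: "to_cplx (- x) = - to_cplx x"
  using to_cplx_scaleR[of "- 1" x] by simp

lemma to_cplx_inject: "to_cplx x = to_cplx y \<longleftrightarrow> x = y"
proof
  assume "to_cplx x = to_cplx y"
  then have "to_cplx (x + (- y)) = 0" by (simp add: to_cplx_add to_cplx_minus del: add_uminus_conv_diff)
  then have "norm (x - y) = 0" by (metis norm_to_cplx norm_zero diff_conv_add_uminus)
  then show "x = y" by simp
qed simp

text \<open>\<open>1\<close> and any element with nonzero imaginary part span the ground field over
  the reals; if no such element exists, \<open>1\<close> alone does.\<close>

lemma finite_dim_ground: "finite_dim TYPE('k::real_or_complex)"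
proof -
  obtain j :: 'k where j: "\<And>x::'k. \<exists>a b. x = a *\<^sub>R 1 + b *\<^sub>R j"
  proof (cases "\<exists>j::'k. Im (to_cplx j) \<noteq> 0")
    case True
    then obtain j :: 'k where j: "Im (to_cplx j) \<noteq> 0" by blast
    have "\<exists>a b. x = a *\<^sub>R 1 + b *\<^sub>R j" for x :: 'k
    proof (intro exI)
      let ?b = "Im (to_cplx x) / Im (to_cplx j)"
      let ?a = "Re (to_cplx x) - ?b * Re (to_cplx j)"
      have "to_cplx x = to_cplx (?a *\<^sub>R 1 + ?b *\<^sub>R j)"
        unfolding to_cplx_add to_cplx_scaleR to_cplx_scaleR_one
        using j by (simp add: complex_eq_iff to_cplx_of_real[of 1, simplified])
      then show "x = ?a *\<^sub>R 1 + ?b *\<^sub>R j" by (simp add: to_cplx_inject)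
    qed
    with that show ?thesis by blast
  next
    case False
    have "x = Re (to_cplx x) *\<^sub>R 1 + 0 *\<^sub>R 0" for x :: 'k
    proof -
      have "to_cplx x = to_cplx (Re (to_cplx x) *\<^sub>R 1 :: 'k)"
        unfolding to_cplx_scaleR_one using False by (simp add: complex_eq_iff)
      then show ?thesis by (simp add: to_cplx_inject)
    qed
    with that show ?thesis by blast
  qed
  have "x \<in> span {1, j}" for x
    using j[of x] by (auto intro!: span_add span_scale intro: span_base)
  then show ?thesis unfolding finite_dim_def by (intro exI[of _ "{1, j}"]) auto
qed

lemma klinear_on_comp:
  "klinear_on s1 s2 UNIV f \<Longrightarrow> klinear_on s2 s3 UNIV g \<Longrightarrow> klinear_on s1 s3 UNIV (\<lambda>x. g (f x))"
  by (simp add: klinear_on_def)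

locale fd_space =
  fixes sc :: "'k::real_or_complex \<Rightarrow> 'v::real_normed_vector \<Rightarrow> 'v"
  assumes fd: "fd_vector_space sc"
begin

sublocale vector_space sc
  using fd by (simp add: fd_vector_space_def)

lemma sc_of_real: "sc (of_real r) x = r *\<^sub>R x"
  using fd by (simp add: fd_vector_space_def)

lemma sc_scaleR_left: "sc (r *\<^sub>R c) x = r *\<^sub>R sc c x"
  by (metis scale_scale mult.commute sc_of_real scaleR_conv_of_real)

lemma sc_scaleR_right: "sc c (r *\<^sub>R x) = r *\<^sub>R sc c x"
  by (metis scale_left_commute sc_of_real)

lemma ex_finite_span: "\<exists>B. finite B \<and> span B = UNIV"
  using fd by (simp add: fd_vector_space_def)

lemma ex_finite_basis: "\<exists>B. finite B \<and> independent B \<and> span B = UNIV"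
proof -
  obtain B0 where B0: "finite B0" "span B0 = UNIV" using ex_finite_span by blast
  obtain B where B: "B \<subseteq> B0" "independent B" "B0 \<subseteq> span B"
    using maximal_independent_subset[of B0] by blast
  have "span B = UNIV"
    using span_minimal[OF B(3) subspace_span] B0(2) by auto
  with B B0(1) show ?thesis by (meson finite_subset)
qed

lemma linear_sc: "linear (sc c)"
  by (rule linearI) (auto simp: scale_right_distrib sc_scaleR_right)

lemma linear_sc_left: "linear (\<lambda>c. sc c x)"
  by (rule linearI) (auto simp: scale_left_distrib sc_scaleR_left)

text \<open>A spanning set over the reals consists of the products of real generators of the ground
  field with generators over the ground field.\<close>

lemma finite_dim: "finite_dim TYPE('v)"
proof -
  obtain B where B: "finite B" "span B = UNIV" using ex_finite_span by blast
  obtain K :: "'k set" where K: "finite K" "Real_Vector_Spaces.span K = UNIV"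
    using finite_dim_ground[where 'k='k] by (auto simp: finite_dim_def)
  define S where "S = Real_Vector_Spaces.span ((\<lambda>(k, b). sc k b) ` (K \<times> B))"
  have gen: "sc c b \<in> S" if "b \<in> B" for c b
  proof -
    have "sc c b \<in> (\<lambda>c. sc c b) ` Real_Vector_Spaces.span K" using K by blast
    also have "\<dots> = Real_Vector_Spaces.span ((\<lambda>c. sc c b) ` K)"
      by (simp add: linear_span_image[OF linear_sc_left])
    also have "\<dots> \<subseteq> S" unfolding S_def using that by (intro real_vector.span_mono) auto
    finally show ?thesis .
  qed
  have scS: "sc c x \<in> S" if "x \<in> S" for c x
    using that unfolding S_def
  proof (induction rule: real_vector.span_induct)
    case (step a)
    then show ?case using gen unfolding S_def by force
  next
    case base
    show ?case unfolding real_vector.subspace_def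
      by (auto simp: scale_right_distrib sc_scaleR_right intro: real_vector.span_zero real_vector.span_add
          real_vector.span_scale)
  qed
  have "subspace S"
    unfolding subspace_def using scS
    by (auto simp: S_def intro: real_vector.span_zero real_vector.span_add)
  moreover have "B \<subseteq> S" using gen[of _ 1] by auto
  ultimately have "S = UNIV" using span_minimal[of B S] B by auto
  moreover have "finite ((\<lambda>(k, b). sc k b) ` (K \<times> B))" using B K by blast
  ultimately show ?thesis unfolding finite_dim_def S_def by metis
qed

lemma bounded_bilinear_sc: "bounded_bilinear sc"
  by (rule finite_dim_bilinear_bounded[OF finite_dim_ground finite_dim linear_sc_left linear_sc])

lemma real_subspace: "subspace V \<Longrightarrow> Real_Vector_Spaces.subspace V"
  by (simp add: real_vector.subspace_def subspace_def flip: sc_of_real)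

lemma closed_subspace: "subspace V \<Longrightarrow> closed V"
  by (rule finite_dim_closed_subspace[OF finite_dim real_subspace])

lemma subspace_finite_span:
  assumes "subspace V" shows "\<exists>B. finite B \<and> B \<subseteq> V \<and> span B = V"
proof -
  obtain B0 where B0: "finite B0" "span B0 = UNIV" using ex_finite_span by blast
  obtain B where B: "B \<subseteq> V" "independent B" "V \<subseteq> span B"
    using maximal_independent_subset[of V] by blast
  have "finite B" using independent_span_bound[OF B0(1) B(2)] B0 by auto
  then show ?thesis using B span_minimal[OF B(1) assms] by blast
qed

end

lemma klinear_real_linear:
  assumes "fd_vector_space s1" "fd_vector_space s2" "klinear_on s1 s2 UNIV f"
  shows "linear f"
proof (rule linearI)
  show "f (x + y) = f x + f y" for x y using assms(3) by (simp add: klinear_on_def)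
  show "f (r *\<^sub>R x) = r *\<^sub>R f x" for r x
    using assms unfolding klinear_on_def fd_vector_space_def by (metis UNIV_I)
qed

lemma klinear_bounded:
  fixes s1 :: "'k::real_or_complex \<Rightarrow> 'v::real_normed_vector \<Rightarrow> 'v"
  assumes "fd_vector_space s1" "fd_vector_space s2" "klinear_on s1 s2 UNIV f"
  shows "bounded_linear f"
  using finite_dim_linear_bounded[OF fd_space.finite_dim klinear_real_linear] assms
  by (metis fd_space.intro)

lemma fd_ground: "fd_vector_space ((*) :: 'k::real_or_complex \<Rightarrow> 'k \<Rightarrow> 'k)"
proof -
  have "x \<in> vector_space_over_itself.span {1}" for x :: 'k
    using vector_space_over_itself.span_scale[OF vector_space_over_itself.span_base[of 1 "{1}"], of x] by simp
  then show ?thesis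
    unfolding fd_vector_space_def
    by (auto simp: vector_space_over_itself.vector_space_axioms scaleR_conv_of_real intro!: exI[of _ "{1}"])
qed

lemma fd_prod:
  fixes s1 :: "'k::real_or_complex \<Rightarrow> 'v::real_normed_vector \<Rightarrow> 'v" and s2 :: "'k \<Rightarrow> 'w::real_normed_vector \<Rightarrow> 'w"
  assumes "fd_vector_space s1" "fd_vector_space s2"
  shows "fd_vector_space (prod_scale s1 s2)"
proof -
  interpret A: fd_space s1 using assms by unfold_locales
  interpret B: fd_space s2 using assms by unfold_locales
  interpret C: vector_space "prod_scale s1 s2"
    by unfold_locales (auto simp: prod_scale_def A.scale_right_distrib A.scale_left_distrib
      B.scale_right_distrib B.scale_left_distrib)
  obtain S1 S2 where S: "finite S1" "A.span S1 = UNIV" "finite S2" "B.span S2 = UNIV"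
    using A.ex_finite_span B.ex_finite_span by blast
  let ?S = "(\<lambda>x. (x, 0)) ` S1 \<union> (\<lambda>y. (0, y)) ` S2"
  have "(x, 0) \<in> C.span ?S" for x
  proof -
    have "x \<in> A.span S1" using S by simp
    then show ?thesis
    proof (induction rule: A.span_induct)
      case base
      show ?case unfolding A.subspace_def
      proof (auto)
        show "(0, 0) \<in> C.span ?S" using C.span_zero by (simp add: zero_prod_def)
        show "(x + y, 0) \<in> C.span ?S" if "(x, 0) \<in> C.span ?S" "(y, 0) \<in> C.span ?S" for x y
          using C.span_add[OF that] by simp
        show "(s1 c x, 0) \<in> C.span ?S" if "(x, 0) \<in> C.span ?S" for c x
          using C.span_scale[OF that, of c] by (simp add: prod_scale_def)
      qed
    qed (auto intro: C.span_base)
  qed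
  moreover have "(0, x) \<in> C.span ?S" for x
  proof -
    have "x \<in> B.span S2" using S by simp
    then show ?thesis
    proof (induction rule: B.span_induct)
      case base
      show ?case unfolding B.subspace_def
      proof (auto)
        show "(0, 0) \<in> C.span ?S" using C.span_zero by (simp add: zero_prod_def)
        show "(0, x + y) \<in> C.span ?S" if "(0, x) \<in> C.span ?S" "(0, y) \<in> C.span ?S" for x y
          using C.span_add[OF that] by simp
        show "(0, s2 c x) \<in> C.span ?S" if "(0, x) \<in> C.span ?S" for c x
          using C.span_scale[OF that, of c] by (simp add: prod_scale_def)
      qed
    qed (auto intro: C.span_base)
  qed
  ultimately have "(x, 0) + (0, y) \<in> C.span ?S" for x y by (rule C.span_add)
  then have "C.span ?S = UNIV" by auto
  moreover have "finite ?S" using S by simp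
  ultimately show ?thesis
    unfolding fd_vector_space_def using C.vector_space_axioms
    by (auto simp: prod_scale_def A.sc_of_real B.sc_of_real)
qed

text \<open>If some \<open>x0\<close> in the common kernel of the other functionals has
  \<open>f a x0\<close> nonzero, subtracting \<open>u x0 / f a x0\<close> times \<open>f a\<close>
  from \<open>u\<close> reduces to the smaller set. The lemma supplies the vectors and covectors
  that represent functionals under a nondegenerate pairing.\<close>

lemma (in fd_space) functional_combination:
  assumes "finite B" "subspace V"
    and "\<And>b. b \<in> B \<Longrightarrow> klinear_on sc (*) V (f b)" and "klinear_on sc (*) V u"
    and "\<And>x. x \<in> V \<Longrightarrow> \<forall>b\<in>B. f b x = 0 \<Longrightarrow> u x = 0"
  shows "\<exists>c. \<forall>x\<in>V. u x = (\<Sum>b\<in>B. c b * f b x)"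
  using assms
proof (induction B arbitrary: u rule: finite_induct)
  case empty
  then show ?case by simp
next
  case (insert a B)
  let ?K = "{x \<in> V. \<forall>b\<in>B. f b x = 0}"
  show ?case
  proof (cases "\<exists>x0\<in>?K. f a x0 \<noteq> 0")
    case False
    then have "\<exists>c. \<forall>x\<in>V. u x = (\<Sum>b\<in>B. c b * f b x)"
      using insert.prems by (intro insert.IH) auto
    then obtain c where c: "\<And>x. x \<in> V \<Longrightarrow> u x = (\<Sum>b\<in>B. c b * f b x)" by blast
    have "(\<Sum>b\<in>B. (c(a := 0)) b * f b x) = (\<Sum>b\<in>B. c b * f b x)" for x
      using \<open>a \<notin> B\<close> by (intro sum.cong) auto
    then show ?thesis
      using insert.hyps c by (intro exI[of _ "c(a := 0)"]) auto
  next
    case True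
    then obtain x0 where x0: "x0 \<in> V" "\<forall>b\<in>B. f b x0 = 0" "f a x0 \<noteq> 0" by blast
    let ?k = "u x0 / f a x0"
    let ?u = "\<lambda>x. u x - ?k * f a x"
    have sub: "x - sc (f a x / f a x0) x0 \<in> V" if "x \<in> V" for x
      using x0 that \<open>subspace V\<close> by (auto intro: subspace_diff subspace_scale)
    have lin: "g (x - sc c x0) = g x - c * g x0" if "klinear_on sc (*) V g" "x \<in> V" for g c x
    proof -
      have s: "sc c x0 \<in> V" "x - sc c x0 \<in> V"
        using x0 that \<open>subspace V\<close> by (auto intro: subspace_diff subspace_scale)
      have "g x = g (x - sc c x0 + sc c x0)" by simp
      also have "\<dots> = g (x - sc c x0) + g (sc c x0)"
        using that(1) s by (simp only: klinear_on_def)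
      also have "g (sc c x0) = c * g x0" using that(1) x0 by (simp add: klinear_on_def)
      finally show ?thesis by simp
    qed
    have "\<exists>c. \<forall>x\<in>V. ?u x = (\<Sum>b\<in>B. c b * f b x)"
    proof (rule insert.IH)
      show "klinear_on sc (*) V ?u"
        using insert.prems(2)[of a] insert.prems(3) by (simp add: klinear_on_def algebra_simps add_divide_distrib)
      show "?u x = 0" if x: "x \<in> V" "\<forall>b\<in>B. f b x = 0" for x
      proof -
        \<comment> \<open>This correction moves \<open>x\<close> into the kernel of
          \<open>f a\<close> and leaves its values under the other functionals unchanged.\<close>
        let ?y = "x - sc (f a x / f a x0) x0"
        have "f b ?y = 0" if "b \<in> insert a B" for b
          unfolding lin[OF insert.prems(2)[OF that] x(1), of "f a x / f a x0"] using that x x0 by force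
        then have "u ?y = 0" using insert.prems(4)[of ?y] sub[OF x(1)] by blast
        then show ?thesis using lin[OF insert.prems(3) x(1)] x0 by (simp add: field_simps)
      qed
    qed (use insert.prems in auto)
    then obtain c where c: "\<And>x. x \<in> V \<Longrightarrow> ?u x = (\<Sum>b\<in>B. c b * f b x)" by blast
    have "(\<Sum>b\<in>B. (c(a := ?k)) b * f b x) = (\<Sum>b\<in>B. c b * f b x)" for x
      using \<open>a \<notin> B\<close> by (intro sum.cong) auto
    then have "\<forall>x\<in>V. u x = (\<Sum>b\<in>insert a B. (c(a := ?k)) b * f b x)"
      using insert.hyps c by (auto simp: algebra_simps)
    then show ?thesis by blast
  qed
qed

section \<open>Spaces in duality\<close>

locale duality =
  fixes D :: "('k::real_or_complex, 'v::real_normed_vector, 's::real_normed_vector, 'z) dual_pair_scheme"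
  assumes dp: "is_dual_pair D"
begin

sublocale V: fd_space "scv D" using dp by unfold_locales (simp add: is_dual_pair_def)
sublocale S: fd_space "scs D" using dp by unfold_locales (simp add: is_dual_pair_def)

lemma car_subspace: "V.subspace (car D)" using dp by (simp add: is_dual_pair_def)

lemma pair_add_right: "x \<in> car D \<Longrightarrow> y \<in> car D \<Longrightarrow> pair D \<xi> (x + y) = pair D \<xi> x + pair D \<xi> y"
  and pair_scale_right: "x \<in> car D \<Longrightarrow> pair D \<xi> (scv D c x) = c * pair D \<xi> x"
  and pair_add_left: "x \<in> car D \<Longrightarrow> pair D (\<xi> + \<eta>) x = pair D \<xi> x + pair D \<eta> x"
  and pair_scale_left: "x \<in> car D \<Longrightarrow> pair D (scs D c \<xi>) x = c * pair D \<xi> x"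
  using dp by (simp_all add: is_dual_pair_def klinear_on_def)

lemma pair_nondeg_left: "(\<And>x. x \<in> car D \<Longrightarrow> pair D \<xi> x = 0) \<Longrightarrow> \<xi> = 0"
  and pair_nondeg_right: "x \<in> car D \<Longrightarrow> (\<And>\<xi>. pair D \<xi> x = 0) \<Longrightarrow> x = 0"
  using dp by (simp_all add: is_dual_pair_def)

lemma pair_zero_left: "x \<in> car D \<Longrightarrow> pair D 0 x = 0"
  using pair_add_left[of x 0 0] by simp

lemma pair_zero_right: "pair D \<xi> 0 = 0"
  using pair_add_right[of 0 0 \<xi>] car_subspace V.subspace_0 by simp

lemma pair_minus_left: "x \<in> car D \<Longrightarrow> pair D (- \<xi>) x = - pair D \<xi> x"
  using pair_add_left[of x \<xi> "- \<xi>"] pair_zero_left by (simp add: eq_neg_iff_add_eq_0 add.commute)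

lemma pair_diff_left: "x \<in> car D \<Longrightarrow> pair D (\<xi> - \<eta>) x = pair D \<xi> x - pair D \<eta> x"
  using pair_add_left[of x \<xi> "- \<eta>"] pair_minus_left by simp

lemma pair_minus_right: "x \<in> car D \<Longrightarrow> pair D \<xi> (- x) = - pair D \<xi> x"
  using pair_add_right[of x "- x" \<xi>] pair_zero_right V.subspace_neg[OF car_subspace]
  by (simp add: eq_neg_iff_add_eq_0 add.commute)

lemma pair_diff_right: "x \<in> car D \<Longrightarrow> y \<in> car D \<Longrightarrow> pair D \<xi> (x - y) = pair D \<xi> x - pair D \<xi> y"
  using pair_add_right[of x "- y" \<xi>] pair_minus_right V.subspace_neg[OF car_subspace] by simp

lemma covec_eqI: "(\<And>x. x \<in> car D \<Longrightarrow> pair D \<xi> x = pair D \<eta> x) \<Longrightarrow> \<xi> = \<eta>"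
  using pair_nondeg_left[of "\<xi> - \<eta>"] by (simp add: pair_diff_left)

lemma vec_eqI: "x \<in> car D \<Longrightarrow> y \<in> car D \<Longrightarrow> (\<And>\<xi>. pair D \<xi> x = pair D \<xi> y) \<Longrightarrow> x = y"
  using pair_nondeg_right[of "x - y"] V.subspace_diff[OF car_subspace]
  by (simp add: pair_diff_right)

lemma covec_of_unique: "(\<And>x. x \<in> car D \<Longrightarrow> pair D \<xi> x = u x) \<Longrightarrow> covec_of D u = \<xi>"
  unfolding covec_of_def by (rule the_equality) (auto intro: covec_eqI)

lemma vec_of_unique: "x \<in> car D \<Longrightarrow> (\<And>\<xi>. pair D \<xi> x = u \<xi>) \<Longrightarrow> vec_of D u = x"
  unfolding vec_of_def by (rule the_equality) (auto intro: vec_eqI)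

text \<open>Nondegeneracy says that the covectors of a finite spanning set of the dual separate the
  points of \<open>car D\<close>; every functional is then a combination of them, so the description
  in \<open>covec_of\<close> has a witness.\<close>

lemma pair_covec_of:
  assumes "klinear_on (scv D) (*) (car D) u" "x \<in> car D"
  shows "pair D (covec_of D u) x = u x"
proof -
  obtain B where B: "finite B" "S.span B = UNIV" using S.ex_finite_span by blast
  have "\<exists>c. \<forall>x\<in>car D. u x = (\<Sum>b\<in>B. c b * pair D b x)"
  proof (rule V.functional_combination[OF B(1) car_subspace _ assms(1)])
    show "klinear_on (scv D) (*) (car D) (pair D b)" for b
      by (simp add: klinear_on_def pair_add_right pair_scale_right)
    fix x assume x: "x \<in> car D" "\<forall>b\<in>B. pair D b x = 0"
    have "pair D \<xi> x = 0" for \<xi>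
    proof -
      have "\<xi> \<in> S.span B" using B by simp
      then show ?thesis
        by (induction rule: S.span_induct) (use x in \<open>auto simp: S.subspace_def pair_add_left pair_zero_left pair_scale_left\<close>)
    qed
    then have "x = 0" using x pair_nondeg_right by blast
    then show "u x = 0" using assms(1) x by (auto simp: klinear_on_def) (metis add_cancel_right_right add_0)
  qed
  then obtain c where c: "\<And>x. x \<in> car D \<Longrightarrow> u x = (\<Sum>b\<in>B. c b * pair D b x)" by blast
  have "pair D (\<Sum>b\<in>B. scs D (c b) b) x = (\<Sum>b\<in>B. c b * pair D b x)" if "x \<in> car D" for x
    using B(1) that by (induction B rule: finite_induct) (auto simp: pair_zero_left pair_add_left pair_scale_left)
  then have "covec_of D u = (\<Sum>b\<in>B. scs D (c b) b)" "\<And>x. x \<in> car D \<Longrightarrow> pair D (\<Sum>b\<in>B. scs D (c b) b) x = u x"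
    using c by (auto intro!: covec_of_unique)
  then show ?thesis using assms by simp
qed

lemma pair_vec_of:
  assumes "klinear_on (scs D) (*) UNIV u"
  shows "vec_of D u \<in> car D" "pair D \<xi> (vec_of D u) = u \<xi>"
proof -
  obtain B where B: "finite B" "B \<subseteq> car D" "V.span B = car D"
    using V.subspace_finite_span[OF car_subspace] by blast
  have "\<exists>c. \<forall>\<xi>\<in>UNIV. u \<xi> = (\<Sum>b\<in>B. c b * pair D \<xi> b)"
  proof (rule S.functional_combination[OF B(1) S.subspace_UNIV _ assms(1)])
    show "klinear_on (scs D) (*) UNIV (\<lambda>\<xi>. pair D \<xi> b)" if "b \<in> B" for b
      using that B by (auto simp: klinear_on_def pair_add_left pair_scale_left)
    fix \<xi> assume x: "\<forall>b\<in>B. pair D \<xi> b = 0"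
    have "pair D \<xi> x = 0" if "x \<in> car D" for x
    proof -
      have "x \<in> V.span B" using B that by simp
      then have "x \<in> car D \<and> pair D \<xi> x = 0"
        by (induction rule: V.span_induct) (use x B car_subspace in \<open>auto simp: V.subspace_def pair_add_right pair_zero_right pair_scale_right\<close>)
      then show ?thesis by simp
    qed
    then have "\<xi> = 0" using pair_nondeg_left by blast
    then show "u \<xi> = 0" using assms(1) by (auto simp: klinear_on_def) (metis add_cancel_right_right add_0)
  qed
  then obtain c where c: "\<And>\<xi>. u \<xi> = (\<Sum>b\<in>B. c b * pair D \<xi> b)" by blast
  have car: "(\<Sum>b\<in>B. scv D (c b) b) \<in> car D \<and> pair D \<xi> (\<Sum>b\<in>B. scv D (c b) b) = (\<Sum>b\<in>B. c b * pair D \<xi> b)" for \<xi>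
    using B(1,2) car_subspace
    by (induction B rule: finite_induct)
      (auto simp: pair_zero_right pair_add_right pair_scale_right V.subspace_def)
  then have "vec_of D u = (\<Sum>b\<in>B. scv D (c b) b)"
    using c by (auto intro!: vec_of_unique)
  then show "vec_of D u \<in> car D" "pair D \<xi> (vec_of D u) = u \<xi>" using car c by simp_all
qed

end

section \<open>Smooth maps\<close>

lemma has_derivative_cong_open:
  assumes "open W" "p \<in> W" "\<And>q. q \<in> W \<Longrightarrow> f q = g q"
  shows "(f has_derivative F) (at p) \<longleftrightarrow> (g has_derivative F) (at p)"
proof
  assume "(f has_derivative F) (at p)"
  then show "(g has_derivative F) (at p)"
    using assms by (rule has_derivative_transform_within_open)
next
  assume "(g has_derivative F) (at p)"
  then show "(f has_derivative F) (at p)"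
    using assms by (intro has_derivative_transform_within_open[of g F p UNIV W f]) auto
qed

lemma deriv_at_cong_open:
  assumes "open W" "p \<in> W" "\<And>q. q \<in> W \<Longrightarrow> f q = g q"
  shows "deriv_at f p = deriv_at g p"
  unfolding frechet_derivative_def using has_derivative_cong_open[OF assms] by simp

lemma differentiable_cong_open:
  assumes "open W" "p \<in> W" "\<And>q. q \<in> W \<Longrightarrow> f q = g q"
  shows "f differentiable (at p) \<longleftrightarrow> g differentiable (at p)"
  unfolding differentiable_def using has_derivative_cong_open[OF assms] by simp

lemma deriv_at_eq: "(f has_derivative f') (at p) \<Longrightarrow> deriv_at f p = f'"
  by (rule frechet_derivative_at[symmetric])

lemma Ck_on_cong_imp:
  "open W \<Longrightarrow> (\<And>q. q \<in> W \<Longrightarrow> f q = g q) \<Longrightarrow> Ck_on n sb sf W f \<Longrightarrow> Ck_on n sb sf W g"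
proof (induction n arbitrary: f g)
  case 0
  then show ?case using continuous_on_cong[of W W f g] by simp
next
  case (Suc n)
  have d: "deriv_at f p = deriv_at g p" if "p \<in> W" for p
    using deriv_at_cong_open[OF Suc.prems(1) that Suc.prems(2)] by simp
  show ?case unfolding Ck_on.simps
  proof (intro conjI ballI allI)
    fix p assume p: "p \<in> W"
    show "g differentiable at p"
      using Suc.prems(3) p differentiable_cong_open[OF Suc.prems(1) p Suc.prems(2), THEN iffD1] by simp
    show "klinear_on sb sf UNIV (deriv_at g p)" using Suc.prems(3) p unfolding d[OF p, symmetric] by simp
  next
    fix v
    show "Ck_on n sb sf W (\<lambda>p. deriv_at g p v)"
    proof (rule Suc.IH[OF Suc.prems(1)])
      show "deriv_at f q v = deriv_at g q v" if "q \<in> W" for q using d[OF that] by simp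
      show "Ck_on n sb sf W (\<lambda>p. deriv_at f p v)" using Suc.prems(3) by simp
    qed
  qed
qed

lemma Ck_on_cong:
  assumes "open W" "\<And>q. q \<in> W \<Longrightarrow> f q = g q"
  shows "Ck_on n sb sf W f \<longleftrightarrow> Ck_on n sb sf W g"
  by (rule iffI; rule Ck_on_cong_imp[OF assms(1)]) (auto simp: assms(2))

lemma Ck_on_Suc_D: "Ck_on (Suc n) sb sf W f \<Longrightarrow> Ck_on n sb sf W f"
proof (induction n arbitrary: f)
  case 0
  then show ?case
    by (auto simp: intro!: differentiable_imp_continuous_within continuous_at_imp_continuous_on)
next
  case (Suc n)
  then show ?case unfolding Ck_on.simps(2)[of "Suc n"] by (simp add: Ck_on.simps(2)[of n])
qed

lemma Ck_on_subset: "Ck_on n sb sf W f \<Longrightarrow> W' \<subseteq> W \<Longrightarrow> Ck_on n sb sf W' f"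
proof (induction n arbitrary: f)
  case 0
  then show ?case by (auto intro: continuous_on_subset)
next
  case (Suc n)
  then show ?case unfolding Ck_on.simps by blast
qed

lemma Ck_on_SucI:
  assumes "open W" "\<And>p. p \<in> W \<Longrightarrow> (f has_derivative f' p) (at p)"
    and "\<And>p. p \<in> W \<Longrightarrow> klinear_on sb sf UNIV (f' p)" "\<And>v. Ck_on n sb sf W (\<lambda>p. f' p v)"
  shows "Ck_on (Suc n) sb sf W f"
proof -
  have d: "deriv_at f p = f' p" if "p \<in> W" for p
    using deriv_at_eq assms(2)[OF that] .
  have "Ck_on n sb sf W (\<lambda>p. deriv_at f p v)" for v
    by (rule Ck_on_cong_imp[OF assms(1) _ assms(4)]) (simp add: d)
  then show ?thesis using assms d by (auto simp: differentiable_def)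
qed

lemma smooth_on_subset: "smooth_on sb sf W f \<Longrightarrow> W' \<subseteq> W \<Longrightarrow> smooth_on sb sf W' f"
  by (auto simp: smooth_on_def intro: Ck_on_subset)

lemma smooth_on_Suc_D: "smooth_on sb sf W f \<Longrightarrow> Ck_on (Suc n) sb sf W f"
  unfolding smooth_on_def by (rule spec)

lemma smooth_on_cong:
  assumes "open W" "\<And>q. q \<in> W \<Longrightarrow> f q = g q"
  shows "smooth_on sb sf W f \<longleftrightarrow> smooth_on sb sf W g"
  unfolding smooth_on_def by (simp only: Ck_on_cong[OF assms])

lemma smooth_on_deriv:
  assumes "smooth_on sb sf W f" shows "smooth_on sb sf W (\<lambda>p. deriv_at f p v)"
  unfolding smooth_on_def using smooth_on_Suc_D[OF assms] by simp

lemma smooth_on_differentiable: "smooth_on sb sf W f \<Longrightarrow> p \<in> W \<Longrightarrow> f differentiable (at p)"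
  by (auto dest: smooth_on_Suc_D[where n=0])

lemma smooth_on_has_derivative:
  "smooth_on sb sf W f \<Longrightarrow> p \<in> W \<Longrightarrow> (f has_derivative deriv_at f p) (at p)"
  by (drule (1) smooth_on_differentiable) (simp flip: frechet_derivative_works)

lemma smooth_on_klinear: "smooth_on sb sf W f \<Longrightarrow> p \<in> W \<Longrightarrow> klinear_on sb sf UNIV (deriv_at f p)"
  by (auto dest: smooth_on_Suc_D[where n=0])

context
  fixes sf :: "'k::real_or_complex \<Rightarrow> 'f::real_normed_vector \<Rightarrow> 'f"
  assumes fdf: "fd_vector_space sf"
begin

interpretation F: fd_space sf using fdf by unfold_locales

lemma Ck_on_const: "open W \<Longrightarrow> Ck_on n sb sf W (\<lambda>p. c)"
proof (induction n arbitrary: c)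
  case (Suc n)
  then show ?case
    by (intro Ck_on_SucI[where f' = "\<lambda>p v. 0"]) (auto simp: klinear_on_def)
qed simp

lemma Ck_on_add:
  "open W \<Longrightarrow> Ck_on n sb sf W f \<Longrightarrow> Ck_on n sb sf W g \<Longrightarrow> Ck_on n sb sf W (\<lambda>p. f p + g p)"
proof (induction n arbitrary: f g)
  case 0
  then show ?case by (auto intro: continuous_intros)
next
  case (Suc n)
  show ?case
    by (rule Ck_on_SucI[where f' = "\<lambda>p v. deriv_at f p v + deriv_at g p v"])
      (use Suc in \<open>auto simp: klinear_on_def F.scale_right_distrib
        intro!: has_derivative_add simp flip: frechet_derivative_works\<close>)
qed

end

lemma Ck_on_klinear_comp:
  fixes s1 :: "'k::real_or_complex \<Rightarrow> 'v::real_normed_vector \<Rightarrow> 'v" and s2 :: "'k \<Rightarrow> 'w::real_normed_vector \<Rightarrow> 'w"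
  assumes "fd_vector_space s1" "fd_vector_space s2" "klinear_on s1 s2 UNIV h"
  shows "open W \<Longrightarrow> Ck_on n sb s1 W f \<Longrightarrow> Ck_on n sb s2 W (\<lambda>p. h (f p))"
proof (induction n arbitrary: f)
  case 0
  then show ?case using klinear_bounded[OF assms] linear_continuous_on
    by (auto intro: bounded_linear.continuous_on)
next
  case (Suc n)
  show ?case
  proof (rule Ck_on_SucI[where f' = "\<lambda>p v. h (deriv_at f p v)"])
    show "((\<lambda>p. h (f p)) has_derivative (\<lambda>v. h (deriv_at f p v))) (at p)" if "p \<in> W" for p
      using Suc.prems that
      by (intro bounded_linear.has_derivative[OF klinear_bounded[OF assms]]) (simp flip: frechet_derivative_works)
    show "klinear_on sb s2 UNIV (\<lambda>v. h (deriv_at f p v))" if "p \<in> W" for p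
      using Suc.prems that assms(3) by (auto simp: klinear_on_def)
    show "Ck_on n sb s2 W (\<lambda>p. h (deriv_at f p v))" for v
      using Suc by auto
  qed (use Suc in auto)
qed

lemma Ck_on_bilinear:
  fixes s1 :: "'k::real_or_complex \<Rightarrow> 'v::real_normed_vector \<Rightarrow> 'v" and s2 :: "'k \<Rightarrow> 'w::real_normed_vector \<Rightarrow> 'w"
    and s3 :: "'k \<Rightarrow> 'x::real_normed_vector \<Rightarrow> 'x"
  assumes "fd_vector_space s3" and bb: "bounded_bilinear h"
    and h1: "\<And>y. klinear_on s1 s3 UNIV (\<lambda>x. h x y)" and h2: "\<And>x. klinear_on s2 s3 UNIV (h x)"
  shows "open W \<Longrightarrow> Ck_on n sb s1 W f \<Longrightarrow> Ck_on n sb s2 W g \<Longrightarrow> Ck_on n sb s3 W (\<lambda>p. h (f p) (g p))"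
proof (induction n arbitrary: f g)
  case 0
  then show ?case using bounded_bilinear.continuous_on[OF bb] by auto
next
  case (Suc n)
  interpret fd_space s3 using assms by unfold_locales
  show ?case
  proof (rule Ck_on_SucI[where f' = "\<lambda>p v. h (f p) (deriv_at g p v) + h (deriv_at f p v) (g p)"])
    show "((\<lambda>p. h (f p) (g p)) has_derivative
        (\<lambda>v. h (f p) (deriv_at g p v) + h (deriv_at f p v) (g p))) (at p)" if "p \<in> W" for p
      using Suc.prems that
      by (intro bounded_bilinear.FDERIV[OF bb]) (auto simp: frechet_derivative_works)
    show "klinear_on sb s3 UNIV (\<lambda>v. h (f p) (deriv_at g p v) + h (deriv_at f p v) (g p))" if "p \<in> W" for p
      using Suc.prems that h1 h2 by (auto simp: klinear_on_def scale_right_distrib)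
    show "Ck_on n sb s3 W (\<lambda>p. h (f p) (deriv_at g p v) + h (deriv_at f p v) (g p))" for v
      using Suc.prems Ck_on_Suc_D[OF Suc.prems(2)] Ck_on_Suc_D[OF Suc.prems(3)]
      by (intro Ck_on_add[OF assms(1)] Suc.IH) auto
  qed (use Suc in auto)
qed

lemma Ck_on_sum:
  fixes sf :: "'k::real_or_complex \<Rightarrow> 'f::real_normed_vector \<Rightarrow> 'f"
  assumes "fd_vector_space sf" "open W" "\<And>i. i \<in> I \<Longrightarrow> Ck_on n sb sf W (f i)"
  shows "Ck_on n sb sf W (\<lambda>p. \<Sum>i\<in>I. f i p)"
  using assms(3)
proof (induction I rule: infinite_finite_induct)
  case (insert i I)
  then show ?case using Ck_on_add[OF assms(1,2)] by auto
qed (auto intro: Ck_on_const[OF assms(1,2)])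

lemma Ck_on_minus:
  fixes sf :: "'k::real_or_complex \<Rightarrow> 'f::real_normed_vector \<Rightarrow> 'f"
  assumes "fd_vector_space sf" "open W" "Ck_on n sb sf W f"
  shows "Ck_on n sb sf W (\<lambda>p. - f p)"
proof -
  interpret fd_space sf using assms by unfold_locales
  show ?thesis
    by (rule Ck_on_klinear_comp[OF assms(1,1) _ assms(2,3)]) (auto simp: klinear_on_def)
qed

lemma Ck_on_diff:
  fixes sf :: "'k::real_or_complex \<Rightarrow> 'f::real_normed_vector \<Rightarrow> 'f"
  assumes "fd_vector_space sf" "open W" "Ck_on n sb sf W f" "Ck_on n sb sf W g"
  shows "Ck_on n sb sf W (\<lambda>p. f p - g p)"
  using Ck_on_add[OF assms(1-3) Ck_on_minus[OF assms(1,2,4)]] by simp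

lemma (in fd_space) klinear_expand:
  assumes "klinear_on sc s2 UNIV f" "finite B" "independent B" "span B = UNIV" "s2 0 (f 0) = 0"
  shows "f x = (\<Sum>b\<in>B. s2 (representation B x b) (f b))"
proof -
  have f0: "f 0 = 0" using assms(1) unfolding klinear_on_def by (metis UNIV_I add_cancel_right_right add_0)
  have fs: "f (\<Sum>b\<in>C. sc (c b) b) = (\<Sum>b\<in>C. s2 (c b) (f b))" if "finite C" for c C
    using that by (induction C rule: finite_induct) (use assms(1) f0 in \<open>auto simp: klinear_on_def\<close>)
  have "x = (\<Sum>b\<in>B. sc (representation B x b) b)"
    using sum_representation_eq[OF assms(3), of x B] assms by simp
  then have "f x = f (\<Sum>b\<in>B. sc (representation B x b) b)" by simp
  also have "\<dots> = (\<Sum>b\<in>B. s2 (representation B x b) (f b))"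
    using fs[OF assms(2)] by simp
  finally show ?thesis .
qed

text \<open>Coordinates are taken over the ground field here, because \<open>Ck_on\<close> demands
  derivatives that are linear over it.\<close>

lemma Ck_on_family_apply:
  fixes se :: "'k::real_or_complex \<Rightarrow> 'e::real_normed_vector \<Rightarrow> 'e" and sf :: "'k \<Rightarrow> 'f::real_normed_vector \<Rightarrow> 'f"
  assumes "fd_vector_space se" "fd_vector_space sf" "open W"
    and lin: "\<And>p. klinear_on se sf UNIV (T p)" and T: "\<And>u. Ck_on n sb sf W (\<lambda>p. T p u)"
    and x: "Ck_on n sb se W x"
  shows "Ck_on n sb sf W (\<lambda>p. T p (x p))"
proof -
  interpret E: fd_space se using assms by unfold_locales
  interpret F: fd_space sf using assms by unfold_locales
  obtain B where B: "finite B" "E.independent B" "E.span B = UNIV"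
    using E.ex_finite_basis by blast
  let ?r = "\<lambda>b x. E.representation B x b"
  have lr: "klinear_on se (*) UNIV (?r b)" for b
    using B by (simp add: klinear_on_def E.representation_add E.representation_scale)
  have "Ck_on n sb sf W (\<lambda>p. sf (?r b (x p)) (T p b))" for b
  proof (rule Ck_on_bilinear[OF assms(2) F.bounded_bilinear_sc _ _ assms(3) _ T])
    show "Ck_on n sb (*) W (\<lambda>p. ?r b (x p))"
      by (rule Ck_on_klinear_comp[OF assms(1) fd_ground lr assms(3) x])
  qed (auto simp: klinear_on_def F.scale_left_distrib F.scale_right_distrib)
  then have "Ck_on n sb sf W (\<lambda>p. \<Sum>b\<in>B. sf (?r b (x p)) (T p b))"
    by (intro Ck_on_sum[OF assms(2,3)])
  moreover have "(\<Sum>b\<in>B. sf (?r b (x p)) (T p b)) = T p (x p)" for p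
    by (rule E.klinear_expand[symmetric, OF lin B]) simp
  ultimately show ?thesis by simp
qed

text \<open>A left inverse of \<open>T p0\<close> on \<open>V\<close> gives the bound at
  \<open>p0\<close>. Coordinates make the pointwise continuity in \<open>p\<close> uniform over
  \<open>u\<close>, and half of the constant survives nearby. From this follow the openness of
  injectivity and the continuity and differentiability of the inverse family.\<close>

lemma inj_linear_family_lower_bound:
  fixes T :: "'b::real_normed_vector \<Rightarrow> 'e::real_normed_vector \<Rightarrow> 'f::real_normed_vector"
  assumes fd: "finite_dim TYPE('e)" "finite_dim TYPE('f)"
    and lin: "\<And>p. linear (T p)" and cont: "\<And>u. isCont (\<lambda>p. T p u) p0"
    and V: "subspace V" "inj_on (T p0) V"
  shows "\<exists>c>0. \<forall>\<^sub>F p in nhds p0. \<forall>u\<in>V. c * norm u \<le> norm (T p u)"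
proof -
  obtain g where g: "linear g" "\<And>v. v \<in> V \<Longrightarrow> g (T p0 v) = v"
    using real_vector.linear_exists_left_inverse_on[OF lin V] by blast
  obtain K where K: "K > 0" "\<And>y. norm (g y) \<le> norm y * K"
    using bounded_linear.pos_bounded[OF finite_dim_linear_bounded[OF fd(2) g(1)]] by blast
  obtain B :: "'e set" where B: "finite B" "independent B" "span B = UNIV"
    using finite_dim_basis[OF fd(1)] .
  obtain C where C: "\<And>c. (\<Sum>b\<in>B. \<bar>c b\<bar>) \<le> C * norm (\<Sum>b\<in>B. c b *\<^sub>R b)"
    using coeff_bound[OF B(1,2)] by blast
  let ?d = "\<lambda>p. C * (\<Sum>b\<in>B. norm (T p b - T p0 b))"
  have "isCont ?d p0" by (intro continuous_intros cont)
  then have "(?d \<longlongrightarrow> ?d p0) (nhds p0)"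
    unfolding isCont_def by (subst tendsto_at_iff_tendsto_nhds[symmetric])
  then have "(?d \<longlongrightarrow> 0) (nhds p0)" by simp
  then have ev: "\<forall>\<^sub>F p in nhds p0. ?d p < 1 / (2 * K)"
    using K by (auto elim!: order_tendstoD)
  have "1 / (2 * K) * norm u \<le> norm (T p u)" if p: "?d p < 1 / (2 * K)" and u: "u \<in> V" for p u
  proof -
    let ?r = "representation B u"
    have ux: "u = (\<Sum>b\<in>B. ?r b *\<^sub>R b)"
      using linear_expand[OF linear_id B, of u] by simp
    have "norm u \<le> norm (T p0 u) * K" using K(2)[of "T p0 u"] g(2)[OF u] by simp
    then have 1: "1 / K * norm u \<le> norm (T p0 u)" using K(1) by (simp add: field_simps)
    have "T p u - T p0 u = (\<Sum>b\<in>B. ?r b *\<^sub>R (T p b - T p0 b))"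
      by (simp add: linear_expand[OF lin B, of _ u] scaleR_diff_right sum_subtractf)
    then have "norm (T p u - T p0 u) \<le> (\<Sum>b\<in>B. norm (?r b *\<^sub>R (T p b - T p0 b)))"
      using norm_sum by metis
    also have "\<dots> = (\<Sum>b\<in>B. \<bar>?r b\<bar> * norm (T p b - T p0 b))" by simp
    also have "\<dots> \<le> (\<Sum>b\<in>B. \<bar>?r b\<bar> * (\<Sum>b\<in>B. norm (T p b - T p0 b)))"
      using B by (intro sum_mono mult_left_mono) (auto intro: member_le_sum)
    also have "\<dots> = (\<Sum>b\<in>B. \<bar>?r b\<bar>) * (\<Sum>b\<in>B. norm (T p b - T p0 b))" by (simp add: sum_distrib_right)
    also have "\<dots> \<le> (C * norm u) * (\<Sum>b\<in>B. norm (T p b - T p0 b))"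
      using C[of ?r] ux by (intro mult_right_mono) (auto intro: sum_nonneg)
    also have "\<dots> = ?d p * norm u" by simp
    also have "\<dots> \<le> 1 / (2 * K) * norm u" using p by (intro mult_right_mono) auto
    finally have 2: "norm (T p u - T p0 u) \<le> 1 / (2 * K) * norm u" .
    have "norm (T p0 u) \<le> norm (T p u) + norm (T p u - T p0 u)"
      using norm_triangle_sub[of "T p0 u" "T p u"] by (simp add: norm_minus_commute)
    with 1 2 show ?thesis by (simp add: field_simps)
  qed
  with ev K show ?thesis
    by (intro exI[of _ "1 / (2 * K)"]) (auto elim: eventually_mono)
qed

text \<open>Composing \<open>f\<close> with a linear retraction onto \<open>V\<close> does not
  change it near \<open>p\<close>, so the retraction fixes the derivative as well.\<close>

lemma has_derivative_in_subspace:
  fixes f :: "'b::real_normed_vector \<Rightarrow> 'f::real_normed_vector"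
  assumes "finite_dim TYPE('f)" "subspace V" "open W" "p \<in> W" "\<And>q. q \<in> W \<Longrightarrow> f q \<in> V"
    and f: "(f has_derivative f') (at p)"
  shows "f' h \<in> V"
proof -
  obtain g where g: "linear g" "g ` UNIV \<subseteq> V" "\<And>v. v \<in> V \<Longrightarrow> g v = v"
    using real_vector.linear_exists_left_inverse_on[OF linear_id assms(2)] by (auto simp: inj_on_def)
  have "((\<lambda>q. g (f q)) has_derivative (\<lambda>h. g (f' h))) (at p)"
    by (rule bounded_linear.has_derivative[OF finite_dim_linear_bounded[OF assms(1) g(1)] f])
  then have "(f has_derivative (\<lambda>h. g (f' h))) (at p)"
    using has_derivative_cong_open[OF assms(3,4), of f "\<lambda>q. g (f q)"] g(3) assms(5) by simp
  then have "f' = (\<lambda>h. g (f' h))" using f has_derivative_unique by blast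
  then have "f' h = g (f' h)" by (rule fun_cong)
  then show ?thesis using g(2) by (metis rangeI subsetD)
qed

section \<open>Smooth families of linear maps and their inverses\<close>

locale smooth_family =
  fixes sb :: "'k::real_or_complex \<Rightarrow> 'b::real_normed_vector \<Rightarrow> 'b"
    and se :: "'k \<Rightarrow> 'e::real_normed_vector \<Rightarrow> 'e" and sf :: "'k \<Rightarrow> 'f::real_normed_vector \<Rightarrow> 'f"
    and U :: "'b set" and T :: "'b \<Rightarrow> 'e \<Rightarrow> 'f"
  assumes fdb: "fd_vector_space sb" and fde: "fd_vector_space se" and fdf: "fd_vector_space sf"
    and opU: "open U"
    and lin: "\<And>p. klinear_on se sf UNIV (T p)"
    and smooth: "\<And>u. smooth_on sb sf U (\<lambda>p. T p u)"
begin

sublocale B: fd_space sb using fdb by unfold_locales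
sublocale E: fd_space se using fde by unfold_locales
sublocale F: fd_space sf using fdf by unfold_locales

lemma rlin: "linear (T p)"
  using klinear_real_linear[OF fde fdf lin] .

lemma smooth_on_apply:
  assumes "open W" "W \<subseteq> U" "smooth_on sb se W x"
  shows "smooth_on sb sf W (\<lambda>p. T p (x p))"
  unfolding smooth_on_def
proof
  fix n
  show "Ck_on n sb sf W (\<lambda>p. T p (x p))"
  proof (rule Ck_on_family_apply[OF fde fdf assms(1) lin])
    show "Ck_on n sb sf W (\<lambda>p. T p u)" for u
      using smooth[of u] by (auto simp: smooth_on_def intro: Ck_on_subset[OF _ assms(2)])
  qed (use assms(3) in \<open>simp add: smooth_on_def\<close>)
qed

text \<open>The value 0 outside \<open>U\<close> makes \<open>Td v p\<close> linear for every
  \<open>p\<close>, as \<open>Ck_on_family_apply\<close> demands.\<close>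

definition Td :: "'b \<Rightarrow> 'b \<Rightarrow> 'e \<Rightarrow> 'f" where "Td v p u = (if p \<in> U then deriv_at (\<lambda>q. T q u) p v else 0)"

lemma has_deriv: "p \<in> U \<Longrightarrow> ((\<lambda>q. T q u) has_derivative (\<lambda>v. Td v p u)) (at p)"
  using smooth_on_has_derivative[OF smooth, of p u] by (simp add: Td_def[abs_def])

lemma Td_lin: "klinear_on se sf UNIV (Td v p)"
proof (cases "p \<in> U")
  case True
  have "Td v p (x + y) = Td v p x + Td v p y" for x y
  proof -
    have "((\<lambda>q. T q x + T q y) has_derivative (\<lambda>v. Td v p x + Td v p y)) (at p)"
      by (intro has_derivative_add has_deriv True)
    moreover have "(\<lambda>q. T q x + T q y) = (\<lambda>q. T q (x + y))" using lin by (simp add: klinear_on_def)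
    ultimately have "((\<lambda>q. T q (x + y)) has_derivative (\<lambda>v. Td v p x + Td v p y)) (at p)" by simp
    from has_derivative_unique[OF has_deriv[OF True] this] show ?thesis by (rule fun_cong)
  qed
  moreover have "Td v p (se c x) = sf c (Td v p x)" for c x
  proof -
    have "((\<lambda>q. sf c (T q x)) has_derivative (\<lambda>v. sf c (Td v p x))) (at p)"
      by (intro bounded_linear.has_derivative[OF finite_dim_linear_bounded[OF F.finite_dim F.linear_sc]] has_deriv True)
    moreover have "(\<lambda>q. sf c (T q x)) = (\<lambda>q. T q (se c x))" using lin by (simp add: klinear_on_def)
    ultimately have "((\<lambda>q. T q (se c x)) has_derivative (\<lambda>v. sf c (Td v p x))) (at p)" by simp
    from has_derivative_unique[OF has_deriv[OF True] this] show ?thesis by (rule fun_cong)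
  qed
  ultimately show ?thesis by (simp add: klinear_on_def)
qed (simp add: Td_def klinear_on_def)

lemma Td_klin: "p \<in> U \<Longrightarrow> klinear_on sb sf UNIV (\<lambda>v. Td v p u)"
  using smooth_on_klinear[OF smooth, of p u] by (simp add: Td_def[abs_def])

lemma Td_smooth: "smooth_on sb sf U (\<lambda>p. Td v p u)"
  by (rule smooth_on_cong[OF opU, THEN iffD1, OF _ smooth_on_deriv[OF smooth]]) (simp add: Td_def)

lemma has_derivative_apply:
  "p \<in> U \<Longrightarrow> (x has_derivative x') (at p) \<Longrightarrow>
    ((\<lambda>q. T q (x q)) has_derivative (\<lambda>h. Td h p (x p) + T p (x' h))) (at p)"
  by (rule has_derivative_family_apply[OF E.finite_dim rlin has_deriv])

lemma isCont_T: "p \<in> U \<Longrightarrow> isCont (\<lambda>p. T p u) p"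
  by (rule has_derivative_continuous[OF has_deriv])

lemma lower_bound:
  assumes "p \<in> U" "E.subspace V" "inj_on (T p) V"
  shows "\<exists>c>0. \<forall>\<^sub>F q in nhds p. \<forall>u\<in>V. c * norm u \<le> norm (T q u)"
  by (rule inj_linear_family_lower_bound[OF E.finite_dim F.finite_dim rlin isCont_T E.real_subspace])
    (use assms in auto)

lemma inj_near:
  assumes "p \<in> U" "E.subspace V" "inj_on (T p) V"
  shows "\<forall>\<^sub>F q in nhds p. inj_on (T q) V"
proof -
  obtain c where c: "c > 0" "\<forall>\<^sub>F q in nhds p. \<forall>u\<in>V. c * norm u \<le> norm (T q u)"
    using lower_bound[OF assms] by blast
  from c(2) show ?thesis
  proof (rule eventually_mono)
    fix q assume q: "\<forall>u\<in>V. c * norm u \<le> norm (T q u)"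
    show "inj_on (T q) V"
    proof (rule inj_onI)
      fix x y assume xy: "x \<in> V" "y \<in> V" "T q x = T q y"
      then have "c * norm (x - y) \<le> norm (T q (x - y))" using q E.subspace_diff[OF assms(2)] by blast
      also have "T q (x - y) = 0" using xy linear_diff[OF rlin] by simp
      finally have "norm (x - y) \<le> 0" using c(1) by (simp add: mult_le_0_iff)
      then show "x = y" by simp
    qed
  qed
qed

context
  fixes V :: "'e set" and V' :: "'f set"
  assumes V: "E.subspace V" and V': "F.subspace V'"
    and bij: "\<And>p. p \<in> U \<Longrightarrow> bij_betw (T p) V V'"
begin

abbreviation Ti :: "'b \<Rightarrow> 'f \<Rightarrow> 'e" where "Ti p \<equiv> inv_into V (T p)"

lemma Ti_in: "p \<in> U \<Longrightarrow> y \<in> V' \<Longrightarrow> Ti p y \<in> V"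
  using bij[of p] by (metis bij_betw_def inv_into_into)

lemma T_Ti: "p \<in> U \<Longrightarrow> y \<in> V' \<Longrightarrow> T p (Ti p y) = y"
  using bij[of p] by (meson bij_betw_inv_into_right)

lemma Ti_T: "p \<in> U \<Longrightarrow> x \<in> V \<Longrightarrow> Ti p (T p x) = x"
  using bij[of p] by (meson bij_betw_inv_into_left)

lemma Ti_eqI: "p \<in> U \<Longrightarrow> x \<in> V \<Longrightarrow> T p x = y \<Longrightarrow> Ti p y = x"
  using Ti_T by auto

lemma Ti_add: "p \<in> U \<Longrightarrow> x \<in> V' \<Longrightarrow> y \<in> V' \<Longrightarrow> Ti p (x + y) = Ti p x + Ti p y"
  using lin[of p] T_Ti Ti_in E.subspace_add[OF V] by (intro Ti_eqI) (auto simp: klinear_on_def)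

lemma Ti_scale: "p \<in> U \<Longrightarrow> x \<in> V' \<Longrightarrow> Ti p (sf c x) = se c (Ti p x)"
  using lin[of p] T_Ti Ti_in E.subspace_scale[OF V] by (intro Ti_eqI) (auto simp: klinear_on_def)

lemma Td_in: "p \<in> U \<Longrightarrow> u \<in> V \<Longrightarrow> Td v p u \<in> V'"
  by (rule has_derivative_in_subspace[OF F.finite_dim F.real_subspace[OF V'] opU _ _ has_deriv])
    (use bij in \<open>auto simp: bij_betw_def\<close>)

text \<open>The candidate is found by differentiating \<open>T q (x q) = \<tau> q\<close> and
  solving for the derivative of \<open>x\<close>. The lower bound on \<open>T q\<close> then
  estimates the remainder of the inverse by that of the equation.\<close>

lemma Ti_has_derivative:
  assumes W: "open W" "W \<subseteq> U" "p \<in> W" and \<tau>: "\<And>q. q \<in> W \<Longrightarrow> \<tau> q \<in> V'"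
    and d: "(\<tau> has_derivative \<tau>') (at p)"
  shows "((\<lambda>q. Ti q (\<tau> q)) has_derivative (\<lambda>h. Ti p (\<tau>' h - Td h p (Ti p (\<tau> p))))) (at p)"
proof -
  have pU: "p \<in> U" using W by auto
  let ?x = "\<lambda>q. Ti q (\<tau> q)"
  let ?y = "\<lambda>h. \<tau>' h - Td h p (?x p)"
  let ?x' = "\<lambda>h. Ti p (?y h)"
  have x0V: "?x p \<in> V" using Ti_in pU \<tau> W(3) by blast
  have yV': "?y h \<in> V'" for h
    using has_derivative_in_subspace[OF F.finite_dim F.real_subspace[OF V'] W(1,3) \<tau> d]
      Td_in[OF pU x0V] F.subspace_diff[OF V'] by blast
  have x'V: "?x' h \<in> V" for h using Ti_in[OF pU yV'] .
  have Tlin: "linear (\<lambda>v. Td v p u)" for u using has_deriv[OF pU] has_derivative_linear by blast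
  have y_add: "?y (h + k) = ?y h + ?y k" and y_sc: "?y (r *\<^sub>R h) = sf (of_real r) (?y h)" for h k r
    using linear_add[OF Tlin] linear_scale[OF Tlin] has_derivative_linear[OF d]
    by (simp_all add: linear_add linear_scale F.sc_of_real scaleR_diff_right)
  have "linear ?x'"
    by (rule linearI) (simp_all only: y_add y_sc Ti_add[OF pU yV' yV'] Ti_scale[OF pU yV'] E.sc_of_real)
  then have bl: "bounded_linear ?x'" by (rule finite_dim_linear_bounded[OF B.finite_dim])
  \<comment> \<open>\<open>T q\<close> maps the first-order remainder of the inverse to
    \<open>?\<Phi> q\<close>, and the choice of \<open>?x'\<close> makes the derivative of
    \<open>?\<Phi>\<close> at \<open>p\<close> vanish.\<close>
  let ?\<Phi> = "\<lambda>q. \<tau> q - T q (?x p) - T q (?x' (q - p))"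
  have "((\<lambda>q. ?x' (q - p)) has_derivative ?x') (at p)"
    by (rule bounded_linear.has_derivative[OF bl, of "\<lambda>q. q - p" "\<lambda>h. h"]) (auto intro!: derivative_eq_intros)
  then have "(?\<Phi> has_derivative (\<lambda>h. \<tau>' h - Td h p (?x p) - (Td h p (?x' (p - p)) + T p (?x' h)))) (at p)"
    by (intro has_derivative_diff d has_deriv has_derivative_apply pU)
  moreover have x'0: "?x' 0 = 0" using linear_0[OF \<open>linear ?x'\<close>] .
  moreover have "Td h p 0 = 0" for h
    using Td_lin[of h p] unfolding klinear_on_def by (metis UNIV_I add_cancel_right_right add_0)
  ultimately have \<Phi>: "(?\<Phi> has_derivative (\<lambda>h. 0)) (at p)"
    by (simp add: T_Ti[OF pU yV'])
  have \<Phi>0: "?\<Phi> p = 0" using x'0 linear_0[OF rlin] T_Ti[OF pU \<tau>[OF W(3)]] by simp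
  obtain c where c: "c > 0" "\<forall>\<^sub>F q in nhds p. \<forall>u\<in>V. c * norm u \<le> norm (T q u)"
    using lower_bound[OF pU V] bij[OF pU] by (auto simp: bij_betw_def)
  let ?r = "\<lambda>q. ?x q - ?x p - ?x' (q - p)"
  have "\<forall>\<^sub>F q in nhds p. norm (?r q) \<le> 1 / c * norm (?\<Phi> q)"
    using c(2) eventually_nhds_in_open[OF W(1,3)]
  proof eventually_elim
    case (elim q)
    have qU: "q \<in> U" using elim W by auto
    have "?r q \<in> V" using Ti_in[OF qU \<tau>[OF elim(2)]] x0V x'V E.subspace_diff[OF V] by simp
    then have "c * norm (?r q) \<le> norm (T q (?r q))" using elim by blast
    also have "T q (?r q) = ?\<Phi> q"
      by (simp add: linear_diff[OF rlin] T_Ti[OF qU \<tau>[OF elim(2)]])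
    finally show ?case using c(1) by (simp add: field_simps)
  qed
  then have ev: "\<forall>\<^sub>F q in at p. norm (?r q /\<^sub>R norm (q - p)) \<le> norm (1 / c * (norm (?\<Phi> q) / norm (q - p)))"
    unfolding eventually_at_filter
    by (rule eventually_mono) (use c(1) in \<open>auto simp: divide_simps\<close>)
  have "((\<lambda>q. ?\<Phi> q /\<^sub>R norm (q - p)) \<longlongrightarrow> 0) (at p)"
    using \<Phi> \<Phi>0 by (simp add: has_derivative_at_within divide_inverse)
  then have "((\<lambda>q. 1 / c * (norm (?\<Phi> q) / norm (q - p))) \<longlongrightarrow> 0) (at p)"
    by (intro tendsto_mult_right_zero) (auto dest: tendsto_norm_zero simp: divide_inverse mult.commute)
  then have "((\<lambda>q. ?r q /\<^sub>R norm (q - p)) \<longlongrightarrow> 0) (at p)"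
    by (rule Lim_transform_bound[OF ev])
  then show ?thesis
    unfolding has_derivative_at_within by (rule conjI[OF bl])
qed

text \<open>The induction closes because the derivative of the inverse applied to
  \<open>\<tau>\<close> is again the inverse applied to a curve; that curve involves the derivative
  of \<open>T\<close> at the solution, which has the lower order of smoothness by the induction
  hypothesis.\<close>

lemma Ck_on_Ti:
  assumes W: "open W" "W \<subseteq> U"
  shows "(\<And>q. q \<in> W \<Longrightarrow> \<tau> q \<in> V') \<Longrightarrow> Ck_on n sb sf W \<tau> \<Longrightarrow> Ck_on n sb se W (\<lambda>q. Ti q (\<tau> q))"
proof (induction n arbitrary: \<tau>)
  case 0
  have "isCont (\<lambda>q. Ti q (\<tau> q)) p" if p: "p \<in> W" for p
  proof -
    have pU: "p \<in> U" using p W by auto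
    obtain c where c: "c > 0" "\<forall>\<^sub>F q in nhds p. \<forall>u\<in>V. c * norm u \<le> norm (T q u)"
      using lower_bound[OF pU V] bij[OF pU] by (auto simp: bij_betw_def)
    have x0V: "Ti p (\<tau> p) \<in> V" using Ti_in pU 0 p by blast
    have "isCont \<tau> p" using 0 p W(1) by (simp add: continuous_on_eq_continuous_at)
    then have "((\<lambda>q. \<tau> q - T q (Ti p (\<tau> p))) \<longlongrightarrow> \<tau> p - T p (Ti p (\<tau> p))) (at p)"
      using isCont_T[OF pU] by (intro tendsto_diff) (auto simp: isCont_def)
    then have "((\<lambda>q. 1 / c * norm (\<tau> q - T q (Ti p (\<tau> p)))) \<longlongrightarrow> 0) (at p)"
      using T_Ti[OF pU 0(1)[OF p]] by (intro tendsto_mult_right_zero tendsto_norm_zero) simp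
    moreover have "\<forall>\<^sub>F q in nhds p. norm (Ti q (\<tau> q) - Ti p (\<tau> p)) \<le> norm (1 / c * norm (\<tau> q - T q (Ti p (\<tau> p))))"
      using c(2) eventually_nhds_in_open[OF W(1) p]
    proof eventually_elim
      case (elim q)
      have qU: "q \<in> U" using elim W by auto
      have "Ti q (\<tau> q) - Ti p (\<tau> p) \<in> V"
        using Ti_in[OF qU 0(1)[OF elim(2)]] x0V E.subspace_diff[OF V] by simp
      then have "c * norm (Ti q (\<tau> q) - Ti p (\<tau> p)) \<le> norm (T q (Ti q (\<tau> q) - Ti p (\<tau> p)))" using elim by blast
      also have "T q (Ti q (\<tau> q) - Ti p (\<tau> p)) = \<tau> q - T q (Ti p (\<tau> p))"
        by (simp add: linear_diff[OF rlin] T_Ti[OF qU 0(1)[OF elim(2)]])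
      finally show ?case using c(1) by (simp add: field_simps)
    qed
    then have "\<forall>\<^sub>F q in at p. norm (Ti q (\<tau> q) - Ti p (\<tau> p)) \<le> norm (1 / c * norm (\<tau> q - T q (Ti p (\<tau> p))))"
      unfolding eventually_at_filter by (rule eventually_mono) simp
    ultimately have "((\<lambda>q. Ti q (\<tau> q) - Ti p (\<tau> p)) \<longlongrightarrow> 0) (at p)"
      by (rule Lim_transform_bound[rotated])
    then show ?thesis by (simp add: isCont_def LIM_zero_iff)
  qed
  then show ?case by (simp add: continuous_at_imp_continuous_on)
next
  case (Suc n)
  let ?x = "\<lambda>q. Ti q (\<tau> q)"
  have d: "(\<tau> has_derivative deriv_at \<tau> p) (at p)" if "p \<in> W" for p
    using Suc.prems(2) that by (simp add: frechet_derivative_works)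
  have x: "?x p \<in> V" if "p \<in> W" for p using Ti_in Suc.prems(1) that W by blast
  have yV': "deriv_at \<tau> p h - Td h p (?x p) \<in> V'" if "p \<in> W" for p h
    using has_derivative_in_subspace[OF F.finite_dim F.real_subspace[OF V'] W(1) that Suc.prems(1) d]
      Td_in[OF _ x] F.subspace_diff[OF V'] that W by blast
  show ?case
  proof (rule Ck_on_SucI[OF W(1)])
    show "(?x has_derivative (\<lambda>h. Ti p (deriv_at \<tau> p h - Td h p (?x p)))) (at p)" if "p \<in> W" for p
      by (rule Ti_has_derivative[OF W that Suc.prems(1) d]) (use that in auto)
    show "klinear_on sb se UNIV (\<lambda>h. Ti p (deriv_at \<tau> p h - Td h p (?x p)))" if p: "p \<in> W" for p
    proof -
      have pU: "p \<in> U" using p W by auto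
      have k: "klinear_on sb sf UNIV (deriv_at \<tau> p)" using Suc.prems(2) p by simp
      note k' = Td_klin[OF pU, of "?x p"]
      have a: "deriv_at \<tau> p (h + k) - Td (h + k) p (?x p) = (deriv_at \<tau> p h - Td h p (?x p)) + (deriv_at \<tau> p k - Td k p (?x p))"
       and s: "deriv_at \<tau> p (sb c h) - Td (sb c h) p (?x p) = sf c (deriv_at \<tau> p h - Td h p (?x p))" for h k c
        using k k' by (simp_all add: klinear_on_def F.scale_right_diff_distrib)
      show ?thesis
        by (simp only: klinear_on_def a s Ti_add[OF pU yV'[OF p] yV'[OF p]] Ti_scale[OF pU yV'[OF p]]) simp
    qed
    show "Ck_on n sb se W (\<lambda>p. Ti p (deriv_at \<tau> p v - Td v p (?x p)))" for v
    proof (rule Suc.IH[OF yV'])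
      have "Ck_on n sb se W ?x" by (rule Suc.IH[OF Suc.prems(1) Ck_on_Suc_D[OF Suc.prems(2)]])
      moreover have "Ck_on n sb sf W (\<lambda>p. Td v p u)" for u
        using Td_smooth[of v u] by (auto simp: smooth_on_def intro: Ck_on_subset[OF _ W(2)])
      ultimately have "Ck_on n sb sf W (\<lambda>p. Td v p (?x p))"
        by (rule Ck_on_family_apply[OF fde fdf W(1) Td_lin, rotated])
      then show "Ck_on n sb sf W (\<lambda>p. deriv_at \<tau> p v - Td v p (?x p))"
        using Suc.prems(2) by (intro Ck_on_diff[OF fdf W(1), rotated]) auto
    qed
  qed
qed

lemma smooth_on_Ti:
  "open W \<Longrightarrow> W \<subseteq> U \<Longrightarrow> (\<And>q. q \<in> W \<Longrightarrow> \<tau> q \<in> V') \<Longrightarrow> smooth_on sb sf W \<tau> \<Longrightarrow>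
    smooth_on sb se W (\<lambda>q. Ti q (\<tau> q))"
  by (simp add: smooth_on_def Ck_on_Ti)

end

end

section \<open>Entire functions of an endomorphism\<close>

text \<open>The majorant in product form makes the family absolutely summable over pairs of indices;
  the two sides sum it by rows and by antidiagonals.\<close>

lemma suminf_antidiagonal:
  fixes a :: "nat \<Rightarrow> nat \<Rightarrow> 'v::banach"
  assumes bd: "\<And>i j. norm (a i j) \<le> b i * c j"
    and b: "summable b" "\<And>i. b i \<ge> 0" and c: "summable c" "\<And>i. c i \<ge> (0::real)"
  shows "(\<Sum>i. \<Sum>j. a i j) = (\<Sum>n. \<Sum>i\<le>n. a i (n - i))" and "summable (\<lambda>n. norm (\<Sum>i\<le>n. a i (n - i)))"
proof -
  let ?f = "\<lambda>(i, j). a i j"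
  let ?g = "\<lambda>(n, i). a i (n - i)"
  let ?S = "Sigma UNIV (\<lambda>n::nat. {..n})"
  have inner: "summable (\<lambda>j. norm (a i j))" for i
    by (rule summable_comparison_test'[of "\<lambda>j. b i * c j" 0]) (use bd c in \<open>auto intro: summable_mult\<close>)
  have nsum: "(\<Sum>j. norm (a i j)) \<le> b i * suminf c" for i
  proof -
    have "(\<Sum>j. norm (a i j)) \<le> (\<Sum>j. b i * c j)"
      by (intro suminf_le bd inner summable_mult c)
    then show ?thesis using c by (simp add: suminf_mult)
  qed
  have ns: "norm (\<Sum>j. a i j) \<le> b i * suminf c" for i
    using summable_norm[OF inner[of i]] nsum[of i] by simp
  have nn: "(\<Sum>j. norm (a i j)) \<ge> 0" for i using inner by (rule suminf_nonneg) simp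
  have inf: "infsum (\<lambda>j. norm (a i j)) UNIV = (\<Sum>j. norm (a i j))" for i
    using norm_summable_imp_has_sum[OF _ summable_sums[OF inner[of i]]] inner[of i] by (simp add: infsumI)
  have "summable (\<lambda>i. norm (\<Sum>j. norm (a i j)))"
    by (rule summable_comparison_test'[of "\<lambda>i. b i * suminf c" 0])
      (use nsum nn b in \<open>auto intro: summable_mult2\<close>)
  then have fs: "?f abs_summable_on UNIV \<times> UNIV"
    using inner by (intro Infinite_Sum.abs_summable_on_Sigma_iff[THEN iffD2] conjI ballI norm_summable_imp_summable_on)
      (simp_all add: inf)
  then have gs: "?g abs_summable_on ?S"
    by (rule summable_on_reindex_bij_witness[of ?S "\<lambda>(i, j). (i + j, i)" "\<lambda>(n, i). (i, n - i)"
          "UNIV \<times> UNIV" "\<lambda>x. norm (?f x)" "\<lambda>x. norm (?g x)", THEN iffD2, rotated -1]) auto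
  have eq: "infsum ?f (UNIV \<times> UNIV) = infsum ?g ?S"
    by (rule infsum_reindex_bij_witness[of _ "\<lambda>(n, i). (i, n - i)" "\<lambda>(i, j). (i + j, i)"]) auto
  have outer: "summable (\<lambda>i. norm (\<Sum>j. a i j))"
    by (rule summable_comparison_test'[of "\<lambda>i. b i * suminf c" 0]) (use ns b in \<open>auto intro: summable_mult2\<close>)
  have "infsum ?f (UNIV \<times> UNIV) = infsum (\<lambda>i. infsum (\<lambda>j. a i j) UNIV) UNIV"
    using infsum_Sigma_banach[OF abs_summable_summable[OF fs]] unfolding prod.case by (rule sym)
  also have "\<dots> = (\<Sum>i. \<Sum>j. a i j)"
    by (simp add: infsumI[OF norm_summable_imp_has_sum[OF inner summable_sums[OF summable_norm_cancel[OF inner]]]]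
      infsumI[OF norm_summable_imp_has_sum[OF outer summable_sums[OF summable_norm_cancel[OF outer]]]])
  finally have 1: "infsum ?f (UNIV \<times> UNIV) = (\<Sum>i. \<Sum>j. a i j)" .
  have "(\<lambda>n. infsum (\<lambda>i. norm (a i (n - i))) {..n}) summable_on UNIV"
    using summable_on_Sigma_banach[of "\<lambda>n i. norm (a i (n - i))" UNIV "\<lambda>n. {..n}"] gs
    by (simp add: case_prod_unfold)
  then have "(\<lambda>n. \<Sum>i\<le>n. norm (a i (n - i))) summable_on UNIV" by simp
  then have "summable (\<lambda>n. \<Sum>i\<le>n. norm (a i (n - i)))" by (rule summable_on_imp_summable)
  then show sm: "summable (\<lambda>n. norm (\<Sum>i\<le>n. a i (n - i)))"
    by (rule summable_comparison_test'[of _ 0]) (auto intro: norm_sum)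
  have "infsum ?g ?S = infsum (\<lambda>n. \<Sum>i\<le>n. a i (n - i)) UNIV"
    using infsum_Sigma_banach[OF abs_summable_summable[OF gs], symmetric] by simp
  also have "\<dots> = (\<Sum>n. \<Sum>i\<le>n. a i (n - i))"
    by (rule infsumI[OF norm_summable_imp_has_sum[OF sm summable_sums[OF summable_norm_cancel[OF sm]]]])
  finally show "(\<Sum>i. \<Sum>j. a i j) = (\<Sum>n. \<Sum>i\<le>n. a i (n - i))" using eq 1 by simp
qed

text \<open>Equivalent to an infinite radius of convergence, but phrased for comparison with the
  powers of a bounded operator, whose bound takes the place of \<open>r\<close>.\<close>

definition entire :: "real fps \<Rightarrow> bool" where
  "entire f \<longleftrightarrow> (\<forall>r. summable (\<lambda>n. \<bar>fps_nth f n\<bar> * r ^ n))"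

lemma entire_iff: "entire f \<longleftrightarrow> fps_conv_radius f = \<infinity>"
proof
  assume f: "fps_conv_radius f = \<infinity>"
  have "summable (\<lambda>n. \<bar>fps_nth f n\<bar> * r ^ n)" for r
  proof -
    have "summable (\<lambda>n. norm (fps_nth f n * r ^ n))"
      using f by (intro abs_summable_in_conv_radius) (simp add: fps_conv_radius_def)
    then show ?thesis
      by (rule summable_norm_cancel[OF summable_cong[THEN iffD1], rotated]) (simp add: abs_mult power_abs)
  qed
  then show "entire f" by (simp add: entire_def)
next
  assume f: "entire f"
  have "norm r \<le> conv_radius (fps_nth f)" for r :: real
    using f[unfolded entire_def, rule_format, of "\<bar>r\<bar>"]
    by (intro conv_radius_geI summable_norm_cancel[of "\<lambda>n. fps_nth f n * r ^ n"])
      (simp add: abs_mult power_abs)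
  then have "ereal r \<le> conv_radius (fps_nth f)" for r :: real
    by (metis abs_ge_self ereal_less_eq(3) order_trans real_norm_def)
  then show "fps_conv_radius f = \<infinity>"
    unfolding fps_conv_radius_def by (metis ereal_top)
qed

lemma entire_bound:
  assumes "\<And>n. \<bar>fps_nth f n\<bar> \<le> c * d ^ n / fact n" "d \<ge> 0" shows "entire f"
  unfolding entire_def
proof
  fix r :: real
  have "summable (\<lambda>n. c * (inverse (fact n) * (d * \<bar>r\<bar>) ^ n))"
    by (intro summable_mult summable_exp)
  then show "summable (\<lambda>n. \<bar>fps_nth f n\<bar> * r ^ n)"
  proof (rule summable_comparison_test'[of _ 0])
    fix n
    have "\<bar>fps_nth f n\<bar> * \<bar>r\<bar> ^ n \<le> c * d ^ n / fact n * \<bar>r\<bar> ^ n"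
      by (intro mult_right_mono assms) auto
    then show "norm (\<bar>fps_nth f n\<bar> * r ^ n) \<le> c * (inverse (fact n) * (d * \<bar>r\<bar>) ^ n)"
      by (simp add: abs_mult power_abs field_simps power_mult_distrib)
  qed
qed

lemma entire_mult: "entire f \<Longrightarrow> entire g \<Longrightarrow> entire (f * g)"
  using fps_conv_radius_mult[of f g] by (simp add: entire_iff)

locale bounded_endo =
  fixes A :: "'v::banach \<Rightarrow> 'v"
  assumes bA: "bounded_linear A"
begin

lemma linA: "linear A" using bA by (rule bounded_linear.linear)

lemma linpow: "linear (A ^^ n)"
proof (induction n)
  case 0 then show ?case using linear_id by (simp add: id_def)
next
  case (Suc n) then show ?case using linear_compose[OF Suc linA] by (simp add: o_def)
qed

lemma power_bound: "\<exists>C\<ge>0. \<forall>n v. norm ((A ^^ n) v) \<le> C ^ n * norm v"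
proof -
  obtain C where C: "C \<ge> 0" "\<And>v. norm (A v) \<le> norm v * C"
    using bounded_linear.nonneg_bounded[OF bA] by blast
  have "norm ((A ^^ n) v) \<le> C ^ n * norm v" for n v
  proof (induction n)
    case (Suc n)
    have "norm (A ((A ^^ n) v)) \<le> norm ((A ^^ n) v) * C" by (rule C)
    also have "\<dots> \<le> (C ^ n * norm v) * C" using Suc C by (intro mult_right_mono)
    finally show ?case by (simp add: mult_ac)
  qed simp
  then show ?thesis using C by blast
qed

lemma op_summable_norm: "entire f \<Longrightarrow> summable (\<lambda>n. norm (fps_nth f n *\<^sub>R (A ^^ n) v))"
proof -
  assume f: "entire f"
  obtain C where C: "\<And>n v. norm ((A ^^ n) v) \<le> C ^ n * norm v" using power_bound by blast
  have "summable (\<lambda>n. \<bar>fps_nth f n\<bar> * C ^ n * norm v)"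
    using f by (intro summable_mult2) (simp add: entire_def)
  then show ?thesis
    by (rule summable_comparison_test'[of _ 0]) (auto simp: mult.assoc intro!: mult_left_mono C)
qed

lemma op_summable: "entire f \<Longrightarrow> summable (\<lambda>n. fps_nth f n *\<^sub>R (A ^^ n) v)"
  by (rule summable_norm_cancel[OF op_summable_norm])

lemma op_series_lin:
  assumes f: "entire f" shows "linear (op_series f A)"
proof (rule linearI)
  show "op_series f A (x + y) = op_series f A x + op_series f A y" for x y
    unfolding op_series_def by (simp add: linear_add[OF linpow] scaleR_add_right suminf_add op_summable f)
  show "op_series f A (r *\<^sub>R x) = r *\<^sub>R op_series f A x" for r x
    unfolding op_series_def using suminf_scaleR_right[OF op_summable[OF f, of x], of r]
    by (simp add: linear_scale[OF linpow] mult.commute)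
qed

lemma op_series_add: "entire f \<Longrightarrow> entire g \<Longrightarrow> op_series (f + g) A v = op_series f A v + op_series g A v"
  unfolding op_series_def by (simp add: suminf_add op_summable scaleR_add_left)

lemma op_series_const_mult: "entire f \<Longrightarrow> op_series (fps_const c * f) A v = c *\<^sub>R op_series f A v"
  unfolding op_series_def by (simp add: suminf_scaleR_right op_summable)

lemma op_series_const: "op_series (fps_const c) A v = c *\<^sub>R v"
proof -
  have "(\<lambda>n. fps_nth (fps_const c) n *\<^sub>R (A ^^ n) v) sums (\<Sum>n\<in>{0}. fps_nth (fps_const c) n *\<^sub>R (A ^^ n) v)"
    by (rule sums_finite) auto
  then show ?thesis unfolding op_series_def by (simp add: sums_iff)
qed

lemma op_series_X: "op_series fps_X A v = A v"
proof -
  have "(\<lambda>n. fps_nth fps_X n *\<^sub>R (A ^^ n) v) sums (\<Sum>n\<in>{1}. fps_nth fps_X n *\<^sub>R (A ^^ n) v)"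
    by (rule sums_finite) auto
  then show ?thesis unfolding op_series_def by (simp add: sums_iff)
qed

text \<open>The Cauchy product: the bound \<open>C ^ (i + j)\<close> on the iterates splits into a
  factor for each index, as \<open>suminf_antidiagonal\<close> requires.\<close>

lemma op_series_mult:
  assumes f: "entire f" and g: "entire g"
  shows "op_series (f * g) A v = op_series f A (op_series g A v)"
proof -
  obtain C where C: "C \<ge> 0" "\<And>n v. norm ((A ^^ n) v) \<le> C ^ n * norm v" using power_bound by blast
  let ?a = "\<lambda>i j. (fps_nth f i * fps_nth g j) *\<^sub>R (A ^^ (i + j)) v"
  have pb: "bounded_linear (A ^^ i)" for i
    by (rule bounded_linear_intro[of _ "C ^ i"])
      (use C in \<open>auto simp: linear_add[OF linpow] linear_scale[OF linpow] mult.commute\<close>)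
  have "op_series f A (op_series g A v) = (\<Sum>i. fps_nth f i *\<^sub>R (\<Sum>j. (A ^^ i) (fps_nth g j *\<^sub>R (A ^^ j) v)))"
    unfolding op_series_def by (simp add: bounded_linear.suminf[OF pb op_summable[OF g]])
  also have "\<dots> = (\<Sum>i. \<Sum>j. ?a i j)"
    unfolding suminf_scaleR_right[OF bounded_linear.summable[OF pb op_summable[OF g]]]
    by (simp add: linear_scale[OF linpow] funpow_add)
  also have "\<dots> = (\<Sum>n. \<Sum>i\<le>n. ?a i (n - i))"
  proof (rule suminf_antidiagonal)
    show "norm (?a i j) \<le> (\<bar>fps_nth f i\<bar> * C ^ i) * (\<bar>fps_nth g j\<bar> * C ^ j * norm v)" for i j
      using mult_left_mono[OF C(2)[of "i + j" v], of "\<bar>fps_nth f i\<bar> * \<bar>fps_nth g j\<bar>"]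
      by (simp add: abs_mult power_add mult_ac)
    show "summable (\<lambda>j. \<bar>fps_nth g j\<bar> * C ^ j * norm v)"
      using g by (intro summable_mult2) (simp add: entire_def)
  qed (use f C in \<open>auto simp: entire_def\<close>)
  also have "\<dots> = op_series (f * g) A v"
    unfolding op_series_def
    by (intro suminf_cong) (simp add: fps_mult_nth scaleR_sum_left atLeast0AtMost)
  finally show ?thesis by simp
qed

lemma op_series_closed_subspace:
  assumes "entire f" "subspace V" "closed V" "\<And>n. (A ^^ n) v \<in> V"
  shows "op_series f A v \<in> V"
proof -
  have "(\<lambda>k. \<Sum>n<k. fps_nth f n *\<^sub>R (A ^^ n) v) \<longlonglongrightarrow> op_series f A v"
    unfolding op_series_def using summable_sums[OF op_summable[OF assms(1)]] by (simp add: sums_def)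
  moreover have "(\<Sum>n<k. fps_nth f n *\<^sub>R (A ^^ n) v) \<in> V" for k
    by (intro subspace_sum subspace_scale assms)
  ultimately show ?thesis by (rule closed_sequentially[OF assms(3), rotated])
qed

end

text \<open>Intertwining is asked along one orbit only: the projection to the double of the
  subalgebra will be compared with the ambient bracket just on the image of that double.\<close>

lemma op_series_intertwine:
  assumes "bounded_linear h" "summable (\<lambda>n. fps_nth f n *\<^sub>R (A ^^ n) v)" "\<And>n. h ((A ^^ n) v) = (B ^^ n) w"
  shows "h (op_series f A v) = op_series f B w"
  unfolding op_series_def bounded_linear.suminf[OF assms(1,2)] assms(3)[symmetric]
  by (simp add: linear_scale[OF bounded_linear.linear[OF assms(1)]])

subsection \<open>Dependence on parameters\<close>

text \<open>\<open>HP n sb sf M u\<close>: the map \<open>u\<close> is a homogeneous polynomial of degree \<open>n\<close> whose iterated directional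
  derivatives are controlled by \<open>M\<close>.\<close>

primrec HP ::
    "nat \<Rightarrow> ('k \<Rightarrow> 'b::real_normed_vector \<Rightarrow> 'b) \<Rightarrow> ('k \<Rightarrow> 'f::real_normed_vector \<Rightarrow> 'f) \<Rightarrow>
     real \<Rightarrow> ('b \<Rightarrow> 'f) \<Rightarrow> bool" where
  "HP 0 sb sf M u \<longleftrightarrow> (\<exists>c. norm c \<le> M \<and> u = (\<lambda>p. c))"
| "HP (Suc n) sb sf M u \<longleftrightarrow>
     (\<forall>p. norm (u p) \<le> M * norm p ^ Suc n) \<and>
     (\<forall>p. u differentiable (at p) \<and> klinear_on sb sf UNIV (deriv_at u p)) \<and>
     (\<forall>v. HP n sb sf (real (Suc n) * M * norm v) (\<lambda>p. deriv_at u p v))"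

lemma HP_SucI:
  assumes "\<And>p. norm (u p) \<le> M * norm p ^ Suc n" "\<And>p. (u has_derivative u' p) (at p)"
    "\<And>p. klinear_on sb sf UNIV (u' p)" "\<And>v. HP n sb sf (real (Suc n) * M * norm v) (\<lambda>p. u' p v)"
  shows "HP (Suc n) sb sf M u"
proof -
  have d: "deriv_at u p = u' p" for p by (rule deriv_at_eq[OF assms(2)])
  show ?thesis unfolding HP.simps d using assms by (auto simp: differentiable_def)
qed

lemma HP_bound: "HP n sb sf M u \<Longrightarrow> norm (u p) \<le> M * norm p ^ n"
  by (cases n) auto

lemma HP_has_derivative: "HP n sb sf M u \<Longrightarrow> (u has_derivative deriv_at u p) (at p)"
  by (cases n) (auto simp: frechet_derivative_works)

lemma HP_add:
  assumes "fd_vector_space (sf :: 'k::real_or_complex \<Rightarrow> 'f::real_normed_vector \<Rightarrow> 'f)"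
  shows "HP n sb sf M u \<Longrightarrow> HP n sb sf M' u' \<Longrightarrow> HP n sb sf (M + M') (\<lambda>p. u p + u' p)"
proof (induction n arbitrary: M M' u u')
  case 0
  then obtain c c' where "norm c \<le> M" "u = (\<lambda>p. c)" "norm c' \<le> M'" "u' = (\<lambda>p. c')" by auto
  then show ?case using norm_triangle_mono[of c M c' M'] by auto
next
  case (Suc n)
  interpret fd_space sf using assms by unfold_locales
  show ?case
  proof (rule HP_SucI)
    show "norm (u p + u' p) \<le> (M + M') * norm p ^ Suc n" for p
      using HP_bound[OF Suc.prems(1), of p] HP_bound[OF Suc.prems(2), of p] norm_triangle_ineq[of "u p" "u' p"]
      unfolding distrib_right by linarith
    show "((\<lambda>p. u p + u' p) has_derivative (\<lambda>v. deriv_at u p v + deriv_at u' p v)) (at p)" for p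
      by (intro has_derivative_add HP_has_derivative[OF Suc.prems(1)] HP_has_derivative[OF Suc.prems(2)])
    show "klinear_on sb sf UNIV (\<lambda>v. deriv_at u p v + deriv_at u' p v)" for p
      using Suc.prems by (auto simp: klinear_on_def scale_right_distrib)
    have "HP n sb sf (real (Suc n) * M * norm v + real (Suc n) * M' * norm v) (\<lambda>p. deriv_at u p v + deriv_at u' p v)" for v
      using Suc.prems by (rule_tac Suc.IH) auto
    then show "HP n sb sf (real (Suc n) * (M + M') * norm v) (\<lambda>p. deriv_at u p v + deriv_at u' p v)" for v
      by (simp add: algebra_simps)
  qed
qed

lemma HP_linear_comp:
  assumes "bounded_linear h" "klinear_on sf sf UNIV h" "\<And>x. norm (h x) \<le> K * norm x" "K \<ge> 0"
  shows "HP n sb sf M u \<Longrightarrow> HP n sb sf (K * M) (\<lambda>p. h (u p))"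
proof (induction n arbitrary: M u)
  case 0
  then obtain c where c: "norm c \<le> M" "u = (\<lambda>p. c)" by auto
  have "norm (h c) \<le> K * M" using assms(3)[of c] mult_left_mono[OF c(1) assms(4)] by linarith
  then show ?case using c by auto
next
  case (Suc n)
  show ?case
  proof (rule HP_SucI)
    show "norm (h (u p)) \<le> K * M * norm p ^ Suc n" for p
      using assms(3)[of "u p"] mult_left_mono[OF HP_bound[OF Suc.prems, of p] assms(4)]
      unfolding mult.assoc by linarith
    show "((\<lambda>p. h (u p)) has_derivative (\<lambda>v. h (deriv_at u p v))) (at p)" for p
      by (rule bounded_linear.has_derivative[OF assms(1) HP_has_derivative[OF Suc.prems(1)]])
    show "klinear_on sb sf UNIV (\<lambda>v. h (deriv_at u p v))" for p
      using Suc.prems assms(2) by (auto simp: klinear_on_def)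
    have "HP n sb sf (K * (real (Suc n) * M * norm v)) (\<lambda>p. h (deriv_at u p v))" for v
      using Suc.prems by (rule_tac Suc.IH) auto
    then show "HP n sb sf (real (Suc n) * (K * M) * norm v) (\<lambda>p. h (deriv_at u p v))" for v
      by (simp add: mult_ac)
  qed
qed

locale op_param =
  fixes sb :: "'k::real_or_complex \<Rightarrow> 'b::real_normed_vector \<Rightarrow> 'b" and sf :: "'k \<Rightarrow> 'f::banach \<Rightarrow> 'f"
    and A :: "'b \<Rightarrow> 'f \<Rightarrow> 'f"
  assumes fdf: "fd_vector_space sf"
    and bb: "bounded_bilinear A"
    and k1: "\<And>x. klinear_on sb sf UNIV (\<lambda>p. A p x)" and k2: "\<And>p. klinear_on sf sf UNIV (A p)"
begin

sublocale F: fd_space sf using fdf by unfold_locales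

lemma HP_apply:
  assumes C: "\<And>p x. norm (A p x) \<le> C * norm p * norm x" "C \<ge> 0"
  shows "HP n sb sf M u \<Longrightarrow> HP (Suc n) sb sf (C * M) (\<lambda>p. A p (u p))"
proof (induction n arbitrary: M u)
  case 0
  then obtain c where c: "norm c \<le> M" "u = (\<lambda>p. c)" by auto
  show ?case unfolding c(2)
  proof (rule HP_SucI)
    show "norm (A p c) \<le> C * M * norm p ^ Suc 0" for p
    proof -
      have "norm (A p c) \<le> C * norm p * norm c" by (rule C)
      also have "\<dots> \<le> C * norm p * M" using c C by (intro mult_left_mono) auto
      finally show ?thesis by (simp add: mult_ac)
    qed
    show "((\<lambda>p. A p c) has_derivative (\<lambda>v. A v c)) (at p)" for p
      by (rule bounded_linear_imp_has_derivative[OF bounded_bilinear.bounded_linear_left[OF bb]])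
    show "klinear_on sb sf UNIV (\<lambda>v. A v c)" by (rule k1)
    have "norm (A v c) \<le> C * M * norm v" for v
    proof -
      have "norm (A v c) \<le> C * norm v * norm c" by (rule C)
      also have "\<dots> \<le> C * norm v * M" using c C by (intro mult_left_mono) auto
      finally show ?thesis by (simp add: mult_ac)
    qed
    then show "HP 0 sb sf (real (Suc 0) * (C * M) * norm v) (\<lambda>p. A v c)" for v by auto
  qed
next
  case (Suc n)
  show ?case
  proof (rule HP_SucI)
    show "norm (A p (u p)) \<le> C * M * norm p ^ Suc (Suc n)" for p
    proof -
      have "norm (A p (u p)) \<le> C * norm p * norm (u p)" by (rule C)
      also have "\<dots> \<le> C * norm p * (M * norm p ^ Suc n)"
        using HP_bound[OF Suc.prems] C by (intro mult_left_mono) auto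
      finally show ?thesis by (simp add: mult_ac)
    qed
    show "((\<lambda>p. A p (u p)) has_derivative (\<lambda>v. A p (deriv_at u p v) + A v (u p))) (at p)" for p
      by (rule bounded_bilinear.FDERIV[OF bb has_derivative_ident HP_has_derivative[OF Suc.prems(1)]])
    show "klinear_on sb sf UNIV (\<lambda>v. A p (deriv_at u p v) + A v (u p))" for p
      using Suc.prems k1[of "u p"] k2[of p] by (auto simp: klinear_on_def F.scale_right_distrib)
    have 1: "HP (Suc n) sb sf (C * (real (Suc n) * M * norm v)) (\<lambda>p. A p (deriv_at u p v))" for v
      using Suc.prems by (rule_tac Suc.IH) auto
    have 2: "HP (Suc n) sb sf (C * norm v * M) (\<lambda>p. A v (u p))" for v
      by (rule HP_linear_comp[OF bounded_bilinear.bounded_linear_right[OF bb] k2 C(1) _ Suc.prems])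
        (use C in auto)
    \<comment> \<open>The derivative of \<open>u\<close> contributes \<open>Suc n\<close> and that
      of \<open>A\<close> contributes one more, which gives the factor
      \<open>Suc (Suc n)\<close>.\<close>
    show "HP (Suc n) sb sf (real (Suc (Suc n)) * (C * M) * norm v)
        (\<lambda>p. A p (deriv_at u p v) + A v (u p))" for v
      using HP_add[OF fdf 1[of v] 2[of v]] by (simp add: algebra_simps)
  qed
qed

end

text \<open>An entire function of the parameter, given by its homogeneous parts. The class is closed
  under directional derivatives, so smoothness of all orders follows from differentiability by
  induction.\<close>

definition entire_map ::
    "('k \<Rightarrow> 'b::real_normed_vector \<Rightarrow> 'b) \<Rightarrow> ('k \<Rightarrow> 'f::real_normed_vector \<Rightarrow> 'f) \<Rightarrow>
     (nat \<Rightarrow> 'b \<Rightarrow> 'f) \<Rightarrow> bool" where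
  "entire_map sb sf u \<longleftrightarrow>
     (\<exists>M. (\<forall>n. HP n sb sf (M n) (u n)) \<and> (\<forall>n. M n \<ge> 0) \<and> (\<forall>r\<ge>0. summable (\<lambda>n. M n * r ^ n)))"

lemma summable_diffs_nonneg:
  fixes M :: "nat \<Rightarrow> real"
  assumes M: "\<And>r. r \<ge> 0 \<Longrightarrow> summable (\<lambda>n. M n * r ^ n)" "\<And>n. M n \<ge> 0" and r: "r \<ge> 0"
  shows "summable (\<lambda>n. real (Suc n) * M (Suc n) * r ^ n)"
proof -
  \<comment> \<open>Doubling the radius absorbs the factor \<open>Suc n\<close>; the maximum with 1
    allows the exponent to rise from \<open>n\<close> to \<open>Suc n\<close>.\<close>
  define s where "s = 2 * max r 1"
  have s: "s \<ge> 0" by (simp add: s_def)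
  have "summable (\<lambda>n. M (Suc n) * s ^ Suc n)"
    using M(1)[OF s] by (subst summable_Suc_iff)
  then show ?thesis
  proof (rule summable_comparison_test'[of _ 0])
    fix n
    have "real (Suc n) * r ^ n \<le> 2 ^ Suc n * max r 1 ^ Suc n"
    proof (rule mult_mono)
      show "real (Suc n) \<le> 2 ^ Suc n"
        using of_nat_less_two_power[of "Suc n", where 'a = real] by linarith
      have "r ^ n \<le> max r 1 ^ n" using r by (intro power_mono) auto
      also have "\<dots> \<le> max r 1 ^ Suc n" by (intro power_increasing) auto
      finally show "r ^ n \<le> max r 1 ^ Suc n" .
    qed (use r in auto)
    then have "real (Suc n) * r ^ n \<le> s ^ Suc n" unfolding s_def power_mult_distrib .
    then have "M (Suc n) * (real (Suc n) * r ^ n) \<le> M (Suc n) * s ^ Suc n"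
      using M(2) by (rule mult_left_mono)
    then show "norm (real (Suc n) * M (Suc n) * r ^ n) \<le> M (Suc n) * s ^ Suc n"
      using r M(2)[of "Suc n"] by (simp add: abs_mult mult_ac del: power_Suc of_nat_Suc)
  qed
qed

context
  fixes sb :: "'k::real_or_complex \<Rightarrow> 'b::real_normed_vector \<Rightarrow> 'b" and sf :: "'k \<Rightarrow> 'f::banach \<Rightarrow> 'f"
  assumes fdf: "fd_vector_space sf"
begin

interpretation F: fd_space sf using fdf by unfold_locales

lemma entire_map_summable_norm:
  assumes "entire_map sb sf u" shows "summable (\<lambda>n. norm (u n p))"
proof -
  obtain M where M: "\<And>n. HP n sb sf (M n) (u n)" "\<And>r. r \<ge> 0 \<Longrightarrow> summable (\<lambda>n. M n * r ^ n)"
    using assms by (auto simp: entire_map_def)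
  show ?thesis
    by (rule summable_comparison_test'[OF M(2)[of "norm p"], of 0]) (use HP_bound[OF M(1)] in auto)
qed

lemma entire_map_deriv:
  assumes "entire_map sb sf u" shows "entire_map sb sf (\<lambda>n p. deriv_at (u (Suc n)) p v)"
proof -
  obtain M where M: "\<And>n. HP n sb sf (M n) (u n)" "\<And>n. M n \<ge> 0"
    "\<And>r. r \<ge> 0 \<Longrightarrow> summable (\<lambda>n. M n * r ^ n)"
    using assms by (auto simp: entire_map_def)
  let ?M = "\<lambda>n. real (Suc n) * M (Suc n) * norm v"
  have "summable (\<lambda>n. ?M n * r ^ n)" if r: "r \<ge> 0" for r
    using summable_mult[OF summable_diffs_nonneg[OF M(3,2) r], of "norm v"] by (simp add: mult_ac)
  moreover have "HP n sb sf (?M n) (\<lambda>p. deriv_at (u (Suc n)) p v)" for n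
    using M(1)[of "Suc n"] unfolding HP.simps by blast
  ultimately show ?thesis
    unfolding entire_map_def using M(2) by (intro exI[of _ ?M]) auto
qed

text \<open>The bounds in \<open>HP\<close> give a summable majorant for the derivatives on a ball
  around \<open>p\<close>, so the series may be differentiated term by term. The index shift drops
  the constant term, whose derivative is zero.\<close>

lemma entire_map_has_derivative:
  assumes em: "entire_map sb sf u"
  shows "((\<lambda>p. \<Sum>n. u n p) has_derivative (\<lambda>v. \<Sum>n. deriv_at (u (Suc n)) p v)) (at p)"
proof -
  obtain M where M: "\<And>n. HP n sb sf (M n) (u n)" "\<And>n. M n \<ge> 0"
    "\<And>r. r \<ge> 0 \<Longrightarrow> summable (\<lambda>n. M n * r ^ n)"
    using em by (auto simp: entire_map_def)
  define R where "R = norm p + 1"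
  let ?S = "ball 0 R :: 'b set"
  have R: "R \<ge> 0" "p \<in> ?S" by (auto simp: R_def)
  have d0: "deriv_at (u 0) x h = 0" for x h
    using M(1)[of 0] deriv_at_eq[OF has_derivative_const] by auto
  \<comment> \<open>At \<open>n = 0\<close> the factor \<open>real n\<close> makes the truncated
    exponent harmless.\<close>
  define b where "b n = real n * M n * R ^ (n - 1)" for n
  have bnn: "b n \<ge> 0" for n using M(2) R by (simp add: b_def)
  have db: "norm (deriv_at (u n) x h) \<le> b n * norm h" if "x \<in> ?S" for n x h
  proof (cases n)
    case (Suc m)
    have "HP m sb sf (real (Suc m) * M (Suc m) * norm h) (\<lambda>p. deriv_at (u (Suc m)) p h)"
      using M(1)[of "Suc m"] unfolding HP.simps by blast
    from HP_bound[OF this, of x]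
    have "norm (deriv_at (u (Suc m)) x h) \<le> real (Suc m) * M (Suc m) * norm h * norm x ^ m" .
    also have "\<dots> \<le> real (Suc m) * M (Suc m) * norm h * R ^ m"
      using that M(2) by (intro mult_left_mono power_mono) auto
    finally show ?thesis by (simp add: Suc b_def mult_ac)
  qed (simp add: d0 b_def)
  have sb: "summable b"
    using summable_diffs_nonneg[OF M(3,2) R(1)]
    by (subst summable_Suc_iff[symmetric]) (simp add: b_def)
  let ?g = "\<lambda>x h. \<Sum>n. deriv_at (u n) x h"
  have sd: "summable (\<lambda>n. norm (deriv_at (u n) x h))" if "x \<in> ?S" for x h
    by (rule summable_comparison_test'[OF summable_mult2[OF sb, of "norm h"], of 0]) (use db[OF that] in auto)
  have "\<exists>g. \<forall>x\<in>?S. (\<lambda>n. u n x) sums g x \<and> (g has_derivative ?g x) (at x within ?S)"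
  proof (rule has_derivative_series[of ?S u "\<lambda>n x. deriv_at (u n) x" ?g p])
    show "convex ?S" by simp
    show "(u n has_derivative deriv_at (u n) x) (at x within ?S)" for n x
      using HP_has_derivative[OF M(1)] by (rule has_derivative_at_withinI)
    show "(\<lambda>n. u n p) sums (\<Sum>n. u n p)"
      by (rule summable_sums[OF summable_norm_cancel[OF entire_map_summable_norm[OF em]]])
    show "p \<in> ?S" by (rule R)
    fix e :: real assume "e > 0"
    obtain N where N: "\<And>n. n \<ge> N \<Longrightarrow> norm (\<Sum>i. b (i + n)) < e"
      using suminf_exist_split[OF \<open>e > 0\<close> sb] by blast
    have "norm ((\<Sum>i<n. deriv_at (u i) x h) - ?g x h) \<le> e * norm h" if n: "n \<ge> N" and x: "x \<in> ?S" for n x h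
    proof -
      have s: "summable (\<lambda>i. deriv_at (u i) x h)" using sd[OF x] by (rule summable_norm_cancel)
      have s': "summable (\<lambda>i. norm (deriv_at (u (i + n)) x h))"
        using sd[OF x] by (simp only: summable_iff_shift[of "\<lambda>i. norm (deriv_at (u i) x h)"])
      have b': "summable (\<lambda>i. b (i + n))" using sb by (simp only: summable_iff_shift)
      have "norm ((\<Sum>i<n. deriv_at (u i) x h) - ?g x h) = norm (\<Sum>i. deriv_at (u (i + n)) x h)"
        unfolding suminf_minus_initial_segment[OF s] by (rule norm_minus_commute)
      also have "\<dots> \<le> (\<Sum>i. norm (deriv_at (u (i + n)) x h))" using s' by (rule summable_norm)
      also have "\<dots> \<le> (\<Sum>i. b (i + n) * norm h)"
        using b' by (intro suminf_le db x s' summable_mult2)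
      also have "\<dots> = (\<Sum>i. b (i + n)) * norm h" using b' by (rule suminf_mult2[symmetric])
      also have "\<dots> \<le> e * norm h"
        using N[OF n] by (intro mult_right_mono) auto
      finally show ?thesis .
    qed
    then show "\<forall>\<^sub>F n in sequentially. \<forall>x\<in>?S. \<forall>h. norm ((\<Sum>i<n. deriv_at (u i) x h) - ?g x h) \<le> e * norm h"
      unfolding eventually_sequentially by blast
  qed
  then obtain g where g: "\<And>x. x \<in> ?S \<Longrightarrow> (\<lambda>n. u n x) sums g x"
    "\<And>x. x \<in> ?S \<Longrightarrow> (g has_derivative ?g x) (at x within ?S)" by blast
  have "(g has_derivative ?g p) (at p)" using g(2)[OF R(2)] R(2) by (simp add: at_within_open[OF R(2)])
  then have "((\<lambda>p. \<Sum>n. u n p) has_derivative ?g p) (at p)"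
    by (rule has_derivative_transform_within_open[of _ _ _ _ ?S]) (use R g(1) in \<open>auto simp: sums_iff\<close>)
  moreover have "?g p h = (\<Sum>n. deriv_at (u (Suc n)) p h)" for h
    using suminf_split_head[OF summable_norm_cancel[OF sd[OF R(2), of h]]] d0 by simp
  ultimately show ?thesis by simp
qed

lemma entire_map_klinear:
  assumes em: "entire_map sb sf u"
  shows "klinear_on sb sf UNIV (\<lambda>v. \<Sum>n. deriv_at (u (Suc n)) p v)"
proof -
  have k: "klinear_on sb sf UNIV (deriv_at (u (Suc n)) p)" for n
    using em by (auto simp: entire_map_def dest: spec[of _ "Suc n"])
  have s: "summable (\<lambda>n. deriv_at (u (Suc n)) p v)" for v
    by (rule summable_norm_cancel[OF entire_map_summable_norm[OF entire_map_deriv[OF em]]])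
  have "bounded_linear (sf c)" for c by (rule finite_dim_linear_bounded[OF F.finite_dim F.linear_sc])
  from bounded_linear.suminf[OF this s] suminf_add[OF s s] k show ?thesis
    unfolding klinear_on_def by simp
qed

lemma entire_map_Ck: "entire_map sb sf u \<Longrightarrow> Ck_on k sb sf UNIV (\<lambda>p. \<Sum>n. u n p)"
proof (induction k arbitrary: u)
  case 0
  have "isCont (\<lambda>p. \<Sum>n. u n p) p" for p
    by (rule has_derivative_continuous[OF entire_map_has_derivative[OF 0]])
  then show ?case by (simp add: continuous_at_imp_continuous_on)
next
  case (Suc k)
  show ?case
    by (rule Ck_on_SucI[OF open_UNIV entire_map_has_derivative[OF Suc.prems] entire_map_klinear[OF Suc.prems]])
      (rule Suc.IH[OF entire_map_deriv[OF Suc.prems]])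
qed

end

text \<open>The derivative of \<open>A\<^sup>n v\<close> in the direction \<open>B\<close>.\<close>

primrec Wd :: "('f \<Rightarrow> 'f) \<Rightarrow> ('f \<Rightarrow> 'f) \<Rightarrow> nat \<Rightarrow> 'f::real_normed_vector \<Rightarrow> 'f" where
  "Wd A B 0 v = 0"
| "Wd A B (Suc n) v = B ((A ^^ n) v) + A (Wd A B n v)"

definition op_dseries ::
    "real fps \<Rightarrow> ('v::real_normed_vector \<Rightarrow> 'v) \<Rightarrow> ('v \<Rightarrow> 'v) \<Rightarrow> 'v \<Rightarrow> 'v" where
  "op_dseries f A B v = (\<Sum>n. fps_nth f n *\<^sub>R Wd A B n v)"

context op_param
begin

lemma bl_A: "bounded_linear (A p)"
  by (rule bounded_bilinear.bounded_linear_right[OF bb])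

sublocale P: bounded_endo "A p" for p
  by (rule bounded_endo.intro[OF bl_A])

lemma entire_map_op:
  assumes f: "entire f" shows "entire_map sb sf (\<lambda>n p. fps_nth f n *\<^sub>R (A p ^^ n) v)"
proof -
  obtain C where C: "C \<ge> 0" "\<And>p x. norm (A p x) \<le> C * norm p * norm x"
    using bounded_bilinear.nonneg_bounded[OF bb] by (metis mult.commute mult.assoc)
  have HPn: "HP n sb sf (C ^ n * norm v) (\<lambda>p. (A p ^^ n) v)" for n
  proof (induction n)
    case (Suc n)
    then show ?case using HP_apply[OF C(2,1) Suc] by (simp add: mult_ac)
  qed auto
  have k: "klinear_on sf sf UNIV (\<lambda>x. r *\<^sub>R x)" for r
    by (simp add: klinear_on_def scaleR_add_right F.sc_scaleR_right)
  have "HP n sb sf (\<bar>fps_nth f n\<bar> * (C ^ n * norm v)) (\<lambda>p. fps_nth f n *\<^sub>R (A p ^^ n) v)" for n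
    by (rule HP_linear_comp[OF bounded_linear_scaleR_right k _ _ HPn]) auto
  moreover have "summable (\<lambda>n. \<bar>fps_nth f n\<bar> * (C ^ n * norm v) * r ^ n)" for r
  proof -
    have "summable (\<lambda>n. norm v * (\<bar>fps_nth f n\<bar> * (C * r) ^ n))"
      using f by (intro summable_mult) (simp add: entire_def)
    then show ?thesis by (simp add: power_mult_distrib mult_ac)
  qed
  ultimately show ?thesis
    unfolding entire_map_def using C
    by (intro exI[of _ "\<lambda>n. \<bar>fps_nth f n\<bar> * (C ^ n * norm v)"]) auto
qed

lemma power_has_derivative:
  "((\<lambda>p. (A p ^^ n) v) has_derivative (\<lambda>h. Wd (A p) (A h) n v)) (at p)"
proof (induction n)
  case (Suc n)
  show ?case
    using bounded_bilinear.FDERIV[OF bb has_derivative_ident Suc] by (simp add: add.commute)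
qed simp

lemma op_series_has_derivative:
  assumes f: "entire f"
  shows "((\<lambda>p. op_series f (A p) v) has_derivative (\<lambda>h. op_dseries f (A p) (A h) v)) (at p)"
proof -
  let ?u = "\<lambda>n p. fps_nth f n *\<^sub>R (A p ^^ n) v"
  have d: "deriv_at (?u n) p h = fps_nth f n *\<^sub>R Wd (A p) (A h) n v" for n p h
    using deriv_at_eq[OF has_derivative_scaleR_right[OF power_has_derivative]] by (rule fun_cong)
  have s: "summable (\<lambda>n. fps_nth f (Suc n) *\<^sub>R Wd (A p) (A h) (Suc n) v)" for h
    using entire_map_summable_norm[OF fdf entire_map_deriv[OF fdf entire_map_op[OF f]], of v p h]
    unfolding d by (rule summable_norm_cancel)
  have "(\<Sum>n. deriv_at (?u (Suc n)) p h) = op_dseries f (A p) (A h) v" for h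
    unfolding d op_dseries_def
    using suminf_split_head[OF s[of h, unfolded summable_Suc_iff[of "\<lambda>n. fps_nth f n *\<^sub>R Wd (A p) (A h) n v"]]]
    by simp
  with entire_map_has_derivative[OF fdf entire_map_op[OF f], of v p] show ?thesis
    unfolding op_series_def by simp
qed

lemma op_series_smooth: "entire f \<Longrightarrow> smooth_on sb sf UNIV (\<lambda>p. op_series f (A p) v)"
  unfolding smooth_on_def op_series_def
  by (intro allI) (rule entire_map_Ck[OF fdf entire_map_op])

end

subsection \<open>Exponential generating functions\<close>

text \<open>\<open>1 \<le> c\<close> makes the bound increase with \<open>n\<close>, so that it
  survives shifting the sequence to the right.\<close>

definition exp_bdd :: "(nat \<Rightarrow> 'v::real_normed_vector) \<Rightarrow> bool" where
  "exp_bdd x \<longleftrightarrow> (\<exists>K c. 0 \<le> K \<and> 1 \<le> c \<and> (\<forall>n. norm (x n) \<le> K * c ^ n))"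

definition egf :: "(nat \<Rightarrow> 'v::real_normed_vector) \<Rightarrow> real \<Rightarrow> 'v" where
  "egf x t = (\<Sum>n. (t ^ n / fact n) *\<^sub>R x n)"

lemma exp_bdd_Suc: "exp_bdd x \<Longrightarrow> exp_bdd (\<lambda>n. x (Suc n))"
  unfolding exp_bdd_def
proof (elim exE conjE)
  fix K c :: real assume K: "0 \<le> K" "1 \<le> c" "\<forall>n. norm (x n) \<le> K * c ^ n"
  show "\<exists>K c. 0 \<le> K \<and> 1 \<le> c \<and> (\<forall>n. norm (x (Suc n)) \<le> K * c ^ n)"
    using K(1,2) K(3)[rule_format, of "Suc _"] by (intro exI[of _ "K * c"] exI[of _ c]) (auto simp: mult.assoc)
qed

lemma exp_bdd_shift:
  assumes "exp_bdd x" shows "exp_bdd (\<lambda>n. if n < k then 0 else x (n - k))"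
proof -
  obtain K c where K: "0 \<le> K" "1 \<le> c" "\<And>n. norm (x n) \<le> K * c ^ n"
    using assms by (auto simp: exp_bdd_def)
  have "norm (x (n - k)) \<le> K * c ^ n" for n
  proof -
    have "K * c ^ (n - k) \<le> K * c ^ n" using K by (intro mult_left_mono power_increasing) auto
    with K(3)[of "n - k"] show ?thesis by simp
  qed
  then show ?thesis unfolding exp_bdd_def using K by (intro exI[of _ K] exI[of _ c]) auto
qed

lemma exp_bdd_filter: "exp_bdd x \<Longrightarrow> exp_bdd (\<lambda>n. if P n then x n else 0)"
  unfolding exp_bdd_def by fastforce

lemma egf_summable_norm:
  assumes "exp_bdd x" shows "summable (\<lambda>n. norm ((t ^ n / fact n) *\<^sub>R x n))"
proof -
  obtain K c where K: "0 \<le> K" "1 \<le> c" "\<And>n. norm (x n) \<le> K * c ^ n"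
    using assms by (auto simp: exp_bdd_def)
  have "summable (\<lambda>n. K * (inverse (fact n) * (\<bar>t\<bar> * c) ^ n))"
    by (intro summable_mult summable_exp)
  then show ?thesis
  proof (rule summable_comparison_test'[of _ 0])
    fix n
    have "\<bar>t\<bar> ^ n / fact n * norm (x n) \<le> \<bar>t\<bar> ^ n / fact n * (K * c ^ n)"
      by (intro mult_left_mono K) auto
    then show "norm (norm ((t ^ n / fact n) *\<^sub>R x n)) \<le> K * (inverse (fact n) * (\<bar>t\<bar> * c) ^ n)"
      by (simp add: power_abs power_mult_distrib abs_mult abs_divide divide_inverse mult_ac)
  qed
qed

text \<open>Scalar multiplication is a family of operators linear in its parameter \<open>t\<close>,
  so the series is an entire map of one real variable.\<close>

lemma egf_has_vector_derivative:
  fixes x :: "nat \<Rightarrow> 'v::banach"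
  assumes fd: "finite_dim TYPE('v)" and x: "exp_bdd x"
  shows "(egf x has_vector_derivative egf (\<lambda>n. x (Suc n)) t) (at t)"
proof -
  interpret fd_space "(*\<^sub>R) :: real \<Rightarrow> 'v \<Rightarrow> 'v"
  proof
    obtain B :: "'v set" where "finite B" "span B = UNIV" using fd by (auto simp: finite_dim_def)
    moreover have "vector_space ((*\<^sub>R) :: real \<Rightarrow> 'v \<Rightarrow> 'v)" ..
    ultimately show "fd_vector_space ((*\<^sub>R) :: real \<Rightarrow> 'v \<Rightarrow> 'v)"
      unfolding fd_vector_space_def span_raw_def by auto
  qed
  interpret op_param "(*) :: real \<Rightarrow> real \<Rightarrow> real" "(*\<^sub>R) :: real \<Rightarrow> 'v \<Rightarrow> 'v" "(*\<^sub>R)"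
    by unfold_locales
      (auto simp: klinear_on_def algebra_simps fd intro: exI[of _ 1])
  obtain K c where K: "0 \<le> K" "1 \<le> c" "\<And>n. norm (x n) \<le> K * c ^ n"
    using x by (auto simp: exp_bdd_def)
  let ?u = "\<lambda>n t. (t ^ n / fact n) *\<^sub>R x n"
  have HPn: "HP n (*) (*\<^sub>R) (norm v) (\<lambda>t. t ^ n *\<^sub>R v)" for n and v :: 'v
  proof (induction n)
    case (Suc n)
    have "HP (Suc n) (*) (*\<^sub>R) (1 * norm v) (\<lambda>t. t *\<^sub>R (t ^ n *\<^sub>R v))"
      by (rule HP_apply[OF _ _ Suc]) auto
    then show ?case by simp
  qed auto
  have "HP n (*) (*\<^sub>R) (norm (x n) / fact n) (?u n)" for n
    using HPn[of n "(1 / fact n) *\<^sub>R x n"] by (simp add: divide_inverse mult.commute)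
  moreover have "summable (\<lambda>n. norm (x n) / fact n * r ^ n)" if "r \<ge> 0" for r
    using egf_summable_norm[OF x, of r] that by (simp add: mult.commute)
  ultimately have em: "entire_map (*) (*\<^sub>R) ?u"
    unfolding entire_map_def by (intro exI[of _ "\<lambda>n. norm (x n) / fact n"]) auto
  have d: "deriv_at (?u (Suc n)) t h = h *\<^sub>R ((t ^ n / fact n) *\<^sub>R x (Suc n))" for n h
  proof -
    have "(?u (Suc n) has_derivative (\<lambda>h. h *\<^sub>R ((t ^ n / fact n) *\<^sub>R x (Suc n)))) (at t)"
    proof -
      have "((\<lambda>t. t ^ Suc n / fact (Suc n)) has_real_derivative (real (Suc n) * t ^ n) / fact (Suc n)) (at t)"
        by (rule DERIV_cdivide) (use DERIV_pow[of "Suc n" t] in simp)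
      also have "(real (Suc n) * t ^ n) / fact (Suc n) = t ^ n / fact n" by simp
      finally show ?thesis
        unfolding has_field_derivative_def
        by (drule_tac has_derivative_scaleR_left[of _ _ _ "x (Suc n)"]) (simp add: mult.commute)
    qed
    then show ?thesis by (simp add: deriv_at_eq)
  qed
  have "(\<Sum>n. deriv_at (?u (Suc n)) t h) = h *\<^sub>R egf (\<lambda>n. x (Suc n)) t" for h
    unfolding d egf_def
    by (rule suminf_scaleR_right[symmetric]) (rule summable_norm_cancel[OF egf_summable_norm[OF exp_bdd_Suc[OF x]]])
  with entire_map_has_derivative[OF fd em, of t] show ?thesis
    by (simp add: has_vector_derivative_def egf_def[abs_def])
qed

text \<open>Padding with \<open>k\<close> zeros turns coefficients
  \<open>t ^ (n + k) / fact (n + k)\<close> into those of an exponential generating function, and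
  differentiation in \<open>t\<close> removes one zero.\<close>

lemma shifted_egf:
  fixes x :: "nat \<Rightarrow> 'v::banach"
  assumes "exp_bdd x"
  shows "egf (\<lambda>n. if n < k then 0 else x (n - k)) t = (\<Sum>n. (t ^ (n + k) / fact (n + k)) *\<^sub>R x n)"
  unfolding egf_def
  by (subst suminf_split_initial_segment[OF summable_norm_cancel[OF egf_summable_norm[OF exp_bdd_shift[OF assms]]], of _ _ k])
    simp

lemma shifted_egf_has_vector_derivative:
  fixes x :: "nat \<Rightarrow> 'v::banach"
  assumes fd: "finite_dim TYPE('v)" and x: "exp_bdd x"
  shows "((\<lambda>t. \<Sum>n. (t ^ (n + Suc k) / fact (n + Suc k)) *\<^sub>R x n) has_vector_derivative
      (\<Sum>n. (t ^ (n + k) / fact (n + k)) *\<^sub>R x n)) (at t)"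
  using egf_has_vector_derivative[OF fd exp_bdd_shift[OF x, of "Suc k"], of t]
  unfolding Suc_less_eq diff_Suc_Suc shifted_egf[OF x, symmetric] .

text \<open>\<open>Wd A B n v\<close> is a sum of \<open>n\<close> words with one letter
  \<open>B\<close> each, which gives a bound linear in \<open>n\<close> times \<open>C ^ n\<close>;
  doubling \<open>C\<close> absorbs the factor \<open>n\<close>.\<close>

lemma Wd_bound:
  fixes A B :: "'v::banach \<Rightarrow> 'v"
  assumes "bounded_linear A" "bounded_linear B"
  shows "exp_bdd (\<lambda>n. Wd A B n v)" and "exp_bdd (\<lambda>n. (A ^^ n) v)"
proof -
  interpret bounded_endo A by (rule bounded_endo.intro[OF assms(1)])
  obtain C0 where C0: "C0 \<ge> 0" "\<And>v. norm (A v) \<le> norm v * C0"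
    using bounded_linear.nonneg_bounded[OF assms(1)] by blast
  obtain D where D: "D \<ge> 0" "\<And>v. norm (B v) \<le> norm v * D"
    using bounded_linear.nonneg_bounded[OF assms(2)] by blast
  define C where "C = max C0 1"
  have C: "C \<ge> 1" "norm (A v) \<le> C * norm v" for v
    using C0(2)[of v] mult_left_mono[of C0 C "norm v"] by (auto simp: C_def mult.commute)
  have pw: "norm ((A ^^ n) v) \<le> C ^ n * norm v" for n
  proof (induction n)
    case (Suc n)
    have "norm (A ((A ^^ n) v)) \<le> C * norm ((A ^^ n) v)" by (rule C)
    also have "\<dots> \<le> C * (C ^ n * norm v)" using Suc C by (intro mult_left_mono) auto
    finally show ?case by (simp add: mult_ac)
  qed simp
  show "exp_bdd (\<lambda>n. (A ^^ n) v)"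
    unfolding exp_bdd_def using pw C by (intro exI[of _ "norm v"] exI[of _ C]) (auto simp: mult.commute)
  have wb: "norm (Wd A B n v) \<le> real n * (D * norm v * C ^ n)" for n
  proof (induction n)
    case (Suc n)
    have "norm (B ((A ^^ n) v)) \<le> norm ((A ^^ n) v) * D" by (rule D)
    also have "\<dots> \<le> (C ^ n * norm v) * D" using pw D by (intro mult_right_mono)
    also have "\<dots> = D * norm v * C ^ n" by simp
    also have "\<dots> \<le> D * norm v * C ^ Suc n"
      using C D by (intro mult_left_mono power_increasing) auto
    finally have 1: "norm (B ((A ^^ n) v)) \<le> D * norm v * C ^ Suc n" .
    have "norm (A (Wd A B n v)) \<le> C * norm (Wd A B n v)" by (rule C)
    also have "\<dots> \<le> C * (real n * (D * norm v * C ^ n))" using Suc C by (intro mult_left_mono) auto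
    finally have "norm (A (Wd A B n v)) \<le> real n * (D * norm v * C ^ Suc n)" by (simp add: mult_ac)
    with 1 norm_triangle_ineq[of "B ((A ^^ n) v)" "A (Wd A B n v)"]
    show ?case by (simp add: algebra_simps)
  qed simp
  have "norm (Wd A B n v) \<le> (D * norm v) * (2 * C) ^ n" for n
  proof -
    have "real n * (D * norm v * C ^ n) \<le> 2 ^ n * (D * norm v * C ^ n)"
      using of_nat_less_two_power[of n, where 'a = real] C D by (intro mult_right_mono) auto
    with wb[of n] show ?thesis by (simp add: power_mult_distrib mult_ac)
  qed
  then show "exp_bdd (\<lambda>n. Wd A B n v)"
    unfolding exp_bdd_def using C D by (intro exI[of _ "D * norm v"] exI[of _ "2 * C"]) auto
qed

text \<open>As functions of z: \<open>th t\<close> is (e^(tz) - 1)/z, \<open>ss t\<close> is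
  sinh(tz)/z, \<open>cc t\<close> is (cosh(tz) - 1)/z, \<open>rr t\<close> is (sinh(tz) - tz)/z^2,
  and \<open>ch\<close> is cosh z. The scale \<open>t\<close> serves as time: the
  \<open>t\<close>-derivative of \<open>th t\<close> is e^(tz), and that of \<open>rr t\<close> is
  \<open>cc t\<close>.\<close>

definition th :: "real \<Rightarrow> real fps" where "th t = Abs_fps (\<lambda>n. t ^ (n + 1) / fact (n + 1))"
definition ss :: "real \<Rightarrow> real fps" where "ss t = Abs_fps (\<lambda>n. if even n then t ^ (n + 1) / fact (n + 1) else 0)"
definition cc :: "real \<Rightarrow> real fps" where "cc t = Abs_fps (\<lambda>n. if odd n then t ^ (n + 1) / fact (n + 1) else 0)"
definition rr :: "real \<Rightarrow> real fps" where "rr t = Abs_fps (\<lambda>n. if odd n then t ^ (n + 2) / fact (n + 2) else 0)"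
definition ch :: "real fps" where "ch = Abs_fps (\<lambda>n. if even n then 1 / fact n else 0)"

lemma nths [simp]:
  "fps_nth (th t) n = t ^ (n + 1) / fact (n + 1)"
  "fps_nth (ss t) n = (if even n then t ^ (n + 1) / fact (n + 1) else 0)"
  "fps_nth (cc t) n = (if odd n then t ^ (n + 1) / fact (n + 1) else 0)"
  "fps_nth (rr t) n = (if odd n then t ^ (n + 2) / fact (n + 2) else 0)"
  "fps_nth ch n = (if even n then 1 / fact n else 0)"
  by (simp_all add: th_def ss_def cc_def rr_def ch_def)

lemma abs_pow_fact_bound: "\<bar>t ^ (n + k) / fact (n + k)\<bar> \<le> \<bar>t\<bar> ^ k * \<bar>t\<bar> ^ n / fact n" for t :: real
proof -
  have "\<bar>t ^ (n + k) / fact (n + k)\<bar> = \<bar>t\<bar> ^ (n + k) / fact (n + k)" by (simp add: power_abs)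
  also have "\<dots> \<le> \<bar>t\<bar> ^ (n + k) / fact n"
    by (intro divide_left_mono fact_mono) auto
  finally show ?thesis by (simp add: power_add mult.commute)
qed

lemma entire_simps [simp]:
  "entire (fps_exp t)" "entire (th t)" "entire (ss t)" "entire (cc t)" "entire (rr t)" "entire ch" "entire fps_X"
proof -
  show "entire (fps_exp t)"
    by (rule entire_bound[of _ 1 "\<bar>t\<bar>"]) (auto simp: power_abs)
  show "entire (th t)" "entire (ss t)" "entire (cc t)"
    using abs_pow_fact_bound[of t _ 1] by (auto intro!: entire_bound[of _ "\<bar>t\<bar> ^ 1" "\<bar>t\<bar>"])
  show "entire (rr t)"
    using abs_pow_fact_bound[of t _ 2] by (auto intro!: entire_bound[of _ "\<bar>t\<bar> ^ 2" "\<bar>t\<bar>"])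
  show "entire ch" by (rule entire_bound[of _ 1 1]) auto
  show "entire fps_X" by (rule entire_bound[of _ 1 1]) auto
qed

lemma th_eq: "th t = ss t + cc t"
  by (rule fps_ext) simp

lemma th_minus: "th (- t) = cc t - ss t"
proof (rule fps_ext)
  fix n show "fps_nth (th (- t)) n = fps_nth (cc t - ss t) n"
    by (cases "even n") simp_all
qed

lemma X_mult_th: "fps_X * th t = fps_exp t - 1"
proof (rule fps_ext)
  fix n show "fps_nth (fps_X * th t) n = fps_nth (fps_exp t - 1) n"
    by (cases n) (simp_all del: fact_Suc)
qed

lemma X_mult_rr: "fps_X * rr 1 = ss 1 - 1"
proof (rule fps_ext)
  fix n show "fps_nth (fps_X * rr 1) n = fps_nth (ss 1 - 1) n"
    by (cases n) (simp_all del: fact_Suc)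
qed

lemma exp_eq: "fps_exp 1 = ch + fps_X * ss 1"
proof (rule fps_ext)
  fix n show "fps_nth (fps_exp 1) n = fps_nth (ch + fps_X * ss 1) n"
    by (cases n) (simp_all del: fact_Suc)
qed

lemma X_mult_cc: "fps_X * cc 1 = ch - 1"
proof (rule fps_ext)
  fix n show "fps_nth (fps_X * cc 1) n = fps_nth (ch - 1) n"
    by (cases n) (simp_all del: fact_Suc)
qed

section \<open>Variation of an operator series and its dependence on the scale\<close>

lemma op_dseries_summable:
  fixes A B :: "'v::banach \<Rightarrow> 'v"
  assumes "bounded_linear A" "bounded_linear B" "entire f"
  shows "summable (\<lambda>n. fps_nth f n *\<^sub>R Wd A B n v)"
proof -
  obtain K c where K: "0 \<le> K" "1 \<le> c" "\<And>n. norm (Wd A B n v) \<le> K * c ^ n"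
    using Wd_bound(1)[OF assms(1,2)] unfolding exp_bdd_def by blast
  have "summable (\<lambda>n. K * (\<bar>fps_nth f n\<bar> * c ^ n))"
    using assms(3) by (intro summable_mult) (simp add: entire_def)
  then show ?thesis
    by (rule summable_comparison_test'[of _ 0])
      (use mult_left_mono[OF K(3), of "\<bar>fps_nth f n\<bar>" n for n] in \<open>simp add: mult_ac\<close>)
qed

context
  fixes A B :: "'v::banach \<Rightarrow> 'v"
  assumes bA: "bounded_linear A" and bB: "bounded_linear B"
begin

interpretation bounded_endo A by (rule bounded_endo.intro[OF bA])

lemma op_dseries_add:
  "entire f \<Longrightarrow> entire g \<Longrightarrow> op_dseries (f + g) A B v = op_dseries f A B v + op_dseries g A B v"
  unfolding op_dseries_def
  by (simp add: suminf_add op_dseries_summable[OF bA bB] scaleR_add_left)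

lemma op_dseries_diff:
  "entire f \<Longrightarrow> entire g \<Longrightarrow> op_dseries (f - g) A B v = op_dseries f A B v - op_dseries g A B v"
  unfolding op_dseries_def
  by (simp add: suminf_diff op_dseries_summable[OF bA bB] scaleR_diff_left)

lemma op_series_diff:
  "entire f \<Longrightarrow> entire g \<Longrightarrow> op_series (f - g) A v = op_series f A v - op_series g A v"
  unfolding op_series_def by (simp add: suminf_diff op_summable scaleR_diff_left)

lemma op_dseries_const: "op_dseries (fps_const c) A B v = 0"
proof -
  have "fps_nth (fps_const c) n *\<^sub>R Wd A B n v = 0" for n by (cases n) auto
  then show ?thesis unfolding op_dseries_def by (simp only: suminf_zero)
qed

lemma op_series_one: "op_series 1 A v = v" using op_series_const[of 1 v] by simp
lemma op_dseries_one: "op_dseries 1 A B v = 0" using op_dseries_const[of 1 v] by simp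

lemma op_series_X_mult: "entire f \<Longrightarrow> op_series (fps_X * f) A v = A (op_series f A v)"
  by (simp add: op_series_mult op_series_X)

lemma op_series_commute: "entire f \<Longrightarrow> op_series f A (A v) = A (op_series f A v)"
  using op_series_mult[of f fps_X v] op_series_mult[of fps_X f v] by (simp add: op_series_X mult.commute)

text \<open>Leibniz' rule for the factor \<open>A\<close>; after the index shift it is the recursion
  that defines \<open>Wd\<close>.\<close>

lemma op_dseries_X_mult:
  assumes f: "entire f"
  shows "op_dseries (fps_X * f) A B v = B (op_series f A v) + A (op_dseries f A B v)"
proof -
  let ?d = "\<lambda>n. fps_nth (fps_X * f) n *\<^sub>R Wd A B n v"
  have s: "summable ?d" by (rule op_dseries_summable[OF bA bB entire_mult[OF _ f]]) simp
  note sA = op_dseries_summable[OF bA bB f, of v]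
  have "op_dseries (fps_X * f) A B v = (\<Sum>n. ?d (Suc n))"
    unfolding op_dseries_def using suminf_split_head[OF s] by simp
  also have "\<dots> = (\<Sum>n. B (fps_nth f n *\<^sub>R (A ^^ n) v) + A (fps_nth f n *\<^sub>R Wd A B n v))"
    by (simp add: linear_scale[OF bounded_linear.linear[OF bA]] linear_scale[OF bounded_linear.linear[OF bB]]
        scaleR_add_right)
  also have "\<dots> = (\<Sum>n. B (fps_nth f n *\<^sub>R (A ^^ n) v)) + (\<Sum>n. A (fps_nth f n *\<^sub>R Wd A B n v))"
    by (rule suminf_add[symmetric])
      (intro bounded_linear.summable[OF bA] bounded_linear.summable[OF bB] op_summable[OF f] sA)+
  also have "\<dots> = B (op_series f A v) + A (op_dseries f A B v)"
    unfolding op_series_def op_dseries_def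
    by (simp only: bounded_linear.suminf[OF bA sA] bounded_linear.suminf[OF bB op_summable[OF f]])
  finally show ?thesis .
qed

context
  assumes fd: "finite_dim TYPE('v)"
begin

lemma exp_has_vector_derivative:
  "((\<lambda>t. op_series (fps_exp t) A v) has_vector_derivative A (op_series (fps_exp t) A v)) (at t)"
proof -
  have e: "op_series (fps_exp t) A v = egf (\<lambda>n. (A ^^ n) v) t" for t v
    by (simp add: op_series_def egf_def)
  have "egf (\<lambda>n. (A ^^ Suc n) v) t = A (egf (\<lambda>n. (A ^^ n) v) t)"
    unfolding egf_def
    using bounded_linear.suminf[OF bA summable_norm_cancel[OF egf_summable_norm[OF Wd_bound(2)[OF bA bB]]], of t v]
    by (simp add: linear_scale[OF bounded_linear.linear[OF bA]])
  with egf_has_vector_derivative[OF fd Wd_bound(2)[OF bA bB], of v t] show ?thesis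
    unfolding e by simp
qed

lemma th_has_vector_derivative:
  "((\<lambda>t. op_series (th t) A v) has_vector_derivative op_series (fps_exp t) A v) (at t)"
  using shifted_egf_has_vector_derivative[OF fd Wd_bound(2)[OF bA bB], of 0 v t]
  by (simp add: op_series_def)

lemma dexp_has_vector_derivative:
  "((\<lambda>t. op_dseries (fps_exp t) A B v) has_vector_derivative
     B (op_series (fps_exp t) A v) + A (op_dseries (fps_exp t) A B v)) (at t)"
proof -
  have e: "op_dseries (fps_exp t) A B v = egf (\<lambda>n. Wd A B n v) t" for t v
    by (simp add: op_dseries_def egf_def)
  let ?c = "\<lambda>n. t ^ n / fact n"
  have s1: "summable (\<lambda>n. ?c n *\<^sub>R (A ^^ n) v)" and s2: "summable (\<lambda>n. ?c n *\<^sub>R Wd A B n v)"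
    by (rule summable_norm_cancel[OF egf_summable_norm], rule Wd_bound[OF bA bB])+
  have "egf (\<lambda>n. Wd A B (Suc n) v) t = (\<Sum>n. B (?c n *\<^sub>R (A ^^ n) v) + A (?c n *\<^sub>R Wd A B n v))"
    unfolding egf_def
    by (simp add: linear_scale[OF bounded_linear.linear[OF bA]] linear_scale[OF bounded_linear.linear[OF bB]]
        scaleR_add_right)
  also have "\<dots> = (\<Sum>n. B (?c n *\<^sub>R (A ^^ n) v)) + (\<Sum>n. A (?c n *\<^sub>R Wd A B n v))"
    by (rule suminf_add[symmetric])
      (intro bounded_linear.summable[OF bA] bounded_linear.summable[OF bB] s1 s2)+
  also have "\<dots> = B (op_series (fps_exp t) A v) + A (op_dseries (fps_exp t) A B v)"
    by (simp add: op_series_def op_dseries_def bounded_linear.suminf[OF bA s2] bounded_linear.suminf[OF bB s1])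
  finally show ?thesis
    using egf_has_vector_derivative[OF fd Wd_bound(1)[OF bA bB], of v t] unfolding e by simp
qed

lemma dth_has_vector_derivative:
  "((\<lambda>t. op_dseries (th t) A B v) has_vector_derivative op_dseries (fps_exp t) A B v) (at t)"
  using shifted_egf_has_vector_derivative[OF fd Wd_bound(1)[OF bA bB], of 0 v t]
  by (simp add: op_dseries_def)

lemma drr_has_vector_derivative:
  "((\<lambda>t. op_dseries (rr t) A B v) has_vector_derivative op_dseries (cc t) A B v) (at t)"
proof -
  have "(\<lambda>t. \<Sum>n. (t ^ (n + Suc 1) / fact (n + Suc 1)) *\<^sub>R (if odd n then Wd A B n v else 0)) =
      (\<lambda>t. op_dseries (rr t) A B v)"
    unfolding op_dseries_def by (intro ext suminf_cong) (simp del: fact_Suc)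
  moreover have "(\<Sum>n. (t ^ (n + 1) / fact (n + 1)) *\<^sub>R (if odd n then Wd A B n v else 0)) =
      op_dseries (cc t) A B v"
    unfolding op_dseries_def by (intro suminf_cong) (simp del: fact_Suc)
  ultimately show ?thesis
    using shifted_egf_has_vector_derivative[OF fd exp_bdd_filter[OF Wd_bound(1)[OF bA bB]], of 1 odd v t]
    by argo
qed

lemma exp_inverse: "op_series (fps_exp (- t)) A (op_series (fps_exp t) A v) = v"
  using op_series_mult[of "fps_exp (- t)" "fps_exp t" v] by (simp add: fps_exp_add_mult[symmetric] op_series_one)

text \<open>Applying the exponential of \<open>- t A\<close> to \<open>u t\<close> gives a constant
  curve. This is how identities between conjugated or varied exponentials are proved below: the
  difference of both sides solves the equation and starts at 0.\<close>

lemma linear_ode_zero: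
  assumes u: "\<And>t. (u has_vector_derivative A (u t)) (at t)" and u0: "u 0 = 0"
  shows "u t = 0"
proof -
  let ?g = "\<lambda>t. op_series (fps_exp (- t)) A (u t)"
  have "(?g has_derivative (\<lambda>h. 0)) (at t)" for t
  proof -
    have "((\<lambda>t. op_series (fps_exp (- t)) A v) has_derivative (\<lambda>h. h *\<^sub>R - A (op_series (fps_exp (- t)) A v))) (at t)" for v
      using vector_diff_chain_at[of uminus "-1" t, OF _ exp_has_vector_derivative[of v "- t"]]
      by (simp add: has_vector_derivative_def o_def has_derivative_minus)
    moreover have "(u has_derivative (\<lambda>h. h *\<^sub>R A (u t))) (at t)"
      using u[of t] by (simp add: has_vector_derivative_def)
    ultimately have "(?g has_derivative (\<lambda>h. h *\<^sub>R - A (op_series (fps_exp (- t)) A (u t)) +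
        op_series (fps_exp (- t)) A (h *\<^sub>R A (u t)))) (at t)"
      by (rule has_derivative_family_apply[OF fd op_series_lin[OF entire_simps(1)]])
    then show ?thesis
      by (simp add: linear_scale[OF op_series_lin[OF entire_simps(1)]] op_series_commute)
  qed
  then have "?g t = ?g 0"
    using has_derivative_zero_unique_connected[OF open_UNIV connected_UNIV, of ?g] has_derivative_zero_constant[of UNIV ?g]
    by (metis UNIV_I convex_UNIV has_derivative_at_withinI)
  also have "\<dots> = 0" using u0 op_series_one linear_0[OF op_series_lin[OF entire_simps(1)]] by simp
  finally have "op_series (fps_exp (- (- t))) A (?g t) = 0"
    using linear_0[OF op_series_lin[OF entire_simps(1)]] by simp
  then show ?thesis by (simp only: exp_inverse)
qed

end

end

section \<open>Lie algebras with an invariant bilinear form\<close>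

lemma klinear_ground_0:
  assumes "klinear_on s1 (*) UNIV (f :: 'v::ab_group_add \<Rightarrow> 'k::real_or_complex)" shows "f 0 = 0"
  using assms unfolding klinear_on_def by (metis UNIV_I add_cancel_right_right add_0)

locale quad_lie =
  fixes sc :: "'k::real_or_complex \<Rightarrow> 'd::banach \<Rightarrow> 'd" and br :: "'d \<Rightarrow> 'd \<Rightarrow> 'd" and frm :: "'d \<Rightarrow> 'd \<Rightarrow> 'k"
  assumes fdsc: "fd_vector_space sc" and lie: "lie_algebra sc UNIV br"
    and frm_lin: "\<And>x. klinear_on sc (*) UNIV (frm x)" and frm_sym: "\<And>x y. frm x y = frm y x"
    and frm_inv: "\<And>x y z. frm (br x y) z = frm x (br y z)"
begin

sublocale D: fd_space sc using fdsc by unfold_locales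

lemma br_klin: "klinear_on sc sc UNIV (br x)" and br_klin2: "klinear_on sc sc UNIV (\<lambda>x. br x y)"
  using lie by (auto simp: lie_algebra_def)

lemma br_add: "br x (y + z) = br x y + br x z" "br (x + y) z = br x z + br y z"
  using br_klin[of x] br_klin2[of z] by (auto simp: klinear_on_def)

lemma bb_br: "bounded_bilinear br"
  by (rule finite_dim_bilinear_bounded[OF D.finite_dim D.finite_dim])
    (rule klinear_real_linear[OF fdsc fdsc br_klin2] klinear_real_linear[OF fdsc fdsc br_klin])+

lemma br_skew: "br x y = - br y x"
proof -
  have z: "br x x = 0" for x using lie by (auto simp: lie_algebra_def)
  have "br (x + y) (x + y) = br x y + br y x" unfolding br_add by (simp add: z)
  then show ?thesis using z[of "x + y"] by (simp add: eq_neg_iff_add_eq_0)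
qed

sublocale A: op_param sc sc br
  by (rule op_param.intro[OF fdsc bb_br br_klin2 br_klin])

lemmas bl_br = A.bl_A
lemmas br_minus = bounded_bilinear.minus_left[OF bb_br] bounded_bilinear.minus_right[OF bb_br]
lemmas br_diff = bounded_bilinear.diff_left[OF bb_br] bounded_bilinear.diff_right[OF bb_br]
lemmas br_zero = bounded_bilinear.zero_left[OF bb_br] bounded_bilinear.zero_right[OF bb_br]

lemma jacobi: "br p (br x y) = br (br p x) y + br x (br p y)"
proof -
  have "br p (br x y) + br x (br y p) + br y (br p x) = 0"
    using lie unfolding lie_algebra_def by blast
  moreover have "br x (br y p) = - br x (br p y)" by (subst br_skew[of y p]) (simp add: br_minus)
  moreover have "br y (br p x) = - br (br p x) y" by (rule br_skew)
  ultimately show ?thesis by (simp add: algebra_simps eq_neg_iff_add_eq_0)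
qed

lemma frm_add: "frm x (y + z) = frm x y + frm x z" "frm (x + y) z = frm x z + frm y z"
  using frm_lin[of x] frm_lin[of z] by (auto simp: klinear_on_def frm_sym[of _ z])

lemma frm_rlin: "linear (frm x)" by (rule klinear_real_linear[OF fdsc fd_ground frm_lin])

lemma frm_rlin2: "linear (\<lambda>x. frm x y)" by (subst frm_sym) (rule frm_rlin)

lemma bb_frm: "bounded_bilinear frm"
  by (rule finite_dim_bilinear_bounded[OF D.finite_dim D.finite_dim frm_rlin2 frm_rlin])

lemmas frm_minus = bounded_bilinear.minus_left[OF bb_frm] bounded_bilinear.minus_right[OF bb_frm]
lemmas frm_diff = bounded_bilinear.diff_left[OF bb_frm] bounded_bilinear.diff_right[OF bb_frm]
lemmas frm_zero = bounded_bilinear.zero_left[OF bb_frm] bounded_bilinear.zero_right[OF bb_frm]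

lemma frm_cyc: "frm x (br y z) = frm y (br z x)"
  by (metis frm_inv frm_sym)

lemma frm_br_skew: "frm x (br y z) = - frm y (br x z)"
  by (metis br_skew frm_cyc frm_minus(2))

abbreviation op :: "real fps \<Rightarrow> 'd \<Rightarrow> 'd \<Rightarrow> 'd" where "op f p \<equiv> op_series f (br p)"
abbreviation dop :: "real fps \<Rightarrow> 'd \<Rightarrow> 'd \<Rightarrow> 'd \<Rightarrow> 'd" where "dop f p b \<equiv> op_dseries f (br p) (br b)"

lemma op_lin: "entire f \<Longrightarrow> linear (op f p)" by (rule A.P.op_series_lin)

lemmas op_add = linear_add[OF op_lin] and op_diff = linear_diff[OF op_lin] and op_minus = linear_neg[OF op_lin]
  and op_zero = linear_0[OF op_lin]

lemma op_klin:
  assumes "entire f" shows "klinear_on sc sc UNIV (op f p)"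
proof -
  have "op f p (sc c x) = sc c (op f p x)" for c x
  proof -
    have pw: "sc c ((br p ^^ n) x) = (br p ^^ n) (sc c x)" for n
      by (induction n) (use br_klin in \<open>auto simp: klinear_on_def\<close>, metis)
    show ?thesis
      by (rule op_series_intertwine[OF finite_dim_linear_bounded[OF D.finite_dim D.linear_sc]
            A.P.op_summable[OF assms] pw, symmetric])
  qed
  then show ?thesis using op_add[OF assms] by (simp add: klinear_on_def)
qed

text \<open>\<open>br p\<close> is skew for the invariant form, so each power that crosses the form
  contributes a sign: the adjoint of f(ad p) is f(- ad p).\<close>

lemma op_adjoint:
  assumes f: "entire f" "entire f'" and ff: "\<And>n. fps_nth f' n = (-1) ^ n * fps_nth f n"
  shows "frm (op f p x) y = frm x (op f' p y)"
proof -
  have pw: "frm ((br p ^^ n) x) y = (-1) ^ n * frm x ((br p ^^ n) y)" for n x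
  proof (induction n arbitrary: x)
    case (Suc n)
    have "frm ((br p ^^ Suc n) x) y = frm ((br p ^^ n) (br p x)) y"
      by (simp only: funpow_Suc_right o_apply)
    also have "\<dots> = (-1) ^ n * frm (br p x) ((br p ^^ n) y)" by (rule Suc)
    also have "frm (br p x) ((br p ^^ n) y) = - frm x (br p ((br p ^^ n) y))"
      by (metis br_skew frm_inv frm_minus(1))
    finally show ?case by simp
  qed simp
  have "frm (op f p x) y = (\<Sum>n. frm (fps_nth f n *\<^sub>R (br p ^^ n) x) y)"
    unfolding op_series_def
    by (rule bounded_linear.suminf[OF bounded_bilinear.bounded_linear_left[OF bb_frm] A.P.op_summable[OF f(1)]])
  also have "\<dots> = (\<Sum>n. frm x (fps_nth f' n *\<^sub>R (br p ^^ n) y))"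
  proof (rule suminf_cong)
    fix n
    show "frm (fps_nth f n *\<^sub>R (br p ^^ n) x) y = frm x (fps_nth f' n *\<^sub>R (br p ^^ n) y)"
      unfolding linear_scale[OF frm_rlin] linear_scale[OF frm_rlin2] pw ff
      by (cases "even n") (simp_all add: scaleR_conv_of_real)
  qed
  also have "\<dots> = frm x (op f' p y)"
    unfolding op_series_def
    by (rule bounded_linear.suminf[OF bounded_bilinear.bounded_linear_right[OF bb_frm] A.P.op_summable[OF f(2)], symmetric])
  finally show ?thesis .
qed

lemma op_curve:
  assumes "entire f"
  shows "((\<lambda>h. op f (p + h *\<^sub>R b) v) has_vector_derivative dop f p b v) (at 0)"
proof -
  have "((\<lambda>h::real. p + h *\<^sub>R b) has_derivative (\<lambda>h. h *\<^sub>R b)) (at 0)"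
    by (auto intro!: derivative_eq_intros)
  from has_derivative_compose[OF this, of "\<lambda>p. op f p v"] A.op_series_has_derivative[OF assms, of v "p + 0 *\<^sub>R b"]
  have d: "((\<lambda>h. op f (p + h *\<^sub>R b) v) has_derivative (\<lambda>h. op_dseries f (br p) (br (h *\<^sub>R b)) v)) (at 0)"
    by (simp add: o_def)
  have "Wd (br p) (br (h *\<^sub>R b)) n v = h *\<^sub>R Wd (br p) (br b) n v" for h n
    by (induction n) (simp_all add: bounded_bilinear.scaleR_left[OF bb_br] bounded_bilinear.scaleR_right[OF bb_br] scaleR_add_right)
  then have "op_dseries f (br p) (br (h *\<^sub>R b)) v = h *\<^sub>R dop f p b v" for h
    unfolding op_dseries_def using suminf_scaleR_right[OF op_dseries_summable[OF bl_br bl_br assms, of p b v], of h]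
    by (simp add: mult.commute)
  with d show ?thesis by (simp add: has_vector_derivative_def)
qed

text \<open>Differentiates at 0 an identity between two pairings of curves; with
  \<open>op_curve\<close> it turns an identity in the base point into one between derivatives in the
  direction \<open>b\<close>.\<close>

lemma frm_curve_unique:
  assumes "(x has_vector_derivative x') (at 0)" "(y has_vector_derivative y') (at 0)"
    "(u has_vector_derivative u') (at 0)" "(v has_vector_derivative v') (at 0)"
    and "\<And>h::real. frm (x h) (y h) = frm (u h) (v h)"
  shows "frm (x 0) y' + frm x' (y 0) = frm (u 0) v' + frm u' (v 0)"
proof -
  have "((\<lambda>h. frm (x h) (y h)) has_vector_derivative frm (x 0) y' + frm x' (y 0)) (at 0)"
    by (rule bounded_bilinear.has_vector_derivative[OF bb_frm assms(1,2)])
  moreover have "((\<lambda>h. frm (x h) (y h)) has_vector_derivative frm (u 0) v' + frm u' (v 0)) (at 0)"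
    unfolding assms(5) by (rule bounded_bilinear.has_vector_derivative[OF bb_frm assms(3,4)])
  ultimately show ?thesis by (rule vector_derivative_unique_at)
qed

lemma dop_adjoint:
  assumes f: "entire f" "entire f'" and ff: "\<And>n. fps_nth f' n = (-1) ^ n * fps_nth f n"
  shows "frm (dop f p b x) y = frm x (dop f' p b y)"
  using frm_curve_unique[OF op_curve[OF f(1), of p b x] has_vector_derivative_const[of y]
      has_vector_derivative_const[of x] op_curve[OF f(2), of p b y]] op_adjoint[OF f ff]
  by (simp add: frm_zero)

section \<open>Conjugation by the exponential and its logarithmic derivative\<close>

abbreviation E :: "real \<Rightarrow> 'd \<Rightarrow> 'd \<Rightarrow> 'd" where "E t p \<equiv> op (fps_exp t) p"

lemma E_inv: "E (- t) p (E t p v) = v"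
  by (rule exp_inverse[OF bl_br bl_br D.finite_dim])

lemma E_inv': "E t p (E (- t) p v) = v"
  using E_inv[of "- t" p v] by simp

lemma E_form: "frm (E t p x) (E t p y) = frm x y"
proof -
  have "frm (E t p x) (E t p y) = frm x (E (- t) p (E t p y))"
    by (rule op_adjoint) (auto simp: power_minus')
  then show ?thesis by (simp add: E_inv)
qed

lemma const_zero_deriv:
  fixes u :: "real \<Rightarrow> 'a::real_normed_vector"
  assumes "\<And>t. (u has_vector_derivative 0) (at t)" "u 0 = 0" shows "u t = 0"
proof -
  obtain c where "\<forall>t\<in>UNIV. u t = c"
    using has_derivative_zero_constant[OF convex_UNIV, of u] assms(1)
    by (auto simp: has_vector_derivative_def)
  then show ?thesis using assms(2) by simp
qed

lemma exp0: "E 0 p v = v" by (simp add: op_series_one[OF bl_br bl_br])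

lemma op_0: "op 0 p v = 0" by (simp add: op_series_def)
lemma dop_0: "dop 0 p b v = 0" by (simp add: op_dseries_def)

lemma fps_0 [simp]: "th 0 = 0" "rr 0 = 0" "ss 0 = 0" "cc 0 = 0"
  by (auto intro: fps_ext)

lemma dop_one: "dop 1 p b v = 0" by (rule op_dseries_one[OF bl_br bl_br])
lemma op_one: "op 1 p v = v" by (rule op_series_one[OF bl_br bl_br])

lemmas Ed = exp_has_vector_derivative[OF bl_br bl_br D.finite_dim]
  and thd = th_has_vector_derivative[OF bl_br bl_br D.finite_dim]
  and dEd = dexp_has_vector_derivative[OF bl_br bl_br D.finite_dim]
  and dthd = dth_has_vector_derivative[OF bl_br bl_br D.finite_dim]
  and drrd = drr_has_vector_derivative[OF bl_br bl_br D.finite_dim]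
  and ode = linear_ode_zero[OF bl_br bl_br D.finite_dim]

text \<open>The difference of the two sides solves u' = [p, u] by the Jacobi identity and starts at
  0.\<close>

lemma E_br: "E t p (br x y) = br (E t p x) (E t p y)"
proof -
  let ?u = "\<lambda>t. E t p (br x y) - br (E t p x) (E t p y)"
  have "(?u has_vector_derivative br p (?u t)) (at t)" for t
  proof -
    have "(?u has_vector_derivative br p (E t p (br x y)) -
        (br (E t p x) (br p (E t p y)) + br (br p (E t p x)) (E t p y))) (at t)"
      by (intro has_vector_derivative_diff bounded_bilinear.has_vector_derivative[OF bb_br] Ed)
    moreover have "br p (E t p (br x y)) - (br (E t p x) (br p (E t p y)) + br (br p (E t p x)) (E t p y)) = br p (?u t)"
      by (simp add: br_diff jacobi[of p "E t p x"])
    ultimately show ?thesis by simp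
  qed
  from ode[OF this] exp0 show ?thesis by simp
qed

lemma br_th: "br p (op (th t) p a) = E t p a - a"
  using op_series_X_mult[OF bl_br bl_br, of "th t" p a] op_series_diff[OF bl_br bl_br, of "fps_exp t" 1 p a]
    entire_bound[of 1 1 1]
  by (simp add: X_mult_th op_one)

text \<open>This is e^(-tz) (e^(tz) - 1)/z = (1 - e^(-tz))/z, checked after multiplication by the
  variable, which can be cancelled.\<close>

lemma E_th: "E (- t) p (op (th t) p a) = - op (th (- t)) p a"
proof -
  have "fps_X * (fps_exp (- t) * th t) = fps_X * - th (- t)"
  proof -
    have "fps_X * (fps_exp (- t) * th t) = fps_exp (- t) * (fps_X * th t)" by (simp add: mult_ac)
    also have "\<dots> = 1 - fps_exp (- t)"
      unfolding X_mult_th by (simp add: right_diff_distrib fps_exp_add_mult[symmetric])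
    also have "\<dots> = fps_X * - th (- t)" unfolding mult_minus_right X_mult_th by simp
    finally show ?thesis .
  qed
  then have eq: "fps_exp (- t) * th t = - th (- t)"
    by (rule mult_left_cancel[OF fps_X_neq_zero, THEN iffD1])
  have "E (- t) p (op (th t) p a) = op (fps_exp (- t) * th t) p a"
    by (simp add: A.P.op_series_mult)
  also have "\<dots> = op (fps_const (-1) * th (- t)) p a" unfolding eq
    by (rule arg_cong[of _ _ "\<lambda>f. op f p a"]) (rule fps_ext, simp)
  also have "\<dots> = - op (th (- t)) p a" by (simp add: A.P.op_series_const_mult)
  finally show ?thesis .
qed

text \<open>\<open>op (th t) p\<close> is the logarithmic derivative of the exponential map: both
  sides satisfy the same inhomogeneous linear equation in \<open>t\<close> and vanish at
  \<open>t = 0\<close>.\<close>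

lemma dE: "dop (fps_exp t) p b v = br (op (th t) p b) (E t p v)"
proof -
  let ?u = "\<lambda>t. dop (fps_exp t) p b v - br (op (th t) p b) (E t p v)"
  have "(?u has_vector_derivative br p (?u t)) (at t)" for t
  proof -
    have "(?u has_vector_derivative br b (E t p v) + br p (dop (fps_exp t) p b v) -
        (br (op (th t) p b) (br p (E t p v)) + br (E t p b) (E t p v))) (at t)"
      by (intro has_vector_derivative_diff bounded_bilinear.has_vector_derivative[OF bb_br] Ed dEd thd)
    moreover have "br b (E t p v) + br p (dop (fps_exp t) p b v) -
        (br (op (th t) p b) (br p (E t p v)) + br (E t p b) (E t p v)) = br p (?u t)"
      by (simp add: br_diff jacobi[of p "op (th t) p b"] br_th)
    ultimately show ?thesis by simp
  qed
  moreover have "?u 0 = 0" using dop_one by (simp add: op_0 br_zero)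
  ultimately show ?thesis using ode[of ?u p t] by simp
qed

text \<open>The Maurer-Cartan equation of the logarithmic derivative. The
  \<open>t\<close>-derivatives of the two sides agree by two uses of \<open>dE\<close>, and both
  sides vanish at \<open>t = 0\<close>.\<close>

lemma flat: "dop (th t) p a b - dop (th t) p b a = br (op (th t) p a) (op (th t) p b)"
proof -
  let ?u = "\<lambda>t. dop (th t) p a b - dop (th t) p b a - br (op (th t) p a) (op (th t) p b)"
  have "(?u has_vector_derivative 0) (at t)" for t
  proof -
    have "(?u has_vector_derivative dop (fps_exp t) p a b - dop (fps_exp t) p b a -
        (br (op (th t) p a) (E t p b) + br (E t p a) (op (th t) p b))) (at t)"
      by (intro has_vector_derivative_diff bounded_bilinear.has_vector_derivative[OF bb_br] dthd thd)
    moreover have "dop (fps_exp t) p a b - dop (fps_exp t) p b a -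
        (br (op (th t) p a) (E t p b) + br (E t p a) (op (th t) p b)) = 0"
      unfolding dE using br_skew[of "E t p a" "op (th t) p b"] by simp
    ultimately show ?thesis by simp
  qed
  from const_zero_deriv[OF this] show ?thesis by (simp add: dop_0 op_0 br_zero)
qed

end

text \<open>\<open>Lp\<close> models the subalgebra, \<open>M\<close> the image of its dual under
  \<open>s\<close>, and \<open>D1\<close> the sum of \<open>m\<close> and the annihilator of the
  subalgebra. Bracketing with \<open>M\<close> exchanges \<open>Lp\<close> and \<open>M\<close>, so
  the parity of a series decides where its values lie, and isotropy then kills pairings of the wrong
  parity.\<close>

locale graded = quad_lie sc br frm
  for sc :: "'k::real_or_complex \<Rightarrow> 'd::banach \<Rightarrow> 'd" and br :: "'d \<Rightarrow> 'd \<Rightarrow> 'd" and frm :: "'d \<Rightarrow> 'd \<Rightarrow> 'k" +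
  fixes Lp M D1 :: "'d set"
  assumes subL: "D.subspace Lp" and subM: "D.subspace M" and sub1: "D.subspace D1"
    and brMM: "\<And>x y. x \<in> M \<Longrightarrow> y \<in> M \<Longrightarrow> br x y \<in> Lp" and brML: "\<And>x y. x \<in> M \<Longrightarrow> y \<in> Lp \<Longrightarrow> br x y \<in> M"
    and brM1: "\<And>x y. x \<in> M \<Longrightarrow> y \<in> D1 \<Longrightarrow> br x y \<in> D1"
    and fMM: "\<And>x y. x \<in> M \<Longrightarrow> y \<in> M \<Longrightarrow> frm x y = 0" and fLL: "\<And>x y. x \<in> Lp \<Longrightarrow> y \<in> Lp \<Longrightarrow> frm x y = 0"
    and fM1: "\<And>x y. x \<in> M \<Longrightarrow> y \<in> D1 \<Longrightarrow> frm x y = 0" and fL1: "\<And>x y. x \<in> Lp \<Longrightarrow> y \<in> D1 \<Longrightarrow> frm x y = 0"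
begin

lemma suminf_mem:
  assumes "D.subspace V" "summable u" "\<And>n. u n \<in> V" shows "suminf u \<in> V"
proof -
  have "(\<lambda>k. \<Sum>n<k. u n) \<longlonglongrightarrow> suminf u"
    using summable_sums[OF assms(2)] by (simp add: sums_def)
  moreover have "(\<Sum>n<k. u n) \<in> V" for k
    by (intro D.subspace_sum assms)
  ultimately show ?thesis by (rule closed_sequentially[OF D.closed_subspace[OF assms(1)], rotated])
qed

lemma scaleR_mem: "D.subspace V \<Longrightarrow> (r \<noteq> 0 \<Longrightarrow> x \<in> V) \<Longrightarrow> r *\<^sub>R x \<in> V"
  using real_vector.subspace_scale[OF D.real_subspace] D.subspace_0 by (cases "r = 0") auto

text \<open>Only iterates with a nonzero coefficient have to lie in \<open>V\<close>; this is where
  the parity of a series enters.\<close>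

lemma op_mem:
  assumes "D.subspace V" "entire f" "\<And>n. fps_nth f n \<noteq> 0 \<Longrightarrow> (br p ^^ n) x \<in> V"
  shows "op f p x \<in> V"
  unfolding op_series_def
  by (rule suminf_mem[OF assms(1) A.P.op_summable[OF assms(2)] scaleR_mem[OF assms(1,3)]])

lemma dop_mem:
  assumes "D.subspace V" "entire f" "\<And>n. fps_nth f n \<noteq> 0 \<Longrightarrow> Wd (br p) (br b) n x \<in> V"
  shows "dop f p b x \<in> V"
  unfolding op_dseries_def
  by (rule suminf_mem[OF assms(1) op_dseries_summable[OF bl_br bl_br assms(2)] scaleR_mem[OF assms(1,3)]])

definition evenf :: "real fps \<Rightarrow> bool" where "evenf f \<longleftrightarrow> entire f \<and> (\<forall>n. odd n \<longrightarrow> fps_nth f n = 0)"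
definition oddf :: "real fps \<Rightarrow> bool" where "oddf f \<longleftrightarrow> entire f \<and> (\<forall>n. even n \<longrightarrow> fps_nth f n = 0)"

lemma parity [simp]: "evenf (ss t)" "evenf ch" "oddf (cc t)" "oddf (rr t)" "oddf (fps_X * ss 1)"
  by (auto simp: evenf_def oddf_def entire_mult)

lemma ent [simp]: "evenf f \<Longrightarrow> entire f" "oddf f \<Longrightarrow> entire f"
  by (auto simp: evenf_def oddf_def)

lemma even_adjoint: "evenf f \<Longrightarrow> frm (op f p x) y = frm x (op f p y)"
  by (rule op_adjoint) (auto simp: evenf_def minus_one_power_iff)

lemma even_dadjoint: "evenf f \<Longrightarrow> frm (dop f p b x) y = frm x (dop f p b y)"
  by (rule dop_adjoint) (auto simp: evenf_def minus_one_power_iff)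

lemma odd_adjoint: "oddf f \<Longrightarrow> frm (op f p x) y = - frm x (op f p y)"
proof -
  assume f: "oddf f"
  have "frm (op f p x) y = frm x (op (fps_const (-1) * f) p y)"
    by (rule op_adjoint) (use f in \<open>auto simp: oddf_def minus_one_power_iff intro!: entire_mult entire_bound[of "fps_const (-1)" 1 1]\<close>)
  then show ?thesis using f by (simp add: A.P.op_series_const_mult frm_minus)
qed

lemma odd_dadjoint: "oddf f \<Longrightarrow> frm (dop f p b x) y = - frm x (dop f p b y)"
proof -
  assume f: "oddf f"
  have "frm (dop f p b x) y = - frm x (dop f p b y)"
    using frm_curve_unique[OF op_curve[of f p b x] has_vector_derivative_const[of y]
        has_vector_derivative_const[of "- x"] op_curve[of f p b y]] odd_adjoint[OF f] f
    by (simp add: frm_zero frm_minus)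
  then show ?thesis .
qed

lemma pow_mem:
  assumes p: "p \<in> M"
  shows "x \<in> Lp \<Longrightarrow> (even n \<longrightarrow> (br p ^^ n) x \<in> Lp) \<and> (odd n \<longrightarrow> (br p ^^ n) x \<in> M)"
    and "x \<in> M \<Longrightarrow> (even n \<longrightarrow> (br p ^^ n) x \<in> M) \<and> (odd n \<longrightarrow> (br p ^^ n) x \<in> Lp)"
    and "x \<in> D1 \<Longrightarrow> (br p ^^ n) x \<in> D1"
  by (induction n) (use brML[OF p] brMM[OF p] brM1[OF p] in auto)

lemma Wd_mem:
  assumes p: "p \<in> M" and b: "b \<in> M"
  shows "x \<in> Lp \<Longrightarrow> (even n \<longrightarrow> Wd (br p) (br b) n x \<in> Lp) \<and> (odd n \<longrightarrow> Wd (br p) (br b) n x \<in> M)"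
    and "x \<in> M \<Longrightarrow> (even n \<longrightarrow> Wd (br p) (br b) n x \<in> M) \<and> (odd n \<longrightarrow> Wd (br p) (br b) n x \<in> Lp)"
    and "x \<in> D1 \<Longrightarrow> Wd (br p) (br b) n x \<in> D1"
proof -
  note m = brML[OF p] brMM[OF p] brM1[OF p] brML[OF b] brMM[OF b] brM1[OF b]
    D.subspace_0[OF subL] D.subspace_0[OF subM] D.subspace_0[OF sub1]
    D.subspace_add[OF subL] D.subspace_add[OF subM] D.subspace_add[OF sub1]
  show "x \<in> Lp \<Longrightarrow> (even n \<longrightarrow> Wd (br p) (br b) n x \<in> Lp) \<and> (odd n \<longrightarrow> Wd (br p) (br b) n x \<in> M)"
  proof (induction n)
    case (Suc n)
    then show ?case using m pow_mem(1)[OF p, of x n] by simp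
  qed (simp add: m)
  show "x \<in> M \<Longrightarrow> (even n \<longrightarrow> Wd (br p) (br b) n x \<in> M) \<and> (odd n \<longrightarrow> Wd (br p) (br b) n x \<in> Lp)"
  proof (induction n)
    case (Suc n)
    then show ?case using m pow_mem(2)[OF p, of x n] by simp
  qed (simp add: m)
  show "x \<in> D1 \<Longrightarrow> Wd (br p) (br b) n x \<in> D1"
  proof (induction n)
    case (Suc n)
    then show ?case using m pow_mem(3)[OF p, of x n] by simp
  qed (simp add: m)
qed

lemma op_even_L: "p \<in> M \<Longrightarrow> evenf f \<Longrightarrow> x \<in> Lp \<Longrightarrow> op f p x \<in> Lp"
  and op_even_M: "p \<in> M \<Longrightarrow> evenf f \<Longrightarrow> x \<in> M \<Longrightarrow> op f p x \<in> M"
  and op_odd_L: "p \<in> M \<Longrightarrow> oddf f \<Longrightarrow> x \<in> Lp \<Longrightarrow> op f p x \<in> M"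
  and op_odd_M: "p \<in> M \<Longrightarrow> oddf f \<Longrightarrow> x \<in> M \<Longrightarrow> op f p x \<in> Lp"
  and op_D1: "p \<in> M \<Longrightarrow> entire f \<Longrightarrow> x \<in> D1 \<Longrightarrow> op f p x \<in> D1"
  using pow_mem[of p x] unfolding evenf_def oddf_def
  by (metis op_mem subL, metis op_mem subM, metis op_mem subM, metis op_mem subL, metis op_mem sub1)

lemma dop_even_L: "p \<in> M \<Longrightarrow> b \<in> M \<Longrightarrow> evenf f \<Longrightarrow> x \<in> Lp \<Longrightarrow> dop f p b x \<in> Lp"
  and dop_even_M: "p \<in> M \<Longrightarrow> b \<in> M \<Longrightarrow> evenf f \<Longrightarrow> x \<in> M \<Longrightarrow> dop f p b x \<in> M"
  and dop_odd_L: "p \<in> M \<Longrightarrow> b \<in> M \<Longrightarrow> oddf f \<Longrightarrow> x \<in> Lp \<Longrightarrow> dop f p b x \<in> M"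
  and dop_odd_M: "p \<in> M \<Longrightarrow> b \<in> M \<Longrightarrow> oddf f \<Longrightarrow> x \<in> M \<Longrightarrow> dop f p b x \<in> Lp"
  and dop_D1: "p \<in> M \<Longrightarrow> b \<in> M \<Longrightarrow> entire f \<Longrightarrow> x \<in> D1 \<Longrightarrow> dop f p b x \<in> D1"
  using Wd_mem[of p b x] unfolding evenf_def oddf_def
  by (metis dop_mem subL, metis dop_mem subM, metis dop_mem subM, metis dop_mem subL, metis dop_mem sub1)

lemma fLM_sym: "x \<in> D1 \<Longrightarrow> y \<in> M \<Longrightarrow> frm x y = 0" "x \<in> D1 \<Longrightarrow> y \<in> Lp \<Longrightarrow> frm x y = 0"
  using fM1 fL1 frm_sym by metis+

lemma op_th: "op (th t) p v = op (ss t) p v + op (cc t) p v"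
  by (simp add: th_eq A.P.op_series_add)

lemma op_thm: "op (th (- t)) p v = op (cc t) p v - op (ss t) p v"
  by (simp add: th_minus op_series_diff[OF bl_br bl_br])

lemma dop_th: "dop (th t) p b v = dop (ss t) p b v + dop (cc t) p b v"
  by (simp add: th_eq op_dseries_add[OF bl_br bl_br])

lemma dop_thm: "dop (th (- t)) p b v = dop (cc t) p b v - dop (ss t) p b v"
  by (simp add: th_minus op_dseries_diff[OF bl_br bl_br])

lemma op_exp: "E 1 p v = op ch p v + br p (op (ss 1) p v)"
  unfolding exp_eq by (subst A.P.op_series_add) (simp_all add: entire_mult op_series_X_mult[OF bl_br bl_br])

lemma dop_exp: "dop (fps_exp 1) p b v = dop ch p b v + (br b (op (ss 1) p v) + br p (dop (ss 1) p b v))"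
  unfolding exp_eq by (subst op_dseries_add[OF bl_br bl_br])
    (simp_all add: entire_mult op_dseries_X_mult[OF bl_br bl_br])

lemma op_ss: "op (ss 1) p v = v + br p (op (rr 1) p v)"
proof -
  have "ss 1 = 1 + fps_X * rr 1" using X_mult_rr by simp
  then show ?thesis
    using A.P.op_series_add[of 1 "fps_X * rr 1"] entire_bound[of 1 1 1]
    by (simp add: entire_mult op_series_X_mult[OF bl_br bl_br] op_one)
qed

lemma dop_ss: "dop (ss 1) p b v = br b (op (rr 1) p v) + br p (dop (rr 1) p b v)"
proof -
  have "ss 1 = 1 + fps_X * rr 1" using X_mult_rr by simp
  then show ?thesis
    using op_dseries_add[OF bl_br bl_br, of 1 "fps_X * rr 1"] entire_bound[of 1 1 1]
    by (simp add: entire_mult op_dseries_X_mult[OF bl_br bl_br] dop_one)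
qed

context
  fixes p assumes p: "p \<in> M"
begin

text \<open>The two-form \<open>(a, c) \<mapsto> (a, rr(ad p) c)\<close> is a primitive of the pull-back of the invariant
  three-form under the exponential map.\<close>

lemma rr_cyclic:
  assumes abc: "a \<in> M" "b \<in> M" "c \<in> M"
  shows "2 * (frm b (dop (rr t) p a c) + frm c (dop (rr t) p b a) + frm a (dop (rr t) p c b))
     = - frm (op (th t) p a) (br (op (th t) p b) (op (th t) p c))"
proof -
  let ?T = "\<lambda>t. op (th t) p" and ?E = "\<lambda>t. E t p"
  let ?K = "\<lambda>t. frm b (dop (rr t) p a c) + frm c (dop (rr t) p b a) + frm a (dop (rr t) p c b)"
  let ?K' = "\<lambda>t. frm b (dop (cc t) p a c) + frm c (dop (cc t) p b a) + frm a (dop (cc t) p c b)"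
  let ?w = "\<lambda>t. frm (?T t a) (br (?T t b) (?T t c))"
  have rd: "((\<lambda>t. frm x (dop (rr t) p y z)) has_vector_derivative frm x (dop (cc t) p y z)) (at t)" for x y z t
    by (rule bounded_linear.has_vector_derivative[OF bounded_bilinear.bounded_linear_right[OF bb_frm] drrd])
  have Kd: "(?K has_vector_derivative ?K' t) (at t)" for t
    by (intro has_vector_derivative_add rd)
  have wd: "(?w has_vector_derivative (frm (?T t a) (br (?T t b) (?E t c) + br (?E t b) (?T t c))
      + frm (?E t a) (br (?T t b) (?T t c)))) (at t)" for t
    by (intro bounded_bilinear.has_vector_derivative[OF bb_frm] bounded_bilinear.has_vector_derivative[OF bb_br] thd)
  \<comment> \<open>Conjugation by \<open>E (- t)\<close> turns \<open>th t\<close> into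
    \<open>- th (- t)\<close>, to which \<open>flat\<close> applies. The contribution of
    \<open>ss t\<close> lies in \<open>M\<close> and is therefore orthogonal to \<open>x\<close>,
    which leaves \<open>cc t\<close>, the time derivative of \<open>rr t\<close>.\<close>
  have key: "frm (?E t x) (br (?T t y) (?T t z)) = frm x (dop (cc t) p y z) - frm x (dop (cc t) p z y)"
    if x: "x \<in> M" "y \<in> M" "z \<in> M" for x y z t
  proof -
    have "frm (?E t x) (br (?T t y) (?T t z)) = frm (?E (- t) (?E t x)) (?E (- t) (br (?T t y) (?T t z)))"
      by (simp only: E_form)
    also have "\<dots> = frm x (br (op (th (- t)) p y) (op (th (- t)) p z))"
      by (simp only: E_inv E_br E_th br_minus minus_minus)
    also have "\<dots> = frm x (dop (th (- t)) p y z - dop (th (- t)) p z y)"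
      unfolding flat ..
    also have "\<dots> = frm x (dop (cc t) p y z) - frm x (dop (cc t) p z y)
        - (frm x (dop (ss t) p y z) - frm x (dop (ss t) p z y))"
      by (simp add: dop_thm frm_diff)
    also have "frm x (dop (ss t) p y z) - frm x (dop (ss t) p z y) = 0"
      using x p by (simp add: fMM dop_even_M)
    finally show ?thesis by simp
  qed
  have sk: "frm x (dop (cc t) p y z) = - frm z (dop (cc t) p y x)" for x y z t
    using odd_dadjoint[of "cc t" p y x z] by (simp add: frm_sym[of z])
  let ?u = "\<lambda>t. ?K t + ?K t + ?w t"
  have "(?u has_vector_derivative 0) (at t)" for t
  proof -
    have "(?u has_vector_derivative ?K' t + ?K' t + (frm (?T t a) (br (?T t b) (?E t c) + br (?E t b) (?T t c))
      + frm (?E t a) (br (?T t b) (?T t c)))) (at t)"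
      by (intro has_vector_derivative_add[OF has_vector_derivative_add[OF Kd Kd] wd])
    moreover have "frm (?T t a) (br (?T t b) (?E t c)) = frm c (dop (cc t) p a b) - frm c (dop (cc t) p b a)"
      using key[of c a b t] abc frm_cyc[of "?E t c" "?T t a" "?T t b"] by simp
    moreover have "frm (?T t a) (br (?E t b) (?T t c)) = frm b (dop (cc t) p c a) - frm b (dop (cc t) p a c)"
      using key[of b c a t] abc frm_cyc[of "?T t a" "?E t b" "?T t c"] by simp
    moreover have "frm (?E t a) (br (?T t b) (?T t c)) = frm a (dop (cc t) p b c) - frm a (dop (cc t) p c b)"
      using key[of a b c t] abc by simp
    ultimately show ?thesis
      using sk[of c t a b] sk[of b t c a] sk[of a t b c]
      by (simp add: frm_add algebra_simps)
  qed
  moreover have "?u 0 = 0" by (simp add: dop_0 op_0 frm_zero)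
  ultimately have "?u t = 0" using const_zero_deriv[of ?u t] by blast
  then show ?thesis by (simp add: eq_neg_iff_add_eq_0 algebra_simps)
qed

text \<open>\<open>ss t\<close> keeps \<open>M\<close> and \<open>cc t\<close> maps it to
  \<open>Lp\<close>, and both subspaces are isotropic. The mixed terms cancel because the even part
  is self-adjoint, the odd part is skew, and the two commute.\<close>

lemma th_isotropic:
  assumes "a \<in> M" "c \<in> M" shows "frm (op (th t) p a) (op (th t) p c) = 0"
proof -
  let ?S = "op (ss t) p" and ?C = "op (cc t) p"
  have "frm (?S a) (?S c) = 0" "frm (?C a) (?C c) = 0"
    using assms p by (simp_all add: fMM fLL op_even_M op_odd_M)
  moreover have "frm (?S a) (?C c) = frm a (?S (?C c))" by (rule even_adjoint) simp
  moreover have "frm (?C a) (?S c) = - frm a (?C (?S c))" by (rule odd_adjoint) simp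
  moreover have "?S (?C c) = ?C (?S c)"
    using A.P.op_series_mult[of "ss t" "cc t" p c] A.P.op_series_mult[of "cc t" "ss t" p c] by (simp add: mult.commute)
  ultimately show ?thesis by (simp add: op_th frm_add)
qed

end

text \<open>A torsion-type argument, as for the Levi-Civita connection.\<close>

lemma th_dth:
  assumes p: "p \<in> M" and abc: "a \<in> M" "b \<in> M" "c \<in> M"
  shows "2 * frm (op (th t) p a) (dop (th t) p b c) = frm (op (th t) p a) (br (op (th t) p b) (op (th t) p c))"
proof -
  let ?T = "op (th t) p"
  define q where "q a b c = frm (?T a) (dop (th t) p b c)" for a b c
  define w where "w a b c = frm (?T a) (br (?T b) (?T c))" for a b c
  \<comment> \<open>\<open>th_isotropic\<close> holds at every base point in \<open>M\<close>, so it
    can be differentiated along \<open>p + h b\<close>.\<close>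
  have q13: "q a b c = - q c b a" if x: "a \<in> M" "b \<in> M" "c \<in> M" for a b c
  proof -
    have "frm (op (th t) (p + h *\<^sub>R b) a) (op (th t) (p + h *\<^sub>R b) c) = frm 0 0" for h :: real
      using th_isotropic[OF _ x(1,3), of "p + h *\<^sub>R b" t] p x scaleR_mem[OF subM, of h b] D.subspace_add[OF subM]
      by (simp add: frm_zero)
    from frm_curve_unique[OF op_curve[of "th t" p b a] op_curve[of "th t" p b c] has_vector_derivative_const
        has_vector_derivative_const this]
    show ?thesis by (simp add: q_def frm_zero frm_sym[of "dop _ _ _ _"] eq_neg_iff_add_eq_0)
  qed
  have q23: "q a b c - q a c b = w a b c" for a b c
    unfolding q_def w_def flat[symmetric] by (simp add: frm_diff)
  have w1: "w a b c = - w b a c" "w a b c = w b c a" for a b c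
    unfolding w_def by (rule frm_br_skew, rule frm_cyc)
  \<comment> \<open>Skewness in the outer arguments and the prescribed difference in the last two
    determine \<open>q\<close>, as in Koszul's formula; as \<open>w\<close> is totally skew, the
    solution is half of it.\<close>
  have "q a b c + q a b c = w a b c"
    using q13[of a b c] q13[of b c a] q13[of c a b] q13[of a c b] q13[of c b a] q13[of b a c] abc
      q23[of a b c] q23[of b c a] q23[of c a b] w1(1)[of a b c] w1(2)[of a b c] w1(2)[of b c a]
    by algebra
  then show ?thesis by (simp add: q_def w_def)
qed

section \<open>The component in the subalgebra, split by degree in the base directions\<close>

context
  fixes p b assumes p: "p \<in> M" and b: "b \<in> M"
begin

abbreviation "S1 \<equiv> op (ss 1) p"
abbreviation "R1 \<equiv> op (rr 1) p"
abbreviation "T1 \<equiv> op (th 1) p"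
abbreviation "E1 \<equiv> E 1 p"

text \<open>\<open>dE\<close> writes the variation as a bracket, and the isometry
  \<open>E (- 1)\<close> removes the exponentials. This leaves \<open>th (- 1)\<close> at
  \<open>b\<close>, of which only the even part pairs with \<open>z\<close>, and nothing pairs with
  \<open>x\<close>.\<close>

lemma part_yy:
  assumes "br y y' = z + x" "z \<in> Lp" "x \<in> D1"
  shows "frm (E1 y) (dop (fps_exp 1) p b y') = - frm b (S1 z)"
proof -
  have "frm (E1 y) (dop (fps_exp 1) p b y') = frm (E1 y) (br (T1 b) (E1 y'))" by (simp only: dE)
  also have "\<dots> = - frm (T1 b) (br (E1 y) (E1 y'))" by (rule frm_br_skew)
  also have "\<dots> = - frm (E (- 1) p (T1 b)) (E (- 1) p (E1 (br y y')))"
    by (simp only: E_form) (simp only: E_br)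
  also have "\<dots> = frm (op (cc 1) p b - S1 b) (z + x)"
    by (simp only: E_inv E_th op_thm assms frm_minus minus_minus)
  also have "\<dots> = frm (op (cc 1) p b) z - frm (S1 b) z + (frm (op (cc 1) p b) x - frm (S1 b) x)"
    by (simp add: frm_add frm_diff)
  also have "frm (op (cc 1) p b) z = 0" using assms p b by (simp add: fLL op_odd_M)
  also have "frm (op (cc 1) p b) x = 0" using assms p b by (simp add: fL1 op_odd_M)
  also have "frm (S1 b) x = 0" using assms p b by (simp add: fM1 op_even_M)
  also have "frm (S1 b) z = frm b (S1 z)" by (rule even_adjoint) simp
  finally show ?thesis by simp
qed

text \<open>With e^A = cosh A + A S and S = sinh A / A, all pairings inside \<open>Lp\<close>
  vanish; the rest cancels by moving \<open>br p\<close> and \<open>br b\<close> across the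
  form.\<close>

lemma part_zz:
  assumes z: "z \<in> Lp" "z' \<in> Lp" "x \<in> D1" "x' \<in> D1"
  shows "- frm b (br (S1 z) (S1 z')) - frm (S1 z) (dop (fps_exp 1) p b (z' + x'))
    - frm (E1 (z + x)) (dop (ss 1) p b z') + frm (S1 z) (dop (ss 1) p b z') = 0"
proof -
  note m = op_even_L[OF p] op_D1[OF p] dop_even_L[OF p b] dop_D1[OF p b]
  have 1: "dop (fps_exp 1) p b (z' + x') = dop (fps_exp 1) p b z' + dop (fps_exp 1) p b x'"
    by (simp add: dE op_add br_add)
  have 2: "frm (S1 z) (dop (fps_exp 1) p b x') = 0" using m z by (simp add: fL1)
  have 3: "frm (S1 z) (dop (fps_exp 1) p b z') = frm (S1 z) (br b (S1 z')) + frm (S1 z) (br p (dop (ss 1) p b z'))"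
    unfolding dop_exp frm_add using m z by (simp add: fLL)
  have 4: "frm (E1 (z + x)) (dop (ss 1) p b z') = frm (br p (S1 z)) (dop (ss 1) p b z')"
    unfolding op_add[OF entire_simps(1)] frm_add op_exp[of p z] using m z by (simp add: fLL fLM_sym)
  have 5: "frm (S1 z) (dop (ss 1) p b z') = 0" using m z by (simp add: fLL)
  have 6: "frm (br p (S1 z)) (dop (ss 1) p b z') = - frm (S1 z) (br p (dop (ss 1) p b z'))"
    by (metis br_skew frm_inv frm_minus(1))
  have 7: "frm (S1 z) (br b (S1 z')) = - frm b (br (S1 z) (S1 z'))" by (rule frm_br_skew)
  show ?thesis using 2 3 4 5 6 7 by (simp add: 1 frm_add)
qed

text \<open>\<open>dE\<close> and the isometry \<open>E (- 1)\<close> reduce the pairing to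
  \<open>flat\<close> at scale \<open>- 1\<close>; only the variations of \<open>ss 1\<close> pair
  with \<open>z\<close>.\<close>

lemma th_dexp:
  assumes a: "a \<in> M" and z: "z \<in> Lp" "x \<in> D1"
  shows "frm (T1 a) (dop (fps_exp 1) p b (z + x)) = frm a (dop (ss 1) p b z) - frm b (dop (ss 1) p a z)"
proof -
  have "frm (T1 a) (dop (fps_exp 1) p b (z + x)) = frm (T1 a) (br (T1 b) (E1 (z + x)))" by (simp only: dE)
  also have "\<dots> = frm (E1 (z + x)) (br (T1 a) (T1 b))" by (rule frm_cyc[symmetric])
  also have "\<dots> = frm (E (- 1) p (E1 (z + x))) (E (- 1) p (br (T1 a) (T1 b)))" by (simp only: E_form)
  also have "\<dots> = frm (z + x) (br (op (th (- 1)) p a) (op (th (- 1)) p b))"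
    by (simp only: E_inv E_br E_th br_minus minus_minus)
  also have "\<dots> = frm (z + x) (dop (th (- 1)) p a b - dop (th (- 1)) p b a)" unfolding flat ..
  also have "\<dots> = frm z (dop (ss 1) p b a) - frm z (dop (ss 1) p a b)"
    unfolding dop_thm frm_add frm_diff
    using dop_odd_M[OF p a, of "cc 1" b] dop_odd_M[OF p b, of "cc 1" a]
      dop_even_M[OF p a, of "ss 1" b] dop_even_M[OF p b, of "ss 1" a] a b z
    by (simp add: fLL fLM_sym)
  also have "\<dots> = frm (dop (ss 1) p b z) a - frm (dop (ss 1) p a z) b"
    by (simp add: even_dadjoint)
  finally show ?thesis by (simp add: frm_sym)
qed

lemma S_R: "frm (br p (R1 a)) x = frm (S1 a) x - frm a x"
  unfolding op_ss[of p a] by (simp add: frm_add)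

lemma ad_skew: "frm x (br p y) = - frm (br p x) y"
  by (metis br_skew frm_inv frm_minus(1))

text \<open>The derivative of A S contributes a term with \<open>br p\<close>; moved to the other
  argument it meets \<open>R1 a\<close>, where A R = S - 1 turns it into terms of the remaining
  summands.\<close>

lemma part_az:
  assumes a: "a \<in> M" and z: "z \<in> Lp" "x \<in> D1"
  shows "- frm b (dop (ss 1) p a z) + frm b (br (R1 a) (S1 z)) - frm (T1 a) (dop (fps_exp 1) p b (z + x))
    + frm (T1 a) (dop (ss 1) p b z) + frm (R1 a) (dop (fps_exp 1) p b (z + x)) - frm (R1 a) (dop (ss 1) p b z) = 0"
proof -
  have m: "R1 a \<in> Lp" "op (cc 1) p a \<in> Lp" "dop (ss 1) p b z \<in> Lp" "dop ch p b z \<in> Lp"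
    "dop (fps_exp 1) p b x \<in> D1"
    using a z p b by (simp_all add: op_odd_M dop_even_L dop_D1)
  have 1: "dop (fps_exp 1) p b (z + x) = dop (fps_exp 1) p b z + dop (fps_exp 1) p b x"
    by (simp add: dE op_add br_add)
  have 2: "frm (R1 a) (dop (fps_exp 1) p b (z + x)) = frm (R1 a) (br b (S1 z)) + frm (R1 a) (br p (dop (ss 1) p b z))"
    unfolding 1 dop_exp[of p b z] frm_add using m by (simp add: fLL fL1)
  have 3: "frm (R1 a) (br p (dop (ss 1) p b z)) = - (frm (S1 a) (dop (ss 1) p b z) - frm a (dop (ss 1) p b z))"
    unfolding ad_skew S_R ..
  have 4: "frm (R1 a) (br b (S1 z)) = - frm b (br (R1 a) (S1 z))" by (rule frm_br_skew)
  have 5: "frm (T1 a) (dop (ss 1) p b z) = frm (S1 a) (dop (ss 1) p b z)"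
    unfolding op_th frm_add using m by (simp add: fLL)
  have 6: "frm (R1 a) (dop (ss 1) p b z) = 0" using m by (simp add: fLL)
  show ?thesis unfolding th_dexp[OF a z] 2 3 4 5 6 by simp
qed

lemma part_za:
  assumes a: "a \<in> M" and z: "z \<in> Lp" "x \<in> D1"
  shows "frm b (dop (ss 1) p a z) + frm b (br (S1 z) (R1 a)) - frm (E1 (z + x)) (dop (th 1) p b a)
    + frm (E1 (z + x)) (dop (rr 1) p b a) + frm (S1 z) (dop (th 1) p b a) - frm (S1 z) (dop (rr 1) p b a) = 0"
proof -
  have m: "S1 z \<in> Lp" "op ch p z \<in> Lp" "E1 x \<in> D1" "dop (rr 1) p b a \<in> Lp" "dop (cc 1) p b a \<in> Lp"
    using a z p b by (simp_all add: op_even_L dop_odd_M op_D1)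
  \<comment> \<open>The pairing of the exponential with \<open>th 1\<close> has a simple value at
    every base point. Differentiating it along \<open>p + h b\<close> trades the variation of
    \<open>th 1\<close> for that of the exponential, which \<open>th_dexp\<close> evaluates.\<close>
  have dE_th: "frm (E1 (z + x)) (dop (th 1) p b a) = frm b (dop (ss 1) p a z)"
  proof -
    have "frm (E 1 q (z + x)) (op (th 1) q a) = frm z (op (ss 1) q a)" if q: "q \<in> M" for q
    proof -
      have "frm (E 1 q (z + x)) (op (th 1) q a) = frm (E (- 1) q (E 1 q (z + x))) (E (- 1) q (op (th 1) q a))"
        by (simp only: E_form)
      also have "\<dots> = - frm (z + x) (op (cc 1) q a - op (ss 1) q a)"
        by (simp only: E_inv E_th op_thm frm_minus)
      also have "\<dots> = frm z (op (ss 1) q a)"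
        using op_odd_M[OF q, of "cc 1" a] op_even_M[OF q, of "ss 1" a] a z
        by (simp add: frm_add frm_diff fLL fLM_sym)
      finally show ?thesis .
    qed
    then have "frm (E 1 (p + h *\<^sub>R b) (z + x)) (op (th 1) (p + h *\<^sub>R b) a) = frm z (op (ss 1) (p + h *\<^sub>R b) a)" for h :: real
      using p scaleR_mem[OF subM, of h b] b D.subspace_add[OF subM] by blast
    from frm_curve_unique[OF op_curve[of "fps_exp 1" p b "z + x"] op_curve[of "th 1" p b a]
        has_vector_derivative_const op_curve[of "ss 1" p b a] this]
    have "frm (E1 (z + x)) (dop (th 1) p b a) + frm (dop (fps_exp 1) p b (z + x)) (T1 a) = frm z (dop (ss 1) p b a)"
      by (simp add: frm_zero)
    moreover have "frm z (dop (ss 1) p b a) = frm a (dop (ss 1) p b z)"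
      using even_dadjoint[of "ss 1" p b z a] by (simp add: frm_sym)
    ultimately show ?thesis using th_dexp[OF a z] by (simp add: frm_sym[of _ "T1 a"])
  qed
  have 1: "frm (E1 (z + x)) (dop (rr 1) p b a) = frm (br p (S1 z)) (dop (rr 1) p b a)"
    unfolding op_add[OF entire_simps(1)] frm_add op_exp[of p z] using m by (simp add: fLL fLM_sym)
  have 2: "frm (S1 z) (dop (th 1) p b a) = frm (S1 z) (br b (R1 a)) + frm (S1 z) (br p (dop (rr 1) p b a))"
    unfolding dop_th dop_ss frm_add using m by (simp add: fLL)
  have 3: "frm (S1 z) (br p (dop (rr 1) p b a)) = - frm (br p (S1 z)) (dop (rr 1) p b a)" by (rule ad_skew)
  have 4: "frm (S1 z) (br b (R1 a)) = - frm b (br (S1 z) (R1 a))" by (rule frm_br_skew)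
  have 5: "frm (S1 z) (dop (rr 1) p b a) = 0" using m by (simp add: fLL)
  show ?thesis unfolding dE_th 1 2 3 4 5 by simp
qed

text \<open>The reductions by parity and A R = S - 1 leave the cyclic sum of the variations of
  \<open>rr 1\<close> and one pairing with the variation of \<open>th 1\<close>. Only this degree
  needs the primitive of the three-form.\<close>

lemma part_aa:
  assumes a: "a \<in> M" "c \<in> M"
  shows "frm b (dop (rr 1) p a c) - frm b (dop (rr 1) p c a) - frm b (br (R1 a) (R1 c))
    + frm (T1 a) (dop (th 1) p b c) - frm (T1 a) (dop (rr 1) p b c)
    - frm (R1 a) (dop (th 1) p b c) + frm (R1 a) (dop (rr 1) p b c) = 0"
proof -
  have m: "R1 a \<in> Lp" "op (cc 1) p a \<in> Lp" "dop (rr 1) p b c \<in> Lp" "dop (cc 1) p b c \<in> Lp"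
    using a p b by (simp_all add: op_odd_M dop_odd_M)
  have 1: "frm (T1 a) (dop (rr 1) p b c) = frm (S1 a) (dop (rr 1) p b c)"
    unfolding op_th frm_add using m by (simp add: fLL)
  have 2: "frm (R1 a) (dop (th 1) p b c) = frm (R1 a) (br b (R1 c)) + frm (R1 a) (br p (dop (rr 1) p b c))"
    unfolding dop_th dop_ss frm_add using m by (simp add: fLL)
  have 3: "frm (R1 a) (br p (dop (rr 1) p b c)) = - (frm (S1 a) (dop (rr 1) p b c) - frm a (dop (rr 1) p b c))"
    unfolding ad_skew S_R ..
  have 4: "frm (R1 a) (br b (R1 c)) = - frm b (br (R1 a) (R1 c))" by (rule frm_br_skew)
  have 5: "frm (R1 a) (dop (rr 1) p b c) = 0" using m by (simp add: fLL)
  have sk: "frm x (dop (rr 1) p y z) = - frm z (dop (rr 1) p y x)" for x y z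
    using odd_dadjoint[of "rr 1" p y x z] by (simp add: frm_sym[of z])
  \<comment> \<open>\<open>rr_cyclic\<close> and \<open>th_dth\<close> both evaluate the three-form
    on \<open>T1\<close>; eliminating it relates the two.\<close>
  have cyc: "2 * (frm b (dop (rr 1) p a c) + frm c (dop (rr 1) p b a) + frm a (dop (rr 1) p c b))
     = - (2 * frm (T1 a) (dop (th 1) p b c))"
    unfolding rr_cyclic[OF p a(1) b a(2)] th_dth[OF p a(1) b a(2)] ..
  then have "frm b (dop (rr 1) p a c) + frm c (dop (rr 1) p b a) + frm a (dop (rr 1) p c b)
     = - frm (T1 a) (dop (th 1) p b c)"
    by (metis mult_minus_right mult_left_cancel zero_neq_numeral)
  then show ?thesis unfolding 1 2 3 4 5 using sk[of c b a] sk[of a c b] by (simp add: algebra_simps eq_neg_iff_add_eq_0)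
qed

end

text \<open>\<open>Tw\<close> and \<open>TX\<close> are the elements w and X attached to \<alpha>
  and y, both taken in the double; \<open>dTw\<close> and \<open>dTX\<close> are their derivatives
  in the base point in the direction \<open>b\<close>.\<close>

definition Tw :: "'d \<Rightarrow> 'd \<Rightarrow> 'd \<Rightarrow> 'd" where "Tw p a z = op (rr 1) p a - op (ss 1) p z"
definition TX :: "'d \<Rightarrow> 'd \<Rightarrow> 'd \<Rightarrow> 'd" where "TX p a y = E 1 p y - op (th 1) p a"
definition dTw :: "'d \<Rightarrow> 'd \<Rightarrow> 'd \<Rightarrow> 'd \<Rightarrow> 'd" where "dTw p b a z = dop (rr 1) p b a - dop (ss 1) p b z"
definition dTX :: "'d \<Rightarrow> 'd \<Rightarrow> 'd \<Rightarrow> 'd \<Rightarrow> 'd" where "dTX p b a y = dop (fps_exp 1) p b y - dop (th 1) p b a"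

text \<open>By bilinearity the left side falls apart into \<open>part_yy\<close> and
  \<open>part_zz\<close>, free of \<open>a\<close> and \<open>a'\<close>, then
  \<open>part_az\<close> and \<open>part_za\<close>, linear in one of them, and
  \<open>part_aa\<close>.\<close>

lemma l_component:
  assumes p: "p \<in> M" and b: "b \<in> M" and a: "a \<in> M" "a' \<in> M"
    and z: "z \<in> Lp" "z' \<in> Lp" "z'' \<in> Lp" and x: "x \<in> D1" "x' \<in> D1" "x'' \<in> D1"
    and br: "br (z + x) (z' + x') = z'' + x''"
  shows "frm b (dTw p a a' z') - frm b (dTw p a' a z) - frm b (br (Tw p a z) (Tw p a' z'))
    + frm (TX p a (z + x) + Tw p a z) (dTX p b a' (z' + x') + dTw p b a' z') = - frm b (op (ss 1) p z'')"
proof -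
  note p1 = part_yy[OF p b br z(3) x(3)]
  note p2 = part_zz[OF p b z(1,2) x(1,2)]
  note p3 = part_az[OF p b a(1) z(2) x(2)]
  note p4 = part_za[OF p b a(2) z(1) x(1)]
  note p5 = part_aa[OF p b a]
  show ?thesis
    unfolding Tw_def TX_def dTw_def dTX_def br_diff frm_add frm_diff
    using p1 p2 p3 p4 p5 by algebra
qed

lemma gauge_component:
  "dTX p a a' y' - dTX p a' a y + br (TX p a y) (TX p a' y') = E 1 p (br y y')"
proof -
  have "dop (th 1) p a a' = dop (th 1) p a' a + br (op (th 1) p a) (op (th 1) p a')"
    unfolding flat[symmetric] by simp
  then show ?thesis
    unfolding dTX_def TX_def br_diff dE E_br using br_skew[of "E 1 p y" "op (th 1) p a'"] by simp
qed

end

section \<open>The canonical double\<close>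

locale canon =
  fixes G :: "('k::real_or_complex, 'g::banach, 'gs::banach) qbialg"
    and L :: "('k, 'g, 'ls::banach) dual_pair"
    and m :: "'g set"
  assumes carG: "car G = UNIV"
    and lqb: "lie_quasi_bialgebra G"
    and dpL: "is_dual_pair L" and scL: "scv L = scv G"
    and red: "reductive_decomposition G (car L) m"
    and comp: "canonically_compatible G (car L) m"
begin

sublocale G: duality G using lqb by unfold_locales (simp add: lie_quasi_bialgebra_def)
sublocale L: duality L using dpL by unfold_locales

lemmas vecG = G.pair_vec_of(2) and covecG = G.pair_covec_of[unfolded carG, OF _ UNIV_I]

lemmas pairG = G.pair_add_right[unfolded carG, OF UNIV_I UNIV_I] G.pair_add_left[unfolded carG, OF UNIV_I]
  G.pair_diff_right[unfolded carG, OF UNIV_I UNIV_I] G.pair_diff_left[unfolded carG, OF UNIV_I]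
  G.pair_minus_right[unfolded carG, OF UNIV_I] G.pair_minus_left[unfolded carG, OF UNIV_I]
  G.pair_zero_right G.pair_zero_left[unfolded carG, OF UNIV_I]
  G.pair_scale_right[unfolded carG, OF UNIV_I] G.pair_scale_left[unfolded carG, OF UNIV_I]

lemma covecG_eqI: "(\<And>x. pair G \<xi> x = pair G \<eta> x) \<Longrightarrow> \<xi> = \<eta>"
  by (rule G.covec_eqI) simp

lemma vecG_eqI: "(\<And>\<xi>. pair G \<xi> x = pair G \<xi> y) \<Longrightarrow> x = y"
  by (rule G.vec_eqI) (simp_all add: carG)

lemma brk_lin: "klinear_on (scv G) (scv G) UNIV (brk G x)" "klinear_on (scv G) (scv G) UNIV (\<lambda>x. brk G x y)"
  and brk_self: "brk G x x = 0"
proof -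
  have "lie_algebra (scv G) (car G) (brk G)" using lqb unfolding lie_quasi_bialgebra_def by blast
  then show "klinear_on (scv G) (scv G) UNIV (brk G x)" "klinear_on (scv G) (scv G) UNIV (\<lambda>x. brk G x y)"
    "brk G x x = 0"
    unfolding lie_algebra_def carG by blast+
qed

lemma brk_add: "brk G x (y + z) = brk G x y + brk G x z" "brk G (x + y) z = brk G x z + brk G y z"
  and brk_scale: "brk G x (scv G c y) = scv G c (brk G x y)" "brk G (scv G c x) y = scv G c (brk G x y)"
  using brk_lin[of x] brk_lin(2)[of z] brk_lin(2)[of y] by (simp_all add: klinear_on_def)

lemma brk_zero: "brk G x 0 = 0" "brk G 0 x = 0"
  using brk_add(1)[of x 0 0] brk_add(2)[of 0 0 x] by simp_all

lemma brk_skew: "brk G x y = - brk G y x"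
proof -
  have "brk G (x + y) (x + y) = brk G x y + brk G y x" unfolding brk_add by (simp add: brk_self)
  then show ?thesis using brk_self[of "x + y"] by (simp add: eq_neg_iff_add_eq_0)
qed

lemma varpi_lin: "klinear_on (scs G) (scv G) UNIV (varpi G x)" "klinear_on (scv G) (scv G) UNIV (\<lambda>x. varpi G x \<xi>)"
  and varpi_skew: "pair G \<xi> (varpi G x \<eta>) = - pair G \<eta> (varpi G x \<xi>)"
proof -
  note l = lqb[unfolded lie_quasi_bialgebra_def carG]
  have "varpi G x \<in> skew_maps G" using l by blast
  then show "klinear_on (scs G) (scv G) UNIV (varpi G x)" "pair G \<xi> (varpi G x \<eta>) = - pair G \<eta> (varpi G x \<xi>)"
    unfolding skew_maps_def by blast+
  show "klinear_on (scv G) (scv G) UNIV (\<lambda>x. varpi G x \<xi>)" using l by blast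
qed

lemma varpi_add: "varpi G x (\<xi> + \<eta>) = varpi G x \<xi> + varpi G x \<eta>" "varpi G (x + y) \<xi> = varpi G x \<xi> + varpi G y \<xi>"
  using varpi_lin(1)[of x] varpi_lin(2)[of \<xi>] by (simp_all add: klinear_on_def)

lemma varpi_zero: "varpi G x 0 = 0" "varpi G 0 \<xi> = 0"
  using varpi_add(1)[of x 0 0] varpi_add(2)[of 0 0 \<xi>] by simp_all

lemma phi_lin: "klinear_on (scs G) (*) UNIV (phi G \<xi> \<eta>)" "klinear_on (scs G) (*) UNIV (\<lambda>\<eta>. phi G \<xi> \<eta> \<zeta>)"
  "klinear_on (scs G) (*) UNIV (\<lambda>\<xi>. phi G \<xi> \<eta> \<zeta>)"
  and phi_alt: "phi G \<xi> \<xi> \<eta> = 0" "phi G \<xi> \<eta> \<eta> = 0"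
proof -
  have "phi G \<in> alternating3 G" using lqb unfolding lie_quasi_bialgebra_def by blast
  then show "klinear_on (scs G) (*) UNIV (phi G \<xi> \<eta>)" "klinear_on (scs G) (*) UNIV (\<lambda>\<eta>. phi G \<xi> \<eta> \<zeta>)"
    "klinear_on (scs G) (*) UNIV (\<lambda>\<xi>. phi G \<xi> \<eta> \<zeta>)" "phi G \<xi> \<xi> \<eta> = 0" "phi G \<xi> \<eta> \<eta> = 0"
    unfolding alternating3_def by blast+
qed

lemma phi_add: "phi G (\<xi> + \<xi>') \<eta> \<zeta> = phi G \<xi> \<eta> \<zeta> + phi G \<xi>' \<eta> \<zeta>"
  "phi G \<xi> (\<eta> + \<eta>') \<zeta> = phi G \<xi> \<eta> \<zeta> + phi G \<xi> \<eta>' \<zeta>"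
  "phi G \<xi> \<eta> (\<zeta> + \<zeta>') = phi G \<xi> \<eta> \<zeta> + phi G \<xi> \<eta> \<zeta>'"
  using phi_lin(3)[of \<eta> \<zeta>] phi_lin(2)[of \<xi> \<zeta>] phi_lin(1)[of \<xi> \<eta>] by (simp_all add: klinear_on_def)

lemma phi_swap: "phi G \<xi> \<eta> \<zeta> = - phi G \<eta> \<xi> \<zeta>" "phi G \<xi> \<eta> \<zeta> = - phi G \<xi> \<zeta> \<eta>"
proof -
  have "phi G (\<xi> + \<eta>) (\<xi> + \<eta>) \<zeta> = 0" by (rule phi_alt)
  then show "phi G \<xi> \<eta> \<zeta> = - phi G \<eta> \<xi> \<zeta>" unfolding phi_add by (simp add: phi_alt eq_neg_iff_add_eq_0 add.commute)
  have "phi G \<xi> (\<eta> + \<zeta>) (\<eta> + \<zeta>) = 0" by (rule phi_alt)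
  then show "phi G \<xi> \<eta> \<zeta> = - phi G \<xi> \<zeta> \<eta>" unfolding phi_add by (simp add: phi_alt eq_neg_iff_add_eq_0 add.commute)
qed

lemma phi_zero: "phi G 0 \<eta> \<zeta> = 0" "phi G \<xi> 0 \<zeta> = 0" "phi G \<xi> \<eta> 0 = 0"
  using klinear_ground_0[OF phi_lin(1)] klinear_ground_0[OF phi_lin(2)] klinear_ground_0[OF phi_lin(3)]
  by simp_all

lemma pair_ad_star: "pair G (ad_star G x \<eta>) y = pair G \<eta> (brk G x y)"
  unfolding ad_star_def transp_def
  by (rule covecG) (simp add: klinear_on_def brk_add brk_scale pairG)

lemma pair_covarpi: "pair G (covec_of G (\<lambda>x. pair G \<eta> (varpi G x \<xi>))) x = pair G \<eta> (varpi G x \<xi>)"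
  by (rule covecG) (use varpi_lin(2)[of \<xi>] in \<open>simp add: klinear_on_def pairG\<close>)

lemma covec_zero: "covec_of G (\<lambda>x. 0) = 0"
  by (rule G.covec_of_unique) (simp add: pairG)

lemma pair_vec_phi: "pair G \<zeta> (vec_of G (\<lambda>\<zeta>. phi G \<xi> \<eta> \<zeta>)) = phi G \<xi> \<eta> \<zeta>"
  by (rule vecG) (rule phi_lin)

definition frm :: "'g \<times> 'gs \<Rightarrow> 'g \<times> 'gs \<Rightarrow> 'k" where
  "frm v w = pair G (snd v) (fst w) + pair G (snd w) (fst v)"

abbreviation br :: "'g \<times> 'gs \<Rightarrow> 'g \<times> 'gs \<Rightarrow> 'g \<times> 'gs" where "br \<equiv> double_brk G"

lemma quad: "quad_lie (double_scale G) br frm"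
proof
  show "fd_vector_space (double_scale G)"
    unfolding double_scale_def by (rule fd_prod[OF G.V.fd G.S.fd])
  show "lie_algebra (double_scale G) UNIV br"
    using lqb carG by (simp add: lie_quasi_bialgebra_def double_car_def)
  show "klinear_on (double_scale G) (*) UNIV (frm x)" for x
    by (simp add: klinear_on_def frm_def double_scale_def prod_scale_def pairG algebra_simps)
  show "frm x y = frm y x" for x y by (simp add: frm_def add.commute)
  show "frm (br v w) u = frm v (br w u)" for v w u
  proof -
    obtain x \<xi> y \<eta> z \<zeta> where v: "v = (x, \<xi>)" "w = (y, \<eta>)" "u = (z, \<zeta>)" by (metis prod.exhaust)
    show ?thesis
      unfolding v frm_def double_brk.simps fst_conv snd_conv pairG pair_ad_star pair_covarpi pair_vec_phi
      using brk_skew[of y x] brk_skew[of z x] varpi_skew[of \<zeta> y \<xi>] varpi_skew[of \<eta> z \<xi>]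
        phi_swap(1)[of \<xi> \<eta> \<zeta>] phi_swap(2)[of \<eta> \<xi> \<zeta>]
      by (simp add: pairG algebra_simps)
  qed
qed

sublocale quad_lie "double_scale G" br frm by (rule quad)

subsection \<open>The reductive decomposition\<close>

lemma l_subspace: "G.V.subspace (car L)" and m_subspace: "G.V.subspace m"
  and l_brk: "x \<in> car L \<Longrightarrow> y \<in> car L \<Longrightarrow> brk G x y \<in> car L"
  and lm_brk: "x \<in> car L \<Longrightarrow> w \<in> m \<Longrightarrow> brk G x w \<in> m"
  and lm_int: "x \<in> car L \<Longrightarrow> x \<in> m \<Longrightarrow> x = 0"
  and lm_decomp: "\<exists>y\<in>car L. \<exists>w\<in>m. x = y + w"
proof -
  note r = red[unfolded reductive_decomposition_def lie_subalgebra_def carG]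
  show "G.V.subspace (car L)" "G.V.subspace m" using r by blast+
  show "x \<in> car L \<Longrightarrow> y \<in> car L \<Longrightarrow> brk G x y \<in> car L" "x \<in> car L \<Longrightarrow> w \<in> m \<Longrightarrow> brk G x w \<in> m"
    "\<exists>y\<in>car L. \<exists>w\<in>m. x = y + w" "x \<in> car L \<Longrightarrow> x \<in> m \<Longrightarrow> x = 0"
    using r by blast+
qed

lemma ml_brk: "w \<in> m \<Longrightarrow> x \<in> car L \<Longrightarrow> brk G w x \<in> m"
  using lm_brk[of x w] G.V.subspace_neg[OF m_subspace, of "brk G x w"] by (simp add: brk_skew[of w x])

abbreviation P :: "'g \<Rightarrow> 'g" where "P \<equiv> proj_l L m"

lemma P_unique: "y \<in> car L \<Longrightarrow> x - y \<in> m \<Longrightarrow> P x = y"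
proof -
  assume y: "y \<in> car L" "x - y \<in> m"
  have eq: "y' = y" if "y' \<in> car L \<and> x - y' \<in> m" for y'
  proof -
    have "(x - y) - (x - y') \<in> m" using that y G.V.subspace_diff[OF m_subspace] by blast
    moreover have "(x - y) - (x - y') \<in> car L" using that y G.V.subspace_diff[OF l_subspace] by simp
    ultimately have "(x - y) - (x - y') = 0" by (intro lm_int)
    then show ?thesis by simp
  qed
  show "P x = y" unfolding proj_l_def by (rule the_equality[OF _ eq]) (use y in auto)
qed

lemma P_in: "P x \<in> car L" and P_m: "x - P x \<in> m"
proof -
  obtain y w where y: "y \<in> car L" "w \<in> m" "x = y + w" using lm_decomp by blast
  then have "P x = y" by (intro P_unique) simp_all
  then show "P x \<in> car L" "x - P x \<in> m" using y by simp_all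
qed

lemma P_l: "x \<in> car L \<Longrightarrow> P x = x"
  by (rule P_unique) (simp_all add: G.V.subspace_0[OF m_subspace])

lemma P_0: "x \<in> m \<Longrightarrow> P x = 0"
  by (rule P_unique) (simp_all add: G.V.subspace_0[OF l_subspace])

lemma P_add: "P (x + y) = P x + P y"
proof (rule P_unique)
  show "P x + P y \<in> car L" using P_in G.V.subspace_add[OF l_subspace] by blast
  have "x + y - (P x + P y) = (x - P x) + (y - P y)" by simp
  then show "x + y - (P x + P y) \<in> m" using P_m G.V.subspace_add[OF m_subspace] by metis
qed

lemma P_scale: "P (scv G c x) = scv G c (P x)"
proof (rule P_unique)
  show "scv G c (P x) \<in> car L" using P_in G.V.subspace_scale[OF l_subspace] by blast
  have "scv G c x - scv G c (P x) = scv G c (x - P x)" by (simp add: G.V.scale_right_diff_distrib)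
  then show "scv G c x - scv G c (P x) \<in> m" using P_m G.V.subspace_scale[OF m_subspace] by metis
qed

lemma P_brk: "z \<in> car L \<Longrightarrow> P (brk G z x) = brk G z (P x)"
proof (rule P_unique)
  assume z: "z \<in> car L"
  then show "brk G z (P x) \<in> car L" using P_in l_brk by blast
  have "brk G z (x - P x + P x) = brk G z (x - P x) + brk G z (P x)" by (rule brk_add)
  then have "brk G z x - brk G z (P x) = brk G z (x - P x)" by simp
  then show "brk G z x - brk G z (P x) \<in> m" using lm_brk[OF z P_m] by simp
qed

lemmas pairL = L.pair_add_right L.pair_add_left L.pair_diff_right L.pair_diff_left L.pair_minus_right L.pair_minus_left
  L.pair_zero_right L.pair_zero_left L.pair_scale_right[unfolded scL] L.pair_scale_left

abbreviation s :: "'ls \<Rightarrow> 'gs" where "s \<equiv> s_map G L m"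
abbreviation ist :: "'gs \<Rightarrow> 'ls" where "ist \<equiv> i_star G L"

lemma pair_s: "pair G (s \<alpha>) x = pair L \<alpha> (P x)"
  unfolding s_map_def transp_def
  by (rule covecG) (simp add: klinear_on_def P_add P_scale P_in pairL)

lemma pair_is: "z \<in> car L \<Longrightarrow> pair L (ist \<xi>) z = pair G \<xi> z"
  unfolding i_star_def transp_def
  by (rule L.pair_covec_of) (simp_all add: klinear_on_def pairG scL)

lemma s_add: "s (\<alpha> + \<beta>) = s \<alpha> + s \<beta>" and s_scale: "s (scs L c \<alpha>) = scs G c (s \<alpha>)"
  by (rule covecG_eqI, simp add: pair_s pairG pairL P_in)+

lemma s_lin: "klinear_on (scs L) (scs G) UNIV s" by (simp add: klinear_on_def s_add s_scale)

lemma is_add: "ist (\<alpha> + \<beta>) = ist \<alpha> + ist \<beta>" and is_scale: "ist (scs G c \<alpha>) = scs L c (ist \<alpha>)"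
  by (rule L.covec_eqI, simp add: pair_is pairG pairL)+

lemma is_lin: "klinear_on (scs G) (scs L) UNIV ist" by (simp add: klinear_on_def is_add is_scale)

lemma s_rlin: "linear s" by (rule klinear_real_linear[OF L.S.fd G.S.fd s_lin])
lemma is_rlin: "linear ist" by (rule klinear_real_linear[OF G.S.fd L.S.fd is_lin])

lemma is_s: "ist (s \<alpha>) = \<alpha>"
  by (rule L.covec_eqI) (simp add: pair_is pair_s P_l)

abbreviation "annl \<equiv> annihilator G (car L)"
abbreviation "annm \<equiv> annihilator G m"

lemma annl_subspace: "G.S.subspace annl" and annm_subspace: "G.S.subspace annm"
  by (auto simp: annihilator_def G.S.subspace_def pairG)

lemma s_annm: "s \<alpha> \<in> annm"
  by (auto simp: annihilator_def pair_s P_0 pairL)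

lemma s_is: "\<xi> \<in> annm \<Longrightarrow> s (ist \<xi>) = \<xi>"
proof (rule covecG_eqI)
  fix x assume xi: "\<xi> \<in> annm"
  have "pair G \<xi> x = pair G \<xi> (P x) + pair G \<xi> (x - P x)" unfolding pairG(1)[symmetric] by simp
  also have "pair G \<xi> (x - P x) = 0" using xi P_m by (auto simp: annihilator_def)
  finally show "pair G (s (ist \<xi>)) x = pair G \<xi> x" by (simp add: pair_s pair_is P_in)
qed

lemma is_annl: "\<xi> \<in> annl \<longleftrightarrow> ist \<xi> = 0"
proof
  assume "\<xi> \<in> annl"
  then show "ist \<xi> = 0" by (intro L.pair_nondeg_left) (auto simp: pair_is annihilator_def)
next
  assume "ist \<xi> = 0"
  then show "\<xi> \<in> annl" using pair_is[of _ \<xi>] by (auto simp: annihilator_def pairL)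
qed

lemma minus_s_is: "\<eta> - s (ist \<eta>) \<in> annl"
  by (simp add: is_annl linear_diff[OF is_rlin] is_s)

lemma in_l_iff: "(\<And>\<zeta>. \<zeta> \<in> annl \<Longrightarrow> pair G \<zeta> v = 0) \<Longrightarrow> v \<in> car L"
proof -
  assume v: "\<And>\<zeta>. \<zeta> \<in> annl \<Longrightarrow> pair G \<zeta> v = 0"
  have "pair G \<zeta> v = pair G \<zeta> (P v)" for \<zeta>
    using v[OF minus_s_is, of \<zeta>] by (simp add: pairG pair_s pair_is P_in)
  then have "v = P v" by (rule vecG_eqI)
  then show "v \<in> car L" using P_in by metis
qed

lemma in_m_iff: "(\<And>\<alpha>. pair G (s \<alpha>) v = 0) \<Longrightarrow> v \<in> m"
proof -
  assume "\<And>\<alpha>. pair G (s \<alpha>) v = 0"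
  then have "P v = 0" by (intro L.pair_nondeg_right) (simp_all add: pair_s P_in)
  then show "v \<in> m" using P_m[of v] by simp
qed

lemma varpi_l: "z \<in> car L \<Longrightarrow> varpi G z \<xi> = 0"
  and varpi_ss: "pair G (s \<alpha>) (varpi G x (s \<beta>)) = 0"
  and phi_lll: "\<xi> \<in> annl \<Longrightarrow> \<eta> \<in> annl \<Longrightarrow> \<zeta> \<in> annl \<Longrightarrow> phi G \<xi> \<eta> \<zeta> = 0"
proof -
  note c = comp[unfolded canonically_compatible_def carG]
  show "varpi G z \<xi> = 0" if "z \<in> car L" using conjunct1[OF c] that by (elim ballE allE) auto
  show "phi G \<xi> \<eta> \<zeta> = 0" if "\<xi> \<in> annl" "\<eta> \<in> annl" "\<zeta> \<in> annl"
    using conjunct2[OF conjunct2[OF conjunct2[OF c]]] that by (elim ballE) auto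
  show "pair G (s \<alpha>) (varpi G x (s \<beta>)) = 0"
    using conjunct1[OF conjunct2[OF c], THEN bspec, OF UNIV_I, THEN bspec, OF s_annm, THEN bspec, OF s_annm] .
qed

lemma tensor3_zero:
  assumes "\<psi> \<in> tensor3 G A B C"
    and "(\<forall>a\<in>A. pair G \<xi> a = 0) \<or> (\<forall>b\<in>B. pair G \<eta> b = 0) \<or> (\<forall>c\<in>C. pair G \<zeta> c = 0)"
  shows "\<psi> \<xi> \<eta> \<zeta> = 0"
proof -
  obtain n :: nat and a b c where abc: "\<And>i. i < n \<Longrightarrow> a i \<in> A \<and> b i \<in> B \<and> c i \<in> C"
    and psi: "\<psi> = (\<lambda>\<xi> \<eta> \<zeta>. \<Sum>i<n. pair G \<xi> (a i) * pair G \<eta> (b i) * pair G \<zeta> (c i))"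
    using assms(1) unfolding tensor3_def by blast
  have "pair G \<xi> (a i) * pair G \<eta> (b i) * pair G \<zeta> (c i) = 0" if "i < n" for i
    using assms(2) abc[OF that] by auto
  then show ?thesis unfolding psi by (intro sum.neutral) simp
qed

text \<open>The summand of type lll dies because \<open>\<zeta>\<close> vanishes on
  \<open>car L\<close>. The other two have factors from \<open>m\<close> in the last two slots, and
  after any permutation one of these slots holds \<open>s \<alpha>\<close> or
  \<open>s \<beta>\<close>, which vanish on \<open>m\<close>.\<close>

lemma phi_ssl: assumes "\<zeta> \<in> annl" shows "phi G (s \<alpha>) (s \<beta>) \<zeta> = 0"
proof -
  obtain \<psi>1 \<psi>2 \<psi>3 where psi: "\<psi>1 \<in> tensor3 G (car L) (car L) (car L)" "\<psi>2 \<in> tensor3 G (car L) m m"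
      "\<psi>3 \<in> tensor3 G m m m" and phi: "phi G = Alt3 (\<lambda>\<xi> \<eta> \<zeta>. \<psi>1 \<xi> \<eta> \<zeta> + \<psi>2 \<xi> \<eta> \<zeta> + \<psi>3 \<xi> \<eta> \<zeta>)"
    using comp unfolding canonically_compatible_def by blast
  have s: "\<forall>a\<in>m. pair G (s \<alpha>) a = 0" "\<forall>a\<in>m. pair G (s \<beta>) a = 0" "\<forall>a\<in>car L. pair G \<zeta> a = 0"
    using s_annm[of \<alpha>] s_annm[of \<beta>] assms by (simp_all add: annihilator_def)
  have 1: "\<psi>1 x y w = 0" if "x = \<zeta> \<or> y = \<zeta> \<or> w = \<zeta>" for x y w
    by (rule tensor3_zero[OF psi(1)]) (use that s(3) in blast)
  have 2: "\<psi>2 x y w = 0" "\<psi>3 x y w = 0" if "y = s \<alpha> \<or> y = s \<beta> \<or> w = s \<alpha> \<or> w = s \<beta>" for x y w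
    by (rule tensor3_zero[OF psi(2)] tensor3_zero[OF psi(3)], use that s(1,2) in blast)+
  show ?thesis unfolding phi Alt3_def by (simp add: 1 2)
qed

definition "Lp = car L \<times> {0 :: 'gs}"
definition "Ms = {0 :: 'g} \<times> range s"
definition "D1 = m \<times> annl"

lemma range_s: "range s = annm"
  using s_annm s_is by (metis rangeI subsetI subset_antisym image_subset_iff)

lemma br_ss: "br (0, s \<alpha>) (0, s \<beta>) = (vec_of G (phi G (s \<alpha>) (s \<beta>)), 0)"
  and vec_ss: "vec_of G (phi G (s \<alpha>) (s \<beta>)) \<in> car L"
proof -
  have "ad_star G 0 \<xi> = 0" for \<xi> by (rule covecG_eqI) (simp add: pair_ad_star brk_zero pairG)
  moreover have "covec_of G (\<lambda>x. pair G (s \<beta>) (varpi G x (s \<alpha>))) = 0"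
    by (rule covecG_eqI) (simp add: pair_covarpi varpi_ss pairG covec_zero)
  ultimately show "br (0, s \<alpha>) (0, s \<beta>) = (vec_of G (phi G (s \<alpha>) (s \<beta>)), 0)"
    by (simp add: brk_zero varpi_zero)
  show "vec_of G (phi G (s \<alpha>) (s \<beta>)) \<in> car L"
    by (rule in_l_iff) (simp add: pair_vec_phi phi_ssl)
qed

lemma br_sl: "z \<in> car L \<Longrightarrow> br (0, s \<alpha>) (z, 0) = (0, ad_star G z (s \<alpha>))"
  and ad_star_ss: "z \<in> car L \<Longrightarrow> ad_star G z (s \<alpha>) \<in> annm"
proof -
  assume z: "z \<in> car L"
  have "ad_star G 0 0 = 0" by (rule covecG_eqI) (simp add: pair_ad_star brk_zero pairG)
  moreover have "covec_of G (\<lambda>x. pair G 0 (varpi G x (s \<alpha>))) = 0"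
    by (rule covecG_eqI) (simp add: pair_covarpi pairG covec_zero)
  moreover have "vec_of G (phi G (s \<alpha>) 0) = 0"
    by (rule vecG_eqI) (simp add: pair_vec_phi pairG phi_zero)
  ultimately show "br (0, s \<alpha>) (z, 0) = (0, ad_star G z (s \<alpha>))"
    by (simp add: brk_zero varpi_zero varpi_l[OF z])
  show "ad_star G z (s \<alpha>) \<in> annm"
    by (auto simp: annihilator_def pair_ad_star pair_s P_0 lm_brk[OF z] pairL)
qed

lemma subspace_Times: "G.V.subspace A \<Longrightarrow> G.S.subspace B \<Longrightarrow> D.subspace (A \<times> B)"
  unfolding D.subspace_def G.V.subspace_def G.S.subspace_def
  by (auto simp: double_scale_def prod_scale_def zero_prod_def)

text \<open>Here canonical compatibility is spent: \<open>varpi_ss\<close> and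
  \<open>phi_ssl\<close> put brackets of two elements of \<open>Ms\<close> into \<open>Lp\<close>
  and first components of brackets with \<open>D1\<close> into \<open>m\<close>, while
  \<open>varpi_l\<close> controls brackets with \<open>Lp\<close> and the annihilator component in
  \<open>D1\<close>.\<close>

lemma gr: "graded (double_scale G) br frm Lp Ms D1"
proof (unfold_locales)
  show "D.subspace Lp" "D.subspace Ms" "D.subspace D1"
    unfolding Lp_def Ms_def D1_def range_s
    by (intro subspace_Times l_subspace m_subspace annl_subspace annm_subspace
        G.V.subspace_single_0 G.S.subspace_single_0)+
  show "br x y \<in> Lp" if "x \<in> Ms" "y \<in> Ms" for x y
    using that vec_ss by (auto simp: Ms_def Lp_def br_ss simp del: double_brk.simps)
  show "br x y \<in> Ms" if xy: "x \<in> Ms" "y \<in> Lp" for x y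
  proof -
    obtain \<alpha> z where "x = (0, s \<alpha>)" "y = (z, 0)" "z \<in> car L" using xy by (auto simp: Ms_def Lp_def)
    then show ?thesis using ad_star_ss[of z \<alpha>] by (simp add: br_sl Ms_def range_s del: double_brk.simps)
  qed
  show "br v y \<in> D1" if v: "v \<in> Ms" and y: "y \<in> D1" for v y
  proof -
    obtain \<alpha> w \<xi> where [simp]: "v = (0, s \<alpha>)" "y = (w, \<xi>)" and w: "w \<in> m" "\<xi> \<in> annl"
      using v y by (auto simp: Ms_def D1_def)
    have "fst (br v y) \<in> m"
    proof (rule in_m_iff)
      fix \<beta>
      have "phi G (s \<alpha>) \<xi> (s \<beta>) = 0" using phi_swap(2)[of "s \<alpha>" \<xi> "s \<beta>"] phi_ssl[OF w(2)] by simp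
      then show "pair G (s \<beta>) (fst (br v y)) = 0"
        by (simp add: pairG pair_vec_phi varpi_ss brk_zero varpi_zero)
    qed
    moreover have "snd (br v y) \<in> annl"
      unfolding annihilator_def
    proof (safe)
      fix z assume z: "z \<in> car L"
      have "pair G (s \<alpha>) (brk G w z) = 0" using s_annm ml_brk[OF w(1) z] by (auto simp: annihilator_def)
      then show "pair G (snd (br v y)) z = 0"
        by (simp add: pairG pair_ad_star pair_covarpi brk_zero varpi_l[OF z])
    qed
    ultimately show ?thesis by (simp add: D1_def mem_Times_iff)
  qed
  show "frm x y = 0" if "x \<in> Ms" "y \<in> Ms" for x y using that by (auto simp: Ms_def frm_def pairG)
  show "frm x y = 0" if "x \<in> Lp" "y \<in> Lp" for x y using that by (auto simp: Lp_def frm_def pairG)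
  show "frm x y = 0" if "x \<in> Ms" "y \<in> D1" for x y
    using that s_annm by (auto simp: Ms_def D1_def frm_def pairG annihilator_def)
  show "frm x y = 0" if "x \<in> Lp" "y \<in> D1" for x y
    using that by (auto simp: Lp_def D1_def frm_def pairG annihilator_def)
qed

sublocale graded "double_scale G" br frm Lp Ms D1 by (rule gr)

lemma g0_subspace: "D.subspace (g0_star G L)"
  unfolding g0_star_def by (rule subspace_Times[OF l_subspace annl_subspace])

text \<open>The term with \<open>phi\<close> lies in \<open>car L\<close> because \<open>phi\<close>
  vanishes on three covectors of the annihilator; the terms with \<open>varpi\<close> are harmless
  since \<open>varpi\<close> is zero on \<open>car L\<close>.\<close>

lemma g0_closed: "v \<in> g0_star G L \<Longrightarrow> w \<in> g0_star G L \<Longrightarrow> br v w \<in> g0_star G L"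
proof -
  assume vw: "v \<in> g0_star G L" "w \<in> g0_star G L"
  obtain x \<xi> y \<eta> where [simp]: "v = (x, \<xi>)" "w = (y, \<eta>)" and
    x: "x \<in> car L" "\<xi> \<in> annl" "y \<in> car L" "\<eta> \<in> annl"
    using vw by (auto simp: g0_star_def)
  have ph: "vec_of G (phi G \<xi> \<eta>) \<in> car L"
    by (rule in_l_iff) (simp add: pair_vec_phi phi_lll x)
  then have "fst (br v w) \<in> car L"
    using x l_brk G.V.subspace_add[OF l_subspace] by (simp add: varpi_l)
  moreover have "snd (br v w) \<in> annl"
    unfolding annihilator_def
  proof safe
    fix z assume z: "z \<in> car L"
    have "pair G \<eta> (brk G x z) = 0" "pair G \<xi> (brk G y z) = 0"
      using x l_brk z by (auto simp: annihilator_def)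
    then show "pair G (snd (br v w)) z = 0"
      by (simp add: pairG pair_ad_star pair_covarpi varpi_l[OF z])
  qed
  ultimately show ?thesis by (simp add: g0_star_def mem_Times_iff)
qed

lemma g0_subalgebra: "lie_subalgebra (double_scale G) (double_car G) br (g0_star G L)"
  using lie g0_subspace g0_closed carG by (simp add: lie_subalgebra_def double_car_def)

end

section \<open>Spectra and meromorphic functional calculus\<close>

lemma linear_inj_on_surj_on:
  fixes f :: "'a::real_vector \<Rightarrow> 'a"
  assumes fd: "finite_dim TYPE('a)" and f: "linear f" and V: "subspace V" "f ` V \<subseteq> V" "inj_on f V"
  shows "f ` V = V"
proof
  obtain B0 :: "'a set" where B0: "finite B0" "span B0 = UNIV" using fd by (auto simp: finite_dim_def)
  obtain B where B: "B \<subseteq> V" "independent B" "V \<subseteq> span B"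
    using maximal_independent_subset[of V] by blast
  have fB: "finite B" using independent_span_bound[OF B0(1) B(2)] B0(2) by auto
  have spB: "span B = V" using B V(1) by (metis span_minimal subset_antisym)
  have ind: "independent (f ` B)"
    using V(3) spB by (intro linear_independent_injective_image[OF f B(2)]) simp
  have card: "card (f ` B) = card B" using V(3) B(1) by (intro card_image) (auto intro: inj_on_subset)
  have "V \<subseteq> span (f ` B)"
  proof
    fix x assume x: "x \<in> V"
    show "x \<in> span (f ` B)"
    proof (rule ccontr)
      assume nx: "x \<notin> span (f ` B)"
      then have "independent (insert x (f ` B))" using ind by (simp add: independent_insert)
      moreover have "insert x (f ` B) \<subseteq> span B" using x V(2) B(1) spB by auto
      ultimately have "card (insert x (f ` B)) \<le> card B" using independent_span_bound[OF fB] by blast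
      moreover have "x \<notin> f ` B" using nx span_base[of x "f ` B"] by auto
      ultimately show False using card fB by simp
    qed
  qed
  also have "\<dots> = f ` V" using spB by (simp add: linear_span_image[OF f])
  finally show "V \<subseteq> f ` V" .
qed (rule V)

lemma entire_poly: "entire (fps_of_poly p)"
  unfolding entire_def
proof
  fix r :: real
  show "summable (\<lambda>n. \<bar>fps_nth (fps_of_poly p) n\<bar> * r ^ n)"
    by (rule summable_finite[of "{..degree p}"]) (auto simp: coeff_eq_0)
qed

lemma op_series_poly: "op_series (fps_of_poly p) A x = (\<Sum>i\<le>degree p. coeff p i *\<^sub>R (A ^^ i) x)"
  unfolding op_series_def
  by (rule suminf_finite[of "{..degree p}", THEN trans]) (auto simp: coeff_eq_0)

lemma (in bounded_endo) op_series_poly_arith: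
  "op_series (fps_of_poly (p + q)) A x = op_series (fps_of_poly p) A x + op_series (fps_of_poly q) A x"
  "op_series (fps_of_poly (smult c p)) A x = c *\<^sub>R op_series (fps_of_poly p) A x"
  "op_series (fps_of_poly (pCons 0 p)) A x = A (op_series (fps_of_poly p) A x)"
  "op_series (fps_of_poly 0) A x = 0"
proof -
  show "op_series (fps_of_poly (p + q)) A x = op_series (fps_of_poly p) A x + op_series (fps_of_poly q) A x"
    by (simp add: fps_of_poly_add op_series_add entire_poly)
  show "op_series (fps_of_poly (smult c p)) A x = c *\<^sub>R op_series (fps_of_poly p) A x"
    by (simp add: fps_of_poly_smult op_series_const_mult entire_poly)
  show "op_series (fps_of_poly (pCons 0 p)) A x = A (op_series (fps_of_poly p) A x)"
    by (simp add: fps_of_poly_pCons op_series_X_mult[OF bA bA] entire_poly mult.commute[of _ fps_X])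
  show "op_series (fps_of_poly 0) A x = 0" by (simp add: op_series_def)
qed

lemma sinh_eq_0_imp:
  assumes "sinh z = (0::complex)" shows "\<exists>k::int. z = \<i> * of_real pi * of_int k"
proof -
  have "exp z = exp (- z)" using assms by (simp add: sinh_def)
  then have "exp z * exp z = exp (- z) * exp z" by simp
  also have "\<dots> = 1" by (simp add: exp_minus)
  also have "exp z * exp z = exp (2 * z)" by (simp only: mult_2 exp_add)
  finally have "exp (2 * z) = 1" .
  then obtain n :: int where "Re (2 * z) = 0" "Im (2 * z) = of_int (2 * n) * pi" unfolding exp_eq_1 by blast
  then have "Re z = 0" "Im z = of_int n * pi" by simp_all
  then show ?thesis by (intro exI[of _ n]) (simp add: complex_eq_iff)
qed

lemma ss_sums_sinh: "(\<lambda>n. complex_of_real (fps_nth (ss 1) n) * z ^ Suc n) sums sinh z"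
proof -
  have "(\<lambda>n. if even (Suc n) then 0 else z ^ Suc n /\<^sub>R fact (Suc n)) sums sinh z"
    using sinh_converges[of z] by (subst sums_Suc_iff) simp
  then show ?thesis
    by (rule sums_cong[THEN iffD1, rotated]) (auto simp: scaleR_conv_of_real divide_inverse mult.commute)
qed

text \<open>The zeros of \<open>sinh z / z\<close> are the points \<open>\<i> \<pi> k\<close> with \<open>k \<noteq> 0\<close>, and for an eigenvector \<open>a + \<i> b\<close> of a
  real endomorphism with such an eigenvalue both \<open>a\<close> and \<open>b\<close> satisfy \<open>A (A v) = - (\<pi> k)\<^sup>2 v\<close>.\<close>

lemma (in bounded_endo) ss_inj_on_iff:
  assumes fd: "finite_dim TYPE('v)" and V: "subspace V" "A ` V \<subseteq> V"
  shows "inj_on (op_series (ss 1) A) V \<longleftrightarrow>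
    \<not> (\<exists>v\<in>V. \<exists>k::int. k \<noteq> (0::int) \<and> v \<noteq> 0 \<and> A (A v) = - ((pi * real_of_int k)\<^sup>2) *\<^sub>R v)"
proof -
  let ?S = "op_series (ss 1) A"
  have lS: "linear ?S" by (rule op_series_lin) simp
  have clV: "closed V" by (rule finite_dim_closed_subspace[OF fd V(1)])
  have powV: "(A ^^ n) x \<in> V" if "x \<in> V" for n x using that V(2) by (induction n) auto
  have "False" if inj: "inj_on ?S V" and v: "v \<in> V" "k \<noteq> 0" "v \<noteq> 0" "A (A v) = - ((pi * real_of_int k)\<^sup>2) *\<^sub>R v" for v and k :: int
  proof -
    define b where "b = pi * real_of_int k"
    have b: "b \<noteq> 0" using v by (simp add: b_def)
    have pw: "(A ^^ (2 * n)) v = ((-1) ^ n * b ^ (2 * n)) *\<^sub>R v" for n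
    proof (induction n)
      case (Suc n)
      have "(A ^^ (2 * Suc n)) v = A (A ((A ^^ (2 * n)) v))" by simp
      also have "\<dots> = ((-1) ^ n * b ^ (2 * n)) *\<^sub>R A (A v)" unfolding Suc by (simp add: linear_scale[OF linA])
      finally show ?case unfolding v(4) b_def[symmetric] by (simp add: power2_eq_square)
    qed simp
    \<comment> \<open>Only even powers of \<open>A\<close> occur, so the series at \<open>v\<close>
      is that of sin b / b, which vanishes because \<open>b\<close> is a nonzero multiple of
      pi.\<close>
    have t: "fps_nth (ss 1) n *\<^sub>R (A ^^ n) v = (sin_coeff (Suc n) * b ^ Suc n / b) *\<^sub>R v" for n
    proof (cases "even n")
      case True
      then obtain j where "n = 2 * j" by (elim evenE)
      then show ?thesis using b pw[of j] by (simp add: sin_coeff_def)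
    qed (simp add: sin_coeff_def)
    have "(\<lambda>n. sin_coeff (Suc n) * b ^ Suc n) sums sin b"
      using sin_converges[of b] by (subst sums_Suc_iff) simp
    then have "(\<lambda>n. (sin_coeff (Suc n) * b ^ Suc n / b) *\<^sub>R v) sums ((sin b / b) *\<^sub>R v)"
      by (intro sums_scaleR_left sums_divide)
    then have "?S v = (sin b / b) *\<^sub>R v" unfolding op_series_def t by (rule sums_unique[symmetric])
    also have "sin b = 0" unfolding b_def using sin_zero_iff_int2 by (metis mult.commute)
    finally have "?S v = ?S 0" using linear_0[OF lS] by simp
    then show False using inj v(1,3) subspace_0[OF V(1)] by (auto dest: inj_onD)
  qed
  moreover have "\<exists>v\<in>V. \<exists>k::int. k \<noteq> (0::int) \<and> v \<noteq> 0 \<and> A (A v) = - ((pi * real_of_int k)\<^sup>2) *\<^sub>R v" if ninj: "\<not> inj_on ?S V"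
  proof -
    obtain u where u: "u \<in> V" "u \<noteq> 0" "?S u = 0"
      using ninj linear_injective_on_subspace_0[OF lS V(1)] by blast
    let ?pa = "\<lambda>p. op_series (fps_of_poly p) A u"
    \<comment> \<open>Let \<open>p\<close> be a polynomial of least degree annihilating
      \<open>u\<close>, \<open>l\<close> a complex root and \<open>r\<close> the cofactor. Then r(A)
      u = a + i b is an eigenvector for \<open>l\<close>, and minimality keeps it from
      vanishing.\<close>
    obtain p0 where "p0 \<noteq> 0 \<and> ?pa p0 = 0"
      unfolding op_series_poly using finite_dim_powers_dependent[OF fd] by blast
    from ex_has_least_nat[of "\<lambda>p. p \<noteq> 0 \<and> ?pa p = 0", OF this, of degree]
    obtain p where p: "p \<noteq> 0" "?pa p = 0" and pmin: "\<And>q. q \<noteq> 0 \<Longrightarrow> ?pa q = 0 \<Longrightarrow> degree p \<le> degree q"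
      by blast
    have "degree p \<noteq> 0"
    proof
      assume "degree p = 0"
      then obtain c where "p = [:c:]" by (rule degree_eq_zeroE)
      with p u show False by (simp add: op_series_poly)
    qed
    define pc where "pc = map_poly complex_of_real p"
    have degc: "degree pc = degree p" unfolding pc_def by (rule degree_map_poly) simp
    have "\<exists>z. poly pc z = 0"
      by (rule fundamental_theorem_of_algebra_alt) (use degc \<open>degree p \<noteq> 0\<close> in auto)
    then obtain l where "poly pc l = 0" ..
    then obtain r where r: "pc = [:- l, 1:] * r" by (meson dvdE poly_eq_0_iff_dvd)
    have "pc \<noteq> 0" using p(1) unfolding pc_def by (simp add: map_poly_eq_0_iff)
    then have r0: "r \<noteq> 0" using r by auto
    have degr: "degree r < degree p"
      using degree_mult_eq[of "[:- l, 1:]" r] r0 degc unfolding r[symmetric] by simp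
    define r1 where "r1 = map_poly Re r"
    define r2 where "r2 = map_poly Im r"
    have c12: "coeff r1 i = Re (coeff r i)" "coeff r2 i = Im (coeff r i)" for i
      by (simp_all add: r1_def r2_def coeff_map_poly)
    have cp: "complex_of_real (coeff p i) = coeff (pCons 0 r) i - l * coeff r i" for i
    proof -
      have "complex_of_real (coeff p i) = coeff pc i" by (simp add: pc_def coeff_map_poly)
      also have "\<dots> = coeff (pCons 0 r) i - l * coeff r i" unfolding r by (simp add: mult_pCons_left)
      finally show ?thesis .
    qed
    have p1: "p = pCons 0 r1 + (smult (- Re l) r1 + smult (Im l) r2)"
    proof (rule poly_eqI)
      fix i
      show "coeff p i = coeff (pCons 0 r1 + (smult (- Re l) r1 + smult (Im l) r2)) i"
        using arg_cong[OF cp[of i], of Re] by (cases i) (simp_all add: c12)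
    qed
    have p2: "0 = pCons 0 r2 + (smult (- Re l) r2 + smult (- Im l) r1)"
    proof (rule poly_eqI)
      fix i
      show "coeff 0 i = coeff (pCons 0 r2 + (smult (- Re l) r2 + smult (- Im l) r1)) i"
        using arg_cong[OF cp[of i], of Im] by (cases i) (simp_all add: c12)
    qed
    define a where "a = ?pa r1"
    define b where "b = ?pa r2"
    have Aa: "A a = Re l *\<^sub>R a - Im l *\<^sub>R b"
      using p(2)[unfolded arg_cong[OF p1, of ?pa] op_series_poly_arith]
      unfolding a_def b_def by (simp add: algebra_simps)
    have Ab: "A b = Im l *\<^sub>R a + Re l *\<^sub>R b"
      using arg_cong[OF p2, of ?pa, unfolded op_series_poly_arith]
      unfolding a_def b_def by (simp add: algebra_simps)
    have nz: "a \<noteq> 0 \<or> b \<noteq> 0"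
    proof (rule ccontr)
      assume "\<not> (a \<noteq> 0 \<or> b \<noteq> 0)"
      moreover have "degree r1 \<le> degree r" "degree r2 \<le> degree r"
        by (intro degree_le allI impI; simp add: c12 coeff_eq_0)+
      ultimately have "r1 = 0" "r2 = 0"
        using pmin[of r1] pmin[of r2] degr unfolding a_def b_def by linarith+
      then have "coeff r i = 0" for i using c12[of i] by (simp add: complex_eq_iff)
      then show False using r0 by (simp add: poly_eq_iff)
    qed
    have abV: "a \<in> V" "b \<in> V"
      unfolding a_def b_def by (rule op_series_closed_subspace[OF entire_poly V(1) clV powV[OF u(1)]])+
    have S0: "?S (?pa q) = 0" for q
    proof -
      have "?S (?pa q) = op_series (ss 1 * fps_of_poly q) A u" by (simp add: op_series_mult entire_poly)
      also have "\<dots> = op_series (fps_of_poly q) A (?S u)"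
        by (simp add: op_series_mult entire_poly mult.commute[of "ss 1"])
      finally show ?thesis using u(3) linear_0[OF op_series_lin[OF entire_poly]] by simp
    qed
    have pw: "(A ^^ n) a = Re (l ^ n) *\<^sub>R a - Im (l ^ n) *\<^sub>R b \<and> (A ^^ n) b = Im (l ^ n) *\<^sub>R a + Re (l ^ n) *\<^sub>R b" for n
    proof (induction n)
      case (Suc n)
      then have "(A ^^ Suc n) a = A (Re (l ^ n) *\<^sub>R a - Im (l ^ n) *\<^sub>R b)"
        "(A ^^ Suc n) b = A (Im (l ^ n) *\<^sub>R a + Re (l ^ n) *\<^sub>R b)" by simp_all
      then show ?case
        by (simp add: linear_add[OF linA] linear_diff[OF linA] linear_scale[OF linA] Aa Ab algebra_simps)
    qed simp
    let ?c = "\<lambda>n. complex_of_real (fps_nth (ss 1) n) * l ^ n"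
    have sc: "summable (\<lambda>n. norm (?c n))"
      using entire_simps(3)[of 1, unfolded entire_def, rule_format, of "norm l"]
      by (simp add: norm_mult norm_power del: nths)
    \<comment> \<open>\<open>\<sigma>\<close> is the value of the series at \<open>l\<close>, hence
      the eigenvalue of \<open>?S\<close> at a + i b. As \<open>?S\<close> kills both
      \<open>a\<close> and \<open>b\<close>, multiplying by the conjugate shows that
      \<open>\<sigma>\<close> is zero.\<close>
    define \<sigma> where "\<sigma> = suminf ?c"
    have \<sigma>: "?c sums \<sigma>" unfolding \<sigma>_def by (rule summable_sums[OF summable_norm_cancel[OF sc]])
    have re: "(\<lambda>n. fps_nth (ss 1) n * Re (l ^ n)) sums Re \<sigma>"
      using sums_Re[OF \<sigma>] by simp
    have im: "(\<lambda>n. fps_nth (ss 1) n * Im (l ^ n)) sums Im \<sigma>"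
      using sums_Im[OF \<sigma>] by simp
    have "(\<lambda>n. fps_nth (ss 1) n *\<^sub>R (A ^^ n) a) sums (Re \<sigma> *\<^sub>R a - Im \<sigma> *\<^sub>R b)"
      using sums_diff[OF sums_scaleR_left[OF re, of a] sums_scaleR_left[OF im, of b]]
      by (simp only: pw scaleR_diff_right scaleR_scaleR)
    then have "?S a = Re \<sigma> *\<^sub>R a - Im \<sigma> *\<^sub>R b" unfolding op_series_def by (rule sums_unique[symmetric])
    then have Sa: "Re \<sigma> *\<^sub>R a - Im \<sigma> *\<^sub>R b = 0" using S0[of r1, folded a_def] by simp
    have "(\<lambda>n. fps_nth (ss 1) n *\<^sub>R (A ^^ n) b) sums (Im \<sigma> *\<^sub>R a + Re \<sigma> *\<^sub>R b)"
      using sums_add[OF sums_scaleR_left[OF im, of a] sums_scaleR_left[OF re, of b]]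
      by (simp only: pw scaleR_add_right scaleR_scaleR)
    then have "?S b = Im \<sigma> *\<^sub>R a + Re \<sigma> *\<^sub>R b" unfolding op_series_def by (rule sums_unique[symmetric])
    then have Sb: "Im \<sigma> *\<^sub>R a + Re \<sigma> *\<^sub>R b = 0" using S0[of r2, folded b_def] by simp
    have "((Re \<sigma>)\<^sup>2 + (Im \<sigma>)\<^sup>2) *\<^sub>R a = Re \<sigma> *\<^sub>R (Re \<sigma> *\<^sub>R a - Im \<sigma> *\<^sub>R b) + Im \<sigma> *\<^sub>R (Im \<sigma> *\<^sub>R a + Re \<sigma> *\<^sub>R b)"
      "((Re \<sigma>)\<^sup>2 + (Im \<sigma>)\<^sup>2) *\<^sub>R b = Re \<sigma> *\<^sub>R (Im \<sigma> *\<^sub>R a + Re \<sigma> *\<^sub>R b) - Im \<sigma> *\<^sub>R (Re \<sigma> *\<^sub>R a - Im \<sigma> *\<^sub>R b)"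
      by (simp_all add: algebra_simps power2_eq_square)
    then have "((Re \<sigma>)\<^sup>2 + (Im \<sigma>)\<^sup>2) *\<^sub>R a = 0" "((Re \<sigma>)\<^sup>2 + (Im \<sigma>)\<^sup>2) *\<^sub>R b = 0"
      unfolding Sa Sb by simp_all
    then have "(Re \<sigma>)\<^sup>2 + (Im \<sigma>)\<^sup>2 = 0" using nz unfolding scaleR_eq_0_iff by blast
    then have \<sigma>0: "\<sigma> = 0" by (simp add: complex_eq_iff sum_power2_eq_zero_iff)
    have "(\<lambda>n. complex_of_real (fps_nth (ss 1) n) * l ^ Suc n) sums (\<sigma> * l)"
      using sums_mult2[OF \<sigma>, of l] by (simp only: mult.assoc power_Suc2)
    then have "sinh l = \<sigma> * l" by (rule sums_unique2[OF ss_sums_sinh])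
    then have "sinh l = 0" using \<sigma>0 by simp
    then obtain k :: int where k: "l = \<i> * of_real pi * of_int k" using sinh_eq_0_imp by blast
    have "k \<noteq> 0"
    proof
      assume "k = 0"
      then have "?c sums 1" using sums_finite[of "{0}" ?c] k by simp
      then have "\<sigma> = 1" using \<sigma> sums_unique2 by blast
      then show False using \<sigma>0 by simp
    qed
    have "Re l = 0" "Im l = pi * k" using k by simp_all
    then have "A a = - (pi * k) *\<^sub>R b" "A b = (pi * k) *\<^sub>R a" using Aa Ab by simp_all
    then have "A (A a) = - ((pi * k)\<^sup>2) *\<^sub>R a" "A (A b) = - ((pi * k)\<^sup>2) *\<^sub>R b"
      by (simp_all add: linear_scale[OF linA] linear_neg[OF linA] power2_eq_square)
    then show ?thesis using nz abV \<open>k \<noteq> 0\<close> by blast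
  qed
  ultimately show ?thesis by blast
qed

text \<open>Replaces the spectrum, which is defined differently over the two ground fields, by a
  condition on the square of \<open>A\<close> that makes sense over the reals.\<close>

lemma cspectrum_sinh:
  fixes sc :: "'k::real_or_complex \<Rightarrow> 'v::real_normed_vector \<Rightarrow> 'v"
  assumes fd: "fd_vector_space sc" and V: "module.subspace sc V"
    and A: "klinear_on sc sc V A" "A ` V \<subseteq> V"
  shows "cspectrum sc V A \<inter> {\<i> * of_real pi * of_int k | k :: int. k \<noteq> 0} = {} \<longleftrightarrow>
    \<not> (\<exists>v\<in>V. \<exists>k::int. k \<noteq> (0::int) \<and> v \<noteq> 0 \<and> A (A v) = - ((pi * real_of_int k)\<^sup>2) *\<^sub>R v)"
proof -
  interpret fd_space sc using fd by unfold_locales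
  have Aadd: "A (x + y) = A x + A y" and Asc: "A (sc c x) = sc c (A x)" if "x \<in> V" "y \<in> V" for x y c
    using A(1) that by (auto simp: klinear_on_def)
  have Ar: "A (r *\<^sub>R x) = r *\<^sub>R A x" if "x \<in> V" for r x using Asc[OF that that, of "of_real r"] by (simp add: sc_of_real)
  have AV: "A x \<in> V" if "x \<in> V" for x using A(2) that by auto
  have scV: "sc c x \<in> V" "r *\<^sub>R x \<in> V" if "x \<in> V" for c r x
    using that subspace_scale[OF V, of x] sc_of_real by metis+
  let ?C = "{\<i> * of_real pi * of_int k | k :: int. k \<noteq> 0}"
  let ?ex = "\<exists>v\<in>V. \<exists>k::int. k \<noteq> (0::int) \<and> v \<noteq> 0 \<and> A (A v) = - ((pi * real_of_int k)\<^sup>2) *\<^sub>R v"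
  have "cspectrum sc V A \<inter> ?C \<noteq> {} \<longleftrightarrow> ?ex"
  proof (cases "range (to_cplx :: 'k \<Rightarrow> complex) = UNIV")
    case True
    then obtain j :: 'k where j: "to_cplx j = \<i>" by (metis UNIV_I imageE)
    have jj: "j * j = of_real (- 1)"
      by (rule to_cplx_inject[THEN iffD1]) (simp only: to_cplx_mult j to_cplx_of_real, simp)
    have cs: "cspectrum sc V A = {to_cplx c | c. \<exists>v\<in>V. v \<noteq> 0 \<and> A v = sc c v}"
      using True by (simp add: cspectrum_def)
    show ?thesis
    proof
      assume "cspectrum sc V A \<inter> ?C \<noteq> {}"
      then obtain c v k where v: "v \<in> V" "v \<noteq> 0" "A v = sc c v" "to_cplx c = \<i> * of_real pi * of_int k" "k \<noteq> (0::int)"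
        unfolding cs by auto
      have "c * c = of_real (- ((pi * k)\<^sup>2))"
        by (rule to_cplx_inject[THEN iffD1])
          (simp add: to_cplx_mult v(4) to_cplx_of_real power2_eq_square complex_eq_iff del: of_real_minus)
      moreover have "A (A v) = sc (c * c) v" using v(3) Asc[OF v(1) v(1)] by simp
      ultimately have "A (A v) = - ((pi * k)\<^sup>2) *\<^sub>R v" by (simp only: sc_of_real)
      then show ?ex using v by blast
    next
      assume ?ex
      then obtain v and k :: int where v: "v \<in> V" "k \<noteq> 0" "v \<noteq> 0" "A (A v) = - ((pi * k)\<^sup>2) *\<^sub>R v" by blast
      define b where "b = pi * real_of_int k"
      define c where "c = j * of_real b"
      have tc: "to_cplx c = \<i> * of_real pi * of_int k" "to_cplx (- c) = \<i> * of_real pi * of_int (- k)"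
        unfolding c_def to_cplx_minus to_cplx_mult to_cplx_of_real j by (simp_all add: b_def)
      have "c * c = (j * j) * of_real (b * b)" by (simp add: c_def algebra_simps)
      then have cc: "c * c = of_real (- (b\<^sup>2))" unfolding jj by (simp add: power2_eq_square)
      have AAv: "A (A v) = sc (c * c) v" using v(4) unfolding cc sc_of_real b_def .
      \<comment> \<open>Since (A - c)(A + c) v = 0, either \<open>v\<close> is an eigenvector for
        \<open>- c\<close> or \<open>A v + sc c v\<close> is one for \<open>c\<close>.\<close>
      show "cspectrum sc V A \<inter> ?C \<noteq> {}"
      proof (cases "A v + sc c v = 0")
        case True
        then have "A v = sc (- c) v" by (simp add: eq_neg_iff_add_eq_0)
        then have "to_cplx (- c) \<in> cspectrum sc V A" unfolding cs using v by blast
        then show ?thesis using tc(2) v(2) by (auto intro!: exI[of _ "- k"])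
      next
        case False
        have "A (A v + sc c v) = sc c (A v + sc c v)"
          using AAv Aadd[OF AV[OF v(1)] scV(1)[OF v(1)]] Asc[OF v(1) v(1)]
          by (simp add: scale_right_distrib add.commute)
        moreover have "A v + sc c v \<in> V" using AV scV v(1) subspace_add[OF V] by blast
        ultimately have "to_cplx c \<in> cspectrum sc V A" unfolding cs using False by blast
        then show ?thesis using tc(1) v(2) by blast
      qed
    qed
  next
    case False
    then have cs: "cspectrum sc V A = {Complex a b | a b. \<exists>v\<in>V. \<exists>w\<in>V. (v, w) \<noteq> (0, 0) \<and>
              A v = a *\<^sub>R v - b *\<^sub>R w \<and> A w = b *\<^sub>R v + a *\<^sub>R w}"
      by (simp add: cspectrum_def)
    show ?thesis
    proof
      assume "cspectrum sc V A \<inter> ?C \<noteq> {}"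
      then obtain c where c: "c \<in> cspectrum sc V A" "c \<in> ?C" by blast
      obtain a b v w where v: "v \<in> V" "w \<in> V" "(v, w) \<noteq> (0, 0)" "A v = a *\<^sub>R v - b *\<^sub>R w"
          "A w = b *\<^sub>R v + a *\<^sub>R w" "c = Complex a b"
        using c(1) unfolding cs by blast
      obtain k :: int where k: "c = \<i> * of_real pi * of_int k" "k \<noteq> 0" using c(2) by blast
      have ab: "a = 0" "b = pi * k" using v(6) k(1) by (simp_all add: complex_eq_iff)
      have Av: "A v = (- b) *\<^sub>R w" "A w = b *\<^sub>R v" using v(4,5) ab(1) by simp_all
      have "A (A v) = - ((pi * k)\<^sup>2) *\<^sub>R v" "A (A w) = - ((pi * k)\<^sup>2) *\<^sub>R w"
        unfolding Av Ar[OF v(1)] Ar[OF v(2)] ab(2)[symmetric] by (simp_all add: Av power2_eq_square)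
      then show ?ex using v k(2) by (metis prod.inject)
    next
      assume ?ex
      then obtain v and k :: int where v: "v \<in> V" "k \<noteq> 0" "v \<noteq> 0" "A (A v) = - ((pi * k)\<^sup>2) *\<^sub>R v" by blast
      define b where "b = pi * real_of_int k"
      have b: "b \<noteq> 0" using v(2) by (simp add: b_def)
      \<comment> \<open>The imaginary part of the eigenvector for i b whose real part is
        \<open>v\<close>.\<close>
      let ?w = "(- 1 / b) *\<^sub>R A v"
      have "A v = 0 *\<^sub>R v - b *\<^sub>R ?w" "A ?w = b *\<^sub>R v + 0 *\<^sub>R ?w"
        using b v(4) unfolding Ar[OF AV[OF v(1)]] b_def[symmetric] by (simp_all add: power2_eq_square)
      moreover have "?w \<in> V" using scV AV v(1) by blast
      ultimately have "Complex 0 b \<in> cspectrum sc V A" unfolding cs using v by blast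
      moreover have "Complex 0 b = \<i> * of_real pi * of_int k" by (simp add: complex_eq_iff b_def)
      ultimately show "cspectrum sc V A \<inter> ?C \<noteq> {}" using v(2) by auto
    qed
  qed
  then show ?thesis by blast
qed

section \<open>Quotients of entire series and the function F\<close>

abbreviation cfps :: "real fps \<Rightarrow> complex fps" where
  "cfps g \<equiv> Abs_fps (\<lambda>n. complex_of_real (fps_nth g n))"

lemma cfps_mult: "cfps (g * h) = cfps g * cfps h"
  by (rule fps_ext) (simp add: fps_mult_nth)

lemma cfps_inject: "cfps g = cfps h \<longleftrightarrow> g = h"
  by (auto simp: fps_eq_iff)

lemma cfps_conv_radius: "fps_conv_radius (cfps g) = fps_conv_radius g"
proof -
  have "conv_radius (\<lambda>n. norm (complex_of_real (fps_nth g n))) = conv_radius (\<lambda>n. norm (fps_nth g n))" by simp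
  then show ?thesis unfolding fps_conv_radius_def conv_radius_norm by simp
qed

lemma sums_eval_cfps: "entire g \<Longrightarrow> (\<lambda>n. complex_of_real (fps_nth g n) * z ^ n) sums eval_fps (cfps g) z"
  using sums_eval_fps[of z "cfps g"] by (simp add: cfps_conv_radius entire_iff)

text \<open>The cross products agree near 0, hence as power series. The extra factor
  \<open>fps_X\<close> forces agreement at 0 itself, where \<open>F\<close> says nothing; it is
  cancelled at the end.\<close>

lemma quotient_unique:
  assumes e: "entire g" "entire h" "entire g'" "entire h'"
    and F: "\<forall>\<^sub>F z in at 0. eval_fps (cfps g) z = F z * eval_fps (cfps h) z"
    and F': "\<forall>\<^sub>F z in at 0. eval_fps (cfps g') z = F z * eval_fps (cfps h') z"
  shows "g * h' = g' * h"
proof -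
  have ev: "eval_fps (cfps (f * k)) z = eval_fps (cfps f) z * eval_fps (cfps k) z" if "entire f" "entire k" for f k z
    unfolding cfps_mult using that by (subst eval_fps_mult) (simp_all add: cfps_conv_radius entire_iff)
  have "\<forall>\<^sub>F z in at 0. eval_fps (cfps (fps_X * (g * h'))) z = eval_fps (cfps (fps_X * (g' * h))) z"
    using F F'
  proof eventually_elim
    case (elim z)
    have X: "entire fps_X" by simp
    have gh: "entire (g * h')" "entire (g' * h)" using e by (simp_all add: entire_mult)
    have "eval_fps (cfps g) z * eval_fps (cfps h') z = eval_fps (cfps g') z * eval_fps (cfps h) z"
      unfolding elim by (simp only: mult_ac)
    then show ?case by (simp only: ev[OF X gh(1)] ev[OF X gh(2)] ev[OF e(1,4)] ev[OF e(3,2)])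
  qed
  moreover have "eval_fps (cfps (fps_X * (g * h'))) 0 = eval_fps (cfps (fps_X * (g' * h))) 0"
    by (simp add: eval_fps_at_0)
  ultimately have "\<forall>\<^sub>F z in nhds 0. eval_fps (cfps (fps_X * (g * h'))) z = eval_fps (cfps (fps_X * (g' * h))) z"
    unfolding eventually_at_filter by (auto elim!: eventually_mono)
  moreover have "fps_conv_radius (cfps (fps_X * k)) > 0" if "entire k" for k
    unfolding cfps_conv_radius entire_mult[OF entire_simps(7) that, unfolded entire_iff] by simp
  ultimately have "cfps (fps_X * (g * h')) = cfps (fps_X * (g' * h))"
    using e by (intro eval_fps_eqD) (simp_all only: entire_mult)
  then have "fps_X * (g * h') = fps_X * (g' * h)" by (simp only: cfps_inject)
  then show ?thesis by simp
qed

lemma entire_diff: "entire f \<Longrightarrow> entire g \<Longrightarrow> entire (f - g)"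
  using fps_conv_radius_diff[of f g] by (simp add: entire_iff)

text \<open>(cosh z - 1)/z - (sinh z - z)/z^2 equals (coth z - 1/z) sinh z / z. The radius pi keeps
  away from the nonzero zeros of sinh.\<close>

lemma F_can_quotient:
  "\<forall>\<^sub>F z in at 0. eval_fps (cfps (cc 1 - rr 1)) z = F_can z * eval_fps (cfps (ss 1)) z"
proof -
  have "eval_fps (cfps (cc 1 - rr 1)) z = F_can z * eval_fps (cfps (ss 1)) z" if z: "z \<noteq> 0" "norm z < pi" for z
  proof -
    let ?e = "\<lambda>f. eval_fps (cfps f) z"
    have S: "?e (ss 1) * z = sinh z"
      using sums_mult2[OF sums_eval_cfps[of "ss 1" z], of z] ss_sums_sinh[of z]
      by (intro sums_unique2[of "\<lambda>n. complex_of_real (fps_nth (ss 1) n) * z ^ Suc n"])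
        (simp_all only: entire_simps mult.assoc power_Suc2 simp_thms)
    have C: "?e (cc 1) * z = cosh z - 1"
    proof -
      have "(\<lambda>n. if even (Suc n) then z ^ Suc n /\<^sub>R fact (Suc n) else 0) sums (cosh z - 1)"
        using cosh_converges[of z] by (subst sums_Suc_iff) simp
      then have "(\<lambda>n. complex_of_real (fps_nth (cc 1) n) * z ^ Suc n) sums (cosh z - 1)"
        by (rule sums_cong[THEN iffD1, rotated]) (auto simp: scaleR_conv_of_real divide_inverse mult.commute)
      moreover have "(\<lambda>n. complex_of_real (fps_nth (cc 1) n) * z ^ Suc n) sums (?e (cc 1) * z)"
        using sums_mult2[OF sums_eval_cfps[of "cc 1" z], of z] by (simp only: entire_simps mult.assoc power_Suc2 simp_thms)
      ultimately show ?thesis by (metis sums_unique2)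
    qed
    have R: "?e (rr 1) * z * z = sinh z - z"
    proof -
      have "(\<lambda>n. complex_of_real (fps_nth (ss 1) n) * z ^ Suc n) sums sinh z" by (rule ss_sums_sinh)
      then have "(\<lambda>n. complex_of_real (fps_nth (ss 1) (Suc n)) * z ^ Suc (Suc n)) sums (sinh z - z)"
        by (subst sums_Suc_iff) simp
      then have "(\<lambda>n. complex_of_real (fps_nth (rr 1) n) * z ^ Suc (Suc n)) sums (sinh z - z)"
        by (rule sums_cong[THEN iffD1, rotated]) simp
      moreover have "(\<lambda>n. complex_of_real (fps_nth (rr 1) n) * z ^ Suc (Suc n)) sums (?e (rr 1) * z * z)"
        using sums_mult2[OF sums_mult2[OF sums_eval_cfps[of "rr 1" z], of z], of z]
        by (simp only: entire_simps mult.assoc power_Suc2 simp_thms)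
      ultimately show ?thesis by (metis sums_unique2)
    qed
    have sz: "sinh z \<noteq> 0"
    proof
      assume "sinh z = 0"
      then obtain k :: int where k: "z = \<i> * of_real pi * of_int k" using sinh_eq_0_imp by blast
      then have "k \<noteq> 0" using z(1) by auto
      then have "pi * 1 \<le> pi * \<bar>real_of_int k\<bar>" by (intro mult_left_mono) auto
      then show False using z(2) unfolding k by (simp add: norm_mult)
    qed
    have "?e (cc 1 - rr 1) = ?e (cc 1) - ?e (rr 1)"
    proof -
      have "(\<lambda>n. complex_of_real (fps_nth (cc 1 - rr 1) n) * z ^ n) sums (?e (cc 1) - ?e (rr 1))"
        using sums_diff[OF sums_eval_cfps[of "cc 1" z] sums_eval_cfps[of "rr 1" z]]
        by (simp add: algebra_simps del: nths)
      then show ?thesis using sums_eval_cfps[of "cc 1 - rr 1" z] by (metis sums_unique2 entire_diff entire_simps(4,5))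
    qed
    moreover have "?e (cc 1) = (cosh z - 1) / z" "?e (rr 1) = (sinh z - z) / (z * z)" "?e (ss 1) = sinh z / z"
      using C R S z(1) by (simp_all add: eq_divide_eq mult.assoc)
    ultimately have "?e (cc 1 - rr 1) = (cosh z - 1) / z - (sinh z - z) / (z * z)" "?e (ss 1) = sinh z / z"
      by (simp_all only:)
    moreover have "(cosh z - 1) / z - (sinh z - z) / (z * z) = F_can z * (sinh z / z)"
      using z(1) sz by (simp add: F_can_def field_simps)
    ultimately show ?thesis by (simp only:)
  qed
  then show ?thesis
    unfolding eventually_at by (intro exI[of _ pi]) (auto simp: dist_norm)
qed

text \<open>\<open>Al\<close> acts on the double of the subalgebra and \<open>A\<close> on the
  ambient one, with \<open>io\<close> and \<open>pr\<close> identifying \<open>V\<close> and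
  \<open>D0\<close>. Any admissible quotient has the same value as \<open>cc 1 - rr 1\<close> over
  \<open>ss 1\<close>, by \<open>quotient_unique\<close> and the commutation of series in
  \<open>Al\<close>.\<close>

lemma mero_calc_transport:
  fixes A :: "'d::banach \<Rightarrow> 'd" and Al :: "'w::banach \<Rightarrow> 'w"
  assumes "bounded_linear A"
    and io: "\<And>v. v \<in> V \<Longrightarrow> io v \<in> D0" "\<And>v. v \<in> V \<Longrightarrow> pr (io v) = v"
    and pr: "\<And>x. x \<in> D0 \<Longrightarrow> pr x \<in> V" "\<And>x. x \<in> D0 \<Longrightarrow> io (pr x) = x"
    and D0: "\<And>f x. entire f \<Longrightarrow> x \<in> D0 \<Longrightarrow> op_series f A x \<in> D0"
    and tr: "\<And>f v. entire f \<Longrightarrow> v \<in> V \<Longrightarrow> op_series f Al v = pr (op_series f A (io v))"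
    and bij: "bij_betw (op_series (ss 1) A) D0 D0"
    and y: "y \<in> D0" "op_series (ss 1) A y = io v" and v: "v \<in> V"
  shows "mero_calc F_can V Al v = pr (op_series (cc 1 - rr 1) A y)"
proof -
  interpret bounded_endo A by (rule bounded_endo.intro[OF assms(1)])
  let ?o = "\<lambda>f. op_series f Al"
  have oV: "?o f x \<in> V" if "entire f" "x \<in> V" for f x
    using tr[OF that] pr(1) D0 io(1) that by simp
  have om: "?o f (?o g x) = ?o (f * g) x" if "entire f" "entire g" "x \<in> V" for f g x
  proof -
    have "?o f (?o g x) = pr (op_series f A (io (pr (op_series g A (io x)))))"
      using tr[OF that(1) oV[OF that(2,3)]] tr[OF that(2,3)] by simp
    also have "\<dots> = pr (op_series f A (op_series g A (io x)))"
      using pr(2)[OF D0[OF that(2) io(1)[OF that(3)]]] by simp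
    also have "\<dots> = ?o (f * g) x" using tr[OF entire_mult[OF that(1,2)] that(3)] that by (simp add: op_series_mult)
    finally show ?thesis .
  qed
  have prinj: "a = b" if "pr a = pr b" "a \<in> D0" "b \<in> D0" for a b using that pr(2) by metis
  have ioinj: "a = b" if "io a = io b" "a \<in> V" "b \<in> V" for a b using that io(2) by metis
  have sbij: "bij_betw (?o (ss 1)) V V"
    unfolding bij_betw_def
  proof
    show "inj_on (?o (ss 1)) V"
    proof (rule inj_onI)
      fix a b assume ab: "a \<in> V" "b \<in> V" "?o (ss 1) a = ?o (ss 1) b"
      then have "op_series (ss 1) A (io a) = op_series (ss 1) A (io b)"
        using tr[of "ss 1"] by (intro prinj) (simp_all add: D0 io)
      then have "io a = io b" using bij ab io(1) unfolding bij_betw_def by (metis inj_onD)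
      then show "a = b" using ioinj ab by blast
    qed
    show "?o (ss 1) ` V = V"
    proof
      show "?o (ss 1) ` V \<subseteq> V" using oV[of "ss 1"] by auto
      show "V \<subseteq> ?o (ss 1) ` V"
      proof
        fix x assume x: "x \<in> V"
        then obtain u where u: "u \<in> D0" "op_series (ss 1) A u = io x"
          using bij io(1) unfolding bij_betw_def by (metis imageE)
        then have "?o (ss 1) (pr u) = x" using tr[of "ss 1" "pr u"] pr x io by simp
        then show "x \<in> ?o (ss 1) ` V" using pr(1)[OF u(1)] by (metis imageI)
      qed
    qed
  qed
  have iy: "inv_into V (?o (ss 1)) v = pr y"
  proof -
    have "?o (ss 1) (pr y) = v" using tr[of "ss 1" "pr y"] pr y io v by simp
    then show ?thesis using bij_betw_inv_into_left[OF sbij pr(1)[OF y(1)]] by simp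
  qed
  have ent: "fps_conv_radius (cc 1 - rr 1) = \<infinity>" "fps_conv_radius (ss 1) = \<infinity>"
    using entire_diff[of "cc 1" "rr 1"] entire_simps(3)[of 1] unfolding entire_iff[symmetric] by simp_all
  have w: "pr (op_series (cc 1 - rr 1) A y) = ?o (cc 1 - rr 1) (inv_into V (?o (ss 1)) v)"
    unfolding iy using tr[of "cc 1 - rr 1" "pr y"] pr y(1) by (simp add: entire_diff)
  show ?thesis
    unfolding mero_calc_def
  proof (rule the_equality)
    show "\<exists>g h :: real fps. fps_conv_radius g = \<infinity> \<and> fps_conv_radius h = \<infinity> \<and>
     (\<forall>\<^sub>F z in at 0. eval_fps (cfps g) z = F_can z * eval_fps (cfps h) z) \<and>
     bij_betw (op_series h Al) V V \<and>
     pr (op_series (cc 1 - rr 1) A y) = op_series g Al (inv_into V (op_series h Al) v)"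
      by (intro exI[of _ "cc 1 - rr 1"] exI[of _ "ss 1"] conjI ent F_can_quotient sbij w)
  next
    fix u
    assume "\<exists>g h :: real fps. fps_conv_radius g = \<infinity> \<and> fps_conv_radius h = \<infinity> \<and>
     (\<forall>\<^sub>F z in at 0. eval_fps (cfps g) z = F_can z * eval_fps (cfps h) z) \<and>
     bij_betw (op_series h Al) V V \<and> u = op_series g Al (inv_into V (op_series h Al) v)"
    then obtain g h where gh: "entire g" "entire h"
      "\<forall>\<^sub>F z in at 0. eval_fps (cfps g) z = F_can z * eval_fps (cfps h) z"
      "bij_betw (?o h) V V" "u = ?o g (inv_into V (?o h) v)"
      unfolding entire_iff by blast
    let ?g = "cc 1 - rr 1" and ?h = "ss 1"
    have eg: "entire ?g" "entire ?h" by (simp_all add: entire_diff)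
    have q: "g * ?h = ?g * h"
      by (rule quotient_unique[OF gh(1,2) eg gh(3) F_can_quotient])
    define x where "x = inv_into V (?o h) v"
    have x: "x \<in> V" "?o h x = v"
      unfolding x_def using gh(4) v by (metis bij_betw_def inv_into_into, metis bij_betw_inv_into_right)
    \<comment> \<open>\<open>x\<close> is the preimage of \<open>v\<close> under \<open>h\<close>.
      Once it is written as \<open>ss 1\<close> at \<open>b\<close>, the two candidate values are
      the series \<open>(cc 1 - rr 1) * h\<close> and \<open>g * ss 1\<close> at \<open>b\<close>,
      which agree by \<open>q\<close>.\<close>
    obtain b where b: "b \<in> V" "?o ?h b = x" using sbij x(1) unfolding bij_betw_def by (metis imageE)
    have "?o ?h (?o h b) = ?o h (?o ?h b)"
      using om[OF eg(2) gh(2) b(1)] om[OF gh(2) eg(2) b(1)] by (simp only: mult.commute)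
    then have "?o ?h (?o h b) = v" using b x by simp
    then have "inv_into V (?o ?h) v = ?o h b"
      using bij_betw_inv_into_left[OF sbij oV[OF gh(2) b(1)]] by simp
    then have "pr (op_series ?g A y) = ?o ?g (?o h b)" using w by simp
    also have "\<dots> = ?o (?g * h) b" using om eg gh b by simp
    also have "\<dots> = ?o (g * ?h) b" by (simp only: q)
    also have "\<dots> = ?o g (?o ?h b)" using om[OF gh(1) eg(2) b(1)] by simp
    also have "\<dots> = u" using b gh(5) by (simp add: x_def)
    finally show "u = pr (op_series ?g A y)" by simp
  qed
qed

lemma klinearD:
  assumes "klinear_on s1 s2 UNIV f"
  shows "f (x + y) = f x + f y" "f (s1 c x) = s2 c (f x)"
  using assms by (simp_all only: klinear_on_def UNIV_I ball_UNIV)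

context canon
begin

subsection \<open>The double of the subalgebra\<close>

abbreviation Q :: "('k, 'g, 'ls) qbialg" where "Q \<equiv> l_qbialg G L m"
abbreviation pt :: "'ls \<Rightarrow> 'g \<times> 'gs" where "pt p \<equiv> (0, s p)"

text \<open>The inclusion of the double of the subalgebra into the canonical double, with image
  \<open>D0\<close>; \<open>prq\<close> below is a linear left inverse defined everywhere.\<close>

definition iota :: "'g \<times> 'ls \<Rightarrow> 'g \<times> 'gs" where "iota v = (fst v, s (snd v))"
definition prq :: "'g \<times> 'gs \<Rightarrow> 'g \<times> 'ls" where "prq v = (fst v, ist (snd v))"
definition "D0 = car L \<times> annm"

lemma Q_sel [simp]: "car Q = car L" "scv Q = scv G" "scs Q = scs L" "pair Q = pair L" "brk Q = brk G"
  "varpi Q = (\<lambda>z \<alpha>. 0)" "phi Q = (\<lambda>\<alpha> \<beta> \<gamma>. phi G (s \<alpha>) (s \<beta>) (s \<gamma>))"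
  by (simp_all add: l_qbialg_def scL)

lemma pair_ad_star_Q:
  assumes "z \<in> car L" "w \<in> car L"
  shows "pair L (ad_star Q z \<alpha>) w = pair L \<alpha> (brk G z w)"
proof -
  have "ad_star Q z \<alpha> = covec_of L (\<lambda>x. pair L \<alpha> (brk G z x))"
    by (simp add: ad_star_def transp_def covec_of_def)
  moreover have "klinear_on (scv L) (*) (car L) (\<lambda>x. pair L \<alpha> (brk G z x))"
    using assms by (simp add: klinear_on_def brk_add brk_scale pairL l_brk scL)
  ultimately show ?thesis using L.pair_covec_of[of _ w] assms(2) by simp
qed

lemma s_ad_star:
  assumes "z \<in> car L" shows "s (ad_star Q z \<alpha>) = ad_star G z (s \<alpha>)"
proof (rule covecG_eqI)
  fix x
  show "pair G (s (ad_star Q z \<alpha>)) x = pair G (ad_star G z (s \<alpha>)) x"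
    using assms by (simp add: pair_s pair_ad_star_Q P_in pair_ad_star P_brk)
qed

lemma Ms_pt [simp]: "(0, s \<alpha>) \<in> Ms" by (simp add: Ms_def)
lemma Lp_l [simp]: "(z, 0) \<in> Lp \<longleftrightarrow> z \<in> car L" by (simp add: Lp_def)

lemma brq:
  assumes "z \<in> car L"
  shows "double_brk Q (0, p) (z, \<alpha>) = (vec_of G (phi G (s p) (s \<alpha>)), ad_star Q z p)"
proof -
  have "ad_star Q 0 \<alpha> = 0"
    by (rule L.covec_eqI) (simp add: pair_ad_star_Q brk_zero L.V.subspace_0[OF L.car_subspace] pairL)
  moreover have "covec_of Q (\<lambda>x. pair Q \<alpha> 0) = 0"
    by (simp add: covec_of_def[of Q] pairL covec_of_def[of L, symmetric])
      (rule L.covec_of_unique, simp add: pairL)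
  moreover have "vec_of Q (\<lambda>\<gamma>. phi Q p \<alpha> \<gamma>) = vec_of G (phi G (s p) (s \<alpha>))"
  proof -
    have "vec_of L (\<lambda>\<gamma>. phi G (s p) (s \<alpha>) (s \<gamma>)) = vec_of G (phi G (s p) (s \<alpha>))"
    proof (rule L.vec_of_unique[OF vec_ss])
      show "pair L \<gamma> (vec_of G (phi G (s p) (s \<alpha>))) = phi G (s p) (s \<alpha>) (s \<gamma>)" for \<gamma>
        using pair_s[of \<gamma> "vec_of G (phi G (s p) (s \<alpha>))"] by (simp add: P_l vec_ss pair_vec_phi)
    qed
    then show ?thesis by (simp add: vec_of_def)
  qed
  ultimately show ?thesis by (simp add: brk_zero)
qed

lemma brq_in: "v \<in> double_car Q \<Longrightarrow> double_brk Q (0, p) v \<in> double_car Q"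
  by (cases v) (auto simp: double_car_def brq vec_ss simp del: double_brk.simps)

lemma iota_brq:
  assumes "v \<in> double_car Q" shows "iota (double_brk Q (0, p) v) = br (pt p) (iota v)"
proof -
  obtain z \<alpha> where v: "v = (z, \<alpha>)" "z \<in> car L" using assms by (auto simp: double_car_def)
  have "br (pt p) ((z, 0) + (0, s \<alpha>)) = (vec_of G (phi G (s p) (s \<alpha>)), ad_star G z (s p))"
    unfolding br_add br_ss br_sl[OF v(2)] by simp
  then show ?thesis unfolding v(1) brq[OF v(2)] by (simp add: iota_def s_ad_star[OF v(2)] del: double_brk.simps)
qed

lemma prq_iota [simp]: "prq (iota v) = v" by (simp add: prq_def iota_def is_s)
lemma iota_prq: "x \<in> D0 \<Longrightarrow> iota (prq x) = x" by (auto simp: prq_def iota_def D0_def s_is)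
lemma iota_D0: "v \<in> double_car Q \<Longrightarrow> iota v \<in> D0" by (auto simp: iota_def D0_def double_car_def s_annm)
lemma prq_in: "x \<in> D0 \<Longrightarrow> prq x \<in> double_car Q" by (auto simp: prq_def D0_def double_car_def)

lemma prq_klin: "klinear_on (double_scale G) (double_scale Q) UNIV prq"
  by (simp add: klinear_on_def prq_def double_scale_def prod_scale_def is_add is_scale)

lemma fdQ: "fd_vector_space (double_scale Q)"
  unfolding double_scale_def Q_sel by (rule fd_prod[OF G.V.fd L.S.fd])

lemma prq_bl: "bounded_linear prq" by (rule klinear_bounded[OF fdsc fdQ prq_klin])

lemma D0_subspace: "D.subspace D0"
  unfolding D0_def by (rule subspace_Times[OF l_subspace annm_subspace])

lemma D0_eq: "D0 = {z + a | z a. z \<in> Lp \<and> a \<in> Ms}"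
proof
  show "D0 \<subseteq> {z + a | z a. z \<in> Lp \<and> a \<in> Ms}"
  proof
    fix v assume "v \<in> D0"
    then have "v = (fst v, 0) + (0, s (ist (snd v)))" "(fst v, 0) \<in> Lp" "(0, s (ist (snd v))) \<in> Ms"
      by (auto simp: D0_def s_is)
    then show "v \<in> {z + a | z a. z \<in> Lp \<and> a \<in> Ms}" by blast
  qed
  show "{z + a | z a. z \<in> Lp \<and> a \<in> Ms} \<subseteq> D0" by (auto simp: Lp_def Ms_def D0_def s_annm)
qed

lemma D0I: "x \<in> Lp \<Longrightarrow> x \<in> D0" "x \<in> Ms \<Longrightarrow> x \<in> D0"
  by (auto simp: Lp_def Ms_def D0_def s_annm G.S.subspace_0[OF annm_subspace] L.V.subspace_0[OF L.car_subspace])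

lemma br_D0: "p \<in> Ms \<Longrightarrow> x \<in> D0 \<Longrightarrow> br p x \<in> D0"
proof -
  assume p: "p \<in> Ms" "x \<in> D0"
  obtain z a where x: "x = z + a" "z \<in> Lp" "a \<in> Ms" using p(2) unfolding D0_eq by blast
  show "br p x \<in> D0"
    unfolding x(1) br_add using D.subspace_add[OF D0_subspace D0I(2)[OF brML[OF p(1) x(2)]] D0I(1)[OF brMM[OF p(1) x(3)]]] .
qed

lemma op_D0: "p \<in> Ms \<Longrightarrow> entire f \<Longrightarrow> x \<in> D0 \<Longrightarrow> op f p x \<in> D0"
proof (rule op_mem[OF D0_subspace])
  assume p: "p \<in> Ms" "x \<in> D0"
  show "(br p ^^ n) x \<in> D0" for n by (induction n) (simp_all add: p br_D0)
qed

lemma op_brq: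
  assumes f: "entire f" and v: "v \<in> double_car Q"
  shows "op_series f (double_brk Q (0, p)) v = prq (op f (pt p) (iota v))"
proof (rule op_series_intertwine[OF prq_bl A.P.op_summable[OF f], symmetric])
  fix n
  have "(double_brk Q (0, p) ^^ n) v \<in> double_car Q \<and> (br (pt p) ^^ n) (iota v) = iota ((double_brk Q (0, p) ^^ n) v)"
    by (induction n) (simp_all add: v brq_in iota_brq del: double_brk.simps)
  then show "prq ((br (pt p) ^^ n) (iota v)) = (double_brk Q (0, p) ^^ n) v" by simp
qed

lemma double_car_Q_subspace: "module.subspace (double_scale Q) (double_car Q)"
proof -
  interpret DQ: fd_space "double_scale Q" using fdQ by unfold_locales
  show ?thesis
    unfolding DQ.subspace_def
    using l_subspace[unfolded G.V.subspace_def] by (auto simp: double_car_def double_scale_def prod_scale_def zero_prod_def)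
qed

text \<open>The condition on the square of ad p passes along the injective intertwiner
  \<open>iota\<close> from the double of the subalgebra to \<open>D0\<close>, where
  \<open>ss_inj_on_iff\<close> applies.\<close>

lemma spectrum_iff:
  "cspectrum (double_scale Q) (double_car Q) (double_brk Q (0, p))
     \<inter> {\<i> * of_real pi * of_int k | k :: int. k \<noteq> 0} = {} \<longleftrightarrow> inj_on (op (ss 1) (pt p)) D0"
proof -
  let ?A = "double_brk Q (0, p)" and ?V = "double_car Q"
  interpret DQ: fd_space "double_scale Q" using fdQ by unfold_locales
  note VS = double_car_Q_subspace
  have iad: "iota (v + w) = iota v + iota w" for v w by (simp add: iota_def s_add)
  have isc: "iota (double_scale Q c v) = double_scale G c (iota v)" for c v
    by (simp add: iota_def double_scale_def prod_scale_def s_scale)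
  have A1: "?A v = prq (br (pt p) (iota v))" if "v \<in> ?V" for v
    unfolding iota_brq[OF that, symmetric] by simp
  have A: "klinear_on (double_scale Q) (double_scale Q) ?V ?A"
    unfolding klinear_on_def
  proof (intro conjI ballI allI)
    fix v w assume v: "v \<in> ?V" "w \<in> ?V"
    have vw: "v + w \<in> ?V" using DQ.subspace_add[OF VS] v by blast
    show "?A (v + w) = ?A v + ?A w"
      unfolding A1[OF v(1)] A1[OF v(2)] A1[OF vw] iad br_add
      by (rule klinearD[OF prq_klin])
  next
    fix c v assume v: "v \<in> ?V"
    have cv: "double_scale Q c v \<in> ?V" using DQ.subspace_scale[OF VS] v by blast
    show "?A (double_scale Q c v) = double_scale Q c (?A v)"
      unfolding A1[OF v] A1[OF cv] isc
      klinearD(2)[OF br_klin] by (rule klinearD(2)[OF prq_klin])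
  qed
  have eq: "?A (?A v) = r *\<^sub>R v \<longleftrightarrow> br (pt p) (br (pt p) (iota v)) = r *\<^sub>R iota v" if v: "v \<in> ?V" for r v
  proof -
    have 1: "br (pt p) (br (pt p) (iota v)) = iota (?A (?A v))"
      unfolding iota_brq[OF v, symmetric] iota_brq[OF brq_in[OF v], symmetric] ..
    have 2: "r *\<^sub>R iota v = iota (r *\<^sub>R v)" by (simp add: iota_def linear_scale[OF s_rlin])
    show ?thesis unfolding 1 2 by (metis prq_iota)
  qed
  have z: "iota v = 0 \<longleftrightarrow> v = 0" for v
  proof -
    have "iota 0 = 0" by (simp add: iota_def linear_0[OF s_rlin] zero_prod_def)
    then show ?thesis by (metis prq_iota)
  qed
  have "(\<exists>v\<in>?V. \<exists>k::int. k \<noteq> 0 \<and> v \<noteq> 0 \<and> ?A (?A v) = - ((pi * real_of_int k)\<^sup>2) *\<^sub>R v) \<longleftrightarrow>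
    (\<exists>v\<in>D0. \<exists>k::int. k \<noteq> 0 \<and> v \<noteq> 0 \<and> br (pt p) (br (pt p) v) = - ((pi * real_of_int k)\<^sup>2) *\<^sub>R v)"
    (is "?l \<longleftrightarrow> ?r")
  proof
    assume ?l then show ?r using eq z iota_D0 by metis
  next
    assume ?r then show ?l using eq z iota_prq prq_in by metis
  qed
  moreover have "br (pt p) ` D0 \<subseteq> D0" using br_D0 by auto
  ultimately show ?thesis
    using cspectrum_sinh[OF fdQ VS A] brq_in
      A.P.ss_inj_on_iff[OF D.finite_dim D.real_subspace[OF D0_subspace], of "pt p"]
    by (simp add: image_subset_iff del: double_brk.simps)
qed

subsection \<open>The trivialisation\<close>

abbreviation "Ag \<equiv> Ad_gg G L m"
abbreviation "UU \<equiv> U_can G L m"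
abbreviation "T \<equiv> T_map G L m"
abbreviation "lc \<equiv> l_can G L m"
abbreviation "fibA \<equiv> (UNIV :: 'ls set) \<times> g0_star G L"
abbreviation "fibN \<equiv> car L \<times> (UNIV :: 'gs set)"

lemma U_iff: "p \<in> UU \<longleftrightarrow> inj_on (op (ss 1) (pt p)) D0 \<and> bij (Ag p)"
  unfolding U_can_def mem_Collect_eq spectrum_iff ..

lemma Ad_neg: "Ad_exp G (0, - s p) v = E (- 1) (pt p) v"
proof -
  have m: "(0, - s p) = - pt p" by simp
  have "(br (- pt p) ^^ n) v = (- 1) ^ n *\<^sub>R (br (pt p) ^^ n) v" for n
    by (induction n) (simp_all add: br_minus bounded_bilinear.scaleR_right[OF bb_br] del: double_brk.simps uminus_Pair)
  then show ?thesis
    unfolding Ad_exp_def op_series_def m by (simp add: power_minus_mult del: double_brk.simps uminus_Pair)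
qed

lemma Ag_eq: "Ag p x = fst (E (- 1) (pt p) (x, 0))" unfolding Ad_gg_def Ad_neg ..

lemma Ag_klin: "klinear_on (scv G) (scv G) UNIV (Ag p)"
proof -
  have 1: "(x + y, 0) = (x, 0) + (y, 0 :: 'gs)" "(scv G c x, 0) = double_scale G c (x, 0)" for x y c
    using G.S.scale_zero_right by (simp_all add: double_scale_def prod_scale_def)
  show ?thesis
    unfolding klinear_on_def Ag_eq 1 klinearD[OF op_klin[OF entire_simps(1)]]
    by (simp add: double_scale_def prod_scale_def)
qed

lemma rlin_Ag: "linear (Ag p)" by (rule klinear_real_linear[OF G.V.fd G.V.fd Ag_klin])

lemma fst_E_split: "fst (E t (pt p) (x, \<zeta>)) = fst (E t (pt p) (x, 0)) + fst (E t (pt p) (0, \<zeta>))"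
  using op_add[of "fps_exp t" "pt p" "(x, 0)" "(0, \<zeta>)"] by simp

lemma fps_quotients: "(fps_sinh - fps_X) / fps_X ^ 2 = rr 1" "fps_sinh / fps_X = ss 1" "fps_sinh = fps_X * ss 1"
proof -
  show "(fps_sinh - fps_X) / fps_X ^ 2 = rr 1"
    by (rule fps_ext) (simp only: fps_sinh_minus_X_div_X2_nth nths power_one)
  show "fps_sinh / fps_X = ss 1" by (rule fps_ext) (simp only: fps_sinh_div_X_nth nths power_one)
  show "fps_sinh = fps_X * ss 1"
  proof (rule fps_ext)
    show "fps_nth fps_sinh n = fps_nth (fps_X * ss 1) n" for n
      by (cases n) (simp_all add: fps_sinh_nth del: fact_Suc)
  qed
qed

lemma entire_sinh: "entire fps_sinh" unfolding fps_quotients(3) by (simp add: entire_mult)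

lemma T_def': "T p v =
  (fst (op (rr 1) (pt p) (0, s (fst v)) - op (ss 1) (pt p) (fst (snd v), 0)),
   snd (op (ss 1) (pt p) (0, s (fst v)) - op fps_sinh (pt p) (fst (snd v), 0) - E 1 (pt p) (0, snd (snd v))))"
  unfolding T_map_def Let_def split_beta fps_quotients(1,2) Ad_exp_def ..

lemma T_klin: "klinear_on (prod_scale (scs L) (double_scale G)) (double_scale G) UNIV (T p)"
proof -
  have 1: "(0, s (\<alpha> + \<beta>)) = pt \<alpha> + pt \<beta>" "(x + y, 0) = (x, 0) + (y, 0 :: 'gs)" "(0, \<xi> + \<eta>) = (0 :: 'g, \<xi>) + (0, \<eta>)"
    "(0, s (scs L c \<alpha>)) = double_scale G c (pt \<alpha>)" "(scv G c x, 0) = double_scale G c (x, 0 :: 'gs)"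
    "(0, scs G c \<xi>) = double_scale G c (0 :: 'g, \<xi>)" for \<alpha> \<beta> x y \<xi> \<eta> c
    by (simp_all add: double_scale_def prod_scale_def s_add s_scale)
  note E = entire_simps(3) entire_simps(5) entire_sinh entire_simps(1)
  note o = E[THEN op_klin, THEN klinearD(1)] E[THEN op_klin, THEN klinearD(2)]
  have d: "fst (double_scale G c v) = scv G c (fst v)" "snd (double_scale G c v) = scs G c (snd v)" for c v
    by (simp_all add: double_scale_def prod_scale_def)
  show ?thesis
    unfolding klinear_on_def
  proof (intro conjI ballI allI)
    show "T p (v + w) = T p v + T p w" for v w
      unfolding T_def' fst_add snd_add 1(1-3) o(1-4) by (simp del: double_brk.simps)
    show "T p (prod_scale (scs L) (double_scale G) c v) = double_scale G c (T p v)" for c v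
      unfolding T_def' prod_scale_def[of "scs L"] fst_conv snd_conv d 1(4-6) o(5-8)
      unfolding prod_eq_iff d fst_conv snd_conv fst_diff snd_diff
      by (simp add: G.V.scale_right_diff_distrib G.S.scale_right_diff_distrib d del: double_brk.simps)
  qed
qed

definition TwT :: "'ls \<Rightarrow> 'ls \<times> ('g \<times> 'gs) \<Rightarrow> 'g \<times> 'gs" where
  "TwT p v = Tw (pt p) (pt (fst v)) (fst (snd v), 0)"

definition TXT :: "'ls \<Rightarrow> 'ls \<times> ('g \<times> 'gs) \<Rightarrow> 'g \<times> 'gs" where
  "TXT p v = TX (pt p) (pt (fst v)) (snd v)"

lemma TwT_Lp: assumes "v \<in> fibA" shows "TwT p v \<in> Lp"
proof -
  have "(fst (snd v), 0) \<in> Lp" using assms by (auto simp: g0_star_def)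
  then show ?thesis
    unfolding TwT_def Tw_def by (intro D.subspace_diff[OF subL] op_odd_M op_even_L) simp_all
qed

text \<open>Splits X along the grading: its part in \<open>Ms\<close> is - (A w + s \<alpha>), and
  the others lie in \<open>Lp\<close> and \<open>D1\<close>. It rests on e^A = cosh A + A S and S =
  1 + A R with S = sinh A / A and R = (sinh A - A) / A^2.\<close>

lemma TXT_eq:
  assumes "v \<in> fibA"
  shows "TXT p v = - (br (pt p) (TwT p v) + pt (fst v))
      - (op (cc 1) (pt p) (pt (fst v)) - op ch (pt p) (fst (snd v), 0)) + E 1 (pt p) (0, snd (snd v))"
    "op (cc 1) (pt p) (pt (fst v)) - op ch (pt p) (fst (snd v), 0) \<in> Lp"
    "E 1 (pt p) (0, snd (snd v)) \<in> D1"
proof -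
  let ?p = "pt p" and ?a = "pt (fst v)" and ?z = "(fst (snd v), 0) :: 'g \<times> 'gs"
  have zL: "?z \<in> Lp" and x: "(0, snd (snd v)) \<in> D1"
    using assms by (auto simp: g0_star_def D1_def G.V.subspace_0[OF m_subspace])
  show "op (cc 1) ?p ?a - op ch ?p ?z \<in> Lp"
    using zL by (intro D.subspace_diff[OF subL] op_odd_M op_even_L) simp_all
  show "E 1 ?p (0, snd (snd v)) \<in> D1" by (rule op_D1[OF Ms_pt _ x]) simp
  have "snd v = ?z + (0, snd (snd v))" by (simp add: prod_eq_iff)
  then have "TXT p v = op ch ?p ?z + br ?p (op (ss 1) ?p ?z) + E 1 ?p (0, snd (snd v)) - (op (ss 1) ?p ?a + op (cc 1) ?p ?a)"
    unfolding TXT_def TX_def op_th op_exp[symmetric] by (metis op_add entire_simps(1))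
  also have "\<dots> = - (br ?p (TwT p v) + ?a) - (op (cc 1) ?p ?a - op ch ?p ?z) + E 1 ?p (0, snd (snd v))"
    unfolding TwT_def Tw_def br_diff op_ss[of ?p ?a] by (simp del: double_brk.simps)
  finally show "TXT p v = - (br ?p (TwT p v) + ?a) - (op (cc 1) ?p ?a - op ch ?p ?z) + E 1 ?p (0, snd (snd v))" .
qed

lemma br_Tw:
  assumes "v \<in> fibA"
  shows "br (pt p) (TwT p v) = pt (ad_star Q (fst (TwT p v)) p)"
proof -
  have "TwT p v = (fst (TwT p v), 0)" "fst (TwT p v) \<in> car L" using TwT_Lp[OF assms, of p] by (auto simp: Lp_def)
  then show ?thesis by (metis br_sl s_ad_star)
qed

text \<open>The part of X in \<open>Lp\<close> has no dual component, so \<open>- snd X\<close>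
  consists exactly of the terms of the second component of \<open>T\<close>.\<close>

lemma T_eq:
  assumes "v \<in> fibA" shows "T p v = (fst (TwT p v), - snd (TXT p v))"
proof -
  let ?p = "pt p" and ?a = "pt (fst v)" and ?z = "(fst (snd v), 0) :: 'g \<times> 'gs"
  have "op fps_sinh ?p ?z = br ?p (op (ss 1) ?p ?z)"
    unfolding fps_quotients(3) by (rule op_series_X_mult[OF bl_br bl_br]) simp
  then have "op (ss 1) ?p ?a - op fps_sinh ?p ?z = br ?p (TwT p v) + ?a"
    unfolding TwT_def Tw_def br_diff op_ss[of ?p ?a] by simp
  moreover have "snd (op (cc 1) ?p ?a - op ch ?p ?z) = 0"
    using TXT_eq(2)[OF assms] unfolding Lp_def by (metis mem_Times_iff singletonD)
  ultimately show ?thesis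
    unfolding T_def' TXT_eq(1)[OF assms, of p] by (simp add: TwT_def Tw_def del: double_brk.simps)
qed

lemma fst_T: "v \<in> fibA \<Longrightarrow> fst (T p v) = fst (TwT p v)" by (simp add: T_eq)

lemma snd_T:
  assumes "v \<in> fibA"
  shows "snd (T p v) = s (ad_star Q (fst (T p v)) p + fst v) - snd (E 1 (pt p) (0, snd (snd v)))"
proof -
  have "snd (op (cc 1) (pt p) (pt (fst v)) - op ch (pt p) (fst (snd v), 0)) = 0"
    using TXT_eq(2)[OF assms] unfolding Lp_def by (metis mem_Times_iff singletonD)
  then show ?thesis
    unfolding T_eq[OF assms] TXT_eq(1)[OF assms, of p] br_Tw[OF assms] by (simp add: s_add)
qed

lemma snd_E_annl: "v \<in> fibA \<Longrightarrow> snd (E 1 (pt p) (0, snd (snd v))) \<in> annl"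
  using TXT_eq(3)[of v p] by (auto simp: D1_def)

lemma ist_T: "v \<in> fibA \<Longrightarrow> ist (snd (T p v)) = ad_star Q (fst (T p v)) p + fst v"
  using snd_E_annl[of v p] unfolding snd_T is_annl by (simp add: linear_diff[OF is_rlin] is_s)

lemma anchor_T: "v \<in> fibA \<Longrightarrow> N_anchor G L m p (T p v) = fst v"
  unfolding N_anchor_def using ist_T[of v p] by simp

lemma T_in: "v \<in> fibA \<Longrightarrow> T p v \<in> fibN"
  using TwT_Lp[of v p] by (auto simp: T_eq Lp_def)

lemma fibA_subspace: "module.subspace (prod_scale (scs L) (double_scale G)) fibA"
proof -
  interpret FA: fd_space "prod_scale (scs L) (double_scale G)" by unfold_locales (rule fd_prod[OF L.S.fd fdsc])
  show ?thesis unfolding FA.subspace_def using g0_subspace[unfolded D.subspace_def]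
    by (auto simp: prod_scale_def zero_prod_def)
qed

text \<open>The two terms of \<open>l_can\<close> match the grading of X: the meromorphic one
  accounts for the part in \<open>Lp\<close> and for w, the one with the inverse for the first
  component of the part in \<open>D1\<close>.\<close>

lemma l_T:
  assumes p: "p \<in> UU" and v: "v \<in> fibA"
  shows "(lc p (snd (T p v)), snd (T p v)) = - TXT p v - TwT p v"
proof -
  let ?p = "pt p" and ?a = "pt (fst v)" and ?z = "(fst (snd v), 0) :: 'g \<times> 'gs"
  let ?e = "E 1 ?p (0, snd (snd v))" and ?al = "ad_star Q (fst (T p v)) p + fst v"
  let ?c = "op (cc 1) ?p ?a - op ch ?p ?z"
  have zL: "?z \<in> Lp" using v by (auto simp: g0_star_def)
  have Sinj: "inj_on (op (ss 1) ?p) D0" and Ab: "bij (Ag p)" using p by (simp_all add: U_iff)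
  have S: "op (ss 1) ?p ` D0 \<subseteq> D0" using op_D0[OF Ms_pt] by auto
  have "op (ss 1) ?p ` D0 = D0"
    by (rule linear_inj_on_surj_on[OF D.finite_dim op_lin D.real_subspace[OF D0_subspace] S Sinj]) simp
  then have Sb: "bij_betw (op (ss 1) ?p) D0 D0" using Sinj by (simp add: bij_betw_def)
  \<comment> \<open>\<open>ss 1\<close> maps \<open>?y\<close> to the image of
    \<open>(0, ?al)\<close> under \<open>iota\<close>, so F(ad p) at that point is
    \<open>cc 1 - rr 1\<close> at \<open>?y\<close>.\<close>
  let ?y = "?a - br ?p ?z"
  have y: "?y \<in> D0"
    by (intro D.subspace_diff[OF D0_subspace] D0I(2) brML Ms_pt zL)
  have Sy: "op (ss 1) ?p ?y = iota (0, ?al)"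
  proof -
    have "op (ss 1) ?p ?y = br ?p (TwT p v) + ?a"
      unfolding op_diff[OF entire_simps(3)] op_series_commute[OF bl_br bl_br entire_simps(3)] TwT_def Tw_def br_diff op_ss[of ?p ?a]
      by (simp del: double_brk.simps)
    then show ?thesis unfolding br_Tw[OF v] fst_T[OF v] by (simp add: iota_def s_add)
  qed
  have "mero_calc F_can (double_car Q) (double_brk Q (0, p)) (0, ?al) = prq (op (cc 1 - rr 1) ?p ?y)"
  proof (rule mero_calc_transport[of "br ?p" "double_car Q" iota D0 prq])
    show "bounded_linear (br ?p)" by (rule bl_br)
    show "op f ?p x \<in> D0" if "entire f" "x \<in> D0" for f x using op_D0[OF Ms_pt that] .
    show "(0, ?al) \<in> double_car Q" by (simp add: double_car_def L.V.subspace_0[OF L.car_subspace])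
  qed (simp_all only: iota_D0 prq_iota prq_in iota_prq op_brq Sb y Sy)
  then have m1: "fst (mero_calc F_can (double_car Q) (double_brk Q (0, p)) (0, ?al)) = fst (op (cc 1 - rr 1) ?p ?y)"
    by (simp add: prq_def)
  have c1: "br ?p (op (cc 1) ?p ?z) = op ch ?p ?z - ?z"
  proof -
    have "br ?p (op (cc 1) ?p ?z) = op (ch - 1) ?p ?z"
      unfolding X_mult_cc[symmetric] by (rule op_series_X_mult[OF bl_br bl_br, symmetric]) simp
    then show ?thesis
      using op_series_diff[OF bl_br bl_br, of ch 1] entire_bound[of 1 1 1] by (simp add: op_one)
  qed
  have "op (cc 1 - rr 1) ?p ?y = op (cc 1) ?p ?y - op (rr 1) ?p ?y"
    by (rule op_series_diff[OF bl_br bl_br]) simp_all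
  also have "\<dots> = (op (cc 1) ?p ?a - br ?p (op (cc 1) ?p ?z)) - (op (rr 1) ?p ?a - br ?p (op (rr 1) ?p ?z))"
    unfolding op_diff[OF entire_simps(4)] op_diff[OF entire_simps(5)]
      op_series_commute[OF bl_br bl_br entire_simps(4)] op_series_commute[OF bl_br bl_br entire_simps(5)] ..
  also have "\<dots> = ?c - TwT p v"
    unfolding c1 TwT_def Tw_def op_ss[of ?p ?z] by simp
  finally have f1: "fst (mero_calc F_can (double_car Q) (double_brk Q (0, p)) (0, ?al)) = fst ?c - fst (TwT p v)"
    unfolding m1 by simp
  have ist: "ist (snd (T p v)) = ?al" by (rule ist_T[OF v])
  have xi: "snd (T p v) - s ?al = - snd ?e" using snd_T[OF v, of p] by simp
  \<comment> \<open>\<open>E (- 1)\<close> takes \<open>?e\<close> back to a vector without first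
    component. Splitting \<open>?e\<close> into its components shows that
    \<open>Ag p (fst ?e)\<close> is what the inverse in \<open>l_can\<close> is applied to.\<close>
  have "0 = fst (E (- 1) ?p ?e)" unfolding E_inv by simp
  also have "\<dots> = Ag p (fst ?e) + fst (E (- 1) ?p (0, snd ?e))"
    unfolding Ag_eq using fst_E_split[of "- 1" p "fst ?e" "snd ?e"] by simp
  finally have "fst (E (- 1) ?p (- (0, snd ?e))) = Ag p (fst ?e)"
    unfolding op_minus[OF entire_simps(1)] by (simp add: eq_neg_iff_add_eq_0 neg_eq_iff_add_eq_0 add.commute)
  then have f2: "inv (Ag p) (fst (Ad_exp G (0, - s p) (0, - snd ?e))) = fst ?e"
    unfolding Ad_neg using Ab by (simp add: bij_is_inj)
  have l: "lc p (snd (T p v)) = fst ?c - fst (TwT p v) - fst ?e"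
    unfolding l_can_def Let_def ist xi f1 f2 ..
  have "fst (- TXT p v - TwT p v) = fst ?c - fst (TwT p v) - fst ?e"
    unfolding TXT_eq(1)[OF v, of p] br_Tw[OF v] by simp
  moreover have "snd (TwT p v) = 0" using TwT_Lp[OF v, of p] by (auto simp: Lp_def)
  ultimately show ?thesis unfolding l by (simp add: prod_eq_iff T_eq[OF v])
qed

lemma S_bij_L: assumes "p \<in> UU" shows "op (ss 1) (pt p) ` Lp = Lp"
proof (rule linear_inj_on_surj_on[OF D.finite_dim op_lin D.real_subspace[OF subL]])
  show "op (ss 1) (pt p) ` Lp \<subseteq> Lp" by (auto intro!: op_even_L)
  have "Lp \<subseteq> D0" using D0I(1) by blast
  then show "inj_on (op (ss 1) (pt p)) Lp" using assms inj_on_subset by (auto simp: U_iff)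
qed simp

lemma E_D0: "x \<in> D0 \<Longrightarrow> E t (pt p) x \<in> D0" by (rule op_D0) simp_all
lemma E_D1: "x \<in> D1 \<Longrightarrow> E t (pt p) x \<in> D1" by (rule op_D1) simp_all

lemma T_lin: "linear (T p)" by (rule klinear_real_linear[OF fd_prod[OF L.S.fd fdsc] fdsc T_klin])

text \<open>The anchor determines \<alpha>; then the first component determines z because
  \<open>ss 1\<close> is injective on \<open>D0\<close>, and the second determines \<xi> because
  \<open>Ag p\<close> is injective.\<close>

lemma T_inj: assumes p: "p \<in> UU" shows "inj_on (T p) fibA"
proof -
  interpret FA: fd_space "prod_scale (scs L) (double_scale G)" by unfold_locales (rule fd_prod[OF L.S.fd fdsc])
  have "v = 0" if v: "v \<in> fibA" and z: "T p v = 0" for v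
  proof -
    have ad0: "ad_star Q 0 p = 0"
      by (rule L.covec_eqI) (simp add: pair_ad_star_Q brk_zero L.V.subspace_0[OF L.car_subspace] pairL)
    have a: "fst v = 0" using anchor_T[OF v, of p] unfolding z N_anchor_def by (simp add: linear_0[OF is_rlin] ad0)
    have pt0: "pt 0 = 0" by (simp add: linear_0[OF s_rlin] zero_prod_def)
    have zL: "(fst (snd v), 0) \<in> Lp" using v by (auto simp: g0_star_def)
    have "TwT p v = 0" using fst_T[OF v, of p] TwT_Lp[OF v, of p] z by (auto simp: Lp_def prod_eq_iff)
    then have "op (ss 1) (pt p) (fst (snd v), 0) = op (ss 1) (pt p) 0"
      unfolding TwT_def Tw_def a pt0 by (simp add: op_zero)
    then have z0: "(fst (snd v), 0 :: 'gs) = 0"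
      using p D0I(1)[OF zL] D.subspace_0[OF D0_subspace] by (auto simp: U_iff dest: inj_onD)
    let ?e = "E 1 (pt p) (0, snd (snd v))"
    have "snd ?e = 0"
      using snd_T[OF v, of p] unfolding z by (simp add: a linear_0[OF s_rlin] ad0)
    then have e: "?e = (fst ?e, 0)" by (simp add: prod_eq_iff)
    then have "fst (E (- 1) (pt p) (fst ?e, 0)) = fst (E (- 1) (pt p) ?e)" by simp
    then have "Ag p (fst ?e) = Ag p 0" unfolding Ag_eq[of p "fst ?e"] E_inv by (simp add: linear_0[OF rlin_Ag])
    then have "fst ?e = 0" using p by (auto simp: U_iff bij_def dest: injD)
    then have "E 1 (pt p) (0, snd (snd v)) = 0" using e by (simp add: zero_prod_def)
    then have "(0, snd (snd v)) = (0 :: 'g \<times> 'gs)" using E_inv[of 1 "pt p" "(0, snd (snd v))"] by (simp add: op_zero)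
    then show ?thesis using a z0 by (simp add: prod_eq_iff)
  qed
  then show ?thesis
    using linear_inj_on_iff_eq_0[OF T_lin FA.real_subspace[OF fibA_subspace]] by blast
qed

text \<open>Solved in the same triangular order; the last stage needs \<open>\<xi>\<close> in the
  annihilator whose exponential has the dual component \<open>\<zeta>\<close>.\<close>

lemma T_surj: assumes p: "p \<in> UU" and w: "w \<in> car L" shows "\<exists>v\<in>fibA. T p v = (w, \<eta>)"
proof -
  let ?p = "pt p"
  \<comment> \<open>Forced, since the anchor of \<open>T p v\<close> is
    \<open>fst v\<close>.\<close>
  define \<alpha> where "\<alpha> = ist \<eta> - ad_star Q w p"
  define \<zeta> where "\<zeta> = s (ist \<eta>) - \<eta>"
  have \<zeta>: "\<zeta> \<in> annl" using G.S.subspace_neg[OF annl_subspace minus_s_is, of \<eta>] by (simp add: \<zeta>_def)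
  have "op (rr 1) ?p (pt \<alpha>) - (w, 0) \<in> op (ss 1) ?p ` Lp"
    unfolding S_bij_L[OF p] by (intro D.subspace_diff[OF subL] op_odd_M) (simp_all add: w)
  then obtain Z where Z2: "op (rr 1) ?p (pt \<alpha>) - (w, 0) = op (ss 1) ?p Z" and Z1: "Z \<in> Lp" by (rule imageE)
  obtain z where z: "Z = (z, 0)" "z \<in> car L" using Z1 by (auto simp: Lp_def)
  have Ab: "bij (Ag p)" using p by (simp add: U_iff)
  \<comment> \<open>The missing first component of the exponential: \<open>x\<close> is chosen so
    that \<open>E (- 1)\<close> maps \<open>(x, \<zeta>)\<close> to a vector with first component
    0.\<close>
  obtain x where x: "Ag p x = - fst (E (- 1) ?p (0, \<zeta>))" using surjD[OF bij_is_surj[OF Ab]] by metis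
  \<comment> \<open>\<open>Ag p\<close> preserves both \<open>m\<close> and \<open>car L\<close>; as
    its value at \<open>x\<close> lies in \<open>m\<close>, injectivity forces \<open>x\<close> into
    \<open>m\<close>, which puts the solution into \<open>D1\<close>.\<close>
  have Agm: "Ag p y \<in> m" if "y \<in> m" for y
    unfolding Ag_eq using E_D1[of "(y, 0)" "- 1" p] that by (auto simp: D1_def G.S.subspace_0[OF annl_subspace])
  have Agl: "Ag p y \<in> car L" if "y \<in> car L" for y
    unfolding Ag_eq using E_D0[of "(y, 0)" "- 1" p] that by (auto simp: D0_def G.S.subspace_0[OF annm_subspace])
  have "fst (E (- 1) ?p (0, \<zeta>)) \<in> m"
    using E_D1[of "(0, \<zeta>)" "- 1" p] \<zeta> by (auto simp: D1_def G.V.subspace_0[OF m_subspace])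
  then have "Ag p x \<in> m" unfolding x by (rule G.V.subspace_neg[OF m_subspace])
  moreover have "Ag p (P x) = Ag p x - Ag p (x - P x)" by (simp add: linear_diff[OF rlin_Ag])
  ultimately have "Ag p (P x) \<in> m" 
    by (simp only: G.V.subspace_diff[OF m_subspace] Agm[OF P_m])
  then have "Ag p (P x) = Ag p 0" using lm_int[OF Agl[OF P_in]] by (simp add: linear_0[OF rlin_Ag])
  then have "P x = 0" using Ab by (auto simp: bij_def dest: injD)
  then have xm: "x \<in> m" using P_m[of x] by simp
  define X where "X = E (- 1) ?p (x, \<zeta>)"
  have "fst X = 0" unfolding X_def fst_E_split[of "- 1" p x \<zeta>] Ag_eq[symmetric] x by simp
  moreover have "X \<in> D1" unfolding X_def by (rule E_D1) (simp add: D1_def xm \<zeta>)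
  ultimately obtain \<xi> where X: "X = (0, \<xi>)" "\<xi> \<in> annl" by (auto simp: D1_def)
  have EX: "E 1 ?p (0, \<xi>) = (x, \<zeta>)"
    unfolding X(1)[symmetric] X_def using E_inv'[of 1 ?p "(x, \<zeta>)"] by simp
  let ?v = "(\<alpha>, (z, \<xi>))"
  have v: "?v \<in> fibA" using z X by (simp add: g0_star_def)
  have f: "fst (T p ?v) = w"
    unfolding fst_T[OF v] TwT_def Tw_def using Z2[unfolded z(1), symmetric] by simp
  have "snd (T p ?v) = \<eta>"
    unfolding snd_T[OF v] f using EX by (simp add: \<alpha>_def \<zeta>_def)
  then show ?thesis using v f by (metis prod.collapse)
qed

lemma T_bij: "p \<in> UU \<Longrightarrow> bij_betw (T p) fibA fibN"
  unfolding bij_betw_def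
proof (intro conjI T_inj subset_antisym subsetI)
  fix y assume "p \<in> UU" "y \<in> fibN"
  then show "y \<in> T p ` fibA" using T_surj[of p "fst y" "snd y"] by (metis imageI mem_Times_iff prod.collapse)
next
  fix y assume "y \<in> T p ` fibA"
  then show "y \<in> fibN" using T_in by blast
qed

subsection \<open>Dependence on the base point\<close>

lemma pt_klin: "klinear_on (scs L) (double_scale G) UNIV pt"
  by (simp add: klinear_on_def s_add s_scale double_scale_def prod_scale_def)

lemma op_param_pt: "op_param (scs L) (double_scale G) (\<lambda>p. br (pt p))"
proof -
  have k: "klinear_on (scs L) (double_scale G) UNIV (\<lambda>p. br (pt p) x)" for x
    by (rule klinear_on_comp[OF pt_klin br_klin2])
  have "bounded_bilinear (\<lambda>p. br (pt p))"
    by (rule finite_dim_bilinear_bounded[OF L.S.finite_dim D.finite_dim])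
      (rule klinear_real_linear[OF L.S.fd fdsc k] klinear_real_linear[OF fdsc fdsc br_klin])+
  then show ?thesis by (rule op_param.intro[OF fdsc _ k br_klin])
qed

lemmas op_smooth = op_param.op_series_smooth[OF op_param_pt]
  and op_deriv = op_param.op_series_has_derivative[OF op_param_pt]

text \<open>Both conditions in \<open>U_iff\<close> amount to injectivity of a smooth family on a
  fixed subspace, which persists nearby; bijectivity of \<open>Ag\<close> follows by
  dimension.\<close>

lemma U_open: "open UU"
proof -
  interpret SF: smooth_family "scs L" "double_scale G" "double_scale G" UNIV "\<lambda>p. op (ss 1) (pt p)"
    by (rule smooth_family.intro[OF L.S.fd fdsc fdsc open_UNIV op_klin op_smooth]) simp_all
  have fk: "klinear_on (double_scale G) (scv G) UNIV fst"
    by (simp add: klinear_on_def double_scale_def prod_scale_def)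
  have sm: "smooth_on (scs L) (scv G) UNIV (\<lambda>p. Ag p x)" for x
    unfolding smooth_on_def Ag_eq
  proof
    show "Ck_on n (scs L) (scv G) UNIV (\<lambda>p. fst (E (- 1) (pt p) (x, 0)))" for n
      by (rule Ck_on_klinear_comp[OF fdsc G.V.fd fk open_UNIV])
        (use op_smooth[OF entire_simps(1), of "- 1" "(x, 0)"] in \<open>simp add: smooth_on_def\<close>)
  qed
  interpret AF: smooth_family "scs L" "scv G" "scv G" UNIV Ag
    by (rule smooth_family.intro[OF L.S.fd G.V.fd G.V.fd open_UNIV Ag_klin sm])
  have b: "bij (Ag q)" if "inj_on (Ag q) UNIV" for q
    using that linear_inj_on_surj_on[OF G.V.finite_dim rlin_Ag subspace_UNIV, of q] by (simp add: bij_def)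
  have "\<forall>\<^sub>F q in nhds p. q \<in> UU" if "p \<in> UU" for p
  proof -
    have "inj_on (op (ss 1) (pt p)) D0" "inj_on (Ag p) UNIV" using that by (simp_all add: U_iff bij_def)
    from SF.inj_near[OF UNIV_I D0_subspace this(1)] AF.inj_near[OF UNIV_I G.V.subspace_UNIV this(2)]
    show ?thesis by eventually_elim (simp add: U_iff b)
  qed
  then show ?thesis unfolding eventually_nhds by (subst open_subopen) (unfold subset_eq, blast)
qed

lemma T_smooth: "smooth_on (scs L) (double_scale G) UU (\<lambda>p. T p u)"
proof (rule smooth_on_subset[OF _ subset_UNIV], unfold smooth_on_def, rule allI)
  fix n
  have k: "klinear_on (double_scale G) (double_scale G) UNIV (\<lambda>v. (fst v, 0))"
    "klinear_on (double_scale G) (double_scale G) UNIV (\<lambda>v. (0, snd v))"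
    by (simp_all add: klinear_on_def double_scale_def prod_scale_def)
  have o: "Ck_on n (scs L) (double_scale G) UNIV (\<lambda>p. op f (pt p) v)" if "entire f" for f v
    using op_smooth[OF that] by (simp add: smooth_on_def)
  have "Ck_on n (scs L) (double_scale G) UNIV (\<lambda>p.
    (fst (op (rr 1) (pt p) (0, s (fst u)) - op (ss 1) (pt p) (fst (snd u), 0)), 0) +
    (0, snd (op (ss 1) (pt p) (0, s (fst u)) - op fps_sinh (pt p) (fst (snd u), 0) - E 1 (pt p) (0, snd (snd u)))))"
    by (rule Ck_on_add[OF fdsc open_UNIV] Ck_on_klinear_comp[OF fdsc fdsc k(1) open_UNIV]
      Ck_on_klinear_comp[OF fdsc fdsc k(2) open_UNIV] Ck_on_diff[OF fdsc open_UNIV] o entire_simps entire_sinh)+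
  then show "Ck_on n (scs L) (double_scale G) UNIV (\<lambda>p. T p u)"
    unfolding T_def' by (simp del: double_brk.simps fst_diff snd_diff)
qed

sublocale TF: smooth_family "scs L" "prod_scale (scs L) (double_scale G)" "double_scale G" UU T
  by (rule smooth_family.intro[OF L.S.fd fd_prod[OF L.S.fd fdsc] fdsc U_open T_klin T_smooth])

lemma fibN_subspace: "D.subspace fibN"
  by (rule subspace_Times[OF l_subspace G.S.subspace_UNIV])

lemma Ti_in: "p \<in> UU \<Longrightarrow> y \<in> fibN \<Longrightarrow> inv_into fibA (T p) y \<in> fibA"
  and T_Ti: "p \<in> UU \<Longrightarrow> y \<in> fibN \<Longrightarrow> T p (inv_into fibA (T p) y) = y"
  and Ti_T: "p \<in> UU \<Longrightarrow> x \<in> fibA \<Longrightarrow> inv_into fibA (T p) (T p x) = x"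
  by (rule TF.Ti_in[OF fibA_subspace fibN_subspace T_bij] TF.T_Ti[OF fibA_subspace fibN_subspace T_bij]
      TF.Ti_T[OF fibA_subspace fibN_subspace T_bij]; assumption)+

section \<open>Derivatives of the trivialisation and of the matrix \<open>l\<close>\<close>

definition dTwT :: "'ls \<Rightarrow> 'ls \<Rightarrow> 'ls \<times> ('g \<times> 'gs) \<Rightarrow> 'g \<times> 'gs" where
  "dTwT p h v = dTw (pt p) (pt h) (pt (fst v)) (fst (snd v), 0)"

definition dTXT :: "'ls \<Rightarrow> 'ls \<Rightarrow> 'ls \<times> ('g \<times> 'gs) \<Rightarrow> 'g \<times> 'gs" where
  "dTXT p h v = dTX (pt p) (pt h) (pt (fst v)) (snd v)"

lemma TwT_deriv: "((\<lambda>q. TwT q v) has_derivative (\<lambda>h. dTwT p h v)) (at p)"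
  unfolding TwT_def Tw_def dTwT_def dTw_def
  by (rule has_derivative_diff[OF op_deriv op_deriv]) simp_all

lemma TXT_deriv: "((\<lambda>q. TXT q v) has_derivative (\<lambda>h. dTXT p h v)) (at p)"
  unfolding TXT_def TX_def dTXT_def dTX_def
  by (rule has_derivative_diff[OF op_deriv op_deriv]) simp_all

lemma dTwT_Lp: assumes "v \<in> fibA" shows "dTwT p h v \<in> Lp"
proof -
  have "(fst (snd v), 0) \<in> Lp" using assms by (auto simp: g0_star_def)
  then show ?thesis
    unfolding dTwT_def dTw_def by (intro D.subspace_diff[OF subL] dop_odd_M dop_even_L) simp_all
qed

lemma Td_eq: assumes "p \<in> UU" "v \<in> fibA" shows "TF.Td h p v = (fst (dTwT p h v), - snd (dTXT p h v))"
proof -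
  have "((\<lambda>q. (fst (TwT q v), - snd (TXT q v))) has_derivative (\<lambda>h. (fst (dTwT p h v), - snd (dTXT p h v)))) (at p)"
    by (intro has_derivative_Pair has_derivative_minus has_derivative_fst has_derivative_snd TwT_deriv TXT_deriv)
  then have "((\<lambda>q. T q v) has_derivative (\<lambda>h. (fst (dTwT p h v), - snd (dTXT p h v)))) (at p)"
    unfolding T_eq[OF assms(2)] .
  from has_derivative_unique[OF TF.has_deriv[OF assms(1)] this] show ?thesis by (rule fun_cong)
qed

lemma pt_lin: "linear pt" by (rule klinear_real_linear[OF L.S.fd fdsc pt_klin])

lemma TwT_lin: "linear (TwT p)"
proof (rule linearI)
  have 1: "(x + y, 0) = (x, 0) + (y, 0 :: 'gs)" "(r *\<^sub>R x, 0) = r *\<^sub>R (x, 0 :: 'gs)" for x y :: 'g and r by simp_all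
  show "TwT p (v + w) = TwT p v + TwT p w" "TwT p (r *\<^sub>R v) = r *\<^sub>R TwT p v" for v w r
    unfolding TwT_def Tw_def fst_add snd_add fst_scaleR snd_scaleR linear_add[OF pt_lin] linear_scale[OF pt_lin] 1
      op_add[OF entire_simps(3)] op_add[OF entire_simps(5)] linear_scale[OF op_lin[OF entire_simps(3)]]
      linear_scale[OF op_lin[OF entire_simps(5)]]
    by (simp_all add: scaleR_diff_right)
qed

lemma TXT_lin: "linear (TXT p)"
proof (rule linearI)
  show "TXT p (v + w) = TXT p v + TXT p w" "TXT p (r *\<^sub>R v) = r *\<^sub>R TXT p v" for v w r
    unfolding TXT_def TX_def fst_add snd_add fst_scaleR snd_scaleR linear_add[OF pt_lin] linear_scale[OF pt_lin]
      op_add[OF entire_simps(1)] op_add[OF entire_simps(2)] linear_scale[OF op_lin[OF entire_simps(1)]]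
      linear_scale[OF op_lin[OF entire_simps(2)]]
    by (simp_all add: scaleR_diff_right)
qed

lemma g0_split:
  assumes "y \<in> g0_star G L"
  shows "y = (fst y, 0) + (0, snd y)" "(fst y, 0) \<in> Lp" "(0, snd y) \<in> D1"
  using assms by (auto simp: g0_star_def D1_def G.V.subspace_0[OF m_subspace])

lemma frm_g0: "y \<in> g0_star G L \<Longrightarrow> y' \<in> g0_star G L \<Longrightarrow> frm y y' = 0"
  by (auto simp: g0_star_def frm_def annihilator_def)

lemma E_th_form:
  assumes y: "y \<in> g0_star G L"
  shows "frm (E 1 (pt p) y) (op (th 1) (pt p) (pt \<alpha>)) = frm (op (ss 1) (pt p) (fst y, 0)) (pt \<alpha>)"
proof -
  let ?p = "pt p"
  have "frm (E 1 ?p y) (op (th 1) ?p (pt \<alpha>)) = frm (E (- 1) ?p (E 1 ?p y)) (E (- 1) ?p (op (th 1) ?p (pt \<alpha>)))"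
    by (rule E_form[symmetric])
  also have "\<dots> = - frm y (op (th (- 1)) ?p (pt \<alpha>))"
    unfolding E_inv E_th by (simp add: frm_minus)
  also have "\<dots> = frm y (op (ss 1) ?p (pt \<alpha>)) - frm y (op (cc 1) ?p (pt \<alpha>))"
    unfolding op_thm by (simp add: frm_diff)
  also have "op (cc 1) ?p (pt \<alpha>) \<in> Lp" "op (ss 1) ?p (pt \<alpha>) \<in> Ms" by (auto intro!: op_odd_M op_even_M)
  then have "frm y (op (ss 1) ?p (pt \<alpha>)) - frm y (op (cc 1) ?p (pt \<alpha>)) = frm (fst y, 0) (op (ss 1) ?p (pt \<alpha>))"
    using g0_split[OF y] fLL fLM_sym frm_add(2)[of "(fst y, 0)" "(0, snd y)"] by (metis add.right_neutral diff_zero)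
  also have "\<dots> = frm (op (ss 1) ?p (fst y, 0)) (pt \<alpha>)" by (rule even_adjoint[symmetric]) simp
  finally show ?thesis .
qed

text \<open>Preimages under \<open>T\<close> with first component 0 are used: there
  \<open>(l \<eta>, \<eta>)\<close> is - X, and w = 0 exchanges \<open>ss 1\<close> at z for
  \<open>rr 1\<close> at \<alpha>. The cross terms cancel since \<open>rr 1\<close> is odd; the
  others vanish by isotropy.\<close>

lemma l_skew:
  assumes p: "p \<in> UU" shows "pair G \<eta> (lc p \<eta>') + pair G \<eta>' (lc p \<eta>) = 0"
proof -
  let ?p = "pt p"
  obtain v where v: "v \<in> fibA" "T p v = (0, \<eta>)" using T_surj[OF p G.V.subspace_0[OF l_subspace]] by blast
  obtain v' where v': "v' \<in> fibA" "T p v' = (0, \<eta>')" using T_surj[OF p G.V.subspace_0[OF l_subspace]] by blast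
  have w: "TwT p u = 0" if "u \<in> fibA" "fst (T p u) = 0" for u
    using TwT_Lp[OF that(1), of p] that(2) unfolding fst_T[OF that(1)] by (auto simp: Lp_def prod_eq_iff)
  have w0: "TwT p v = 0" "TwT p v' = 0" using w v v' by simp_all
  have S: "op (ss 1) ?p (fst (snd v), 0) = op (rr 1) ?p (pt (fst v))"
    "op (ss 1) ?p (fst (snd v'), 0) = op (rr 1) ?p (pt (fst v'))"
    using w0 unfolding TwT_def Tw_def by simp_all
  have y: "snd v \<in> g0_star G L" "snd v' \<in> g0_star G L" using v v' by auto
  have "frm (TXT p v) (TXT p v') = frm (E 1 ?p (snd v)) (E 1 ?p (snd v'))
      - frm (E 1 ?p (snd v)) (op (th 1) ?p (pt (fst v'))) - frm (E 1 ?p (snd v')) (op (th 1) ?p (pt (fst v)))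
      + frm (op (th 1) ?p (pt (fst v))) (op (th 1) ?p (pt (fst v')))"
    unfolding TXT_def TX_def frm_diff using frm_sym[of "op (th 1) ?p (pt (fst v))" "E 1 ?p (snd v')"] by simp
  also have "\<dots> = - frm (op (rr 1) ?p (pt (fst v))) (pt (fst v')) - frm (op (rr 1) ?p (pt (fst v'))) (pt (fst v))"
    unfolding E_form frm_g0[OF y] E_th_form[OF y(1)] E_th_form[OF y(2)] S
      th_isotropic[OF Ms_pt Ms_pt Ms_pt] by simp
  also have "\<dots> = 0"
    using odd_adjoint[of "rr 1" ?p "pt (fst v)" "pt (fst v')"] frm_sym[of "pt (fst v)"] by simp
  finally have "frm (- TXT p v - TwT p v) (- TXT p v' - TwT p v') = 0" unfolding w0 by (simp add: frm_minus)
  then show ?thesis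
    unfolding l_T[OF p v(1), symmetric] l_T[OF p v'(1), symmetric] v(2) v'(2) by (simp add: frm_def)
qed

text \<open>\<open>snd (T p v')\<close> is held fixed while the base point moves, so
  \<open>l_T\<close> is differentiated along its moving preimage under \<open>T\<close>. The
  derivative \<open>?\<delta>\<close> of that preimage drops out in the end.\<close>

lemma l_deriv:
  assumes p: "p \<in> UU" and v: "v \<in> fibA" and v': "v' \<in> fibA"
  shows "pair G (snd (T p v)) (deriv_at (\<lambda>q. lc q (snd (T p v'))) p h) =
    frm (TXT p v + TwT p v) (dTXT p h v' + dTwT p h v')"
proof -
  let ?y = "T p v'" and ?\<delta> = "\<lambda>h. inv_into fibA (T p) (0 - TF.Td h p v')"
  have y: "?y \<in> fibN" by (rule T_in[OF v'])
  have Ti0: "inv_into fibA (T p) ?y = v'" by (rule Ti_T[OF p v'])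
  have x: "((\<lambda>q. inv_into fibA (T q) ?y) has_derivative ?\<delta>) (at p)"
    using TF.Ti_has_derivative[OF fibA_subspace fibN_subspace T_bij U_open subset_refl p y has_derivative_const]
    unfolding Ti0 by simp
  let ?D = "\<lambda>h. - (dTXT p h v' + TXT p (?\<delta> h)) - (dTwT p h v' + TwT p (?\<delta> h))"
  have "((\<lambda>q. - TXT q (inv_into fibA (T q) ?y) - TwT q (inv_into fibA (T q) ?y)) has_derivative ?D) (at p)"
    using has_derivative_diff[OF has_derivative_minus
        [OF has_derivative_family_apply[OF TF.E.finite_dim TXT_lin TXT_deriv x]]
        has_derivative_family_apply[OF TF.E.finite_dim TwT_lin TwT_deriv x]]
    unfolding Ti0 .
  moreover have "- TXT q (inv_into fibA (T q) ?y) - TwT q (inv_into fibA (T q) ?y) = (lc q (snd ?y), snd ?y)"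
    if "q \<in> UU" for q
    using l_T[OF that Ti_in[OF that y]] unfolding T_Ti[OF that y] by (rule sym)
  ultimately have D: "((\<lambda>q. (lc q (snd ?y), snd ?y)) has_derivative ?D) (at p)"
    by (rule has_derivative_cong_open[OF U_open p, THEN iffD1, rotated])
  \<comment> \<open>The dual component does not move, so \<open>?D h\<close> has none. Its pairing
    with a covector is therefore the invariant form with any completion of that covector; the point
    of the graph of \<open>l\<close> is chosen.\<close>
  have "((\<lambda>q. snd ?y) has_derivative (\<lambda>h. snd (?D h))) (at p)" using has_derivative_snd[OF D] by simp
  from has_derivative_unique[OF this has_derivative_const] have s0: "snd (?D h) = 0" by (rule fun_cong)
  have "deriv_at (\<lambda>q. lc q (snd ?y)) p = (\<lambda>h. fst (?D h))"
    using has_derivative_fst[OF D] by (intro deriv_at_eq) simp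
  moreover have "pair G \<eta> (fst w) = frm (x, \<eta>) w" if "snd w = 0" for \<eta> x w
    using that by (simp add: frm_def pairG)
  ultimately have "pair G (snd (T p v)) (deriv_at (\<lambda>q. lc q (snd ?y)) p h) = frm (lc p (snd (T p v)), snd (T p v)) (?D h)"
    using s0 by (simp only:)
  also have "?D h = - (dTXT p h v' + dTwT p h v') + (- TXT p (?\<delta> h) - TwT p (?\<delta> h))" by simp
  also have "0 - TF.Td h p v' \<in> fibN"
    using D.subspace_diff[OF fibN_subspace D.subspace_0[OF fibN_subspace]]
      TF.Td_in[OF fibA_subspace fibN_subspace T_bij p v'] by blast
  then have "?\<delta> h \<in> fibA" by (rule Ti_in[OF p])
  then have "- TXT p (?\<delta> h) - TwT p (?\<delta> h) = (lc p (snd (T p (?\<delta> h))), snd (T p (?\<delta> h)))"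
    by (rule l_T[OF p, symmetric])
  \<comment> \<open>Both points lie on the graph of the skew map \<open>lc p\<close>, which is
    isotropic.\<close>
  also have "frm (lc p (snd (T p v)), snd (T p v)) (- (dTXT p h v' + dTwT p h v') + (lc p (snd (T p (?\<delta> h))), snd (T p (?\<delta> h))))
    = - frm (lc p (snd (T p v)), snd (T p v)) (dTXT p h v' + dTwT p h v')"
  proof -
    have "frm (lc p (snd (T p v)), snd (T p v)) (lc p (snd (T p (?\<delta> h))), snd (T p (?\<delta> h))) = 0"
      using l_skew[OF p, of "snd (T p v)" "snd (T p (?\<delta> h))"] unfolding frm_def fst_conv snd_conv .
    then show ?thesis by (simp only: frm_add frm_minus add_0_right)
  qed
  also have "\<dots> = - frm (- TXT p v - TwT p v) (dTXT p h v' + dTwT p h v')" unfolding l_T[OF p v] ..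
  also have "\<dots> = frm (TXT p v + TwT p v) (dTXT p h v' + dTwT p h v')"
  proof -
    have "- frm (- A - B) M = frm (A + B) M" for A B M
      unfolding frm_diff frm_add frm_minus by simp
    then show ?thesis .
  qed
  finally show ?thesis .
qed

lemma br_ll: "fst (br (z, 0) (z', 0)) = brk G z z'"
proof -
  have "vec_of G (phi G 0 0) = 0" by (rule vecG_eqI) (simp add: pair_vec_phi pairG phi_zero)
  then show ?thesis by (simp add: varpi_zero)
qed

text \<open>Tested against \<open>\<beta>\<close>: the vectors lie in \<open>Lp\<close>, where the
  form with \<open>pt \<beta>\<close> is the pairing of \<open>L\<close>. \<open>l_deriv\<close>
  rewrites the term with the derivative of \<open>l\<close>, and the rest is
  \<open>l_component\<close>.\<close>

lemma N_first:
  assumes p: "p \<in> UU" and v: "v \<in> fibA" and v': "v' \<in> fibA"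
  shows "vec_of L (\<lambda>\<beta>. pair G (snd (T p v)) (deriv_at (\<lambda>q. lc q (snd (T p v'))) p \<beta>)) =
    fst (T p (0, br (snd v) (snd v'))) - fst (TF.Td (fst v) p v') + fst (TF.Td (fst v') p v)
      + brk G (fst (T p v)) (fst (T p v'))" (is "_ = ?x")
proof (rule L.vec_of_unique)
  let ?u = "(0, br (snd v) (snd v')) :: 'ls \<times> ('g \<times> 'gs)"
  have y: "snd v \<in> g0_star G L" "snd v' \<in> g0_star G L" using v v' by auto
  have u: "?u \<in> fibA" using g0_closed[OF y] by simp
  have Tw: "TwT p w = (fst (T p w), 0)" "fst (T p w) \<in> car L" if "w \<in> fibA" for w
    using TwT_Lp[OF that, of p] unfolding fst_T[OF that] by (auto simp: Lp_def)
  have dTw: "dTwT p h w = (fst (TF.Td h p w), 0)" "fst (TF.Td h p w) \<in> car L" if "w \<in> fibA" for w h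
    using dTwT_Lp[OF that, of p h] unfolding Td_eq[OF p that] by (auto simp: Lp_def)
  show x: "?x \<in> car L"
    by (intro G.V.subspace_add[OF l_subspace] G.V.subspace_diff[OF l_subspace] l_brk Tw(2) dTw(2) u v v')
  fix \<beta>
  have fb: "frm (pt \<beta>) w = pair L \<beta> (fst w)" if "fst w \<in> car L" for w
    using that by (simp add: frm_def pairG pair_s P_l)
  have Twu: "TwT p ?u = - op (ss 1) (pt p) (fst (br (snd v) (snd v')), 0)"
  proof -
    have "pt 0 = 0" by (simp add: linear_0[OF s_rlin] zero_prod_def)
    then show ?thesis unfolding TwT_def Tw_def by (simp add: op_zero del: double_brk.simps)
  qed
  have "frm (pt \<beta>) (dTwT p (fst v) v') - frm (pt \<beta>) (dTwT p (fst v') v) - frm (pt \<beta>) (br (TwT p v) (TwT p v'))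
    + frm (TXT p v + TwT p v) (dTXT p \<beta> v' + dTwT p \<beta> v') = frm (pt \<beta>) (TwT p ?u)"
    using l_component[of "pt p" "pt \<beta>" "pt (fst v)" "pt (fst v')" "(fst (snd v), 0)" "(fst (snd v'), 0)"
        "(fst (br (snd v) (snd v')), 0)" "(0, snd (snd v))" "(0, snd (snd v'))" "(0, snd (br (snd v) (snd v')))"]
      g0_split[OF y(1)] g0_split[OF y(2)] g0_split[OF g0_closed[OF y]]
    unfolding Twu unfolding TwT_def TXT_def dTwT_def dTXT_def
    by (simp add: frm_minus del: double_brk.simps add_Pair)
  moreover have ring: "a - b - c + x = w \<Longrightarrow> x = w - a + b + c" for a b c x w :: 'k by (simp add: algebra_simps)
  ultimately have "pair G (snd (T p v)) (deriv_at (\<lambda>q. lc q (snd (T p v'))) p \<beta>) = frm (pt \<beta>) (TwT p ?u)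
    - frm (pt \<beta>) (dTwT p (fst v) v') + frm (pt \<beta>) (dTwT p (fst v') v) + frm (pt \<beta>) (br (TwT p v) (TwT p v'))"
    unfolding l_deriv[OF p v v'] by (intro ring)
  also have "\<dots> = frm (pt \<beta>) (TwT p ?u - dTwT p (fst v) v' + dTwT p (fst v') v + br (TwT p v) (TwT p v'))"
    (is "_ = frm _ ?W") by (simp only: frm_add frm_diff)
  also have "frm (pt \<beta>) ?W = pair L \<beta> ?x"
  proof -
  have W: "fst ?W = ?x"
    unfolding Tw(1)[OF u] Tw(1)[OF v] Tw(1)[OF v'] dTw(1)[OF v] dTw(1)[OF v'] fst_add fst_diff br_ll fst_conv ..
    show ?thesis unfolding W[symmetric] by (rule fb, unfold W, rule x)
  qed
  finally show "pair L \<beta> ?x = pair G (snd (T p v)) (deriv_at (\<lambda>q. lc q (snd (T p v'))) p \<beta>)" by (rule sym)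
qed

text \<open>Up to sign, the terms without derivatives are the dual component of the bracket of X and
  X' in the double, because X is minus the sum of \<open>(l \<eta>, \<eta>)\<close> and w. The order
  of arguments in the \<open>varpi\<close> term is exchanged by its skewness; the rest is
  \<open>gauge_component\<close>.\<close>

lemma N_second:
  assumes p: "p \<in> UU" and v: "v \<in> fibA" and v': "v' \<in> fibA"
  shows "snd (TF.Td (fst v) p v') - snd (TF.Td (fst v') p v)
      + ad_star G (fst (T p v)) (snd (T p v')) - ad_star G (fst (T p v')) (snd (T p v))
      + covec_of G (\<lambda>x. pair G (snd (T p v)) (varpi G x (snd (T p v'))))
      + ad_star G (lc p (snd (T p v))) (snd (T p v')) - ad_star G (lc p (snd (T p v'))) (snd (T p v))
    = snd (T p (0, br (snd v) (snd v')))"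
proof -
  let ?u = "(0, br (snd v) (snd v')) :: 'ls \<times> ('g \<times> 'gs)"
  have u: "?u \<in> fibA" using g0_closed[of "snd v" "snd v'"] v v' by auto
  have X: "TXT p w = - (fst (T p w) + lc p (snd (T p w)), snd (T p w))" if "w \<in> fibA" for w
  proof -
    have "TXT p w = - ((lc p (snd (T p w)), snd (T p w)) + TwT p w)" unfolding l_T[OF p that] by simp
    moreover have "TwT p w = (fst (T p w), 0)" using TwT_Lp[OF that, of p] unfolding fst_T[OF that] by (auto simp: Lp_def)
    ultimately show ?thesis by (simp add: add.commute)
  qed
  have ads: "ad_star G (x + y) \<eta> = ad_star G x \<eta> + ad_star G y \<eta>" for x y \<eta>
    by (rule covecG_eqI) (simp add: pair_ad_star pairG brk_add)
  have cov: "covec_of G (\<lambda>x. pair G \<eta> (varpi G x \<xi>)) = - covec_of G (\<lambda>x. pair G \<xi> (varpi G x \<eta>))" for \<xi> \<eta>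
    by (rule covecG_eqI) (simp only: pair_covarpi pairG, rule varpi_skew)
  have "TXT p ?u = dTXT p (fst v) v' - dTXT p (fst v') v + br (TXT p v) (TXT p v')"
  proof -
    have "pt 0 = 0" by (simp add: linear_0[OF s_rlin] zero_prod_def)
    then show ?thesis
      using gauge_component[of "pt p" "pt (fst v)" "pt (fst v')" "snd v'" "snd v"]
      unfolding TXT_def dTXT_def by (simp add: TX_def[of _ 0] op_zero del: double_brk.simps)
  qed
  then have "snd (T p ?u) = snd (TF.Td (fst v) p v') - snd (TF.Td (fst v') p v) - snd (br (TXT p v) (TXT p v'))"
    unfolding T_eq[OF u] Td_eq[OF p v] Td_eq[OF p v'] by (simp del: double_brk.simps)
  also have "br (TXT p v) (TXT p v') = br (fst (T p v) + lc p (snd (T p v)), snd (T p v))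
      (fst (T p v') + lc p (snd (T p v')), snd (T p v'))"
    unfolding X[OF v] X[OF v'] br_minus by (simp del: double_brk.simps)
  finally show ?thesis
    using cov[of "snd (T p v)" "snd (T p v')"] by (simp add: ads)
qed

abbreviation "AN \<equiv> N_algebroid G L m UU lc"
abbreviation "AT \<equiv> trivial_algebroid UU (scs L) (double_scale G) (g0_star G L) br"

text \<open>The product rule splits each derivative into one of the family \<open>T\<close> and one
  of the section. \<open>N_first\<close> and \<open>N_second\<close> absorb the former; the latter
  give \<open>T\<close> at the derivative terms of the trivial bracket.\<close>

lemma N_sbrk:
  assumes p: "p \<in> UU" and v: "\<sigma> p \<in> fibA" and v': "\<sigma>' p \<in> fibA"
    and d: "(\<sigma> has_derivative D) (at p)" and d': "(\<sigma>' has_derivative D') (at p)"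
  shows "sbrk AN (\<lambda>q. T q (\<sigma> q)) (\<lambda>q. T q (\<sigma>' q)) p =
    T p (D' (fst (\<sigma> p)) - D (fst (\<sigma>' p)) + (0, br (snd (\<sigma> p)) (snd (\<sigma>' p))))"
proof -
  let ?u = "(0, br (snd (\<sigma> p)) (snd (\<sigma>' p))) :: 'ls \<times> ('g \<times> 'gs)"
  note t = TF.has_derivative_apply[OF p d] and t' = TF.has_derivative_apply[OF p d']
  have e: "deriv_at (\<lambda>q. fst (T q (\<sigma> q))) p = (\<lambda>h. fst (TF.Td h p (\<sigma> p) + T p (D h)))"
    "deriv_at (\<lambda>q. snd (T q (\<sigma> q))) p = (\<lambda>h. snd (TF.Td h p (\<sigma> p) + T p (D h)))"
    "deriv_at (\<lambda>q. fst (T q (\<sigma>' q))) p = (\<lambda>h. fst (TF.Td h p (\<sigma>' p) + T p (D' h)))"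
    "deriv_at (\<lambda>q. snd (T q (\<sigma>' q))) p = (\<lambda>h. snd (TF.Td h p (\<sigma>' p) + T p (D' h)))"
    by (rule deriv_at_eq[OF has_derivative_fst[OF t]] deriv_at_eq[OF has_derivative_snd[OF t]]
      deriv_at_eq[OF has_derivative_fst[OF t']] deriv_at_eq[OF has_derivative_snd[OF t']])+
  have r: "T p (D' (fst (\<sigma> p)) - D (fst (\<sigma>' p)) + ?u) = T p (D' (fst (\<sigma> p))) - T p (D (fst (\<sigma>' p))) + T p ?u"
    by (simp only: linear_add[OF T_lin] linear_diff[OF T_lin])
  show ?thesis
    unfolding r N_algebroid_def algebroid.simps Let_def e anchor_T[OF v] anchor_T[OF v'] N_first[OF p v v']
      N_second[OF p v v', symmetric]
    unfolding prod_eq_iff fst_conv snd_conv fst_add fst_diff snd_add snd_diff N_second[OF p v v', symmetric]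
    by (simp del: double_brk.simps)
qed

end

section \<open>Lie algebroids\<close>

lemma vector_derivative_chain:
  assumes "(f has_derivative F) (at (c + s *\<^sub>R h))"
  shows "((\<lambda>s. f (c + s *\<^sub>R h)) has_vector_derivative F h) (at s)"
proof -
  have "((\<lambda>s. c + s *\<^sub>R h) has_derivative (\<lambda>r. r *\<^sub>R h)) (at s)" by (auto intro!: derivative_eq_intros)
  from has_derivative_compose[OF this assms] have "((\<lambda>s. f (c + s *\<^sub>R h)) has_derivative (\<lambda>r. F (r *\<^sub>R h))) (at s)" .
  moreover have "F (r *\<^sub>R h) = r *\<^sub>R F h" for r
    using has_derivative_linear[OF assms] by (rule linear_scale)
  ultimately show ?thesis by (simp add: has_vector_derivative_def)
qed

lemma vector_mean_value_bound:
  fixes F :: "real \<Rightarrow> 'f::real_normed_vector"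
  assumes t: "0 \<le> t" and F: "\<And>u. 0 \<le> u \<Longrightarrow> u \<le> t \<Longrightarrow> (F has_vector_derivative F' u) (at u)"
    and e: "\<And>u. 0 \<le> u \<Longrightarrow> u \<le> t \<Longrightarrow> norm (F' u - A) \<le> e"
  shows "norm (F t - F 0 - t *\<^sub>R A) \<le> t * e"
proof -
  have "norm ((\<lambda>u. F u - u *\<^sub>R A) t - (\<lambda>u. F u - u *\<^sub>R A) 0) \<le> e * norm (t - 0)"
  proof (rule differentiable_bound[of "{0..t}" _ "\<lambda>u h. h *\<^sub>R (F' u - A)"])
    fix u assume u: "u \<in> {0..t}"
    have "(F has_derivative (\<lambda>h. h *\<^sub>R F' u)) (at u within {0..t})"
      using F[of u] u has_derivative_at_withinI unfolding has_vector_derivative_def by auto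
    then show "((\<lambda>u. F u - u *\<^sub>R A) has_derivative (\<lambda>h. h *\<^sub>R (F' u - A))) (at u within {0..t})"
      by (auto intro!: derivative_eq_intros simp: scaleR_diff_right)
    show "onorm (\<lambda>h. h *\<^sub>R (F' u - A)) \<le> e"
      using e[of u] u by (intro onorm_le) (auto simp: mult.commute[of e] intro: mult_left_mono)
  qed (use t in auto)
  then show ?thesis using t by (simp add: algebra_simps)
qed

text \<open>The mean value inequality is used twice: in the direction \<open>h\<close> for the
  difference of \<open>f\<close> along two parallel segments, and in the direction \<open>k\<close>
  for the resulting difference of first derivatives.\<close>

lemma second_difference:
  fixes f :: "'b::real_normed_vector \<Rightarrow> 'f::real_normed_vector"
  assumes W: "open W" "p \<in> W" and f: "\<And>q. q \<in> W \<Longrightarrow> (f has_derivative f' q) (at q)"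
    and g: "\<And>q. q \<in> W \<Longrightarrow> ((\<lambda>q. f' q h) has_derivative g' q) (at q)"
    and cont: "continuous_on W (\<lambda>q. g' q k)" and e: "e > 0"
  shows "\<exists>d>0. \<forall>t. 0 < t \<longrightarrow> t < d \<longrightarrow>
    norm (f (p + t *\<^sub>R h + t *\<^sub>R k) - f (p + t *\<^sub>R h) - f (p + t *\<^sub>R k) + f p - (t * t) *\<^sub>R g' p k) \<le> t * t * e"
proof -
  obtain d1 where d1: "d1 > 0" "\<And>q. dist q p < d1 \<Longrightarrow> q \<in> W" using W unfolding open_dist by blast
  obtain d2 where d2: "d2 > 0" "\<And>q. q \<in> W \<Longrightarrow> dist q p < d2 \<Longrightarrow> dist (g' q k) (g' p k) < e"
    using cont e W(2) unfolding continuous_on_iff by blast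
  define n where "n = norm h + norm k + 1"
  have n: "n > 0" unfolding n_def by (simp add: add_nonneg_pos)
  have near: "p + a *\<^sub>R h + b *\<^sub>R k \<in> W \<and> norm (g' (p + a *\<^sub>R h + b *\<^sub>R k) k - g' p k) \<le> e"
    if t: "t < min d1 d2 / n" and a: "0 \<le> a" "a \<le> t" and b: "0 \<le> b" "b \<le> t" for a b t
  proof -
    have "norm (a *\<^sub>R h + b *\<^sub>R k) \<le> a * norm h + b * norm k"
      using norm_triangle_ineq[of "a *\<^sub>R h" "b *\<^sub>R k"] a b by simp
    also have "\<dots> \<le> t * norm h + t * norm k" using a b by (intro add_mono mult_right_mono) auto
    also have "\<dots> \<le> t * n" using a by (simp add: n_def algebra_simps)
    also have "\<dots> < min d1 d2" using t n by (simp add: field_simps)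
    finally have "dist (p + a *\<^sub>R h + b *\<^sub>R k) p < min d1 d2" by (simp add: dist_norm add.assoc)
    then show ?thesis using d1(2) d2(2)[of "p + a *\<^sub>R h + b *\<^sub>R k"] by (simp add: dist_norm less_imp_le)
  qed
  have "norm (f (p + t *\<^sub>R h + t *\<^sub>R k) - f (p + t *\<^sub>R h) - f (p + t *\<^sub>R k) + f p - (t * t) *\<^sub>R g' p k) \<le> t * t * e"
    if t: "0 < t" "t < min d1 d2 / n" for t
  proof -
    let ?F = "\<lambda>a. f (p + t *\<^sub>R k + a *\<^sub>R h) - f (p + a *\<^sub>R h)"
    have ne: "p + t *\<^sub>R k + a *\<^sub>R h \<in> W" "p + a *\<^sub>R h \<in> W" if "0 \<le> a" "a \<le> t" for a
      using near[OF t(2) that, of t] near[OF t(2) that, of 0] t(1) by (simp_all add: add_ac)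
    have "norm (?F t - ?F 0 - t *\<^sub>R (t *\<^sub>R g' p k)) \<le> t * (t * e)"
    proof (rule vector_mean_value_bound)
      fix a assume a: "0 \<le> a" "a \<le> t"
      show "(?F has_vector_derivative f' (p + t *\<^sub>R k + a *\<^sub>R h) h - f' (p + a *\<^sub>R h) h) (at a)"
        by (intro has_vector_derivative_diff vector_derivative_chain f ne a)
      have "norm (f' (p + a *\<^sub>R h + t *\<^sub>R k) h - f' (p + a *\<^sub>R h + 0 *\<^sub>R k) h - t *\<^sub>R g' p k) \<le> t * e"
      proof (rule vector_mean_value_bound)
        fix b assume b: "0 \<le> b" "b \<le> t"
        show "((\<lambda>b. f' (p + a *\<^sub>R h + b *\<^sub>R k) h) has_vector_derivative g' (p + a *\<^sub>R h + b *\<^sub>R k) k) (at b)"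
          by (rule vector_derivative_chain[OF g]) (use near[OF t(2) a b] in simp)
        show "norm (g' (p + a *\<^sub>R h + b *\<^sub>R k) k - g' p k) \<le> e" using near[OF t(2) a b] by simp
      qed (use t in simp)
      then show "norm (f' (p + t *\<^sub>R k + a *\<^sub>R h) h - f' (p + a *\<^sub>R h) h - t *\<^sub>R g' p k) \<le> t * e"
        by (simp add: add_ac)
    qed (use t in simp)
    moreover have "?F t - ?F 0 = f (p + t *\<^sub>R h + t *\<^sub>R k) - f (p + t *\<^sub>R h) - f (p + t *\<^sub>R k) + f p"
      by (simp add: algebra_simps)
    ultimately show ?thesis by (simp only: scaleR_scaleR mult.assoc)
  qed
  then show ?thesis using d1(1) d2(1) n by (intro exI[of _ "min d1 d2 / n"]) auto
qed

text \<open>Both sides are limits of one second difference divided by t^2, and that difference is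
  symmetric in \<open>h\<close> and \<open>k\<close>.\<close>

lemma symmetric_second_derivative:
  assumes f: "smooth_on sb sf W f" and W: "open W" "p \<in> W"
  shows "deriv_at (\<lambda>q. deriv_at f q h) p k = deriv_at (\<lambda>q. deriv_at f q k) p h"
proof (rule ccontr)
  let ?A = "\<lambda>h k. deriv_at (\<lambda>q. deriv_at f q h) p k"
  assume ne: "?A h k \<noteq> ?A k h"
  \<comment> \<open>A third, because the two estimates together allow an error of twice
    \<open>e\<close>.\<close>
  define e where "e = norm (?A h k - ?A k h) / 3"
  have e: "e > 0" using ne by (simp add: e_def)
  note fd = smooth_on_has_derivative[OF f] and gd = smooth_on_has_derivative[OF smooth_on_deriv[OF f]]
  have c: "continuous_on W (\<lambda>q. deriv_at (\<lambda>q. deriv_at f q h) q k)" for h k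
    using smooth_on_deriv[OF smooth_on_deriv[OF f], of h k] unfolding smooth_on_def by (metis Ck_on.simps(1))
  obtain d1 where d1: "d1 > 0" "\<And>t. 0 < t \<Longrightarrow> t < d1 \<Longrightarrow>
    norm (f (p + t *\<^sub>R h + t *\<^sub>R k) - f (p + t *\<^sub>R h) - f (p + t *\<^sub>R k) + f p - (t * t) *\<^sub>R ?A h k) \<le> t * t * e"
    using second_difference[OF W fd gd c e, of h k] by blast
  obtain d2 where d2: "d2 > 0" "\<And>t. 0 < t \<Longrightarrow> t < d2 \<Longrightarrow>
    norm (f (p + t *\<^sub>R k + t *\<^sub>R h) - f (p + t *\<^sub>R k) - f (p + t *\<^sub>R h) + f p - (t * t) *\<^sub>R ?A k h) \<le> t * t * e"
    using second_difference[OF W fd gd c e, of k h] by blast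
  define t where "t = min d1 d2 / 2"
  have t: "0 < t" "t < d1" "t < d2" using d1(1) d2(1) by (auto simp: t_def)
  let ?D = "f (p + t *\<^sub>R h + t *\<^sub>R k) - f (p + t *\<^sub>R h) - f (p + t *\<^sub>R k) + f p"
  have "norm (?D - (t * t) *\<^sub>R ?A k h) \<le> t * t * e" using d2(2)[OF t(1,3)] by (simp add: algebra_simps)
  then have "norm ((?D - (t * t) *\<^sub>R ?A k h) - (?D - (t * t) *\<^sub>R ?A h k)) \<le> t * t * e + t * t * e"
    using norm_triangle_ineq4[of "?D - (t * t) *\<^sub>R ?A k h" "?D - (t * t) *\<^sub>R ?A h k"] d1(2)[OF t(1,2)] by linarith
  also have "(?D - (t * t) *\<^sub>R ?A k h) - (?D - (t * t) *\<^sub>R ?A h k) = (t * t) *\<^sub>R (?A h k - ?A k h)"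
    by (simp add: scaleR_diff_right)
  finally have "(t * t) * (3 * e) \<le> (t * t) * (2 * e)" by (simp add: e_def)
  then show False using t(1) e by simp
qed

text \<open>The derivatives of \<open>\<sigma>\<close>, extended by zero off \<open>W\<close>, form
  a smooth family of linear maps, so the results on such families give smoothness and the product
  rule for the derivative along a varying vector.\<close>

lemma
  assumes fd: "fd_vector_space sb" "fd_vector_space sf" and W: "open W" and \<sigma>: "smooth_on sb sf W \<sigma>"
  shows smooth_on_deriv_apply:
      "smooth_on sb sb W X \<Longrightarrow> smooth_on sb sf W (\<lambda>q. deriv_at \<sigma> q (X q))"
    and deriv_apply_has_derivative: "p \<in> W \<Longrightarrow> (X has_derivative X') (at p) \<Longrightarrow>
      ((\<lambda>q. deriv_at \<sigma> q (X q)) has_derivative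
        (\<lambda>h. deriv_at (\<lambda>q. deriv_at \<sigma> q (X p)) p h + deriv_at \<sigma> p (X' h))) (at p)"
proof -
  let ?T = "\<lambda>q u. if q \<in> W then deriv_at \<sigma> q u else 0"
  interpret SF: fd_space sf using fd(2) by unfold_locales
  interpret S: smooth_family sb sb sf W ?T
  proof (rule smooth_family.intro[OF fd(1) fd(1) fd(2) W])
    show "klinear_on sb sf UNIV (?T p)" for p
      using smooth_on_klinear[OF \<sigma>, of p] by (auto simp: klinear_on_def)
    show "smooth_on sb sf W (\<lambda>p. ?T p u)" for u
      by (rule smooth_on_cong[OF W, THEN iffD1, OF _ smooth_on_deriv[OF \<sigma>]]) simp
  qed
  show "smooth_on sb sf W (\<lambda>q. deriv_at \<sigma> q (X q))" if "smooth_on sb sb W X"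
    by (rule smooth_on_cong[OF W, THEN iffD1, OF _ S.smooth_on_apply[OF W subset_refl that]]) simp
  assume p: "p \<in> W" and X: "(X has_derivative X') (at p)"
  have "S.Td h p (X p) = deriv_at (\<lambda>q. deriv_at \<sigma> q (X p)) p h" for h
    using p deriv_at_cong_open[OF W p, of "\<lambda>q. ?T q (X p)" "\<lambda>q. deriv_at \<sigma> q (X p)"] by (simp add: S.Td_def)
  then have "((\<lambda>q. ?T q (X q)) has_derivative
      (\<lambda>h. deriv_at (\<lambda>q. deriv_at \<sigma> q (X p)) p h + deriv_at \<sigma> p (X' h))) (at p)"
    using S.has_derivative_apply[OF p X] p by simp
  then show "((\<lambda>q. deriv_at \<sigma> q (X q)) has_derivative
      (\<lambda>h. deriv_at (\<lambda>q. deriv_at \<sigma> q (X p)) p h + deriv_at \<sigma> p (X' h))) (at p)"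
    by (rule has_derivative_cong_open[OF W p, THEN iffD1, rotated]) simp
qed

lemma smooth_on_klinear_comp:
  assumes "fd_vector_space s1" "fd_vector_space s2" "klinear_on s1 s2 UNIV h" "open W" "smooth_on sb s1 W f"
  shows "smooth_on sb s2 W (\<lambda>p. h (f p))"
  unfolding smooth_on_def
  by (rule allI, rule Ck_on_klinear_comp[OF assms(1-4)], rule assms(5)[unfolded smooth_on_def, THEN spec])

lemma smooth_on_add:
  assumes "fd_vector_space sf" "open W" "smooth_on sb sf W f" "smooth_on sb sf W g"
  shows "smooth_on sb sf W (\<lambda>p. f p + g p)"
  unfolding smooth_on_def
  by (rule allI, rule Ck_on_add[OF assms(1,2)]; rule assms(3,4)[unfolded smooth_on_def, THEN spec])

lemma smooth_on_scale:
  assumes fd: "fd_vector_space sf" and "open W" "smooth_on sb (*) W f" "smooth_on sb sf W g"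
  shows "smooth_on sb sf W (\<lambda>p. sf (f p) (g p))"
proof -
  interpret F: fd_space sf using fd by unfold_locales
  have "klinear_on (*) sf UNIV (\<lambda>c. sf c y)" "klinear_on sf sf UNIV (sf c)" for y c
    by (simp_all add: klinear_on_def F.scale_left_distrib F.scale_right_distrib F.scale_left_commute)
  then show ?thesis
    using Ck_on_bilinear[OF fd F.bounded_bilinear_sc _ _ assms(2)] assms(3,4) unfolding smooth_on_def by blast
qed

lemma trivial_sbrk:
  assumes "\<sigma> differentiable (at p)" "\<tau> differentiable (at p)"
  shows "sbrk (trivial_algebroid U sb sk K b) \<sigma> \<tau> p =
    deriv_at \<tau> p (fst (\<sigma> p)) - deriv_at \<sigma> p (fst (\<tau> p)) + (0, b (snd (\<sigma> p)) (snd (\<tau> p)))"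
proof -
  have d: "(\<sigma> has_derivative deriv_at \<sigma> p) (at p)" "(\<tau> has_derivative deriv_at \<tau> p) (at p)"
    using assms by (simp_all flip: frechet_derivative_works)
  note e = deriv_at_eq[OF has_derivative_fst[OF d(1)]] deriv_at_eq[OF has_derivative_fst[OF d(2)]]
    deriv_at_eq[OF has_derivative_snd[OF d(1)]] deriv_at_eq[OF has_derivative_snd[OF d(2)]]
  show ?thesis
    unfolding trivial_algebroid_def algebroid.simps Let_def vbracket_def e by (simp add: prod_eq_iff)
qed

lemma lie_algebroid_trivial:
  fixes sb :: "'k::real_or_complex \<Rightarrow> 'b::real_normed_vector \<Rightarrow> 'b" and sk :: "'k \<Rightarrow> 'v::real_normed_vector \<Rightarrow> 'v"
  assumes fd: "fd_vector_space sb" "fd_vector_space sk" and U: "open U"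
    and b: "lie_algebra sk UNIV b" and K: "module.subspace sk K" "\<And>x y. x \<in> K \<Longrightarrow> y \<in> K \<Longrightarrow> b x y \<in> K"
  shows "lie_algebroid (trivial_algebroid U sb sk K b)" (is "lie_algebroid ?A")
proof -
  let ?f = "prod_scale sb sk"
  have fdf: "fd_vector_space ?f" by (rule fd_prod[OF fd])
  interpret V: fd_space sk using fd by unfold_locales
  interpret B: fd_space sb using fd by unfold_locales
  interpret F: fd_space ?f using fdf by unfold_locales
  have bk: "klinear_on sk sk UNIV (b x)" "klinear_on sk sk UNIV (\<lambda>x. b x y)" for x y
    using b unfolding lie_algebra_def by blast+
  have self: "b x x = 0" and jac: "b x (b y z) + b y (b z x) + b z (b x y) = 0" for x y z
    using b unfolding lie_algebra_def by blast+
  have skew: "b x y = - b y x" for x y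
    using self[of "x + y"] self[of x] self[of y] klinearD(1)[OF bk(1)] klinearD(1)[OF bk(2)]
    by (simp add: eq_neg_iff_add_eq_0 add.commute)
  have bb: "bounded_bilinear b"
    by (rule finite_dim_bilinear_bounded[OF V.finite_dim V.finite_dim])
      (rule klinear_real_linear[OF fd(2) fd(2) bk(2)] klinear_real_linear[OF fd(2) fd(2) bk(1)])+
  note bl = bounded_bilinear.add_right[OF bb] bounded_bilinear.diff_right[OF bb]
  have sel: "base ?A = U" "bsc ?A = sb" "fib ?A = UNIV \<times> K" "fsc ?A = ?f" "anchor ?A p = fst" for p
    by (simp_all add: trivial_algebroid_def)
  have fib: "F.subspace (UNIV \<times> K)"
    using K(1) unfolding F.subspace_def V.subspace_def by (auto simp: prod_scale_def zero_prod_def)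
  have kf: "klinear_on ?f sb UNIV fst" "klinear_on ?f sk UNIV snd" "klinear_on sk ?f UNIV (\<lambda>y. (0, y))"
    by (simp_all add: klinear_on_def prod_scale_def)
  have W: "(\<forall>\<sigma>\<in>sections ?A W. smooth_on sb sb W (\<lambda>p. anchor ?A p (\<sigma> p))) \<and>
        (\<forall>\<sigma>\<in>sections ?A W. \<forall>\<tau>\<in>sections ?A W.
           sbrk ?A \<sigma> \<tau> \<in> sections ?A W \<and>
           (\<forall>p\<in>W. sbrk ?A \<sigma> \<tau> p = - sbrk ?A \<tau> \<sigma> p) \<and>
           (\<forall>\<tau>'. (\<forall>p\<in>W. \<tau>' p = \<tau> p) \<longrightarrow> (\<forall>p\<in>W. sbrk ?A \<sigma> \<tau>' p = sbrk ?A \<sigma> \<tau> p)) \<and>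
           (\<forall>\<rho>\<in>sections ?A W. \<forall>p\<in>W.
              sbrk ?A \<sigma> (\<lambda>q. \<tau> q + \<rho> q) p = sbrk ?A \<sigma> \<tau> p + sbrk ?A \<sigma> \<rho> p \<and>
              sbrk ?A \<sigma> (sbrk ?A \<tau> \<rho>) p + sbrk ?A \<tau> (sbrk ?A \<rho> \<sigma>) p + sbrk ?A \<rho> (sbrk ?A \<sigma> \<tau>) p = 0) \<and>
           (\<forall>f. smooth_on sb (*) W f \<longrightarrow>
              (\<forall>p\<in>W. sbrk ?A \<sigma> (\<lambda>q. ?f (f q) (\<tau> q)) p =
                 ?f (f p) (sbrk ?A \<sigma> \<tau> p) + ?f (deriv_at f p (anchor ?A p (\<sigma> p))) (\<tau> p))) \<and>
           (\<forall>p\<in>W. anchor ?A p (sbrk ?A \<sigma> \<tau> p) =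
              vbracket (\<lambda>q. anchor ?A q (\<sigma> q)) (\<lambda>q. anchor ?A q (\<tau> q)) p))"
    if W: "open W" for W
  proof -
    have sec: "smooth_on sb ?f W \<sigma>" "\<And>p. p \<in> W \<Longrightarrow> \<sigma> p \<in> UNIV \<times> K" if "\<sigma> \<in> sections ?A W" for \<sigma>
      using that unfolding sections_def sel by auto
    note df = smooth_on_differentiable and hd = smooth_on_has_derivative
    have eq: "sbrk ?A \<sigma> \<tau> p = deriv_at \<tau> p (fst (\<sigma> p)) - deriv_at \<sigma> p (fst (\<tau> p)) + (0, b (snd (\<sigma> p)) (snd (\<tau> p)))"
      if "smooth_on sb ?f W \<sigma>" "smooth_on sb ?f W \<tau>" "p \<in> W" for \<sigma> \<tau> p
      by (rule trivial_sbrk[OF df[OF that(1,3)] df[OF that(2,3)]])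
    have anc: "smooth_on sb sb W (\<lambda>p. fst (\<sigma> p))" if "smooth_on sb ?f W \<sigma>" for \<sigma>
      by (rule smooth_on_klinear_comp[OF fdf fd(1) kf(1) W that])
    have brs: "sbrk ?A \<sigma> \<tau> \<in> sections ?A W" if \<sigma>: "\<sigma> \<in> sections ?A W" and \<tau>: "\<tau> \<in> sections ?A W" for \<sigma> \<tau>
    proof -
      have sm: "smooth_on sb sk W (\<lambda>p. snd (\<sigma> p))" "smooth_on sb sk W (\<lambda>p. snd (\<tau> p))"
        by (rule smooth_on_klinear_comp[OF fdf fd(2) kf(2) W] sec \<sigma> \<tau>)+
      have "smooth_on sb sk W (\<lambda>p. b (snd (\<sigma> p)) (snd (\<tau> p)))"
        using Ck_on_bilinear[OF fd(2) bb bk(2) bk(1) W] sm unfolding smooth_on_def by blast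
      then have "smooth_on sb ?f W (\<lambda>p. (0, b (snd (\<sigma> p)) (snd (\<tau> p))))"
        by (rule smooth_on_klinear_comp[OF fd(2) fdf kf(3) W])
      moreover have "smooth_on sb ?f W (\<lambda>p. deriv_at \<tau> p (fst (\<sigma> p)) - deriv_at \<sigma> p (fst (\<tau> p)))"
        using Ck_on_diff[OF fdf W] smooth_on_deriv_apply[OF fd(1) fdf W sec(1)[OF \<tau>] anc[OF sec(1)[OF \<sigma>]]]
          smooth_on_deriv_apply[OF fd(1) fdf W sec(1)[OF \<sigma>] anc[OF sec(1)[OF \<tau>]]]
        unfolding smooth_on_def by blast
      ultimately have "smooth_on sb ?f W (\<lambda>p. deriv_at \<tau> p (fst (\<sigma> p)) - deriv_at \<sigma> p (fst (\<tau> p))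
          + (0, b (snd (\<sigma> p)) (snd (\<tau> p))))"
        by (rule smooth_on_add[OF fdf W, rotated])
      then have "smooth_on sb ?f W (sbrk ?A \<sigma> \<tau>)"
        by (rule smooth_on_cong[OF W, THEN iffD1, rotated]) (rule eq[symmetric, OF sec(1)[OF \<sigma>] sec(1)[OF \<tau>]])
      moreover have "sbrk ?A \<sigma> \<tau> p \<in> UNIV \<times> K" if p: "p \<in> W" for p
      proof -
        have d: "deriv_at \<rho> p h \<in> UNIV \<times> K" if "\<rho> \<in> sections ?A W" for \<rho> h
          by (rule has_derivative_in_subspace[OF F.finite_dim F.real_subspace[OF fib] W p sec(2)[OF that] hd[OF sec(1)[OF that] p]])
        have "(0, b (snd (\<sigma> p)) (snd (\<tau> p))) \<in> UNIV \<times> K"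
          using sec(2)[OF \<sigma> p] sec(2)[OF \<tau> p] K(2) by auto
        then show ?thesis unfolding eq[OF sec(1)[OF \<sigma>] sec(1)[OF \<tau>] p]
          by (intro F.subspace_add[OF fib] F.subspace_diff[OF fib] d \<sigma> \<tau>)
      qed
      ultimately show ?thesis unfolding sections_def sel mem_Collect_eq image_subset_iff by blast
    qed
    \<comment> \<open>The expansion isolates the second derivatives and fixes the order of arguments
      in \<open>b\<close>. In the cyclic sum they then cancel by symmetry, the first-order terms
      cancel in pairs, and the Jacobi identity of \<open>b\<close> remains.\<close>
    have nested: "sbrk ?A \<sigma> (sbrk ?A \<tau> \<rho>) p =
        deriv_at (\<lambda>q. deriv_at \<rho> q (fst (\<tau> p))) p (fst (\<sigma> p)) + deriv_at \<rho> p (fst (deriv_at \<tau> p (fst (\<sigma> p))))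
        - (deriv_at (\<lambda>q. deriv_at \<tau> q (fst (\<rho> p))) p (fst (\<sigma> p)) + deriv_at \<tau> p (fst (deriv_at \<rho> p (fst (\<sigma> p)))))
        - (deriv_at \<sigma> p (fst (deriv_at \<rho> p (fst (\<tau> p)))) - deriv_at \<sigma> p (fst (deriv_at \<tau> p (fst (\<rho> p)))))
        + (0, b (snd (\<tau> p)) (snd (deriv_at \<rho> p (fst (\<sigma> p)))) - b (snd (\<rho> p)) (snd (deriv_at \<tau> p (fst (\<sigma> p))))
            + (b (snd (\<sigma> p)) (snd (deriv_at \<rho> p (fst (\<tau> p)))) - b (snd (\<sigma> p)) (snd (deriv_at \<tau> p (fst (\<rho> p)))))
            + b (snd (\<sigma> p)) (b (snd (\<tau> p)) (snd (\<rho> p))))"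
      if s: "\<sigma> \<in> sections ?A W" "\<tau> \<in> sections ?A W" "\<rho> \<in> sections ?A W" and p: "p \<in> W" for \<sigma> \<tau> \<rho> p
    proof -
      note h\<tau> = hd[OF sec(1)[OF s(2)] p] and h\<rho> = hd[OF sec(1)[OF s(3)] p]
      let ?t = "\<lambda>q. deriv_at \<rho> q (fst (\<tau> q)) - deriv_at \<tau> q (fst (\<rho> q)) + (0, b (snd (\<tau> q)) (snd (\<rho> q)))"
      let ?t' = "\<lambda>h. (deriv_at (\<lambda>q. deriv_at \<rho> q (fst (\<tau> p))) p h + deriv_at \<rho> p (fst (deriv_at \<tau> p h)))
        - (deriv_at (\<lambda>q. deriv_at \<tau> q (fst (\<rho> p))) p h + deriv_at \<tau> p (fst (deriv_at \<rho> p h)))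
        + (0, b (snd (\<tau> p)) (snd (deriv_at \<rho> p h)) + b (snd (deriv_at \<tau> p h)) (snd (\<rho> p)))"
      have "(?t has_derivative ?t') (at p)"
        by (intro has_derivative_add has_derivative_diff has_derivative_Pair has_derivative_const
          deriv_apply_has_derivative[OF fd(1) fdf W sec(1)[OF s(3)] p has_derivative_fst[OF h\<tau>]]
          deriv_apply_has_derivative[OF fd(1) fdf W sec(1)[OF s(2)] p has_derivative_fst[OF h\<rho>]]
          bounded_bilinear.FDERIV[OF bb has_derivative_snd[OF h\<tau>] has_derivative_snd[OF h\<rho>]])
      then have "deriv_at ?t p = ?t'" by (rule deriv_at_eq)
      moreover have "deriv_at (sbrk ?A \<tau> \<rho>) p = deriv_at ?t p"
        by (rule deriv_at_cong_open[OF W p]) (rule eq[OF sec(1)[OF s(2)] sec(1)[OF s(3)]])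
      ultimately have d: "deriv_at (sbrk ?A \<tau> \<rho>) p = ?t'" by (rule trans[rotated])
      have l: "linear (deriv_at \<sigma> p)" by (rule has_derivative_linear[OF hd[OF sec(1)[OF s(1)] p]])
      have c: "b (snd (deriv_at \<tau> p (fst (\<sigma> p)))) (snd (\<rho> p)) = - b (snd (\<rho> p)) (snd (deriv_at \<tau> p (fst (\<sigma> p))))"
        by (rule skew)
      show ?thesis
        unfolding eq[OF sec(1)[OF s(1)] sec(1)[OF brs[OF s(2,3)]] p] d eq[OF sec(1)[OF s(2)] sec(1)[OF s(3)] p]
          fst_add fst_diff snd_add snd_diff fst_conv snd_conv add_0_right linear_diff[OF l] bl c
        by (simp add: prod_eq_iff)
    qed
    show ?thesis
    proof (intro conjI ballI allI impI)
      fix \<sigma> assume \<sigma>: "\<sigma> \<in> sections ?A W"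
      show "smooth_on sb sb W (\<lambda>p. anchor ?A p (\<sigma> p))" unfolding sel by (rule anc[OF sec(1)[OF \<sigma>]])
      fix \<tau> assume \<tau>: "\<tau> \<in> sections ?A W"
      note s = sec(1)[OF \<sigma>] and t = sec(1)[OF \<tau>]
      show "sbrk ?A \<sigma> \<tau> \<in> sections ?A W" by (rule brs[OF \<sigma> \<tau>])
      show "sbrk ?A \<sigma> \<tau> p = - sbrk ?A \<tau> \<sigma> p" if "p \<in> W" for p
        unfolding eq[OF s t that] eq[OF t s that] using skew[of "snd (\<sigma> p)" "snd (\<tau> p)"] by (simp add: prod_eq_iff)
      show "sbrk ?A \<sigma> \<tau>' p = sbrk ?A \<sigma> \<tau> p" if c: "\<forall>p\<in>W. \<tau>' p = \<tau> p" and p: "p \<in> W" for \<tau>' p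
      proof -
        have c': "\<tau> q = \<tau>' q" if "q \<in> W" for q using c that by simp
        have t': "smooth_on sb ?f W \<tau>'" by (rule smooth_on_cong[OF W c', THEN iffD1, OF _ t])
        have "deriv_at \<tau> p = deriv_at \<tau>' p" by (rule deriv_at_cong_open[OF W p c'])
        then show ?thesis unfolding eq[OF s t p] eq[OF s t' p] c'[OF p] by simp
      qed
      show "anchor ?A p (sbrk ?A \<sigma> \<tau> p) = vbracket (\<lambda>q. anchor ?A q (\<sigma> q)) (\<lambda>q. anchor ?A q (\<tau> q)) p" for p
        unfolding sel by (simp add: trivial_algebroid_def Let_def)
      show "sbrk ?A \<sigma> (\<lambda>q. ?f (f q) (\<tau> q)) p =
          ?f (f p) (sbrk ?A \<sigma> \<tau> p) + ?f (deriv_at f p (anchor ?A p (\<sigma> p))) (\<tau> p)"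
        if f: "smooth_on sb (*) W f" and p: "p \<in> W" for f p
      proof -
        have d: "deriv_at (\<lambda>q. ?f (f q) (\<tau> q)) p = (\<lambda>h. ?f (f p) (deriv_at \<tau> p h) + ?f (deriv_at f p h) (\<tau> p))"
          by (rule deriv_at_eq[OF bounded_bilinear.FDERIV[OF F.bounded_bilinear_sc hd[OF f p] hd[OF t p]]])
        have 1: "fst (?f (f p) (\<tau> p)) = sb (f p) (fst (\<tau> p))" "snd (?f (f p) (\<tau> p)) = sk (f p) (snd (\<tau> p))"
          by (simp_all add: prod_scale_def)
        have 2: "deriv_at \<sigma> p (sb (f p) (fst (\<tau> p))) = ?f (f p) (deriv_at \<sigma> p (fst (\<tau> p)))"
          by (rule klinearD(2)[OF smooth_on_klinear[OF s p]])
        have 3: "(0, sk c y) = ?f c (0, y)" for c y by (simp add: prod_scale_def)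
        show ?thesis
          unfolding eq[OF s smooth_on_scale[OF fdf W f t] p] eq[OF s t p] d 1 2 klinearD(2)[OF bk(1)] 3 sel
          by (simp add: F.scale_right_distrib F.scale_right_diff_distrib)
      qed
      fix \<rho> p assume \<rho>: "\<rho> \<in> sections ?A W" and p: "p \<in> W"
      note r = sec(1)[OF \<rho>]
      have d: "deriv_at (\<lambda>q. \<tau> q + \<rho> q) p = (\<lambda>h. deriv_at \<tau> p h + deriv_at \<rho> p h)"
        by (rule deriv_at_eq[OF has_derivative_add[OF hd[OF t p] hd[OF r p]]])
      have l: "linear (deriv_at \<sigma> p)" by (rule has_derivative_linear[OF hd[OF s p]])
      show "sbrk ?A \<sigma> (\<lambda>q. \<tau> q + \<rho> q) p = sbrk ?A \<sigma> \<tau> p + sbrk ?A \<sigma> \<rho> p"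
        unfolding eq[OF s smooth_on_add[OF fdf W t r] p] eq[OF s t p] eq[OF s r p] d fst_add snd_add linear_add[OF l] bl
        by (simp add: prod_eq_iff)
      have sy: "deriv_at (\<lambda>q. deriv_at \<rho> q (fst (\<sigma> p))) p (fst (\<tau> p)) = deriv_at (\<lambda>q. deriv_at \<rho> q (fst (\<tau> p))) p (fst (\<sigma> p))"
        "deriv_at (\<lambda>q. deriv_at \<tau> q (fst (\<sigma> p))) p (fst (\<rho> p)) = deriv_at (\<lambda>q. deriv_at \<tau> q (fst (\<rho> p))) p (fst (\<sigma> p))"
        "deriv_at (\<lambda>q. deriv_at \<sigma> q (fst (\<tau> p))) p (fst (\<rho> p)) = deriv_at (\<lambda>q. deriv_at \<sigma> q (fst (\<rho> p))) p (fst (\<tau> p))"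
        by (rule symmetric_second_derivative[OF r W p] symmetric_second_derivative[OF t W p]
            symmetric_second_derivative[OF s W p])+
      show "sbrk ?A \<sigma> (sbrk ?A \<tau> \<rho>) p + sbrk ?A \<tau> (sbrk ?A \<rho> \<sigma>) p + sbrk ?A \<rho> (sbrk ?A \<sigma> \<tau>) p = 0"
        unfolding nested[OF \<sigma> \<tau> \<rho> p] nested[OF \<tau> \<rho> \<sigma> p] nested[OF \<rho> \<sigma> \<tau> p] sy
        using jac[of "snd (\<sigma> p)" "snd (\<tau> p)" "snd (\<rho> p)"] by (simp add: prod_eq_iff)
    qed
  qed
  have "klinear_on ?f sb (UNIV \<times> K) (anchor ?A p)" for p
    using kf(1) unfolding sel(5) klinear_on_def by blast
  then have k: "\<forall>p\<in>U. klinear_on ?f sb (UNIV \<times> K) (anchor ?A p)" by blast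
  show ?thesis
    unfolding lie_algebroid_def sel(1-4)
    by (rule conjI[OF U conjI[OF fib conjI[OF k]]], rule allI, rule impI, rule W, erule conjunct1)
qed

text \<open>\<open>T\<close> and its inverse carry each axiom from \<open>A\<close> to
  \<open>B\<close>. Sections are functions on the whole type, but a section of \<open>B\<close> is
  the image of one of \<open>A\<close> only on \<open>W\<close>; \<open>loc\<close> makes that
  enough for brackets.\<close>

lemma lie_algebroid_transport:
  fixes A :: "('k::real_or_complex, 'b::real_normed_vector, 'e::real_normed_vector) algebroid"
    and B :: "('k, 'b, 'f::real_normed_vector) algebroid"
  assumes A: "lie_algebroid A" and fdA: "fd_vector_space (fsc A)" and base: "base B = base A" and bsc: "bsc B = bsc A"
    and fibB: "module.subspace (fsc B) (fib B)"
    and T: "\<And>p. p \<in> base A \<Longrightarrow> klinear_on (fsc A) (fsc B) (fib A) (T p)"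
    and bij: "\<And>p. p \<in> base A \<Longrightarrow> bij_betw (T p) (fib A) (fib B)"
    and anc: "\<And>p v. p \<in> base A \<Longrightarrow> v \<in> fib A \<Longrightarrow> anchor B p (T p v) = anchor A p v"
    and sT: "\<And>W \<sigma>. open W \<Longrightarrow> W \<subseteq> base A \<Longrightarrow> \<sigma> \<in> sections A W \<Longrightarrow> (\<lambda>p. T p (\<sigma> p)) \<in> sections B W"
    and sI: "\<And>W \<sigma>. open W \<Longrightarrow> W \<subseteq> base A \<Longrightarrow> \<sigma> \<in> sections B W \<Longrightarrow>
      (\<lambda>p. inv_into (fib A) (T p) (\<sigma> p)) \<in> sections A W"
    and br: "\<And>W \<sigma> \<tau> p. open W \<Longrightarrow> W \<subseteq> base A \<Longrightarrow> \<sigma> \<in> sections A W \<Longrightarrow> \<tau> \<in> sections A W \<Longrightarrow> p \<in> W \<Longrightarrow>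
      sbrk B (\<lambda>q. T q (\<sigma> q)) (\<lambda>q. T q (\<tau> q)) p = T p (sbrk A \<sigma> \<tau> p)"
    and loc: "\<And>W \<sigma> \<sigma>' \<tau> \<tau>' p. open W \<Longrightarrow> p \<in> W \<Longrightarrow> (\<And>q. q \<in> W \<Longrightarrow> \<sigma> q = \<sigma>' q) \<Longrightarrow>
      (\<And>q. q \<in> W \<Longrightarrow> \<tau> q = \<tau>' q) \<Longrightarrow> sbrk B \<sigma> \<tau> p = sbrk B \<sigma>' \<tau>' p"
  shows "lie_algebroid_iso A B T"
proof -
  note a = A[unfolded lie_algebroid_def]
  have opA: "open (base A)" and fibA: "module.subspace (fsc A) (fib A)"
    and ancA: "\<And>p. p \<in> base A \<Longrightarrow> klinear_on (fsc A) (bsc A) (fib A) (anchor A p)"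
    using a by blast+
  interpret F: fd_space "fsc A" using fdA by unfold_locales
  let ?i = "\<lambda>p. inv_into (fib A) (T p)"
  have i: "?i p y \<in> fib A" "T p (?i p y) = y" if "p \<in> base A" "y \<in> fib B" for p y
    using bij[OF that(1)] that(2) by (metis bij_betw_def inv_into_into, metis bij_betw_inv_into_right)
  have Tadd: "T p (v + w) = T p v + T p w" if "p \<in> base A" "v \<in> fib A" "w \<in> fib A" for p v w
    using T[OF that(1)] that(2,3) unfolding klinear_on_def by blast
  have Tsc: "T p (fsc A c v) = fsc B c (T p v)" if "p \<in> base A" "v \<in> fib A" for p v c
    using T[OF that(1)] that(2) unfolding klinear_on_def by blast
  have T0: "T p 0 = 0" if "p \<in> base A" for p
    using Tadd[OF that F.subspace_0[OF fibA] F.subspace_0[OF fibA]] by simp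
  have Tadd0: "T p v = - T p w" if "p \<in> base A" "v \<in> fib A" "w \<in> fib A" "v = - w" for p v w
  proof -
    have "v + w = 0" using that(4) by simp
    then have "T p v + T p w = 0" using Tadd[OF that(1-3)] T0[OF that(1)] by (simp only:)
    then show ?thesis by (simp only: eq_neg_iff_add_eq_0)
  qed
  have ancB: "klinear_on (fsc B) (bsc A) (fib B) (anchor B p)" if p: "p \<in> base A" for p
    unfolding klinear_on_def
  proof (intro conjI ballI allI)
    fix x y assume x: "x \<in> fib B" "y \<in> fib B"
    note ix = i[OF p x(1)] and iy = i[OF p x(2)]
    have "anchor B p (T p (?i p x + ?i p y)) = anchor B p (T p (?i p x)) + anchor B p (T p (?i p y))"
      using ancA[OF p] ix(1) iy(1) F.subspace_add[OF fibA ix(1) iy(1)] by (simp add: anc[OF p] klinear_on_def)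
    then show "anchor B p (x + y) = anchor B p x + anchor B p y"
      unfolding Tadd[OF p ix(1) iy(1)] ix(2) iy(2) .
  next
    fix c x assume x: "x \<in> fib B"
    note ix = i[OF p x]
    have "anchor B p (T p (fsc A c (?i p x))) = bsc A c (anchor B p (T p (?i p x)))"
      using ancA[OF p] ix(1) F.subspace_scale[OF fibA ix(1)] by (simp add: anc[OF p] klinear_on_def)
    then show "anchor B p (fsc B c x) = bsc A c (anchor B p x)"
      unfolding Tsc[OF p ix(1)] ix(2) .
  qed
  have W: "(\<forall>\<sigma>\<in>sections B W. smooth_on (bsc A) (bsc A) W (\<lambda>p. anchor B p (\<sigma> p))) \<and>
        (\<forall>\<sigma>\<in>sections B W. \<forall>\<tau>\<in>sections B W.
           sbrk B \<sigma> \<tau> \<in> sections B W \<and>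
           (\<forall>p\<in>W. sbrk B \<sigma> \<tau> p = - sbrk B \<tau> \<sigma> p) \<and>
           (\<forall>\<tau>'. (\<forall>p\<in>W. \<tau>' p = \<tau> p) \<longrightarrow> (\<forall>p\<in>W. sbrk B \<sigma> \<tau>' p = sbrk B \<sigma> \<tau> p)) \<and>
           (\<forall>\<rho>\<in>sections B W. \<forall>p\<in>W.
              sbrk B \<sigma> (\<lambda>q. \<tau> q + \<rho> q) p = sbrk B \<sigma> \<tau> p + sbrk B \<sigma> \<rho> p \<and>
              sbrk B \<sigma> (sbrk B \<tau> \<rho>) p + sbrk B \<tau> (sbrk B \<rho> \<sigma>) p + sbrk B \<rho> (sbrk B \<sigma> \<tau>) p = 0) \<and>
           (\<forall>f. smooth_on (bsc A) (*) W f \<longrightarrow>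
              (\<forall>p\<in>W. sbrk B \<sigma> (\<lambda>q. fsc B (f q) (\<tau> q)) p =
                 fsc B (f p) (sbrk B \<sigma> \<tau> p) + fsc B (deriv_at f p (anchor B p (\<sigma> p))) (\<tau> p))) \<and>
           (\<forall>p\<in>W. anchor B p (sbrk B \<sigma> \<tau> p) =
              vbracket (\<lambda>q. anchor B q (\<sigma> q)) (\<lambda>q. anchor B q (\<tau> q)) p))"
    if W: "open W" "W \<subseteq> base A" for W
  proof -
    note aW = a[THEN conjunct2, THEN conjunct2, THEN conjunct2, THEN spec, THEN mp, OF conjI[OF W]]
    note A1 = aW[THEN conjunct1, THEN bspec] and AA = aW[THEN conjunct2, THEN bspec, THEN bspec]
    note sec = AA[THEN conjunct1] and skew = AA[THEN conjunct2, THEN conjunct1, THEN bspec]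
      and A3 = AA[THEN conjunct2, THEN conjunct2, THEN conjunct2, THEN conjunct1, THEN bspec, THEN bspec]
      and leib = AA[THEN conjunct2, THEN conjunct2, THEN conjunct2, THEN conjunct2, THEN conjunct1, THEN spec, THEN mp, THEN bspec]
      and vb = AA[THEN conjunct2, THEN conjunct2, THEN conjunct2, THEN conjunct2, THEN conjunct2, THEN bspec]
    let ?t = "\<lambda>\<sigma> p. inv_into (fib A) (T p) (\<sigma> p)"
    have pA: "p \<in> base A" if "p \<in> W" for p using that W(2) by blast
    have fA: "\<sigma> p \<in> fib A" if "\<sigma> \<in> sections A W" "p \<in> W" for \<sigma> p using that unfolding sections_def by blast
    have fB: "\<sigma> p \<in> fib B" if "\<sigma> \<in> sections B W" "p \<in> W" for \<sigma> p using that unfolding sections_def by blast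
    note ts = sI[OF W]
    have Tt: "T p (?t \<sigma> p) = \<sigma> p" if "\<sigma> \<in> sections B W" "p \<in> W" for \<sigma> p
      by (rule i(2)[OF pA[OF that(2)] fB[OF that]])
    have tA: "anchor A p (?t \<sigma> p) = anchor B p (\<sigma> p)" if "\<sigma> \<in> sections B W" "p \<in> W" for \<sigma> p
      using anc[OF pA[OF that(2)] i(1)[OF pA[OF that(2)] fB[OF that]]] unfolding Tt[OF that] by (rule sym)
    \<comment> \<open>Allowing any sections of \<open>A\<close> with the right images on
      \<open>W\<close> makes this usable for sums, multiples and iterated brackets, whose natural
      preimages are not literally of the form \<open>?t\<close>.\<close>
    have brT: "sbrk B \<sigma> \<tau> p = T p (sbrk A \<sigma>' \<tau>' p)"
      if s: "\<sigma>' \<in> sections A W" "\<tau>' \<in> sections A W" "p \<in> W" and e: "\<And>q. q \<in> W \<Longrightarrow> T q (\<sigma>' q) = \<sigma> q" "\<And>q. q \<in> W \<Longrightarrow> T q (\<tau>' q) = \<tau> q"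
      for \<sigma> \<tau> \<sigma>' \<tau>' p
      unfolding br[OF W s, symmetric] by (rule loc[OF W(1) s(3) e[symmetric]])
    have brB: "sbrk B \<sigma> \<tau> p = T p (sbrk A (?t \<sigma>) (?t \<tau>) p)" if s: "\<sigma> \<in> sections B W" "\<tau> \<in> sections B W" "p \<in> W" for \<sigma> \<tau> p
      by (rule brT[OF ts[OF s(1)] ts[OF s(2)] s(3) Tt[OF s(1)] Tt[OF s(2)]])
    have cong: "\<tau> \<in> sections B W" if "\<sigma> \<in> sections B W" "\<And>p. p \<in> W \<Longrightarrow> \<sigma> p = \<tau> p" for \<sigma> \<tau>
    proof -
      have s: "smooth_on (bsc B) (fsc B) W \<sigma>" "\<And>p. p \<in> W \<Longrightarrow> \<sigma> p \<in> fib B" using that(1) unfolding sections_def by blast+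
      have "smooth_on (bsc B) (fsc B) W \<tau>" by (rule smooth_on_cong[OF W(1) that(2), THEN iffD1, OF _ s(1)])
      moreover have "\<tau> p \<in> fib B" if "p \<in> W" for p using s(2)[OF that] \<open>\<And>p. p \<in> W \<Longrightarrow> \<sigma> p = \<tau> p\<close>[OF that] by simp
      ultimately show ?thesis unfolding sections_def by blast
    qed
    show ?thesis
    proof (intro conjI ballI allI impI)
      fix \<sigma> assume \<sigma>: "\<sigma> \<in> sections B W"
      show "smooth_on (bsc A) (bsc A) W (\<lambda>p. anchor B p (\<sigma> p))"
        by (rule smooth_on_cong[OF W(1) tA[OF \<sigma>], THEN iffD1, OF _ A1[OF ts[OF \<sigma>]]])
      fix \<tau> assume \<tau>: "\<tau> \<in> sections B W"
      note s = ts[OF \<sigma>] and t = ts[OF \<tau>]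
      show "sbrk B \<sigma> \<tau> \<in> sections B W"
        by (rule cong[OF sT[OF W sec[OF s t]] brB[OF \<sigma> \<tau>, symmetric]])
      show "sbrk B \<sigma> \<tau> p = - sbrk B \<tau> \<sigma> p" if p: "p \<in> W" for p
        unfolding brB[OF \<sigma> \<tau> p] brB[OF \<tau> \<sigma> p]
        by (rule Tadd0[OF pA[OF p] fA[OF sec[OF s t] p] fA[OF sec[OF t s] p] skew[OF s t p]])
      show "sbrk B \<sigma> \<tau>' p = sbrk B \<sigma> \<tau> p" if "\<forall>p\<in>W. \<tau>' p = \<tau> p" "p \<in> W" for \<tau>' p
        by (rule loc[OF W(1) that(2)]) (use that(1) in auto)
      show "anchor B p (sbrk B \<sigma> \<tau> p) = vbracket (\<lambda>q. anchor B q (\<sigma> q)) (\<lambda>q. anchor B q (\<tau> q)) p" if p: "p \<in> W" for p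
      proof -
        have "anchor B p (sbrk B \<sigma> \<tau> p) = vbracket (\<lambda>q. anchor A q (?t \<sigma> q)) (\<lambda>q. anchor A q (?t \<tau> q)) p"
          unfolding brB[OF \<sigma> \<tau> p] anc[OF pA[OF p] fA[OF sec[OF s t] p]] by (rule vb[OF s t p])
        also have "\<dots> = vbracket (\<lambda>q. anchor B q (\<sigma> q)) (\<lambda>q. anchor B q (\<tau> q)) p"
        proof -
          have "deriv_at (\<lambda>q. anchor A q (?t \<sigma> q)) p = deriv_at (\<lambda>q. anchor B q (\<sigma> q)) p"
            "deriv_at (\<lambda>q. anchor A q (?t \<tau> q)) p = deriv_at (\<lambda>q. anchor B q (\<tau> q)) p"
            by (rule deriv_at_cong_open[OF W(1) p], rule tA[OF \<sigma>] tA[OF \<tau>], assumption)+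
          then show ?thesis unfolding vbracket_def tA[OF \<sigma> p] tA[OF \<tau> p] by simp
        qed
        finally show ?thesis .
      qed
      show "sbrk B \<sigma> (\<lambda>q. fsc B (f q) (\<tau> q)) p =
          fsc B (f p) (sbrk B \<sigma> \<tau> p) + fsc B (deriv_at f p (anchor B p (\<sigma> p))) (\<tau> p)"
        if f: "smooth_on (bsc A) (*) W f" and p: "p \<in> W" for f p
      proof -
        have ft: "(\<lambda>q. fsc A (f q) (?t \<tau> q)) \<in> sections A W"
          using smooth_on_scale[OF fdA W(1) f] t F.subspace_scale[OF fibA] unfolding sections_def by blast
        note m = fA[OF sec[OF s t] p] and m' = fA[OF t p]
        have "sbrk B \<sigma> (\<lambda>q. fsc B (f q) (\<tau> q)) p = T p (sbrk A (?t \<sigma>) (\<lambda>q. fsc A (f q) (?t \<tau> q)) p)"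
          by (rule brT[OF s ft p Tt[OF \<sigma>]]) (simp_all add: Tsc[OF pA fA[OF t]] Tt[OF \<tau>])
        also have "sbrk A (?t \<sigma>) (\<lambda>q. fsc A (f q) (?t \<tau> q)) p =
            fsc A (f p) (sbrk A (?t \<sigma>) (?t \<tau>) p) + fsc A (deriv_at f p (anchor A p (?t \<sigma> p))) (?t \<tau> p)"
          by (rule leib[OF s t f p])
        also have "T p \<dots> = fsc B (f p) (T p (sbrk A (?t \<sigma>) (?t \<tau>) p)) + fsc B (deriv_at f p (anchor A p (?t \<sigma> p))) (T p (?t \<tau> p))"
          unfolding Tadd[OF pA[OF p] F.subspace_scale[OF fibA m] F.subspace_scale[OF fibA m']] Tsc[OF pA[OF p] m] Tsc[OF pA[OF p] m'] ..
        finally show ?thesis unfolding brB[OF \<sigma> \<tau> p] tA[OF \<sigma> p] Tt[OF \<tau> p] .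
      qed
      fix \<rho> p assume \<rho>: "\<rho> \<in> sections B W" and p: "p \<in> W"
      note r = ts[OF \<rho>]
      have tr: "(\<lambda>q. ?t \<tau> q + ?t \<rho> q) \<in> sections A W"
        using smooth_on_add[OF fdA W(1)] t r F.subspace_add[OF fibA] unfolding sections_def by blast
      have "sbrk B \<sigma> (\<lambda>q. \<tau> q + \<rho> q) p = T p (sbrk A (?t \<sigma>) (\<lambda>q. ?t \<tau> q + ?t \<rho> q) p)"
        by (rule brT[OF s tr p Tt[OF \<sigma>]]) (simp_all add: Tadd[OF pA fA[OF t] fA[OF r]] Tt[OF \<tau>] Tt[OF \<rho>])
      also have "sbrk A (?t \<sigma>) (\<lambda>q. ?t \<tau> q + ?t \<rho> q) p = sbrk A (?t \<sigma>) (?t \<tau>) p + sbrk A (?t \<sigma>) (?t \<rho>) p"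
        by (rule A3[OF s t r p, THEN conjunct1])
      finally show "sbrk B \<sigma> (\<lambda>q. \<tau> q + \<rho> q) p = sbrk B \<sigma> \<tau> p + sbrk B \<sigma> \<rho> p"
        unfolding brB[OF \<sigma> \<tau> p] brB[OF \<sigma> \<rho> p] Tadd[OF pA[OF p] fA[OF sec[OF s t] p] fA[OF sec[OF s r] p]] .
      have n: "sbrk B \<sigma> (sbrk B \<tau> \<rho>) p = T p (sbrk A (?t \<sigma>) (sbrk A (?t \<tau>) (?t \<rho>)) p)"
        if "\<sigma> \<in> sections B W" "\<tau> \<in> sections B W" "\<rho> \<in> sections B W" for \<sigma> \<tau> \<rho>
        by (rule brT[OF ts[OF that(1)] sec[OF ts[OF that(2)] ts[OF that(3)]] p Tt[OF that(1)] brB[OF that(2,3), symmetric]])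
      have m: "sbrk A (?t \<sigma>) (sbrk A (?t \<tau>) (?t \<rho>)) p \<in> fib A" "sbrk A (?t \<tau>) (sbrk A (?t \<rho>) (?t \<sigma>)) p \<in> fib A"
        "sbrk A (?t \<rho>) (sbrk A (?t \<sigma>) (?t \<tau>)) p \<in> fib A"
        by (rule fA[OF sec[OF s sec[OF t r]] p] fA[OF sec[OF t sec[OF r s]] p] fA[OF sec[OF r sec[OF s t]] p])+
      show "sbrk B \<sigma> (sbrk B \<tau> \<rho>) p + sbrk B \<tau> (sbrk B \<rho> \<sigma>) p + sbrk B \<rho> (sbrk B \<sigma> \<tau>) p = 0"
        unfolding n[OF \<sigma> \<tau> \<rho>] n[OF \<tau> \<rho> \<sigma>] n[OF \<rho> \<sigma> \<tau>] Tadd[OF pA[OF p] m(1,2), symmetric]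
          Tadd[OF pA[OF p] F.subspace_add[OF fibA m(1,2)] m(3), symmetric] A3[OF s t r p, THEN conjunct2]
        by (rule T0[OF pA[OF p]])
    qed
  qed
  have k: "\<forall>p\<in>base A. klinear_on (fsc B) (bsc A) (fib B) (anchor B p)" using ancB by blast
  have B: "lie_algebroid B"
    unfolding lie_algebroid_def base bsc
    by (rule conjI[OF opA conjI[OF fibB conjI[OF k]]], rule allI, rule impI, rule W, erule conjunct1, erule conjunct2)
  have 1: "\<forall>p\<in>base A. klinear_on (fsc A) (fsc B) (fib A) (T p) \<and> bij_betw (T p) (fib A) (fib B)"
    and 2: "\<forall>p\<in>base A. \<forall>v\<in>fib A. anchor B p (T p v) = anchor A p v"
    using T bij anc by simp_all
  show ?thesis
    unfolding lie_algebroid_iso_def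
  proof (rule conjI[OF A conjI[OF B conjI[OF base[symmetric] conjI[OF bsc[symmetric] conjI[OF 1 conjI[OF 2]]]]]], rule allI, rule impI)
    fix W assume "open W \<and> W \<subseteq> base A"
    then have W: "open W" "W \<subseteq> base A" by simp_all
    show "(\<forall>\<sigma>\<in>sections A W. (\<lambda>p. T p (\<sigma> p)) \<in> sections B W) \<and>
      (\<forall>\<tau>\<in>sections B W. (\<lambda>p. inv_into (fib A) (T p) (\<tau> p)) \<in> sections A W) \<and>
      (\<forall>\<sigma>\<in>sections A W. \<forall>\<sigma>'\<in>sections A W. \<forall>p\<in>W.
         T p (sbrk A \<sigma> \<sigma>' p) = sbrk B (\<lambda>q. T q (\<sigma> q)) (\<lambda>q. T q (\<sigma>' q)) p)"
      by (intro conjI ballI) (rule sT[OF W] sI[OF W] br[OF W, symmetric]; assumption)+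
  qed
qed

context canon
begin

text \<open>The bracket involves the sections only through their values and first derivatives at the
  point.\<close>

lemma N_sbrk_local:
  assumes W: "open W" "p \<in> W" and c: "\<And>q. q \<in> W \<Longrightarrow> \<sigma> q = \<sigma>' q" and c': "\<And>q. q \<in> W \<Longrightarrow> \<tau> q = \<tau>' q"
  shows "sbrk AN \<sigma> \<tau> p = sbrk AN \<sigma>' \<tau>' p"
proof -
  have "deriv_at (\<lambda>q. fst (\<sigma> q)) p = deriv_at (\<lambda>q. fst (\<sigma>' q)) p" "deriv_at (\<lambda>q. snd (\<sigma> q)) p = deriv_at (\<lambda>q. snd (\<sigma>' q)) p"
    "deriv_at (\<lambda>q. fst (\<tau> q)) p = deriv_at (\<lambda>q. fst (\<tau>' q)) p" "deriv_at (\<lambda>q. snd (\<tau> q)) p = deriv_at (\<lambda>q. snd (\<tau>' q)) p"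
    by (rule deriv_at_cong_open[OF W], simp add: c c')+
  note d = this
  show ?thesis unfolding N_algebroid_def algebroid.simps Let_def d c[OF W(2)] c'[OF W(2)] ..
qed

theorem trivialisation: "lie_algebroid_iso AT AN T"
proof (rule lie_algebroid_transport)
  let ?f = "prod_scale (scs L) (double_scale G)"
  have sT: "base AT = UU" "bsc AT = scs L" "fib AT = fibA" "fsc AT = ?f" "anchor AT p = fst" for p
    by (simp_all add: trivial_algebroid_def)
  have sN: "base AN = UU" "bsc AN = scs L" "fib AN = fibN" "fsc AN = double_scale G" "anchor AN = N_anchor G L m"
    by (simp_all add: N_algebroid_def double_scale_def)
  have secT: "\<sigma> \<in> sections AT W \<longleftrightarrow> smooth_on (scs L) ?f W \<sigma> \<and> (\<forall>p\<in>W. \<sigma> p \<in> fibA)" for \<sigma> W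
    unfolding sections_def sT mem_Collect_eq image_subset_iff ..
  have secN: "\<sigma> \<in> sections AN W \<longleftrightarrow> smooth_on (scs L) (double_scale G) W \<sigma> \<and> (\<forall>p\<in>W. \<sigma> p \<in> fibN)" for \<sigma> W
    unfolding sections_def sN mem_Collect_eq image_subset_iff ..
  show "lie_algebroid AT"
    by (rule lie_algebroid_trivial[OF L.S.fd fdsc U_open lie g0_subspace g0_closed])
  show "fd_vector_space (fsc AT)" unfolding sT by (rule fd_prod[OF L.S.fd fdsc])
  show "base AN = base AT" "bsc AN = bsc AT" unfolding sN sT by (rule refl)+
  show "module.subspace (fsc AN) (fib AN)" unfolding sN by (rule fibN_subspace)
  show "klinear_on (fsc AT) (fsc AN) (fib AT) (T p)" for p
    using T_klin unfolding sT sN klinear_on_def by blast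
  show "bij_betw (T p) (fib AT) (fib AN)" if "p \<in> base AT" for p
    using T_bij that unfolding sT sN by blast
  show "anchor AN p (T p v) = anchor AT p v" if "v \<in> fib AT" for p v
    using anchor_T[of v p] that unfolding sT sN by blast
  show "(\<lambda>p. T p (\<sigma> p)) \<in> sections AN W" if "open W" "W \<subseteq> base AT" "\<sigma> \<in> sections AT W" for W \<sigma>
    using TF.smooth_on_apply[OF that(1)] T_in that(2,3) unfolding secT secN sT by blast
  show "(\<lambda>p. inv_into (fib AT) (T p) (\<sigma> p)) \<in> sections AT W" if "open W" "W \<subseteq> base AT" "\<sigma> \<in> sections AN W" for W \<sigma>
    using TF.smooth_on_Ti[OF fibA_subspace fibN_subspace T_bij that(1), of \<sigma>] Ti_in that(2,3)
    unfolding secT secN sT by blast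
  show "sbrk AN (\<lambda>q. T q (\<sigma> q)) (\<lambda>q. T q (\<tau> q)) p = T p (sbrk AT \<sigma> \<tau> p)"
    if W: "open W" "W \<subseteq> base AT" and s: "\<sigma> \<in> sections AT W" "\<tau> \<in> sections AT W" and p: "p \<in> W" for W \<sigma> \<tau> p
  proof -
    have sm: "smooth_on (scs L) ?f W \<sigma>" "smooth_on (scs L) ?f W \<tau>" and f: "\<sigma> p \<in> fibA" "\<tau> p \<in> fibA" and pU: "p \<in> UU"
      using s p W(2) unfolding secT sT by blast+
    show ?thesis
      unfolding trivial_sbrk[OF smooth_on_differentiable[OF sm(1) p] smooth_on_differentiable[OF sm(2) p]]
      by (rule N_sbrk[OF pU f smooth_on_has_derivative[OF sm(1) p] smooth_on_has_derivative[OF sm(2) p]])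
  qed
  show "sbrk AN \<sigma> \<tau> p = sbrk AN \<sigma>' \<tau>' p"
    if "open W" "p \<in> W" "\<And>q. q \<in> W \<Longrightarrow> \<sigma> q = \<sigma>' q" "\<And>q. q \<in> W \<Longrightarrow> \<tau> q = \<tau>' q" for W \<sigma> \<sigma>' \<tau> \<tau>' p
    using that by (rule N_sbrk_local)
qed

end

theorem theorem7p3:
  fixes G :: "('k::real_or_complex, 'g::banach, 'gs::banach) qbialg"
    and L :: "('k, 'g, 'ls::banach) dual_pair"
    and m :: "'g set"
  assumes "car G = UNIV"
    and "lie_quasi_bialgebra G"
    and "is_dual_pair L" and "scv L = scv G"
    and "reductive_decomposition G (car L) m"
    and "canonically_compatible G (car L) m"
  shows "lie_subalgebra (double_scale G) (double_car G) (double_brk G) (g0_star G L) \<and>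
         lie_algebroid_iso
           (trivial_algebroid (U_can G L m) (scs L) (double_scale G) (g0_star G L) (double_brk G))
           (N_algebroid G L m (U_can G L m) (l_can G L m))
           (T_map G L m)"
proof -
  interpret canon G L m by (rule canon.intro[OF assms])
  show ?thesis using g0_subalgebra trivialisation by blast
qed

end
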